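(* Let $\ell\ge 1$ be an integer, let $\alpha=\frac{1}{2\ell+1}$, let $0<\beta\le\frac12$ with $\alpha\le 2\beta$, and let $X=\{X_t\}_{t\ge0}$, $X_0=0$, be a centered Gaussian process on $(\Omega,\mathcal F,\mathbb P)$ which is self-similar with exponent $\beta$, with $\mathcal F$ the $\sigma$-algebra generated by $X$. Put $\phi(x)=\mathbb E[X_1X_x]$ for $x\ge1$. Assume that $\phi$ is continuous on $[1,\infty)$ and twice continuously differentiable on $(1,\infty)$, that there is $\lambda>0$ such that $\psi(x)=\phi(x)+\lambda(x-1)^\alpha$ has a bounded derivative on $(1,2]$, and that there are constants $C_1,C_2>0$ and $1<\theta\le2$ with $$|\phi''(x)|\le C_1\mathbf 1_{(1,2]}(x)(x-1)^{\alpha-2}+C_2\mathbf 1_{(2,\infty)}(x)x^{-\theta-1},\qquad x>1.$$ For $t\ge 0$ define $$V_n(t)=\sum_{j=0}^{\lfloor nt\rfloor-1}\left(X_{\frac{j+1}{n}}-X_{\frac jn}\right)^{2\ell+1}.$$ Let $Y=\{Y_t\}_{t\ge0}$ be a continuous centered Gaussian process, independent of $X$, with covariance $\mathbb E[Y_sY_t]=(s\wedge t)^{2\beta/\alpha}$, defined on an enlarged probability space $(\Omega,\mathcal G,\mathbb P)$, $\mathcal F\subset\mathcal G$. Then for every $m\ge1$ and all $0\le t_1,\dots,t_m<\infty$, the random vector $(V_n(t_1),\dots,V_n(t_m))$ converges stably, as $n\to\infty$, to $\sigma_\ell\,(Y_{t_1},\dots,Y_{t_m})$, where $\sigma_\ell\ge0$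 is given by $$\sigma_\ell^2=\frac{\alpha}{2\beta}\sum_{r=0}^{\ell-1}K_{r,\ell}\sum_{p\in\mathbb Z}\left(|p+1|^\alpha+|p-1|^\alpha-2|p|^\alpha\right)^{2(\ell-r)+1},\qquad K_{r,\ell}=c_{r,\ell}^2\,2^{2r}\lambda^{2\ell+1}(2(\ell-r)+1)!.$$
   Context: Self-similar with exponent $\beta$: for every $c>0$, the process $\{c^{-\beta}X_{ct}\}_{t\ge0}$ has the same law as $X$. Consequently $\mathbb E[X_sX_t]=s^{2\beta}\phi(t/s)$ for $0<s\le t$. Hermite polynomials: $H_q(x)=(-1)^qe^{x^2/2}\frac{d^q}{dx^q}e^{-x^2/2}$. The integers $c_{r,\ell}$, $0\le r\le \ell$, are the coefficients in the expansion $x^{2\ell+1}=\sum_{r=0}^{\ell}c_{r,\ell}H_{2(\ell-r)+1}(x)$. Stable convergence: let $\xi_n$ be random variables on $(\Omega,\mathcal F,\mathbb P)$ with values in a complete separable metric space $S$, and $\xi$ an $S$-valued random variable on the enlarged space $(\Omega,\mathcal G,\mathbb P)$. Then $\xi_n$ converges stably to $\xi$ if $\lim_{n\to\infty}\mathbb E[f(\xi_n)M]=\mathbb E[f(\xi)M]$ for every bounded continuous $f:S\to\mathbb R$ and every bounded $\mathcal F$-measurable real random variable $M$. *)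

theory Defs
  imports "HOL-Probability.Probability"
begin

section \<open>Gaussian processes indexed by the half line\<close>

definition path_space :: "(real \<Rightarrow> real) measure" where
  "path_space = (\<Pi>\<^sub>M t\<in>{0..}. borel)"

text \<open>
  A process is a family of random variables of which only the members with index \<open>t \<ge> 0\<close>
  matter. Its path map has values in the product space, so that its distribution is the law of
  the process and the preimages of measurable sets form the \<open>\<sigma>\<close>-algebra it generates.
\<close>
definition path_map :: "(real \<Rightarrow> 'a \<Rightarrow> real) \<Rightarrow> 'a \<Rightarrow> (real \<Rightarrow> real)" where
  "path_map X \<omega> = (\<lambda>t\<in>{0..}. X t \<omega>)"

definition generated_by :: "'a measure \<Rightarrow> (real \<Rightarrow> 'a \<Rightarrow> real) \<Rightarrow> bool" where
  "generated_by M X \<longleftrightarrow> sets M = sets (vimage_algebra (space M) (path_map X) path_space)"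

text \<open>The Dirac mass at \<open>0\<close> counts as Gaussian.\<close>
definition centered_gaussian :: "'a measure \<Rightarrow> ('a \<Rightarrow> real) \<Rightarrow> bool" where
  "centered_gaussian M Z \<longleftrightarrow>
     Z \<in> borel_measurable M \<and>
     ((AE \<omega> in M. Z \<omega> = 0) \<or> (\<exists>\<sigma>>0. distributed M lborel Z (normal_density 0 \<sigma>)))"

definition centered_gaussian_process :: "'a measure \<Rightarrow> (real \<Rightarrow> 'a \<Rightarrow> real) \<Rightarrow> bool" where
  "centered_gaussian_process M X \<longleftrightarrow>
     (\<forall>I a. finite I \<and> I \<subseteq> {0..} \<longrightarrow> centered_gaussian M (\<lambda>\<omega>. \<Sum>t\<in>I. a t * X t \<omega>))"

definition self_similar :: "'a measure \<Rightarrow> (real \<Rightarrow> 'a \<Rightarrow> real) \<Rightarrow> real \<Rightarrow> bool" where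
  "self_similar M X \<beta> \<longleftrightarrow>
     (\<forall>c>0. distr M path_space (path_map (\<lambda>t \<omega>. c powr (- \<beta>) * X (c * t) \<omega>)) =
            distr M path_space (path_map X))"

section \<open>Stable convergence\<close>

definition prob_enlargement :: "'a measure \<Rightarrow> 'a measure \<Rightarrow> bool" where
  "prob_enlargement F G \<longleftrightarrow>
     prob_space F \<and> prob_space G \<and> subalgebra G F \<and> (\<forall>A\<in>sets F. emeasure G A = emeasure F A)"

definition converges_stably ::
    "'a measure \<Rightarrow> 'a measure \<Rightarrow> (nat \<Rightarrow> 'a \<Rightarrow> 'b::polish_space) \<Rightarrow> ('a \<Rightarrow> 'b) \<Rightarrow> bool" where
  "converges_stably F G \<xi> \<zeta> \<longleftrightarrow>
     (\<forall>n. \<xi> n \<in> borel_measurable F) \<and> \<zeta> \<in> borel_measurable G \<and>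
     (\<forall>(f :: 'b \<Rightarrow> real) (M :: 'a \<Rightarrow> real).
        continuous_on UNIV f \<and> bounded (range f) \<and>
        M \<in> borel_measurable F \<and> bounded (M ` space F) \<longrightarrow>
        (\<lambda>n. \<integral>\<omega>. f (\<xi> n \<omega>) * M \<omega> \<partial>F) \<longlonglongrightarrow> (\<integral>\<omega>. f (\<zeta> \<omega>) * M \<omega> \<partial>G))"

section \<open>Hermite polynomials\<close>

definition hermite :: "nat \<Rightarrow> real \<Rightarrow> real" where
  "hermite q x = (-1) ^ q * exp (x\<^sup>2 / 2) * (deriv ^^ q) (\<lambda>y. exp (- (y\<^sup>2) / 2)) x"

definition is_hermite_expansion :: "nat \<Rightarrow> (nat \<Rightarrow> int) \<Rightarrow> bool" where
  "is_hermite_expansion l c \<longleftrightarrow>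
     (\<forall>x. x ^ (2 * l + 1) = (\<Sum>r\<le>l. of_int (c r) * hermite (2 * (l - r) + 1) x))"

text \<open>
  The argument order is that of \<open>c\<^sub>r\<^sub>,\<^sub>\<ell>\<close>. Only the values at \<open>r \<le> l\<close> are
  determined; existence is \<open>hermite_expansion_exists\<close> below.
\<close>
definition hermite_coeff :: "nat \<Rightarrow> nat \<Rightarrow> int" where
  "hermite_coeff r l = (SOME c. is_hermite_expansion l c) r"

fun hermite_rec :: "nat \<Rightarrow> real \<Rightarrow> real" where
  "hermite_rec 0 x = 1"
| "hermite_rec (Suc 0) x = x"
| "hermite_rec (Suc (Suc q)) x = x * hermite_rec (Suc q) x - real (Suc q) * hermite_rec q x"

lemma hermite_rec_deriv:
  "(hermite_rec (Suc q) has_real_derivative real (Suc q) * hermite_rec q x) (at x)"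
proof (induction q rule: less_induct)
  case (less q)
  show ?case
  proof (cases q)
    case 0
    have "hermite_rec (Suc 0) = (\<lambda>x. x)" by auto
    then show ?thesis using 0 by simp
  next
    case (Suc m)
    show ?thesis
    proof (cases m)
      case 0
      have "hermite_rec (Suc (Suc 0)) = (\<lambda>x. x * x - 1)" by auto
      then show ?thesis using 0 Suc by (auto intro!: derivative_eq_intros)
    next
      case (Suc k)
      have q: "q = Suc (Suc k)" using \<open>q = Suc m\<close> Suc by simp
      have e: "hermite_rec (Suc q) = (\<lambda>x. x * hermite_rec q x - real q * hermite_rec (Suc k) x)"
        using q by auto
      have 1: "(hermite_rec q has_real_derivative real q * hermite_rec (Suc k) x) (at x)"
        using less[of "Suc k"] q by (simp del: hermite_rec.simps)
      have 2: "(hermite_rec (Suc k) has_real_derivative real (Suc k) * hermite_rec k x) (at x)"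
        using less[of k] q by (simp del: hermite_rec.simps)
      have "((\<lambda>x. x * hermite_rec q x - real q * hermite_rec (Suc k) x) has_real_derivative
          real (Suc q) * hermite_rec q x) (at x)"
        by (rule DERIV_cong, (rule derivative_intros 1 2)+) (simp add: q algebra_simps)
      then show ?thesis unfolding e .
    qed
  qed
qed

lemma hermite_eq_rec: "hermite q = hermite_rec q"
proof -
  define g :: "real \<Rightarrow> real" where "g = (\<lambda>y. exp (- (y\<^sup>2) / 2))"
  have g': "(g has_real_derivative (- x * g x)) (at x)" for x
    unfolding g_def by (auto intro!: derivative_eq_intros)
  have *: "(deriv ^^ q) g = (\<lambda>x. (-1) ^ q * hermite_rec q x * g x)" for q
  proof (induction q)
    case (Suc q)
    have "deriv (\<lambda>x. (-1) ^ q * hermite_rec q x * g x) x = (-1) ^ Suc q * hermite_rec (Suc q) x * g x"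
      for x
    proof (cases q)
      case 0
      then show ?thesis using DERIV_imp_deriv[OF g'] by simp
    next
      case (Suc k)
      have d: "(hermite_rec q has_real_derivative real q * hermite_rec k x) (at x)"
        using hermite_rec_deriv[of k] Suc by simp
      show ?thesis
        by (rule DERIV_imp_deriv, (rule derivative_eq_intros d g' refl)+)
          (simp add: Suc algebra_simps)
    qed
    then show ?case using Suc by (simp add: ext)
  qed simp
  show ?thesis
  proof
    fix x :: real
    have "exp (x\<^sup>2 / 2) * g x = 1" by (simp add: g_def flip: exp_add)
    moreover have "hermite q x = ((-1) ^ q * (-1) ^ q) * hermite_rec q x * (exp (x\<^sup>2 / 2) * g x)"
      unfolding hermite_def g_def[symmetric] * by (simp add: algebra_simps)
    ultimately show "hermite q x = hermite_rec q x"
      by (simp flip: power_mult_distrib)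
  qed
qed

lemma hermite_expansion_exists: "\<exists>c. is_hermite_expansion l c"
proof -
  define h where "h k = hermite_rec (2 * k + 1)" for k
  define S where
    "S l = {f :: real \<Rightarrow> real. \<exists>c :: nat \<Rightarrow> int. f = (\<lambda>x. \<Sum>k\<le>l. of_int (c k) * h k x)}" for l
  have add: "(\<lambda>x. f x + g x) \<in> S l" if "f \<in> S l" "g \<in> S l" for f g l
  proof -
    from that obtain c d where
      "f = (\<lambda>x. \<Sum>k\<le>l. of_int (c k) * h k x)" "g = (\<lambda>x. \<Sum>k\<le>l. of_int (d k) * h k x)"
      by (auto simp: S_def)
    then show ?thesis unfolding S_def
      by (auto intro!: exI[of _ "\<lambda>k. c k + d k"] simp: algebra_simps sum.distrib)
  qed
  have mult: "(\<lambda>x. of_int a * f x) \<in> S l" if "f \<in> S l" for f a l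
  proof -
    from that obtain c where "f = (\<lambda>x. \<Sum>k\<le>l. of_int (c k) * h k x)"
      by (auto simp: S_def)
    then show ?thesis unfolding S_def
      by (auto intro!: exI[of _ "\<lambda>k. a * c k"] simp: algebra_simps sum_distrib_left)
  qed
  have mem: "h j \<in> S l" if "j \<le> l" for j l
  proof -
    have "(\<Sum>k\<le>l. of_int (if k = j then 1 else 0) * h k x) = h j x" for x
      using that by (simp add: if_distrib[of of_int] if_distribR cong: if_cong)
        (simp add: if_distrib[of "\<lambda>y. y * _"] cong: if_cong)
    then show ?thesis unfolding S_def by (auto intro!: exI[of _ "\<lambda>k. if k = j then 1 else 0"])
  qed
  have sum: "(\<lambda>x. \<Sum>k\<le>n. of_int (c k) * F k x) \<in> S l" if "\<And>k. k \<le> n \<Longrightarrow> F k \<in> S l" for n l and c :: "nat \<Rightarrow> int" and F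
    using that
  proof (induction n)
    case 0
    then show ?case using mult by simp
  next
    case (Suc n)
    have "(\<lambda>x. (\<Sum>k\<le>n. of_int (c k) * F k x) + of_int (c (Suc n)) * F (Suc n) x) \<in> S l"
      by (rule add, rule Suc.IH, use Suc.prems in simp, rule mult, use Suc.prems in simp)
    then show ?case by simp
  qed
  have step: "(\<lambda>x. x\<^sup>2 * h k x) \<in> S (Suc l)" if "k \<le> l" for k l
  proof (cases k)
    case 0
    have "(\<lambda>x. x\<^sup>2 * h k x) = (\<lambda>x. h 1 x + of_int 3 * h 0 x)"
      by (auto simp: h_def 0 fun_eq_iff numeral_eq_Suc algebra_simps)
    then show ?thesis using add[OF mem mult[OF mem], of 1 "Suc l" 0 3] by simp
  next
    case (Suc j)
    have "(\<lambda>x. x\<^sup>2 * h k x) = (\<lambda>x. h (Suc k) x + (of_int (int (4 * k + 3)) * h k x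
        + of_int (int ((2 * k + 1) * (2 * k))) * h j x))"
    proof
      fix x :: real
      define a where "a = hermite_rec (2 * j) x"
      define b where "b = hermite_rec (2 * j + 1) x"
      have 0: "h j x = b" by (simp add: h_def b_def)
      have 1: "hermite_rec (2 * j + 2) x = x * b - real (2 * j + 1) * a" by (simp add: a_def b_def)
      have 2: "h k x = x * hermite_rec (2 * j + 2) x - real (2 * j + 2) * b"
        by (simp add: h_def b_def Suc)
      have 3: "hermite_rec (2 * j + 4) x = x * h k x - real (2 * j + 3) * hermite_rec (2 * j + 2) x"
        by (simp add: h_def Suc numeral_eq_Suc)
      have 4: "h (Suc k) x = x * hermite_rec (2 * j + 4) x - real (2 * j + 4) * h k x"
        by (simp add: h_def Suc numeral_eq_Suc)
      have 5: "x * hermite_rec (2 * j + 2) x = h k x + real (2 * j + 2) * b" using 2 by simp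
      have "h (Suc k) x = x * (x * h k x) - real (2 * j + 3) * (x * hermite_rec (2 * j + 2) x)
          - real (2 * j + 4) * h k x"
        unfolding 4 3 by (simp add: algebra_simps)
      then show "x\<^sup>2 * h k x = h (Suc k) x + (of_int (int (4 * k + 3)) * h k x
        + of_int (int ((2 * k + 1) * (2 * k))) * h j x)"
        unfolding 5 0 using Suc by (simp add: algebra_simps power2_eq_square)
    qed
    moreover have "(\<lambda>x. h (Suc k) x + (of_int (int (4 * k + 3)) * h k x
        + of_int (int ((2 * k + 1) * (2 * k))) * h j x)) \<in> S (Suc l)"
      by (intro add mult mem) (use that Suc in auto)
    ultimately show ?thesis by simp
  qed
  have "(\<lambda>x. x ^ (2 * l + 1)) \<in> S l"
  proof (induction l)
    case 0
    have "h 0 = (\<lambda>x. x)" by (auto simp: h_def)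
    then show ?case using mem[of 0 0] by simp
  next
    case (Suc l)
    then obtain c where c: "(\<lambda>x. x ^ (2 * l + 1)) = (\<lambda>x. \<Sum>k\<le>l. of_int (c k) * h k x)"
      by (auto simp: S_def)
    have "x ^ (2 * Suc l + 1) = (\<Sum>k\<le>l. of_int (c k) * (x\<^sup>2 * h k x))" for x :: real
    proof -
      have "x ^ (2 * Suc l + 1) = x\<^sup>2 * x ^ (2 * l + 1)" by (simp add: power2_eq_square)
      also have "\<dots> = x\<^sup>2 * (\<Sum>k\<le>l. of_int (c k) * h k x)" using c by (simp only: fun_eq_iff)
      finally show ?thesis by (simp add: sum_distrib_left algebra_simps)
    qed
    then have e: "(\<lambda>x::real. x ^ (2 * Suc l + 1)) = (\<lambda>x. \<Sum>k\<le>l. of_int (c k) * (x\<^sup>2 * h k x))" by blast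
    show ?case unfolding e by (rule sum) (rule step)
  qed
  then obtain c :: "nat \<Rightarrow> int" where
    c: "\<And>x::real. x ^ (2 * l + 1) = (\<Sum>k\<le>l. of_int (c k) * h k x)"
    by (auto simp: S_def fun_eq_iff)
  have "is_hermite_expansion l (\<lambda>r. c (l - r))"
    unfolding is_hermite_expansion_def hermite_eq_rec
  proof
    fix x :: real
    have "(\<Sum>r\<le>l. of_int (c (l - r)) * hermite_rec (2 * (l - r) + 1) x)
        = (\<Sum>k\<le>l. of_int (c k) * hermite_rec (2 * k + 1) x)"
      by (rule sum.reindex_bij_witness[of _ "\<lambda>k. l - k" "\<lambda>r. l - r"]) auto
    then show "x ^ (2 * l + 1) = (\<Sum>r\<le>l. of_int (c (l - r)) * hermite_rec (2 * (l - r) + 1) x)"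
      using c[of x] by (simp add: h_def)
  qed
  then show ?thesis by blast
qed

section \<open>Odd power variations and the limiting variance\<close>

definition power_variation :: "(real \<Rightarrow> 'a \<Rightarrow> real) \<Rightarrow> nat \<Rightarrow> nat \<Rightarrow> real \<Rightarrow> 'a \<Rightarrow> real" where
  "power_variation X l n t \<omega> =
     (\<Sum>j<nat \<lfloor>real n * t\<rfloor>. (X (real (j + 1) / real n) \<omega> - X (real j / real n) \<omega>) ^ (2 * l + 1))"

definition K_coeff :: "real \<Rightarrow> nat \<Rightarrow> nat \<Rightarrow> real" where
  "K_coeff lam r l =
     (of_int (hermite_coeff r l))\<^sup>2 * 2 ^ (2 * r) * lam ^ (2 * l + 1) * fact (2 * (l - r) + 1)"

definition limit_variance :: "real \<Rightarrow> real \<Rightarrow> real \<Rightarrow> nat \<Rightarrow> real" where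
  "limit_variance \<alpha> \<beta> lam l =
     \<alpha> / (2 * \<beta>) *
       (\<Sum>r<l. K_coeff lam r l *
          (\<Sum>\<^sub>\<infinity>p\<in>(UNIV :: int set).
             (\<bar>of_int p + 1\<bar> powr \<alpha> + \<bar>of_int p - 1\<bar> powr \<alpha> - 2 * \<bar>of_int p\<bar> powr \<alpha>)
               ^ (2 * (l - r) + 1)))"

end

theory Submission
  imports Defs "HOL-Real_Asymp.Real_Asymp"
begin

text \<open>
  Write \<open>V\<^sub>n\<close> as \<open>n\<^sup>-\<^sup>1\<^sup>/\<^sup>2\<close> times a sum of odd powers of the normalised increments
  \<open>y\<^sub>j = n\<^sup>\<alpha>\<^sup>/\<^sup>2 (X((j+1)/n) - X(j/n))\<close>, and let \<open>W\<close> be a linear combination of values of \<open>V\<^sub>n\<close> and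
  \<open>B\<close> one of values of \<open>X\<close>. Gaussian integration by parts turns the derivative of
  \<open>E exp(i(\<tau> W + B))\<close> in \<open>\<tau>\<close> into \<open>- \<tau> E[Q exp(i(\<tau> W + B))] - E[R exp(i(\<tau> W + B))]\<close>, where \<open>Q\<close> is a
  quadratic and \<open>R\<close> a linear functional of polynomials in the \<open>y\<^sub>j\<close>. Since the covariances of the
  \<open>y\<^sub>j\<close> decay summably in the distance of the indices, \<open>Q\<close> concentrates at the limit \<open>S\<close> of the
  variance of \<open>W\<close> and \<open>R\<close> at \<open>0\<close>, so that \<open>E exp(i(W + B))\<close> tends to \<open>exp(- S/2) E exp(i B)\<close>.

  The covariances of the \<open>y\<^sub>j\<close> near time \<open>u\<close> converge to \<open>\<lambda> u\<^sup>2\<^sup>\<beta>\<^sup>-\<^sup>\<alpha>\<close> times the second difference of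
  \<open>\<bar>p\<bar>\<^sup>\<alpha>\<close>. The Hermite expansion of the odd power then gives \<open>S\<close>; the first chaos drops out because
  the second differences telescope to sum \<open>0\<close>, and \<open>\<alpha> = 1/(2 \<ell> + 1)\<close> makes the exponents of \<open>u\<close> add up.
  The exponentials \<open>exp(i B)\<close> determine all weights measurable with respect to \<open>X\<close>, and trigonometric
  polynomials approximate bounded continuous functions.
\<close>

text \<open>The odd power contains a first chaos, linear in \<open>X\<close> itself, and the mean of
  R is the covariance of that part with B: its vanishing is what separates the limit from
  \<open>X\<close>. The fluctuations of R are small for another reason: a Bessel inequality bounds
  the sum of the squared covariances of B with all y_j, and R carries a factor n^(-1/2).

  All this needs a summable bound in the index distance that is uniform on bounded time intervals.
  Off the diagonal it comes from the mixed derivative of the covariance. Far away it requires decay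
  of \<phi>', which is not assumed: \<phi>'' is integrable at infinity, so \<phi>' has a limit
  there, and |\<phi>(x)| \<le> \<phi>(1) x^\<beta> (Cauchy-Schwarz and self-similarity) with \<beta>
  < 1 forces this limit to be 0. Uniformity in time rests on 2 \<beta> - \<alpha> \<ge> 0.

  Every chaos contributes u to the same power (2 l + 1) (2 \<beta> - \<alpha>) = 2 \<beta> /
  \<alpha> - 1. Its integral over [0, min s t] is the origin of the exponent 2 \<beta> / \<alpha>
  and of the factor \<alpha> / (2 \<beta>).\<close>

section \<open>Gaussian vectors\<close>

text \<open>
  Tilting both measures by the weights reduces the claim to Levy uniqueness.
\<close>
lemma weighted_char_unique_pos:
  fixes x :: "'a \<Rightarrow> real" and y :: "'b \<Rightarrow> real"
  assumes P: "prob_space P" and Q: "prob_space Q"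
    and [measurable]: "x \<in> borel_measurable P" "y \<in> borel_measurable Q"
    and w: "integrable P w" "\<And>\<omega>. w \<omega> \<ge> (0::real)" and v: "integrable Q v" "\<And>\<omega>. v \<omega> \<ge> (0::real)"
    and pos: "(\<integral>\<omega>. w \<omega> \<partial>P) > 0"
    and eq: "\<And>s. (\<integral>\<omega>. w \<omega> *\<^sub>R iexp (s * x \<omega>) \<partial>P) = (\<integral>\<omega>. v \<omega> *\<^sub>R iexp (s * y \<omega>) \<partial>Q)"
    and A: "A \<in> sets borel"
  shows "(\<integral>\<omega>. w \<omega> * indicator A (x \<omega>) \<partial>P) = (\<integral>\<omega>. v \<omega> * indicator A (y \<omega>) \<partial>Q)"
proof -
  interpret P: prob_space P by fact
  interpret Q: prob_space Q by fact
  define a where "a = (\<integral>\<omega>. w \<omega> \<partial>P)"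
  have [measurable]: "w \<in> borel_measurable P" "v \<in> borel_measurable Q" "A \<in> sets borel"
    using w v A by auto
  have "complex_of_real a = (\<integral>\<omega>. w \<omega> *\<^sub>R iexp (0 * x \<omega>) \<partial>P)"
    unfolding a_def by (simp add: scaleR_conv_of_real)
  also have "\<dots> = complex_of_real (\<integral>\<omega>. v \<omega> \<partial>Q)"
    unfolding eq by (simp add: scaleR_conv_of_real)
  finally have av: "a = (\<integral>\<omega>. v \<omega> \<partial>Q)" using of_real_eq_iff by blast
  have a0: "a > 0" using pos a_def by simp
  define P' where "P' = density P (\<lambda>\<omega>. ennreal (w \<omega> / a))"
  define Q' where "Q' = density Q (\<lambda>\<omega>. ennreal (v \<omega> / a))"
  have mP: "emeasure P' (space P) = 1"
    unfolding P'_def using w a0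
    by (simp add: emeasure_density cong: nn_integral_cong) (subst nn_integral_eq_integral, auto simp: a_def)
  have mQ: "emeasure Q' (space Q) = 1"
    unfolding Q'_def using v a0
    by (simp add: emeasure_density cong: nn_integral_cong) (subst nn_integral_eq_integral, auto simp: av)
  interpret P': prob_space P' by standard (use mP in \<open>simp add: P'_def\<close>)
  interpret Q': prob_space Q' by standard (use mQ in \<open>simp add: Q'_def\<close>)
  have xm: "x \<in> borel_measurable P'" "y \<in> borel_measurable Q'" by (auto simp: P'_def Q'_def)
  have "distr P' borel x = distr Q' borel y"
  proof (rule Levy_uniqueness)
    show "real_distribution (distr P' borel x)" by (rule P'.real_distribution_distr) fact
    show "real_distribution (distr Q' borel y)" by (rule Q'.real_distribution_distr) fact
    show "char (distr P' borel x) = char (distr Q' borel y)"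
    proof
      fix s
      have "char (distr P' borel x) s = (\<integral>\<omega>. (w \<omega> / a) *\<^sub>R iexp (s * x \<omega>) \<partial>P)"
        unfolding char_def P'_def using w a0
        by (subst integral_distr) (auto simp: integral_density)
      also have "\<dots> = (\<integral>\<omega>. (w \<omega> *\<^sub>R iexp (s * x \<omega>)) /\<^sub>R a \<partial>P)"
        by (intro Bochner_Integration.integral_cong refl) (simp add: divide_inverse mult.commute)
      also have "\<dots> = (\<integral>\<omega>. w \<omega> *\<^sub>R iexp (s * x \<omega>) \<partial>P) /\<^sub>R a" by (rule integral_scaleR_right)
      also have "\<dots> = (\<integral>\<omega>. v \<omega> *\<^sub>R iexp (s * y \<omega>) \<partial>Q) /\<^sub>R a" using eq by simp
      also have "\<dots> = (\<integral>\<omega>. (v \<omega> *\<^sub>R iexp (s * y \<omega>)) /\<^sub>R a \<partial>Q)" by (rule integral_scaleR_right[symmetric])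
      also have "\<dots> = (\<integral>\<omega>. (v \<omega> / a) *\<^sub>R iexp (s * y \<omega>) \<partial>Q)"
        by (intro Bochner_Integration.integral_cong refl) (simp add: divide_inverse mult.commute)
      also have "\<dots> = char (distr Q' borel y) s"
        unfolding char_def Q'_def using v a0
        by (subst integral_distr) (auto simp: integral_density)
      finally show "char (distr P' borel x) s = char (distr Q' borel y) s" .
    qed
  qed
  then have "(\<integral>u. indicator A u \<partial>distr P' borel x) = (\<integral>u. (indicator A u :: real) \<partial>distr Q' borel y)" by simp
  then have "(\<integral>\<omega>. indicator A (x \<omega>) \<partial>P') = (\<integral>\<omega>. (indicator A (y \<omega>) :: real) \<partial>Q')"
    using xm by (subst (asm) (1 2) integral_distr) auto
  then have "(\<integral>\<omega>. w \<omega> / a * indicator A (x \<omega>) \<partial>P) = (\<integral>\<omega>. v \<omega> / a * indicator A (y \<omega>) \<partial>Q)"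
    unfolding P'_def Q'_def using w v a0 by (subst (asm) (1 2) integral_density) auto
  then show ?thesis using a0 by simp
qed

text \<open>A real weight bounded by \<open>K\<close> becomes at least 1 after adding
  \<open>K + 1\<close>, so that \<open>weighted_char_unique_pos\<close> applies; the unweighted
  identity \<open>eq1\<close> then removes the shift. A complex weight is split into real and
  imaginary parts. Their identities follow from those for \<open>w\<close> and \<open>cnj w\<close>,
  the latter being the conjugate of \<open>eq\<close> at \<open>- s\<close>.\<close>

lemma weighted_char_unique:
  fixes x :: "'a \<Rightarrow> real" and y :: "'b \<Rightarrow> real" and w :: "'a \<Rightarrow> complex" and v :: "'b \<Rightarrow> complex"
  assumes P: "prob_space P" and Q: "prob_space Q"
    and [measurable]: "x \<in> borel_measurable P" "y \<in> borel_measurable Q"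
      "w \<in> borel_measurable P" "v \<in> borel_measurable Q"
    and w: "\<And>\<omega>. cmod (w \<omega>) \<le> K" and v: "\<And>\<omega>. cmod (v \<omega>) \<le> K"
    and eq1: "\<And>s. (\<integral>\<omega>. iexp (s * x \<omega>) \<partial>P) = (\<integral>\<omega>. iexp (s * y \<omega>) \<partial>Q)"
    and eq: "\<And>s. (\<integral>\<omega>. w \<omega> * iexp (s * x \<omega>) \<partial>P) = (\<integral>\<omega>. v \<omega> * iexp (s * y \<omega>) \<partial>Q)"
    and A: "A \<in> sets borel"
  shows "(\<integral>\<omega>. w \<omega> * indicator A (x \<omega>) \<partial>P) = (\<integral>\<omega>. v \<omega> * indicator A (y \<omega>) \<partial>Q)"
proof -
  interpret P: prob_space P by fact
  interpret Q: prob_space Q by fact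
  have [measurable]: "A \<in> sets borel" by fact
  have iw: "integrable P (\<lambda>\<omega>. g \<omega> * w \<omega>)" if "g \<in> borel_measurable P" "\<And>\<omega>. cmod (g \<omega>) \<le> 1" for g
    by (rule P.integrable_const_bound[where B=K])
      (use that w norm_ge_zero mult_mono[of "cmod (g _)" 1 "cmod (w _)" K] in \<open>auto simp: norm_mult\<close>)
  have iv: "integrable Q (\<lambda>\<omega>. g \<omega> * v \<omega>)" if "g \<in> borel_measurable Q" "\<And>\<omega>. cmod (g \<omega>) \<le> 1" for g
    by (rule Q.integrable_const_bound[where B=K])
      (use that v norm_ge_zero mult_mono[of "cmod (g _)" 1 "cmod (v _)" K] in \<open>auto simp: norm_mult\<close>)
  have iw': "integrable P (\<lambda>\<omega>. w \<omega> * iexp (s * x \<omega>))" for s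
    using iw[of "\<lambda>\<omega>. iexp (s * x \<omega>)"] by (simp add: mult.commute)
  have iv': "integrable Q (\<lambda>\<omega>. v \<omega> * iexp (s * y \<omega>))" for s
    using iv[of "\<lambda>\<omega>. iexp (s * y \<omega>)"] by (simp add: mult.commute)
  have icw': "integrable P (\<lambda>\<omega>. cnj (w \<omega>) * iexp (s * x \<omega>))" for s
    using integrable_cnj[OF iw'[of "-s"]] by (simp add: exp_cnj)
  have icv': "integrable Q (\<lambda>\<omega>. cnj (v \<omega>) * iexp (s * y \<omega>))" for s
    using integrable_cnj[OF iv'[of "-s"]] by (simp add: exp_cnj)
  have eqc: "(\<integral>\<omega>. cnj (w \<omega>) * iexp (s * x \<omega>) \<partial>P) = (\<integral>\<omega>. cnj (v \<omega>) * iexp (s * y \<omega>) \<partial>Q)" for s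
  proof -
    have "cnj (\<integral>\<omega>. w \<omega> * iexp (- s * x \<omega>) \<partial>P) = cnj (\<integral>\<omega>. v \<omega> * iexp (- s * y \<omega>) \<partial>Q)"
      using eq[of "-s"] by simp
    moreover have "cnj (\<integral>\<omega>. w \<omega> * iexp (- s * x \<omega>) \<partial>P) = (\<integral>\<omega>. cnj (w \<omega>) * iexp (s * x \<omega>) \<partial>P)"
      unfolding Bochner_Integration.integral_cnj[symmetric] by (simp add: exp_cnj del: Bochner_Integration.integral_cnj)
    moreover have "cnj (\<integral>\<omega>. v \<omega> * iexp (- s * y \<omega>) \<partial>Q) = (\<integral>\<omega>. cnj (v \<omega>) * iexp (s * y \<omega>) \<partial>Q)"
      unfolding Bochner_Integration.integral_cnj[symmetric] by (simp add: exp_cnj del: Bochner_Integration.integral_cnj)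
    ultimately show ?thesis by metis
  qed
  have key: "(\<integral>\<omega>. f \<omega> * indicator A (x \<omega>) \<partial>P) = (\<integral>\<omega>. g \<omega> * indicator A (y \<omega>) \<partial>Q)"
    if [measurable]: "f \<in> borel_measurable P" "g \<in> borel_measurable Q"
      and f: "\<And>\<omega>. \<bar>f \<omega>\<bar> \<le> K" and g: "\<And>\<omega>. \<bar>g \<omega>\<bar> \<le> K"
      and fg: "\<And>s. (\<integral>\<omega>. complex_of_real (f \<omega>) * iexp (s * x \<omega>) \<partial>P) = (\<integral>\<omega>. complex_of_real (g \<omega>) * iexp (s * y \<omega>) \<partial>Q)"
    for f g :: "_ \<Rightarrow> real"
  proof -
    have K0: "K \<ge> 0" using f[of undefined] by linarith
    have if': "integrable P f" by (rule P.integrable_const_bound[where B=K]) (use f in auto)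
    have ig': "integrable Q g" by (rule Q.integrable_const_bound[where B=K]) (use g in auto)
    have ifx: "integrable P (\<lambda>\<omega>. complex_of_real (f \<omega>) * iexp (s * x \<omega>))" for s
      by (rule P.integrable_const_bound[where B=K]) (use f in \<open>auto simp: norm_mult\<close>)
    have igx: "integrable Q (\<lambda>\<omega>. complex_of_real (g \<omega>) * iexp (s * y \<omega>))" for s
      by (rule Q.integrable_const_bound[where B=K]) (use g in \<open>auto simp: norm_mult\<close>)
    have i1: "integrable P (\<lambda>\<omega>. complex_of_real (K+1) * iexp (s * x \<omega>))" for s
      by (rule P.integrable_const_bound[where B="K+1"]) (use K0 in \<open>auto simp: norm_mult simp del: of_real_add\<close>)
    have i2: "integrable Q (\<lambda>\<omega>. complex_of_real (K+1) * iexp (s * y \<omega>))" for s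
      by (rule Q.integrable_const_bound[where B="K+1"]) (use K0 in \<open>auto simp: norm_mult simp del: of_real_add\<close>)
    have "(\<integral>\<omega>. (K + 1 + f \<omega>) * indicator A (x \<omega>) \<partial>P) = (\<integral>\<omega>. (K + 1 + g \<omega>) * indicator A (y \<omega>) \<partial>Q)"
    proof (rule weighted_char_unique_pos[OF P Q])
      show "K + 1 + f \<omega> \<ge> 0" for \<omega> using f[of \<omega>] by linarith
      show "K + 1 + g \<omega> \<ge> 0" for \<omega> using g[of \<omega>] by linarith
      have "(\<integral>\<omega>. 1 \<partial>P) \<le> (\<integral>\<omega>. (K + 1 + f \<omega>) \<partial>P)"
        by (rule integral_mono) (use if' f in \<open>auto simp: abs_le_iff\<close>, smt (verit))
      then show "0 < (\<integral>\<omega>. (K + 1 + f \<omega>) \<partial>P)" by (simp add: P.prob_space)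
      fix s
      have "(\<integral>\<omega>. (K + 1 + f \<omega>) *\<^sub>R iexp (s * x \<omega>) \<partial>P)
        = (\<integral>\<omega>. complex_of_real (K+1) * iexp (s * x \<omega>) + complex_of_real (f \<omega>) * iexp (s * x \<omega>) \<partial>P)"
        by (simp add: scaleR_conv_of_real algebra_simps)
      also have "\<dots> = complex_of_real (K+1) * (\<integral>\<omega>. iexp (s * x \<omega>) \<partial>P) + (\<integral>\<omega>. complex_of_real (f \<omega>) * iexp (s * x \<omega>) \<partial>P)"
        by (subst Bochner_Integration.integral_add[OF i1 ifx]) simp
      also have "\<dots> = complex_of_real (K+1) * (\<integral>\<omega>. iexp (s * y \<omega>) \<partial>Q) + (\<integral>\<omega>. complex_of_real (g \<omega>) * iexp (s * y \<omega>) \<partial>Q)"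
        by (simp only: fg eq1)
      also have "\<dots> = (\<integral>\<omega>. complex_of_real (K+1) * iexp (s * y \<omega>) + complex_of_real (g \<omega>) * iexp (s * y \<omega>) \<partial>Q)"
        by (subst Bochner_Integration.integral_add[OF i2 igx]) simp
      also have "\<dots> = (\<integral>\<omega>. (K + 1 + g \<omega>) *\<^sub>R iexp (s * y \<omega>) \<partial>Q)"
        by (simp add: scaleR_conv_of_real algebra_simps)
      finally show "(\<integral>\<omega>. (K + 1 + f \<omega>) *\<^sub>R iexp (s * x \<omega>) \<partial>P) = (\<integral>\<omega>. (K + 1 + g \<omega>) *\<^sub>R iexp (s * y \<omega>) \<partial>Q)" .
    qed (use if' ig' in auto)
    moreover have "(\<integral>\<omega>. 1 * indicator A (x \<omega>) \<partial>P) = (\<integral>\<omega>. (1::real) * indicator A (y \<omega>) \<partial>Q)"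
      by (rule weighted_char_unique_pos[OF P Q]) (use eq1 in \<open>auto simp: P.prob_space\<close>)
    moreover have "integrable P (\<lambda>\<omega>. f \<omega> * indicator A (x \<omega>))"
      by (rule P.integrable_const_bound[where B=K]) (use f K0 in \<open>auto simp: abs_mult indicator_def\<close>)
    moreover have "integrable Q (\<lambda>\<omega>. g \<omega> * indicator A (y \<omega>))"
      by (rule Q.integrable_const_bound[where B=K]) (use g K0 in \<open>auto simp: abs_mult indicator_def\<close>)
    moreover have "integrable P (\<lambda>\<omega>. indicator A (x \<omega>) :: real)" "integrable Q (\<lambda>\<omega>. indicator A (y \<omega>) :: real)"
      by (auto intro!: P.integrable_const_bound[where B=1] Q.integrable_const_bound[where B=1] simp: indicator_def)
    ultimately show ?thesis
      by (simp add: algebra_simps)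
  qed
  have re: "(\<integral>\<omega>. Re (w \<omega>) * indicator A (x \<omega>) \<partial>P) = (\<integral>\<omega>. Re (v \<omega>) * indicator A (y \<omega>) \<partial>Q)"
  proof (rule key)
    fix s
    have "(\<integral>\<omega>. complex_of_real (Re (w \<omega>)) * iexp (s * x \<omega>) \<partial>P)
       = (\<integral>\<omega>. (w \<omega> * iexp (s * x \<omega>) + cnj (w \<omega>) * iexp (s * x \<omega>)) / 2 \<partial>P)"
      by (intro Bochner_Integration.integral_cong refl)
        (simp add: complex_add_cnj flip: distrib_right)
    also have "\<dots> = (\<integral>\<omega>. (v \<omega> * iexp (s * y \<omega>) + cnj (v \<omega>) * iexp (s * y \<omega>)) / 2 \<partial>Q)"
      unfolding Bochner_Integration.integral_divide_zero
      by (simp only: Bochner_Integration.integral_add[OF iw' icw'] Bochner_Integration.integral_add[OF iv' icv'] eq eqc)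
    also have "\<dots> = (\<integral>\<omega>. complex_of_real (Re (v \<omega>)) * iexp (s * y \<omega>) \<partial>Q)"
      by (intro Bochner_Integration.integral_cong refl)
        (simp add: complex_add_cnj flip: distrib_right)
    finally show "(\<integral>\<omega>. complex_of_real (Re (w \<omega>)) * iexp (s * x \<omega>) \<partial>P) = (\<integral>\<omega>. complex_of_real (Re (v \<omega>)) * iexp (s * y \<omega>) \<partial>Q)" .
    show "\<bar>Re (w \<omega>)\<bar> \<le> K" for \<omega> by (rule order_trans[OF abs_Re_le_cmod w])
    show "\<bar>Re (v \<omega>)\<bar> \<le> K" for \<omega> by (rule order_trans[OF abs_Re_le_cmod v])
  qed measurable
  have im: "(\<integral>\<omega>. Im (w \<omega>) * indicator A (x \<omega>) \<partial>P) = (\<integral>\<omega>. Im (v \<omega>) * indicator A (y \<omega>) \<partial>Q)"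
  proof (rule key)
    fix s
    have "(z - cnj z) / (2 * \<i>) = complex_of_real (Im z)" for z
      by (simp add: complex_eq_iff)
    from this[symmetric] have imc: "complex_of_real (Im z) * e = (z * e - cnj z * e) / (2 * \<i>)" for z e
      by (simp add: left_diff_distrib)
    have "(\<integral>\<omega>. complex_of_real (Im (w \<omega>)) * iexp (s * x \<omega>) \<partial>P)
       = (\<integral>\<omega>. (w \<omega> * iexp (s * x \<omega>) - cnj (w \<omega>) * iexp (s * x \<omega>)) / (2 * \<i>) \<partial>P)"
      by (simp only: imc)
    also have "\<dots> = (\<integral>\<omega>. (v \<omega> * iexp (s * y \<omega>) - cnj (v \<omega>) * iexp (s * y \<omega>)) / (2 * \<i>) \<partial>Q)"
      unfolding Bochner_Integration.integral_divide_zero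
      by (simp only: Bochner_Integration.integral_diff[OF iw' icw'] Bochner_Integration.integral_diff[OF iv' icv'] eq eqc)
    also have "\<dots> = (\<integral>\<omega>. complex_of_real (Im (v \<omega>)) * iexp (s * y \<omega>) \<partial>Q)"
      by (simp only: imc)
    finally show "(\<integral>\<omega>. complex_of_real (Im (w \<omega>)) * iexp (s * x \<omega>) \<partial>P) = (\<integral>\<omega>. complex_of_real (Im (v \<omega>)) * iexp (s * y \<omega>) \<partial>Q)" .
    show "\<bar>Im (w \<omega>)\<bar> \<le> K" for \<omega> by (rule order_trans[OF abs_Im_le_cmod w])
    show "\<bar>Im (v \<omega>)\<bar> \<le> K" for \<omega> by (rule order_trans[OF abs_Im_le_cmod v])
  qed measurable
  have iwA: "integrable P (\<lambda>\<omega>. w \<omega> * indicator A (x \<omega>))"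
    using iw[of "\<lambda>\<omega>. indicator A (x \<omega>)"] by (simp add: mult.commute indicator_def)
  have ivA: "integrable Q (\<lambda>\<omega>. v \<omega> * indicator A (y \<omega>))"
    using iv[of "\<lambda>\<omega>. indicator A (y \<omega>)"] by (simp add: mult.commute indicator_def)
  have ind: "indicator A r = complex_of_real (indicator A r)" for r by (simp add: indicator_def)
  show ?thesis
  proof (rule complex_eqI)
    show "Re (\<integral>\<omega>. w \<omega> * indicator A (x \<omega>) \<partial>P) = Re (\<integral>\<omega>. v \<omega> * indicator A (y \<omega>) \<partial>Q)"
      unfolding integral_Re[OF iwA, symmetric] integral_Re[OF ivA, symmetric] using re
      by (simp add: ind)
    show "Im (\<integral>\<omega>. w \<omega> * indicator A (x \<omega>) \<partial>P) = Im (\<integral>\<omega>. v \<omega> * indicator A (y \<omega>) \<partial>Q)"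
      unfolding integral_Im[OF iwA, symmetric] integral_Im[OF ivA, symmetric] using im
      by (simp add: ind)
  qed
qed

lemma integral_indicator_complex:
  assumes "S \<in> sets M"
  shows "(\<integral>\<omega>. indicator S \<omega> \<partial>M) = complex_of_real (measure M S)"
proof -
  have "(\<integral>\<omega>. indicator S \<omega> \<partial>M) = (\<integral>\<omega>. complex_of_real (indicator S \<omega>) \<partial>M)"
    by (intro Bochner_Integration.integral_cong refl) (simp add: indicator_def)
  also have "\<dots> = complex_of_real (measure M S)"
    using sets.sets_into_space[OF assms] by (simp add: Int_absorb2 Int_commute)
  finally show ?thesis .
qed

text \<open>The exponentials are exchanged for indicators one coordinate at a time. The indicators
  already present and the remaining exponentials together form the bounded weight for
  \<open>weighted_char_unique\<close>, so only uniqueness in one dimension enters. In the end all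
  factors are indicators, which gives equality on rectangles.\<close>

lemma PiM_law_eqI_char:
  fixes x :: "'i \<Rightarrow> 'a \<Rightarrow> real" and y :: "'i \<Rightarrow> 'b \<Rightarrow> real"
  assumes P: "prob_space P" and Q: "prob_space Q" and I: "finite I"
    and x: "\<And>k. k \<in> I \<Longrightarrow> x k \<in> borel_measurable P"
    and y: "\<And>k. k \<in> I \<Longrightarrow> y k \<in> borel_measurable Q"
    and eq: "\<And>t. (\<integral>\<omega>. iexp (\<Sum>k\<in>I. t k * x k \<omega>) \<partial>P) = (\<integral>\<omega>. iexp (\<Sum>k\<in>I. t k * y k \<omega>) \<partial>Q)"
  shows "distr P (PiM I (\<lambda>_. borel)) (\<lambda>\<omega>. \<lambda>k\<in>I. x k \<omega>) = distr Q (PiM I (\<lambda>_. borel)) (\<lambda>\<omega>. \<lambda>k\<in>I. y k \<omega>)"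
proof -
  interpret P: prob_space P by fact
  interpret Q: prob_space Q by fact
  have step: "(\<integral>\<omega>. (\<Prod>k\<in>J. indicator (A k) (x k \<omega>)) * iexp (\<Sum>k\<in>I-J. t k * x k \<omega>) \<partial>P)
      = (\<integral>\<omega>. (\<Prod>k\<in>J. indicator (A k) (y k \<omega>)) * iexp (\<Sum>k\<in>I-J. t k * y k \<omega>) \<partial>Q)"
    if J: "J \<subseteq> I" and A: "\<And>k. k \<in> I \<Longrightarrow> A k \<in> sets borel" for J t and A :: "'i \<Rightarrow> real set"
    using finite_subset[OF J I] J
  proof (induction J arbitrary: t rule: finite_induct)
    case empty
    then show ?case using eq by simp
  next
    case (insert m J)
    let ?K = "I - insert m J"
    have m: "m \<in> I" and JI: "J \<subseteq> I" using insert by auto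
    have K: "finite ?K" using I by auto
    have IJ: "I - J = insert m ?K" "m \<notin> ?K" using insert by auto
    have [measurable]: "x m \<in> borel_measurable P" "y m \<in> borel_measurable Q" using x y m by auto
    have [measurable]: "A k \<in> sets borel" "x k \<in> borel_measurable P" "y k \<in> borel_measurable Q" if "k \<in> J" for k
      using A x y JI that by auto
    have [measurable]: "x k \<in> borel_measurable P" "y k \<in> borel_measurable Q" if "k \<in> ?K" for k
      using x y JI that by auto
    have nb: "cmod (\<Prod>k\<in>J. indicator (A k) (f k) :: complex) \<le> 1" for f :: "'i \<Rightarrow> real"
      unfolding prod_norm[symmetric] by (intro prod_le_1) (auto simp: indicator_def)
    have "(\<integral>\<omega>. ((\<Prod>k\<in>J. indicator (A k) (x k \<omega>)) * iexp (\<Sum>k\<in>?K. t k * x k \<omega>)) * indicator (A m) (x m \<omega>) \<partial>P)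
      = (\<integral>\<omega>. ((\<Prod>k\<in>J. indicator (A k) (y k \<omega>)) * iexp (\<Sum>k\<in>?K. t k * y k \<omega>)) * indicator (A m) (y m \<omega>) \<partial>Q)"
    proof (rule weighted_char_unique[OF P Q, where K=1])
      show "cmod ((\<Prod>k\<in>J. indicator (A k) (x k \<omega>)) * iexp (\<Sum>k\<in>?K. t k * x k \<omega>)) \<le> 1" for \<omega>
        using nb by (simp add: norm_mult del: of_real_sum)
      show "cmod ((\<Prod>k\<in>J. indicator (A k) (y k \<omega>)) * iexp (\<Sum>k\<in>?K. t k * y k \<omega>)) \<le> 1" for \<omega>
        using nb by (simp add: norm_mult del: of_real_sum)
      show "A m \<in> sets borel" using A m by auto
      fix s
      show "(\<integral>\<omega>. iexp (s * x m \<omega>) \<partial>P) = (\<integral>\<omega>. iexp (s * y m \<omega>) \<partial>Q)"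
        using eq[of "\<lambda>k. if k = m then s else 0"] m I
        by (simp add: if_distrib[of "\<lambda>u. u * _"] if_distrib[of complex_of_real] cong: if_cong)
      \<comment> \<open>The induction hypothesis holds for every \<open>t\<close>; varying the entry
        at \<open>m\<close> alone produces the weighted characteristic function of coordinate
        \<open>m\<close>.\<close>
      have "(\<integral>\<omega>. (\<Prod>k\<in>J. indicator (A k) (x k \<omega>)) * iexp (\<Sum>k\<in>I-J. (t(m := s)) k * x k \<omega>) \<partial>P)
      = (\<integral>\<omega>. (\<Prod>k\<in>J. indicator (A k) (y k \<omega>)) * iexp (\<Sum>k\<in>I-J. (t(m := s)) k * y k \<omega>) \<partial>Q)"
        by (rule insert.IH[OF JI])
      moreover have "iexp (\<Sum>k\<in>I-J. (t(m := s)) k * f k) = iexp (\<Sum>k\<in>?K. t k * f k) * iexp (s * f m)" for f :: "'i \<Rightarrow> real"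
      proof -
        have "(\<Sum>k\<in>I-J. (t(m := s)) k * f k) = s * f m + (\<Sum>k\<in>?K. (t(m := s)) k * f k)"
          unfolding IJ(1) using K IJ(2) by (subst sum.insert) auto
        also have "(\<Sum>k\<in>?K. (t(m := s)) k * f k) = (\<Sum>k\<in>?K. t k * f k)"
          by (rule sum.cong) auto
        finally show ?thesis by (simp add: exp_add[symmetric] algebra_simps)
      qed
      ultimately show "(\<integral>\<omega>. ((\<Prod>k\<in>J. indicator (A k) (x k \<omega>)) * iexp (\<Sum>k\<in>?K. t k * x k \<omega>)) * iexp (s * x m \<omega>) \<partial>P)
        = (\<integral>\<omega>. ((\<Prod>k\<in>J. indicator (A k) (y k \<omega>)) * iexp (\<Sum>k\<in>?K. t k * y k \<omega>)) * iexp (s * y m \<omega>) \<partial>Q)"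
        by (simp only: mult.assoc)
    qed measurable
    then show ?case using insert.hyps by (simp add: mult_ac)
  qed
  have mx: "(\<lambda>\<omega>. \<lambda>k\<in>I. x k \<omega>) \<in> P \<rightarrow>\<^sub>M PiM I (\<lambda>_. borel)" by (intro measurable_restrict x)
  have my: "(\<lambda>\<omega>. \<lambda>k\<in>I. y k \<omega>) \<in> Q \<rightarrow>\<^sub>M PiM I (\<lambda>_. borel)" by (intro measurable_restrict y)
  interpret D: prob_space "distr P (PiM I (\<lambda>_. borel)) (\<lambda>\<omega>. \<lambda>k\<in>I. x k \<omega>)"
    by (rule P.prob_space_distr[OF mx])
  show ?thesis
  proof (rule measure_eqI_PiM_finite[OF I])
    fix A :: "'i \<Rightarrow> real set" assume A: "\<And>i. i \<in> I \<Longrightarrow> A i \<in> sets borel"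
    have AI: "Pi\<^sub>E I A \<in> sets (PiM I (\<lambda>_. borel))" using A by (intro sets_PiM_I_finite I) auto
    have ind: "indicator (Pi\<^sub>E I A) (\<lambda>k\<in>I. f k) = (\<Prod>k\<in>I. indicator (A k) (f k) :: complex)" for f :: "'i \<Rightarrow> real"
      using I by (auto simp: indicator_def PiE_iff prod_eq_1_iff Pi_iff)
    have "complex_of_real (measure P ((\<lambda>\<omega>. \<lambda>k\<in>I. x k \<omega>) -` Pi\<^sub>E I A \<inter> space P))
      = (\<integral>\<omega>. indicator ((\<lambda>\<omega>. \<lambda>k\<in>I. x k \<omega>) -` Pi\<^sub>E I A \<inter> space P) \<omega> \<partial>P)"
      by (rule integral_indicator_complex[OF measurable_sets[OF mx AI], symmetric])
    also have "\<dots> = (\<integral>\<omega>. (\<Prod>k\<in>I. indicator (A k) (x k \<omega>)) \<partial>P)"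
      by (intro Bochner_Integration.integral_cong refl) (subst ind[symmetric], simp add: indicator_def)
    also have "\<dots> = (\<integral>\<omega>. (\<Prod>k\<in>I. indicator (A k) (y k \<omega>)) \<partial>Q)"
      using step[of I A "\<lambda>_. 0"] A by simp
    also have "\<dots> = (\<integral>\<omega>. indicator ((\<lambda>\<omega>. \<lambda>k\<in>I. y k \<omega>) -` Pi\<^sub>E I A \<inter> space Q) \<omega> \<partial>Q)"
      by (intro Bochner_Integration.integral_cong refl) (subst ind[symmetric], simp add: indicator_def)
    also have "\<dots> = complex_of_real (measure Q ((\<lambda>\<omega>. \<lambda>k\<in>I. y k \<omega>) -` Pi\<^sub>E I A \<inter> space Q))"
      by (rule integral_indicator_complex[OF measurable_sets[OF my AI]])
    finally have "measure P ((\<lambda>\<omega>. \<lambda>k\<in>I. x k \<omega>) -` Pi\<^sub>E I A \<inter> space P) = measure Q ((\<lambda>\<omega>. \<lambda>k\<in>I. y k \<omega>) -` Pi\<^sub>E I A \<inter> space Q)"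
      using of_real_eq_iff by blast
    then show "emeasure (distr P (PiM I (\<lambda>_. borel)) (\<lambda>\<omega>. \<lambda>k\<in>I. x k \<omega>)) (Pi\<^sub>E I A)
      = emeasure (distr Q (PiM I (\<lambda>_. borel)) (\<lambda>\<omega>. \<lambda>k\<in>I. y k \<omega>)) (Pi\<^sub>E I A)"
      by (simp add: emeasure_distr[OF mx AI] emeasure_distr[OF my AI] P.emeasure_eq_measure Q.emeasure_eq_measure)
  next
    show "range (\<lambda>_::nat. Pi\<^sub>E I (\<lambda>_. UNIV)) \<subseteq> prod_algebra I (\<lambda>_. borel :: real measure)"
      using I by (auto intro!: prod_algebraI_finite)
    show "(\<Union>i::nat. Pi\<^sub>E I (\<lambda>_. UNIV)) = space (PiM I (\<lambda>_. borel :: real measure))"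
      by (simp add: space_PiM)
  qed (auto simp: D.emeasure_eq_measure)
qed

section \<open>Random variables with moments of all orders\<close>

text \<open>Integrability of a product does not follow from that of its factors. Having all moments
  is stable under sums and products, so integrability of polynomials in Gaussian variables becomes a
  matter of introduction rules.\<close>

definition all_moments :: "'a measure \<Rightarrow> ('a \<Rightarrow> real) \<Rightarrow> bool" where
  "all_moments M f \<longleftrightarrow> f \<in> borel_measurable M \<and> (\<forall>k::nat. integrable M (\<lambda>\<omega>. \<bar>f \<omega>\<bar> ^ k))"

lemma all_moments_measurable: "all_moments M f \<Longrightarrow> f \<in> borel_measurable M"
  by (simp add: all_moments_def)

lemma all_moments_integrable:
  assumes "all_moments M f"
  shows "integrable M f"
  using assms[unfolded all_moments_def, THEN conjunct2, rule_format, of 1] assms[THEN all_moments_measurable]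
  by (simp add: integrable_abs_iff)

lemma all_moments_integrable_power: "all_moments M f \<Longrightarrow> integrable M (\<lambda>\<omega>. f \<omega> ^ k)"
  unfolding all_moments_def by (subst integrable_abs_iff[symmetric]) (auto simp: power_abs)

lemma all_moments_dominated:
  assumes "all_moments M f" "g \<in> borel_measurable M" "\<And>\<omega>. \<bar>g \<omega>\<bar> \<le> \<bar>f \<omega>\<bar>"
  shows "all_moments M g"
  unfolding all_moments_def
proof (intro conjI allI)
  fix k
  show "integrable M (\<lambda>\<omega>. \<bar>g \<omega>\<bar> ^ k)"
    by (rule Bochner_Integration.integrable_bound[of M "\<lambda>\<omega>. \<bar>f \<omega>\<bar> ^ k"])
      (use assms in \<open>auto simp: all_moments_def intro!: power_mono\<close>)
qed fact

lemma all_moments_abs: "all_moments M f \<Longrightarrow> all_moments M (\<lambda>\<omega>. \<bar>f \<omega>\<bar>)"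
  by (rule all_moments_dominated) (auto simp: all_moments_def)

lemma all_moments_add:
  assumes f: "all_moments M f" and g: "all_moments M g"
  shows "all_moments M (\<lambda>\<omega>. f \<omega> + g \<omega>)"
  unfolding all_moments_def
proof (intro conjI allI)
  fix k
  have *: "\<bar>a + b\<bar> ^ k \<le> 2 ^ k * (\<bar>a\<bar> ^ k + \<bar>b\<bar> ^ k)" for a b :: real
  proof -
    have "\<bar>a + b\<bar> ^ k \<le> (2 * max \<bar>a\<bar> \<bar>b\<bar>) ^ k" by (intro power_mono) auto
    also have "\<dots> = 2 ^ k * (max \<bar>a\<bar> \<bar>b\<bar>) ^ k" by (simp add: power_mult_distrib)
    also have "\<dots> \<le> 2 ^ k * (\<bar>a\<bar> ^ k + \<bar>b\<bar> ^ k)" by (intro mult_left_mono) (auto simp: max_def)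
    finally show ?thesis .
  qed
  show "integrable M (\<lambda>\<omega>. \<bar>f \<omega> + g \<omega>\<bar> ^ k)"
    by (rule Bochner_Integration.integrable_bound[of M "\<lambda>\<omega>. 2 ^ k * (\<bar>f \<omega>\<bar> ^ k + \<bar>g \<omega>\<bar> ^ k)"])
      (use f g * in \<open>auto simp: all_moments_def\<close>)
qed (use f g in \<open>auto simp: all_moments_def\<close>)

lemma all_moments_mult:
  assumes f: "all_moments M f" and g: "all_moments M g"
  shows "all_moments M (\<lambda>\<omega>. f \<omega> * g \<omega>)"
  unfolding all_moments_def
proof (intro conjI allI)
  fix k
  have *: "\<bar>a * b\<bar> ^ k \<le> \<bar>a\<bar> ^ (2*k) + \<bar>b\<bar> ^ (2*k)" for a b :: real
  proof -
    have "2 * (\<bar>a\<bar>^k * \<bar>b\<bar>^k) \<le> (\<bar>a\<bar>^k)^2 + (\<bar>b\<bar>^k)^2"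
      using sum_squares_bound[of "\<bar>a\<bar>^k" "\<bar>b\<bar>^k"] by simp
    moreover have "0 \<le> \<bar>a\<bar>^k * \<bar>b\<bar>^k" by simp
    ultimately have "\<bar>a\<bar>^k * \<bar>b\<bar>^k \<le> (\<bar>a\<bar>^k)^2 + (\<bar>b\<bar>^k)^2" by linarith
    then show ?thesis by (simp add: abs_mult power_mult_distrib mult.commute flip: power_mult)
  qed
  show "integrable M (\<lambda>\<omega>. \<bar>f \<omega> * g \<omega>\<bar> ^ k)"
    by (rule Bochner_Integration.integrable_bound[of M "\<lambda>\<omega>. \<bar>f \<omega>\<bar> ^ (2*k) + \<bar>g \<omega>\<bar> ^ (2*k)"])
      (use f g * in \<open>auto simp: all_moments_def\<close>)
qed (use f g in \<open>auto simp: all_moments_def\<close>)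

lemma (in finite_measure) all_moments_const: "all_moments M (\<lambda>_. c)"
  by (auto simp: all_moments_def)

lemma (in finite_measure) all_moments_power: "all_moments M f \<Longrightarrow> all_moments M (\<lambda>\<omega>. f \<omega> ^ k)"
  by (induction k) (auto intro: all_moments_mult all_moments_const)

lemma (in finite_measure) all_moments_sum:
  "(\<And>i. i \<in> I \<Longrightarrow> all_moments M (f i)) \<Longrightarrow> all_moments M (\<lambda>\<omega>. \<Sum>i\<in>I. f i \<omega>)"
  by (induction I rule: infinite_finite_induct) (auto intro: all_moments_add all_moments_const)

lemma (in finite_measure) all_moments_cmult: "all_moments M f \<Longrightarrow> all_moments M (\<lambda>\<omega>. c * f \<omega>)"
  by (auto intro: all_moments_mult all_moments_const)

lemma (in finite_measure) all_moments_diff: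
  "all_moments M f \<Longrightarrow> all_moments M g \<Longrightarrow> all_moments M (\<lambda>\<omega>. f \<omega> - g \<omega>)"
  using all_moments_add[of M f "\<lambda>\<omega>. -1 * g \<omega>"] all_moments_cmult[of g "-1"] by simp

section \<open>Integration by parts and moments in one dimension\<close>

lemma vanishing_integral_derivative:
  fixes F f :: "real \<Rightarrow> 'b::euclidean_space"
  assumes "\<And>x. (F has_vector_derivative f x) (at x)" "\<And>x. isCont f x" "integrable lborel f"
    and "(F \<longlongrightarrow> 0) at_top" "(F \<longlongrightarrow> 0) at_bot"
  shows "(\<integral>x. f x \<partial>lborel) = 0"
proof -
  have "(LBINT x=-\<infinity>..\<infinity>. f x) = 0 - 0"
    by (rule interval_integral_FTC_integrable[where F = F])
      (use assms in \<open>auto simp: set_integrable_def ereal_tendsto_simps\<close>)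
  then show ?thesis
    by (simp add: interval_lebesgue_integral_def set_lebesgue_integral_def)
qed

text \<open>The density p satisfies p' = - u p, so p g has the derivative p (g' - u g). Its integral
  over the line is 0 because the polynomial growth of \<open>g\<close> loses against the Gaussian
  decay at both ends. Values in a Euclidean space include complex exponentials.\<close>

lemma std_normal_integration_by_parts:
  fixes g g' :: "real \<Rightarrow> 'b::euclidean_space"
  assumes g: "\<And>u. (g has_vector_derivative g' u) (at u)" and g': "continuous_on UNIV g'"
    and bg: "\<And>u. norm (g u) \<le> C * (1 + \<bar>u\<bar>) ^ D" and bg': "\<And>u. norm (g' u) \<le> C * (1 + \<bar>u\<bar>) ^ D"
  shows "(\<integral>u. u *\<^sub>R g u \<partial>std_normal_distribution) = (\<integral>u. g' u \<partial>std_normal_distribution)"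
proof -
  let ?\<phi> = "std_normal_density"
  have cg: "continuous_on UNIV g"
    using g by (auto intro!: continuous_at_imp_continuous_on has_vector_derivative_continuous)
  have [measurable]: "g \<in> borel_measurable borel" "g' \<in> borel_measurable borel"
    using cg g' by (auto intro: borel_measurable_continuous_onI)
  have d\<phi>: "(?\<phi> has_real_derivative (- u * ?\<phi> u)) (at u)" for u
  proof -
    have "((\<lambda>u. K * exp (- u\<^sup>2 / 2)) has_real_derivative (- u * (K * exp (- u\<^sup>2 / 2)))) (at u)" for K
      by (auto intro!: derivative_eq_intros)
    then show ?thesis unfolding std_normal_density_def .
  qed
  interpret N: prob_space std_normal_distribution by (rule prob_space_normal_density) simp
  have poly: "all_moments std_normal_distribution (\<lambda>u. C * (1 + \<bar>u\<bar>) ^ k)" for k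
  proof -
    have "all_moments std_normal_distribution (\<lambda>u. u)"
      unfolding all_moments_def using integrable_std_normal_distribution_moment
      by (auto simp: power_abs[symmetric])
    then show ?thesis
      by (intro N.all_moments_cmult N.all_moments_power all_moments_add N.all_moments_const all_moments_abs)
  qed
  have C0: "C \<ge> 0" using order_trans[OF norm_ge_zero bg[of 0]] by simp
  have i1: "integrable std_normal_distribution (\<lambda>u. u *\<^sub>R g u)"
  proof (rule Bochner_Integration.integrable_bound[OF all_moments_integrable[OF poly[of "Suc D"]]])
    have "norm (u *\<^sub>R g u) \<le> norm (C * (1 + \<bar>u\<bar>) ^ Suc D)" for u
    proof -
      have "norm (u *\<^sub>R g u) \<le> (1 + \<bar>u\<bar>) * (C * (1 + \<bar>u\<bar>) ^ D)"
        by (simp, rule mult_mono) (use bg in auto)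
      also have "\<dots> = norm (C * (1 + \<bar>u\<bar>) ^ Suc D)" using C0 by (simp add: abs_mult)
      finally show ?thesis .
    qed
    then show "AE u in std_normal_distribution. norm (u *\<^sub>R g u) \<le> norm (C * (1 + \<bar>u\<bar>) ^ Suc D)" by simp
  qed simp
  have i2: "integrable std_normal_distribution g'"
    by (rule Bochner_Integration.integrable_bound[OF all_moments_integrable[OF poly[of D]]])
      (use bg' C0 in \<open>auto simp: abs_mult\<close>)
  define f where "f u = ?\<phi> u *\<^sub>R (g' u - u *\<^sub>R g u)" for u
  have "(\<integral>u. f u \<partial>lborel) = 0"
  proof (rule vanishing_integral_derivative[where F="\<lambda>u. ?\<phi> u *\<^sub>R g u"])
    show "((\<lambda>u. ?\<phi> u *\<^sub>R g u) has_vector_derivative f u) (at u)" for u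
      unfolding f_def
      by (rule has_vector_derivative_eq_rhs[OF has_vector_derivative_scaleR[OF d\<phi> g]])
        (simp add: algebra_simps)
    have "continuous_on UNIV f" unfolding f_def std_normal_density_def
      by (intro continuous_intros g' cg) auto
    then show "isCont f u" for u by (simp add: continuous_on_eq_continuous_at)
    show "integrable lborel f" unfolding f_def
      using Bochner_Integration.integrable_diff[OF i2 i1]
      by (subst (asm) integrable_density) auto
    have b: "norm (?\<phi> u *\<^sub>R g u) \<le> ?\<phi> u * (C * (1 + \<bar>u\<bar>) ^ D)" for u
      using bg by (auto intro!: mult_left_mono)
    have l1: "((\<lambda>u::real. 1 / sqrt (2 * pi) * exp (- u\<^sup>2 / 2) * (C * (1 + \<bar>u\<bar>) ^ D)) \<longlongrightarrow> 0) at_top" by real_asymp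
    have l2: "((\<lambda>u::real. 1 / sqrt (2 * pi) * exp (- u\<^sup>2 / 2) * (C * (1 + \<bar>u\<bar>) ^ D)) \<longlongrightarrow> 0) at_bot" by real_asymp
    show "((\<lambda>u. ?\<phi> u *\<^sub>R g u) \<longlongrightarrow> 0) at_top"
      by (rule Lim_null_comparison[OF _ l1[folded std_normal_density_def]]) (use b in auto)
    show "((\<lambda>u. ?\<phi> u *\<^sub>R g u) \<longlongrightarrow> 0) at_bot"
      by (rule Lim_null_comparison[OF _ l2[folded std_normal_density_def]]) (use b in auto)
  qed
  moreover have "(\<integral>u. f u \<partial>lborel) = (\<integral>u. g' u - u *\<^sub>R g u \<partial>std_normal_distribution)"
    unfolding f_def by (subst integral_density) auto
  ultimately show ?thesis using i1 i2 by simp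
qed

text \<open>Writing the law as that of a standard normal variable times the standard deviation
  treats the degenerate case together with the others, so the formulas for moments and
  characteristic functions need no case split.\<close>

lemma (in prob_space) centered_gaussian_law:
  assumes "centered_gaussian M x"
  shows "distr M borel x = distr std_normal_distribution borel (\<lambda>u. sqrt (\<integral>\<omega>. (x \<omega>)\<^sup>2 \<partial>M) * u)"
proof -
  interpret N: prob_space std_normal_distribution by (rule prob_space_normal_density) simp
  have [measurable]: "x \<in> borel_measurable M" using assms by (simp add: centered_gaussian_def)
  consider "AE \<omega> in M. x \<omega> = 0" | \<sigma> where "\<sigma> > 0" "distributed M lborel x (normal_density 0 \<sigma>)"
    using assms by (auto simp: centered_gaussian_def)
  then show ?thesis
  proof cases
    case 1
    have "(\<integral>\<omega>. (x \<omega>)\<^sup>2 \<partial>M) = (\<integral>\<omega>. 0 \<partial>M)" by (rule integral_cong_AE) (use 1 in auto)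
    moreover have "distr M borel x = distr M borel (\<lambda>_. 0)" by (rule distr_cong_AE) (use 1 in auto)
    ultimately show ?thesis by (simp add: N.distr_const)
  next
    case 2
    then have "distributed M lborel (\<lambda>\<omega>. x \<omega> / \<sigma>) std_normal_density"
      by (subst (asm) normal_standard_normal_convert) auto
    then have "distr M lborel (\<lambda>\<omega>. x \<omega> / \<sigma>) = std_normal_distribution" by (simp add: distributed_def)
    then have z: "distr M borel (\<lambda>\<omega>. x \<omega> / \<sigma>) = std_normal_distribution"
      using distr_cong[of M M lborel borel "\<lambda>\<omega>. x \<omega> / \<sigma>" "\<lambda>\<omega>. x \<omega> / \<sigma>"] by simp
    have "distr std_normal_distribution borel (\<lambda>u. \<sigma> * u) = distr M borel ((\<lambda>u. \<sigma> * u) \<circ> (\<lambda>\<omega>. x \<omega> / \<sigma>))"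
      unfolding z[symmetric] by (rule distr_distr) auto
    also have "(\<lambda>u. \<sigma> * u) \<circ> (\<lambda>\<omega>. x \<omega> / \<sigma>) = x" using 2 by auto
    finally have law: "distr M borel x = distr std_normal_distribution borel (\<lambda>u. \<sigma> * u)" by simp
    have "(\<integral>\<omega>. (x \<omega>)\<^sup>2 \<partial>M) = (\<integral>u. u\<^sup>2 \<partial>distr M borel x)" by (rule integral_distr[symmetric]) auto
    also have "\<dots> = (\<integral>u. (\<sigma> * u)\<^sup>2 \<partial>std_normal_distribution)" unfolding law by (rule integral_distr) auto
    also have "\<dots> = \<sigma>\<^sup>2 * (\<integral>u. u\<^sup>2 \<partial>std_normal_distribution)" by (simp add: power_mult_distrib)
    also have "\<dots> = \<sigma>\<^sup>2" using std_normal_distribution_even_moments(1)[of 1] by simp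
    finally show ?thesis using law 2 by simp
  qed
qed

lemma (in prob_space) centered_gaussian_integral:
  fixes f :: "real \<Rightarrow> 'b::{banach, second_countable_topology}"
  assumes x: "centered_gaussian M x" and [measurable]: "f \<in> borel_measurable borel"
  shows "(\<integral>\<omega>. f (x \<omega>) \<partial>M) = (\<integral>u. f (sqrt (\<integral>\<omega>. (x \<omega>)\<^sup>2 \<partial>M) * u) \<partial>std_normal_distribution)"
    and "integrable M (\<lambda>\<omega>. f (x \<omega>)) \<longleftrightarrow> integrable std_normal_distribution (\<lambda>u. f (sqrt (\<integral>\<omega>. (x \<omega>)\<^sup>2 \<partial>M) * u))"
proof -
  have [measurable]: "x \<in> borel_measurable M" using assms by (simp add: centered_gaussian_def)
  have "(\<integral>\<omega>. f (x \<omega>) \<partial>M) = (\<integral>u. f u \<partial>distr M borel x)" by (rule integral_distr[symmetric]) auto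
  also have "\<dots> = (\<integral>u. f (sqrt (\<integral>\<omega>. (x \<omega>)\<^sup>2 \<partial>M) * u) \<partial>std_normal_distribution)"
    unfolding centered_gaussian_law[OF x] by (rule integral_distr) auto
  finally show "(\<integral>\<omega>. f (x \<omega>) \<partial>M) = (\<integral>u. f (sqrt (\<integral>\<omega>. (x \<omega>)\<^sup>2 \<partial>M) * u) \<partial>std_normal_distribution)" .
  have "integrable M (\<lambda>\<omega>. f (x \<omega>)) \<longleftrightarrow> integrable (distr M borel x) f"
    by (subst integrable_distr_eq) auto
  also have "\<dots> \<longleftrightarrow> integrable std_normal_distribution (\<lambda>u. f (sqrt (\<integral>\<omega>. (x \<omega>)\<^sup>2 \<partial>M) * u))"
    unfolding centered_gaussian_law[OF x] by (subst integrable_distr_eq) auto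
  finally show "integrable M (\<lambda>\<omega>. f (x \<omega>)) \<longleftrightarrow> integrable std_normal_distribution (\<lambda>u. f (sqrt (\<integral>\<omega>. (x \<omega>)\<^sup>2 \<partial>M) * u))" .
qed

lemma (in prob_space) centered_gaussian_all_moments:
  assumes x: "centered_gaussian M x"
  shows "all_moments M x"
  unfolding all_moments_def
proof (intro conjI allI)
  show "x \<in> borel_measurable M" using assms by (simp add: centered_gaussian_def)
  fix k
  show "integrable M (\<lambda>\<omega>. \<bar>x \<omega>\<bar> ^ k)"
    by (subst centered_gaussian_integral(2)[OF x])
      (auto simp: abs_mult power_mult_distrib power_abs[symmetric] intro!: integrable_std_normal_distribution_moment integrable_abs integrable_mult_right)
qed

lemma (in prob_space) centered_gaussian_even_moment:
  assumes x: "centered_gaussian M x"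
  shows "(\<integral>\<omega>. (x \<omega>) ^ (2 * k) \<partial>M) = fact (2 * k) / (2 ^ k * fact k) * (\<integral>\<omega>. (x \<omega>)\<^sup>2 \<partial>M) ^ k"
  using std_normal_distribution_even_moments(1)[of k]
  by (subst centered_gaussian_integral(1)[OF x])
    (auto simp: power_mult_distrib power_mult)

lemma (in prob_space) centered_gaussian_char:
  assumes x: "centered_gaussian M x"
  shows "(\<integral>\<omega>. iexp (x \<omega>) \<partial>M) = complex_of_real (exp (- (\<integral>\<omega>. (x \<omega>)\<^sup>2 \<partial>M) / 2))"
proof -
  let ?s = "sqrt (\<integral>\<omega>. (x \<omega>)\<^sup>2 \<partial>M)"
  have "(\<integral>\<omega>. iexp (x \<omega>) \<partial>M) = char std_normal_distribution ?s"
    by (subst centered_gaussian_integral(1)[OF x, of iexp]) (auto simp: char_def)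
  then show ?thesis unfolding char_std_normal_distribution by simp
qed

section \<open>Gaussian spaces and integration by parts in several variables\<close>

text \<open>Closure under linear combinations makes every finite family from \<open>V\<close>
  jointly Gaussian, so that covariances determine its law.\<close>

locale gaussian_space = prob_space M for M :: "'a measure" +
  fixes V :: "('a \<Rightarrow> real) set"
  assumes gaussian: "x \<in> V \<Longrightarrow> centered_gaussian M x"
    and V_zero: "(\<lambda>_. 0) \<in> V"
    and V_add: "x \<in> V \<Longrightarrow> y \<in> V \<Longrightarrow> (\<lambda>\<omega>. x \<omega> + y \<omega>) \<in> V"
    and V_cmult: "x \<in> V \<Longrightarrow> (\<lambda>\<omega>. c * x \<omega>) \<in> V"
begin

lemma V_sum: "(\<And>i. i \<in> I \<Longrightarrow> x i \<in> V) \<Longrightarrow> (\<lambda>\<omega>. \<Sum>i\<in>I. x i \<omega>) \<in> V"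
  by (induction I rule: infinite_finite_induct) (auto intro: V_zero V_add)

lemma V_diff: "x \<in> V \<Longrightarrow> y \<in> V \<Longrightarrow> (\<lambda>\<omega>. x \<omega> - y \<omega>) \<in> V"
  using V_add[of x "\<lambda>\<omega>. -1 * y \<omega>"] V_cmult[of y "-1"] by simp

lemma V_moments: "x \<in> V \<Longrightarrow> all_moments M x"
  by (intro centered_gaussian_all_moments gaussian)

lemma V_measurable: "x \<in> V \<Longrightarrow> x \<in> borel_measurable M"
  by (intro all_moments_measurable V_moments)

lemma V_integrable_mult: "x \<in> V \<Longrightarrow> y \<in> V \<Longrightarrow> integrable M (\<lambda>\<omega>. x \<omega> * y \<omega>)"
  by (intro all_moments_integrable all_moments_mult V_moments)

lemma V_degenerate:
  assumes "x \<in> V" "(\<integral>\<omega>. x \<omega> * x \<omega> \<partial>M) = 0"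
  shows "AE \<omega> in M. x \<omega> = 0"
  using integral_nonneg_eq_0_iff_AE[OF V_integrable_mult[OF assms(1,1)]] assms by simp

text \<open>Regression on \<open>z j\<close>: the residuals are uncorrelated with
  \<open>z j\<close>, hence independent of it. Independence is not proved as such; the family is
  compared with the residuals joined to a fresh normal variable on a product space. By
  \<open>PiM_law_eqI_char\<close> only the variances of linear combinations \<open>T\<close> have to
  match, and Var T = Var S + a^2 / c, where a is the covariance of \<open>T\<close> with
  \<open>z j\<close>.\<close>

lemma V_regression_law:
  fixes z :: "'i \<Rightarrow> 'a \<Rightarrow> real"
  assumes I: "finite I" and j: "j \<in> I" and z: "\<And>k. k \<in> I \<Longrightarrow> z k \<in> V"
    and c: "c = (\<integral>\<omega>. z j \<omega> * z j \<omega> \<partial>M)" "c > 0"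
    and v: "\<And>k. k \<in> I \<Longrightarrow> v k = (\<integral>\<omega>. z j \<omega> * z k \<omega> \<partial>M)"
  shows "distr M (PiM I (\<lambda>_. borel)) (\<lambda>\<omega>. \<lambda>k\<in>I. z k \<omega>) =
    distr (M \<Otimes>\<^sub>M std_normal_distribution) (PiM I (\<lambda>_. borel))
      (\<lambda>p. \<lambda>k\<in>I. (z k (fst p) - v k / c * z j (fst p)) + v k / sqrt c * snd p)"
proof (rule PiM_law_eqI_char)
  interpret N: prob_space std_normal_distribution by (rule prob_space_normal_density) simp
  interpret Q: pair_prob_space M std_normal_distribution ..
  show "prob_space M" by (rule prob_space_axioms)
  show "prob_space (M \<Otimes>\<^sub>M std_normal_distribution)" by (rule Q.P.prob_space_axioms)
  show "z k \<in> borel_measurable M" if "k \<in> I" for k using V_measurable z that by auto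
  show "(\<lambda>p. (z k (fst p) - v k / c * z j (fst p)) + v k / sqrt c * snd p)
      \<in> borel_measurable (M \<Otimes>\<^sub>M std_normal_distribution)" if "k \<in> I" for k
  proof -
    have [measurable]: "z k \<in> borel_measurable M" "z j \<in> borel_measurable M"
      using V_measurable z that j by auto
    show ?thesis by measurable
  qed
  fix t :: "'i \<Rightarrow> real"
  define T where "T \<omega> = (\<Sum>k\<in>I. t k * z k \<omega>)" for \<omega>
  define a where "a = (\<Sum>k\<in>I. t k * v k)"
  \<comment> \<open>The residual of \<open>T\<close> after regression on \<open>z j\<close>.\<close>
  define S where "S \<omega> = T \<omega> - a / c * z j \<omega>" for \<omega>
  have T: "T \<in> V" unfolding T_def by (intro V_sum V_cmult z)
  have S: "S \<in> V" unfolding S_def by (intro V_diff V_cmult T z j)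
  note zj = z[OF j]
  have [measurable]: "S \<in> borel_measurable M" using V_measurable S by auto
  have aT: "a = (\<integral>\<omega>. z j \<omega> * T \<omega> \<partial>M)"
  proof -
    have "(\<integral>\<omega>. z j \<omega> * T \<omega> \<partial>M) = (\<integral>\<omega>. (\<Sum>k\<in>I. t k * (z j \<omega> * z k \<omega>)) \<partial>M)"
      unfolding T_def by (simp add: sum_distrib_left mult_ac)
    also have "\<dots> = (\<Sum>k\<in>I. t k * v k)"
      using V_integrable_mult[OF zj z] by (subst Bochner_Integration.integral_sum) (auto simp: v)
    finally show ?thesis by (simp add: a_def)
  qed
  have "(\<integral>\<omega>. (S \<omega>)\<^sup>2 \<partial>M) = (\<integral>\<omega>. T \<omega> * T \<omega> - 2 * a / c * (z j \<omega> * T \<omega>) + (a / c)\<^sup>2 * (z j \<omega> * z j \<omega>) \<partial>M)"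
    unfolding S_def by (simp add: power2_eq_square algebra_simps)
  also have "\<dots> = (\<integral>\<omega>. T \<omega> * T \<omega> \<partial>M) - 2 * a / c * a + (a / c)\<^sup>2 * c"
    using V_integrable_mult[OF T T] V_integrable_mult[OF zj T] V_integrable_mult[OF zj zj]
    by (simp add: aT c)
  also have "\<dots> = (\<integral>\<omega>. (T \<omega>)\<^sup>2 \<partial>M) - a\<^sup>2 / c"
    using c(2) by (simp add: power2_eq_square field_simps)
  finally have varS: "(\<integral>\<omega>. (S \<omega>)\<^sup>2 \<partial>M) = (\<integral>\<omega>. (T \<omega>)\<^sup>2 \<partial>M) - a\<^sup>2 / c" .
  have "(\<integral>p. iexp (\<Sum>k\<in>I. t k * ((z k (fst p) - v k / c * z j (fst p)) + v k / sqrt c * snd p)) \<partial>(M \<Otimes>\<^sub>M std_normal_distribution))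
    = (\<integral>p. iexp (S (fst p) + a / sqrt c * snd p) \<partial>(M \<Otimes>\<^sub>M std_normal_distribution))"
  proof (intro Bochner_Integration.integral_cong refl arg_cong[where f=exp] arg_cong[where f="\<lambda>u. \<i> * complex_of_real u"])
    fix p :: "'a \<times> real"
    show "(\<Sum>k\<in>I. t k * ((z k (fst p) - v k / c * z j (fst p)) + v k / sqrt c * snd p)) = S (fst p) + a / sqrt c * snd p"
      unfolding S_def T_def a_def
      by (simp add: sum.distrib sum_subtractf algebra_simps sum_distrib_left sum_divide_distrib)
  qed
  also have "\<dots> = (\<integral>\<omega>. (\<integral>u. iexp (S \<omega> + a / sqrt c * u) \<partial>std_normal_distribution) \<partial>M)"
    by (subst Q.integral_fst'[symmetric]) (auto intro!: Q.P.integrable_const_bound[where B=1] simp del: of_real_add)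
  also have "\<dots> = (\<integral>\<omega>. iexp (S \<omega>) * char std_normal_distribution (a / sqrt c) \<partial>M)"
    by (simp add: char_def distrib_left exp_add mult_ac)
  also have "\<dots> = (\<integral>\<omega>. iexp (S \<omega>) \<partial>M) * char std_normal_distribution (a / sqrt c)" by simp
  also have "\<dots> = complex_of_real (exp (- (\<integral>\<omega>. (S \<omega>)\<^sup>2 \<partial>M) / 2) * exp (- (a / sqrt c)\<^sup>2 / 2))"
    unfolding centered_gaussian_char[OF gaussian[OF S]] char_std_normal_distribution by simp
  also have "\<dots> = complex_of_real (exp (- (\<integral>\<omega>. (T \<omega>)\<^sup>2 \<partial>M) / 2))"
    using c(2) unfolding varS exp_add[symmetric] by (simp add: field_simps power_divide)
  also have "\<dots> = (\<integral>\<omega>. iexp (T \<omega>) \<partial>M)" by (rule centered_gaussian_char[OF gaussian[OF T], symmetric])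
  finally show "(\<integral>\<omega>. iexp (\<Sum>k\<in>I. t k * z k \<omega>) \<partial>M) =
    (\<integral>p. iexp (\<Sum>k\<in>I. t k * ((z k (fst p) - v k / c * z j (fst p)) + v k / sqrt c * snd p)) \<partial>(M \<Otimes>\<^sub>M std_normal_distribution))"
    unfolding T_def by simp
qed fact

text \<open>
  Since \<open>z k - (v k / v j) z j\<close> is independent of \<open>z j\<close>, only the integration over \<open>z j\<close> matters, and
  there the one-dimensional formula applies.
\<close>
theorem gaussian_integration_by_parts:
  fixes z :: "'i \<Rightarrow> 'a \<Rightarrow> real" and G DG :: "('i \<Rightarrow> real) \<Rightarrow> 'b::euclidean_space"
  assumes I: "finite I" and j: "j \<in> I" and z: "\<And>k. k \<in> I \<Longrightarrow> z k \<in> V"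
    and v: "\<And>k. k \<in> I \<Longrightarrow> v k = (\<integral>\<omega>. z j \<omega> * z k \<omega> \<partial>M)"
    and mG[measurable]: "G \<in> borel_measurable (PiM I (\<lambda>_. borel))"
    and mDG[measurable]: "DG \<in> borel_measurable (PiM I (\<lambda>_. borel))"
    and rG: "\<And>p. G (restrict p I) = G p" and rDG: "\<And>p. DG (restrict p I) = DG p"
    and der: "\<And>p s. ((\<lambda>s. G (\<lambda>k. p k + s * v k)) has_vector_derivative DG (\<lambda>k. p k + s * v k)) (at s)"
    and cont: "\<And>p. continuous_on UNIV (\<lambda>s. DG (\<lambda>k. p k + s * v k))"
    and bG: "\<And>p. norm (G p) \<le> C * (1 + (\<Sum>k\<in>I. \<bar>p k\<bar>)) ^ D"
    and bDG: "\<And>p. norm (DG p) \<le> C * (1 + (\<Sum>k\<in>I. \<bar>p k\<bar>)) ^ D"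
  shows "(\<integral>\<omega>. z j \<omega> *\<^sub>R G (\<lambda>k. z k \<omega>) \<partial>M) = (\<integral>\<omega>. DG (\<lambda>k. z k \<omega>) \<partial>M)"
proof -
  define c where "c = (\<integral>\<omega>. z j \<omega> * z j \<omega> \<partial>M)"
  have c0: "c \<ge> 0" unfolding c_def by simp
  note zm = V_measurable[OF z]
  have C0: "C \<ge> 0"
  proof -
    have "0 \<le> C * (1 + (\<Sum>k\<in>I. \<bar>0\<bar>)) ^ D" using order_trans[OF norm_ge_zero bG[of "\<lambda>_. 0"]] .
    then show ?thesis by simp
  qed
  show ?thesis
  proof (cases "c = 0")
    case True
    then have z0: "AE \<omega> in M. z j \<omega> = 0" using V_degenerate[OF z[OF j]] c_def by simp
    have v0: "v k = 0" if "k \<in> I" for k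
    proof -
      have "v k = (\<integral>\<omega>. 0 \<partial>M)" unfolding v[OF that]
        by (rule integral_cong_AE) (use z0 zm j that in auto)
      then show ?thesis by simp
    qed
    \<comment> \<open>Here \<open>v\<close> vanishes on \<open>I\<close>, so \<open>G\<close> is
      constant along the line, and uniqueness of the derivative forces \<open>DG\<close> to
      vanish.\<close>
    have DG0: "DG p = 0" for p
    proof -
      have e: "G (\<lambda>k. p k + s * v k) = G p" for s
        using rG[of "\<lambda>k. p k + s * v k"] rG[of p] v0
        by (metis (no_types, lifting) add.right_neutral mult_zero_right restrict_ext)
      have "((\<lambda>s. G p) has_vector_derivative DG p) (at 0)"
        using der[of p 0] unfolding e by simp
      then show ?thesis using has_vector_derivative_const vector_derivative_unique_at by blast
    qed
    have "(\<integral>\<omega>. z j \<omega> *\<^sub>R G (\<lambda>k. z k \<omega>) \<partial>M) = 0"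
      by (rule integral_eq_zero_AE) (use z0 in auto)
    then show ?thesis by (simp add: DG0)
  next
    case False
    then have c1: "c > 0" using c0 by simp
    let ?N = "std_normal_distribution"
    interpret N: prob_space ?N by (rule prob_space_normal_density) simp
    interpret Q: pair_prob_space M ?N ..
    define r where "r \<omega> k = z k \<omega> - v k / c * z j \<omega>" for \<omega> k
    define X where "X p = (\<lambda>k\<in>I. r (fst p) k + v k / sqrt c * snd p)" for p
    have law: "distr M (PiM I (\<lambda>_. borel)) (\<lambda>\<omega>. \<lambda>k\<in>I. z k \<omega>) = distr (M \<Otimes>\<^sub>M ?N) (PiM I (\<lambda>_. borel)) X"
      unfolding X_def r_def using V_regression_law[of I j z c v, OF I j z c_def c1 v] by simp
    have mz[measurable]: "(\<lambda>\<omega>. \<lambda>k\<in>I. z k \<omega>) \<in> M \<rightarrow>\<^sub>M PiM I (\<lambda>_. borel)"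
      by (intro measurable_restrict zm)
    have mX[measurable]: "X \<in> M \<Otimes>\<^sub>M ?N \<rightarrow>\<^sub>M PiM I (\<lambda>_. borel)"
      unfolding X_def
    proof (intro measurable_restrict)
      fix k assume "k \<in> I"
      then have [measurable]: "z k \<in> borel_measurable M" "z j \<in> borel_measurable M" using zm j by auto
      show "(\<lambda>p. r (fst p) k + v k / sqrt c * snd p) \<in> borel_measurable (M \<Otimes>\<^sub>M ?N)"
        unfolding r_def by measurable
    qed
    have pj[measurable]: "(\<lambda>p. p j) \<in> borel_measurable (PiM I (\<lambda>_. borel :: real measure))"
      using j by measurable
    define w where "w \<omega> = C * (1 + (\<Sum>k\<in>I. \<bar>z k \<omega>\<bar>)) ^ D" for \<omega>
    have w: "all_moments M w" unfolding w_def
      by (intro all_moments_cmult all_moments_power all_moments_add all_moments_const all_moments_sum all_moments_abs V_moments z)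
    have w0: "w \<omega> \<ge> 0" for \<omega> unfolding w_def using C0 by (simp add: sum_nonneg)
    have mGz: "(\<lambda>\<omega>. G (\<lambda>k. z k \<omega>)) \<in> borel_measurable M"
      using measurable_compose[OF mz mG] by (simp add: rG)
    have mDGz: "(\<lambda>\<omega>. DG (\<lambda>k. z k \<omega>)) \<in> borel_measurable M"
      using measurable_compose[OF mz mDG] by (simp add: rDG)
    have iG: "integrable M (\<lambda>\<omega>. z j \<omega> *\<^sub>R G (\<lambda>k. z k \<omega>))"
    proof (rule Bochner_Integration.integrable_bound)
      show "integrable M (\<lambda>\<omega>. z j \<omega> * w \<omega>)"
        by (intro all_moments_integrable all_moments_mult w V_moments z j)
      show "AE \<omega> in M. norm (z j \<omega> *\<^sub>R G (\<lambda>k. z k \<omega>)) \<le> norm (z j \<omega> * w \<omega>)"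
        using bG w0 C0 by (auto simp: abs_mult w_def intro!: mult_left_mono)
    qed (use mGz zm j in measurable)
    have iDG: "integrable M (\<lambda>\<omega>. DG (\<lambda>k. z k \<omega>))"
      by (rule Bochner_Integration.integrable_bound[OF all_moments_integrable[OF w] mDGz])
        (use bDG w0 C0 in \<open>auto simp: w_def\<close>)
    have Xj: "X p j = sqrt c * snd p" for p
    proof -
      have "v j / sqrt c = sqrt c" "v j / c = 1"
        using c1 v[OF j] by (simp_all add: c_def[symmetric] real_div_sqrt)
      then have "z j (fst p) - v j / c * z j (fst p) + v j / sqrt c * snd p = sqrt c * snd p" by (simp only: mult_1 diff_self add_0)
      then show ?thesis using j by (simp add: X_def r_def)
    qed
    have iQ: "integrable (M \<Otimes>\<^sub>M ?N) (\<lambda>p. X p j *\<^sub>R G (X p))"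
    proof -
      have "integrable (distr M (PiM I (\<lambda>_. borel)) (\<lambda>\<omega>. \<lambda>k\<in>I. z k \<omega>)) (\<lambda>p. p j *\<^sub>R G p)"
        by (subst integrable_distr_eq) (use iG j in \<open>auto simp: rG\<close>)
      then show ?thesis unfolding law by (subst (asm) integrable_distr_eq) auto
    qed
    have iQD: "integrable (M \<Otimes>\<^sub>M ?N) (\<lambda>p. DG (X p))"
    proof -
      have "integrable (distr M (PiM I (\<lambda>_. borel)) (\<lambda>\<omega>. \<lambda>k\<in>I. z k \<omega>)) DG"
        by (subst integrable_distr_eq) (use iDG in \<open>auto simp: rDG\<close>)
      then show ?thesis unfolding law by (subst (asm) integrable_distr_eq) auto
    qed
    \<comment> \<open>For fixed residuals \<open>r\<close> the function \<open>G\<close> is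
      restricted to a line with parameter u. Its derivative in u carries a factor 1 / sqrt c, which
      cancels against the coordinate \<open>X p j\<close> = sqrt c * u.\<close>
    have inner: "(\<integral>u. X (\<omega>, u) j *\<^sub>R G (X (\<omega>, u)) \<partial>?N) = (\<integral>u. DG (X (\<omega>, u)) \<partial>?N)" for \<omega>
    proof -
      define g where "g u = G (\<lambda>k. r \<omega> k + (u / sqrt c) * v k)" for u
      define h where "h u = DG (\<lambda>k. r \<omega> k + (u / sqrt c) * v k) /\<^sub>R sqrt c" for u
      define A where "A = 1 + (\<Sum>k\<in>I. \<bar>r \<omega> k\<bar> + \<bar>v k / sqrt c\<bar>)"
      have A1: "A \<ge> 1" unfolding A_def by (simp add: sum_nonneg)
      have bnd: "1 + (\<Sum>k\<in>I. \<bar>r \<omega> k + (u / sqrt c) * v k\<bar>) \<le> A * (1 + \<bar>u\<bar>)" for u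
      proof -
        have "(\<Sum>k\<in>I. \<bar>r \<omega> k + (u / sqrt c) * v k\<bar>) \<le> (\<Sum>k\<in>I. (\<bar>r \<omega> k\<bar> + \<bar>v k / sqrt c\<bar>) * (1 + \<bar>u\<bar>))"
        proof (rule sum_mono)
          fix k
          have "\<bar>r \<omega> k + (u / sqrt c) * v k\<bar> \<le> \<bar>r \<omega> k\<bar> + \<bar>v k / sqrt c\<bar> * \<bar>u\<bar>"
            using abs_triangle_ineq[of "r \<omega> k" "(u / sqrt c) * v k"] by (simp add: abs_mult abs_divide mult.commute)
          also have "\<dots> \<le> (\<bar>r \<omega> k\<bar> + \<bar>v k / sqrt c\<bar>) * (1 + \<bar>u\<bar>)"
          proof -
            have "a + b * t \<le> (a + b) * (1 + t)" if "a \<ge> 0" "b \<ge> 0" "t \<ge> 0" for a b t :: real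
              using that by (simp add: algebra_simps)
            from this[OF abs_ge_zero abs_ge_zero abs_ge_zero] show ?thesis .
          qed
          finally show "\<bar>r \<omega> k + (u / sqrt c) * v k\<bar> \<le> (\<bar>r \<omega> k\<bar> + \<bar>v k / sqrt c\<bar>) * (1 + \<bar>u\<bar>)" .
        qed
        also have "\<dots> = (A - 1) * (1 + \<bar>u\<bar>)" unfolding A_def sum_distrib_right[symmetric] by simp
        finally show ?thesis using abs_ge_zero[of u] by (simp only: left_diff_distrib mult_1)
      qed
      have bnd': "C * (1 + (\<Sum>k\<in>I. \<bar>r \<omega> k + (u / sqrt c) * v k\<bar>)) ^ D \<le> C * A ^ D * (1 + \<bar>u\<bar>) ^ D" for u
        using power_mono[OF bnd[of u], of D] C0
        by (auto simp: power_mult_distrib mult.assoc sum_nonneg intro!: mult_left_mono)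
      define B where "B = C * A ^ D + C * A ^ D / sqrt c"
      have CA: "0 \<le> C * A ^ D" using C0 A1 by simp
      have "(\<integral>u. u *\<^sub>R g u \<partial>?N) = (\<integral>u. h u \<partial>?N)"
      proof (rule std_normal_integration_by_parts[where C=B and D=D])
        show "(g has_vector_derivative h u) (at u)" for u
        proof -
          have d: "((\<lambda>u. u / sqrt c) has_vector_derivative (1 / sqrt c)) (at u)"
            unfolding has_real_derivative_iff_has_vector_derivative[symmetric] by (rule DERIV_cdivide[OF DERIV_ident])
          show ?thesis using vector_diff_chain_at[OF d der[of "r \<omega>" "u / sqrt c"]]
            unfolding g_def h_def o_def by (simp add: inverse_eq_divide)
        qed
        show "continuous_on UNIV h" unfolding h_def
          by (intro continuous_intros continuous_on_compose2[OF cont[of "r \<omega>"], of UNIV "\<lambda>u. u / sqrt c"]) (use c1 in auto)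
        fix u :: real
        have p: "0 \<le> (1 + \<bar>u\<bar>) ^ D" by simp
        have "norm (g u) \<le> C * A ^ D * (1 + \<bar>u\<bar>) ^ D" unfolding g_def by (rule order_trans[OF bG bnd'])
        also have "\<dots> \<le> B * (1 + \<bar>u\<bar>) ^ D" unfolding B_def using CA c1 by (intro mult_right_mono) auto
        finally show "norm (g u) \<le> B * (1 + \<bar>u\<bar>) ^ D" .
        have "norm (h u) \<le> (C * A ^ D * (1 + \<bar>u\<bar>) ^ D) / sqrt c" 
        proof -
          have "norm (h u) = norm (DG (\<lambda>k. r \<omega> k + (u / sqrt c) * v k)) / sqrt c"
            unfolding h_def using c1 by (simp add: divide_inverse mult.commute)
          then show ?thesis using order_trans[OF bDG bnd'[of u]] c1
            by (simp add: divide_right_mono)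
        qed
        also have "\<dots> \<le> B * (1 + \<bar>u\<bar>) ^ D" unfolding B_def using CA c1 p
          by (simp add: distrib_right)
        finally show "norm (h u) \<le> B * (1 + \<bar>u\<bar>) ^ D" .
      qed
      moreover have Xr: "X (\<omega>, u) = restrict (\<lambda>k. r \<omega> k + (u / sqrt c) * v k) I" for u
        unfolding X_def by auto
      then have GX: "G (X (\<omega>, u)) = g u" for u
        by (simp only: rG g_def)
      moreover have "DG (X (\<omega>, u)) = sqrt c *\<^sub>R h u" for u
      proof -
        have "DG (X (\<omega>, u)) = DG (\<lambda>k. r \<omega> k + (u / sqrt c) * v k)"
          by (simp only: Xr rDG)
        then show ?thesis using c1 by (simp add: h_def)
      qed
      moreover have "(\<integral>u. X (\<omega>, u) j *\<^sub>R G (X (\<omega>, u)) \<partial>?N) = (\<integral>u. sqrt c *\<^sub>R (u *\<^sub>R g u) \<partial>?N)"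
        by (simp only: Xj GX snd_conv scaleR_scaleR)
      ultimately show ?thesis by (simp only: Bochner_Integration.integral_scaleR_right)
    qed
    have "(\<integral>\<omega>. z j \<omega> *\<^sub>R G (\<lambda>k. z k \<omega>) \<partial>M) = (\<integral>p. p j *\<^sub>R G p \<partial>distr M (PiM I (\<lambda>_. borel)) (\<lambda>\<omega>. \<lambda>k\<in>I. z k \<omega>))"
      using j by (subst integral_distr) (auto simp: rG)
    also have "\<dots> = (\<integral>p. X p j *\<^sub>R G (X p) \<partial>(M \<Otimes>\<^sub>M ?N))"
      unfolding law by (rule integral_distr) auto
    also have "\<dots> = (\<integral>\<omega>. (\<integral>u. DG (X (\<omega>, u)) \<partial>?N) \<partial>M)"
      unfolding Q.integral_fst'[OF iQ, symmetric] by (simp add: inner)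
    also have "\<dots> = (\<integral>p. DG (X p) \<partial>(M \<Otimes>\<^sub>M ?N))" by (rule Q.integral_fst'[OF iQD])
    also have "\<dots> = (\<integral>p. DG p \<partial>distr M (PiM I (\<lambda>_. borel)) (\<lambda>\<omega>. \<lambda>k\<in>I. z k \<omega>))"
      unfolding law by (rule integral_distr[symmetric]) auto
    also have "\<dots> = (\<integral>\<omega>. DG (\<lambda>k. z k \<omega>) \<partial>M)" by (subst integral_distr) (auto simp: rDG)
    finally show ?thesis .
  qed
qed

end

section \<open>A calculus of test functions for integration by parts\<close>

definition poly_growth :: "'i set \<Rightarrow> (('i \<Rightarrow> real) \<Rightarrow> 'b::real_normed_vector) \<Rightarrow> bool" where
  "poly_growth I G \<longleftrightarrow> (\<exists>C D. \<forall>p. norm (G p) \<le> C * (1 + (\<Sum>k\<in>I. \<bar>p k\<bar>)) ^ D)"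

text \<open>The base is at least 1, so the exponent may be enlarged. This brings two functions of
  different growth to a common exponent.\<close>

lemma poly_growthE:
  assumes "poly_growth I G"
  obtains C D where "C \<ge> 0" "\<And>p D'. D \<le> D' \<Longrightarrow> norm (G p) \<le> C * (1 + (\<Sum>k\<in>I. \<bar>p k\<bar>)) ^ D'"
proof -
  obtain C D where *: "\<And>p. norm (G p) \<le> C * (1 + (\<Sum>k\<in>I. \<bar>p k\<bar>)) ^ D"
    using assms by (auto simp: poly_growth_def)
  have C: "C \<ge> 0" using order_trans[OF norm_ge_zero *[of "\<lambda>_. 0"]] by simp
  have "norm (G p) \<le> C * (1 + (\<Sum>k\<in>I. \<bar>p k\<bar>)) ^ D'" if "D \<le> D'" for p D'
    by (rule order_trans[OF * mult_left_mono[OF power_increasing[OF that] C]]) (simp add: sum_nonneg)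
  then show ?thesis using that C by blast
qed

lemma poly_growth_add:
  assumes "poly_growth I G" "poly_growth I H"
  shows "poly_growth I (\<lambda>p. G p + H p)"
proof -
  obtain C D where G: "C \<ge> 0" "\<And>p D'. D \<le> D' \<Longrightarrow> norm (G p) \<le> C * (1 + (\<Sum>k\<in>I. \<bar>p k\<bar>)) ^ D'"
    using poly_growthE[OF assms(1)] by blast
  obtain C' E where H: "C' \<ge> 0" "\<And>p D'. E \<le> D' \<Longrightarrow> norm (H p) \<le> C' * (1 + (\<Sum>k\<in>I. \<bar>p k\<bar>)) ^ D'"
    using poly_growthE[OF assms(2)] by blast
  have "norm (G p + H p) \<le> (C + C') * (1 + (\<Sum>k\<in>I. \<bar>p k\<bar>)) ^ (D + E)" for p
    unfolding distrib_right
    by (rule order_trans[OF norm_triangle_ineq add_mono]) (use G H in auto)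
  then show ?thesis unfolding poly_growth_def by blast
qed

lemma poly_growth_mult:
  fixes G H :: "('i \<Rightarrow> real) \<Rightarrow> 'b::real_normed_algebra"
  assumes "poly_growth I G" "poly_growth I H"
  shows "poly_growth I (\<lambda>p. G p * H p)"
proof -
  obtain C D where G: "C \<ge> 0" "\<And>p D'. D \<le> D' \<Longrightarrow> norm (G p) \<le> C * (1 + (\<Sum>k\<in>I. \<bar>p k\<bar>)) ^ D'"
    using poly_growthE[OF assms(1)] by blast
  obtain C' E where H: "C' \<ge> 0" "\<And>p D'. E \<le> D' \<Longrightarrow> norm (H p) \<le> C' * (1 + (\<Sum>k\<in>I. \<bar>p k\<bar>)) ^ D'"
    using poly_growthE[OF assms(2)] by blast
  have "norm (G p * H p) \<le> (C * C') * (1 + (\<Sum>k\<in>I. \<bar>p k\<bar>)) ^ (D + E)" for p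
  proof -
    have "norm (G p * H p) \<le> (C * (1 + (\<Sum>k\<in>I. \<bar>p k\<bar>)) ^ D) * (C' * (1 + (\<Sum>k\<in>I. \<bar>p k\<bar>)) ^ E)"
      by (rule order_trans[OF norm_mult_ineq mult_mono]) (use G H in \<open>auto simp: sum_nonneg\<close>)
    then show ?thesis by (simp add: power_add mult_ac)
  qed
  then show ?thesis unfolding poly_growth_def by blast
qed

lemma poly_growth_bounded: "(\<And>p. norm (G p) \<le> C) \<Longrightarrow> poly_growth I G"
  unfolding poly_growth_def by (rule exI[of _ C], rule exI[of _ 0]) simp

lemma poly_growth_coord:
  assumes "finite I" "k \<in> I"
  shows "poly_growth I (\<lambda>p. p k)"
  unfolding poly_growth_def
proof (intro exI allI)
  show "norm (p k) \<le> 1 * (1 + (\<Sum>k\<in>I. \<bar>p k\<bar>)) ^ 1" for p :: "'a \<Rightarrow> real"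
    using member_le_sum[of k I "\<lambda>k. \<bar>p k\<bar>"] assms by simp
qed

lemma poly_growth_norm: "poly_growth I H \<Longrightarrow> (\<And>p. norm (G p) \<le> norm (H p)) \<Longrightarrow> poly_growth I G"
  unfolding poly_growth_def by (meson order_trans)

text \<open>Collects the analytic hypotheses of \<open>gaussian_integration_by_parts\<close> in a
  predicate that is closed under algebraic operations, with the derivative in the direction
  \<open>v\<close> computed alongside. The equations with \<open>restrict\<close> express that only
  the coordinates in \<open>I\<close> matter.\<close>

definition smooth_along :: "'i set \<Rightarrow> ('i \<Rightarrow> real) \<Rightarrow> (('i \<Rightarrow> real) \<Rightarrow> 'b) \<Rightarrow>
    (('i \<Rightarrow> real) \<Rightarrow> 'b::{real_normed_field, euclidean_space}) \<Rightarrow> bool" where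
  "smooth_along I v G DG \<longleftrightarrow>
     G \<in> borel_measurable (PiM I (\<lambda>_. borel)) \<and> DG \<in> borel_measurable (PiM I (\<lambda>_. borel)) \<and>
     (\<forall>p. G (restrict p I) = G p) \<and> (\<forall>p. DG (restrict p I) = DG p) \<and>
     (\<forall>p s. ((\<lambda>s. G (\<lambda>k. p k + s * v k)) has_vector_derivative DG (\<lambda>k. p k + s * v k)) (at s)) \<and>
     (\<forall>p. continuous_on UNIV (\<lambda>s. DG (\<lambda>k. p k + s * v k))) \<and>
     poly_growth I G \<and> poly_growth I DG"

lemma smooth_along_cont:
  assumes "smooth_along I v G DG"
  shows "continuous_on UNIV (\<lambda>s. G (\<lambda>k. p k + s * v k))"
  using assms unfolding smooth_along_def
  by (auto intro!: continuous_at_imp_continuous_on has_vector_derivative_continuous)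

lemma smooth_along_const: "smooth_along I v (\<lambda>_. c) (\<lambda>_. 0 :: 'b :: {real_normed_field, euclidean_space})"
  unfolding smooth_along_def
  using poly_growth_bounded[of "\<lambda>_. c" "norm c" I] poly_growth_bounded[of "\<lambda>_. 0 :: 'b" 0 I] by auto

lemma smooth_along_add:
  assumes "smooth_along I v G DG" "smooth_along I v H DH"
  shows "smooth_along I v (\<lambda>p. G p + H p) (\<lambda>p. DG p + DH p)"
  using assms unfolding smooth_along_def
  by (auto intro!: poly_growth_add continuous_on_add has_vector_derivative_add)

lemma smooth_along_mult:
  assumes "smooth_along I v G DG" "smooth_along I v H DH"
  shows "smooth_along I v (\<lambda>p. G p * H p) (\<lambda>p. G p * DH p + DG p * H p)"
  using assms smooth_along_cont[OF assms(1)] smooth_along_cont[OF assms(2)] unfolding smooth_along_def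
  by (auto intro!: poly_growth_add poly_growth_mult continuous_on_add continuous_on_mult has_vector_derivative_mult)

lemma smooth_along_coord:
  assumes "finite I" "k \<in> I"
  shows "smooth_along I v (\<lambda>p. p k) (\<lambda>p. v k)"
proof -
  have "((\<lambda>s. p k + s * v k) has_vector_derivative v k) (at s)" for s and p :: "'a \<Rightarrow> real"
    unfolding has_real_derivative_iff_has_vector_derivative[symmetric]
    by (auto intro!: derivative_eq_intros)
  then show ?thesis
    using assms poly_growth_coord[OF assms] poly_growth_bounded[of "\<lambda>p. v k" "\<bar>v k\<bar>" I]
    unfolding smooth_along_def by auto
qed

lemma smooth_along_cong:
  assumes "smooth_along I v G DG" "\<And>p. G p = G' p" "\<And>p. DG p = DG' p"
  shows "smooth_along I v G' DG'"
proof -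
  have "G = G'" "DG = DG'" using assms by auto
  then show ?thesis using assms by simp
qed

lemma smooth_along_cmult:
  assumes "smooth_along I v G DG"
  shows "smooth_along I v (\<lambda>p. c * G p) (\<lambda>p. c * DG p)"
  using smooth_along_mult[OF smooth_along_const[of I v c] assms] by simp

lemma smooth_along_power:
  assumes "smooth_along I v G DG"
  shows "smooth_along I v (\<lambda>p. G p ^ m) (\<lambda>p. of_nat m * G p ^ (m - 1) * DG p)"
proof (induction m)
  case 0
  then show ?case using smooth_along_const[of I v 1] by simp
next
  case (Suc m)
  show ?case
    by (rule smooth_along_cong[OF smooth_along_mult[OF assms Suc]]) (cases m; simp add: algebra_simps)+
qed

lemma smooth_along_sum:
  assumes "\<And>i. i \<in> A \<Longrightarrow> smooth_along I v (G i) (DG i)"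
  shows "smooth_along I v (\<lambda>p. \<Sum>i\<in>A. G i p) (\<lambda>p. \<Sum>i\<in>A. DG i p)"
  using assms
proof (induction A rule: infinite_finite_induct)
  case (insert x F)
  then show ?case using smooth_along_add[of I v "G x" "DG x" "\<lambda>p. \<Sum>i\<in>F. G i p" "\<lambda>p. \<Sum>i\<in>F. DG i p"] by simp
qed (auto intro: smooth_along_const)

lemma smooth_along_iexp:
  assumes "smooth_along I v W DW"
  shows "smooth_along I v (\<lambda>p. iexp (W p)) (\<lambda>p. \<i> * complex_of_real (DW p) * iexp (W p))"
proof -
  have "((\<lambda>s. iexp (W (\<lambda>k. p k + s * v k))) has_vector_derivative
      \<i> * complex_of_real (DW (\<lambda>k. p k + s * v k)) * iexp (W (\<lambda>k. p k + s * v k))) (at s)" for p s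
  proof -
    have d: "((\<lambda>s. W (\<lambda>k. p k + s * v k)) has_vector_derivative DW (\<lambda>k. p k + s * v k)) (at s)"
      using assms by (auto simp: smooth_along_def)
    have e: "(iexp has_vector_derivative \<i> * iexp x) (at x)" for x
      by (rule has_vector_derivative_iexp)
    show ?thesis using vector_diff_chain_at[OF d e] by (simp add: o_def scaleR_conv_of_real mult_ac)
  qed
  moreover have "continuous_on UNIV (\<lambda>s. W (\<lambda>k. p k + s * v k))" for p
    by (rule smooth_along_cont[OF assms])
  moreover have "poly_growth I (\<lambda>p. iexp (W p))"
    by (rule poly_growth_bounded[of _ 1]) simp
  moreover have "poly_growth I (\<lambda>p. \<i> * complex_of_real (DW p) * iexp (W p))"
    by (rule poly_growth_norm[of I DW]) (use assms in \<open>auto simp: smooth_along_def norm_mult\<close>)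
  ultimately show ?thesis using assms unfolding smooth_along_def
    by (auto intro!: continuous_intros)
qed

text \<open>The truncated subtraction at \<open>q = 0\<close> is harmless because the factor
  \<open>real q\<close> vanishes there.\<close>

lemma smooth_along_hermite_rec:
  assumes "finite I" "k \<in> I"
  shows "smooth_along I v (\<lambda>p. hermite_rec q (p k)) (\<lambda>p. real q * hermite_rec (q - 1) (p k) * v k)"
proof (induction q rule: less_induct)
  case (less q)
  show ?case
  proof (cases q)
    case 0
    then show ?thesis using smooth_along_const[of I v "1::real"] by simp
  next
    case (Suc m)
    show ?thesis
    proof (cases m)
      case 0
      then show ?thesis using smooth_along_coord[OF assms] Suc by simp
    next
      case (Suc i)
      have q: "q = Suc (Suc i)" using Suc \<open>q = Suc m\<close> by simp
      have 1: "smooth_along I v (\<lambda>p. hermite_rec (Suc i) (p k)) (\<lambda>p. real (Suc i) * hermite_rec i (p k) * v k)"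
        using less[of "Suc i"] q by (simp del: hermite_rec.simps)
      have 2: "smooth_along I v (\<lambda>p. hermite_rec i (p k)) (\<lambda>p. real i * hermite_rec (i - 1) (p k) * v k)"
        using less[of i] q by simp
      have 3: "hermite_rec (Suc i) u = u * hermite_rec i u - real i * hermite_rec (i - 1) u" for u
        by (cases i) auto
      have 4: "u * (n * h * w) + w * h1 + - n * (m * h' * w) = (n + 1) * h1 * w"
        if "h1 = u * h - m * h'" for u n h w h1 m h' :: real
        by (simp add: that algebra_simps)
      show ?thesis unfolding q
      proof (rule smooth_along_cong[OF smooth_along_add[OF smooth_along_mult[OF smooth_along_coord[OF assms] 1]
            smooth_along_cmult[OF 2, of "- real (Suc i)"]]])
        fix p :: "'a \<Rightarrow> real"
        show "p k * hermite_rec (Suc i) (p k) + - real (Suc i) * hermite_rec i (p k) = hermite_rec (Suc (Suc i)) (p k)"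
          by (simp add: algebra_simps)
        show "p k * (real (Suc i) * hermite_rec i (p k) * v k) + v k * hermite_rec (Suc i) (p k) +
           - real (Suc i) * (real i * hermite_rec (i - 1) (p k) * v k) =
           real (Suc (Suc i)) * hermite_rec (Suc (Suc i) - 1) (p k) * v k"
          unfolding 4[OF 3] by simp
      qed
    qed
  qed
qed

context gaussian_space
begin

lemma poly_growth_integrable:
  fixes G :: "('i \<Rightarrow> real) \<Rightarrow> 'b::euclidean_space"
  assumes z: "\<And>k. k \<in> I \<Longrightarrow> z k \<in> V"
    and mG: "G \<in> borel_measurable (PiM I (\<lambda>_. borel))" and rG: "\<And>p. G (restrict p I) = G p"
    and pG: "poly_growth I G"
  shows "integrable M (\<lambda>\<omega>. G (\<lambda>k. z k \<omega>))"
proof -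
  obtain C D where C: "C \<ge> 0" and G: "\<And>p D'. D \<le> D' \<Longrightarrow> norm (G p) \<le> C * (1 + (\<Sum>k\<in>I. \<bar>p k\<bar>)) ^ D'"
    using poly_growthE[OF pG] by blast
  have w: "all_moments M (\<lambda>\<omega>. C * (1 + (\<Sum>k\<in>I. \<bar>z k \<omega>\<bar>)) ^ D)"
    by (intro all_moments_cmult all_moments_power all_moments_add all_moments_const all_moments_sum all_moments_abs V_moments z)
  have mz: "(\<lambda>\<omega>. \<lambda>k\<in>I. z k \<omega>) \<in> M \<rightarrow>\<^sub>M PiM I (\<lambda>_. borel)"
    by (intro measurable_restrict V_measurable z)
  have "(\<lambda>\<omega>. G (\<lambda>k. z k \<omega>)) \<in> borel_measurable M"
    using measurable_compose[OF mz mG] by (simp add: rG)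
  then show ?thesis
    by (rule Bochner_Integration.integrable_bound[OF all_moments_integrable[OF w]])
      (use G[of D] C in \<open>auto simp: sum_nonneg\<close>)
qed

lemma smooth_along_integrable:
  assumes "\<And>k. k \<in> I \<Longrightarrow> z k \<in> V" "smooth_along I v G DG"
  shows "integrable M (\<lambda>\<omega>. G (\<lambda>k. z k \<omega>))" "integrable M (\<lambda>\<omega>. DG (\<lambda>k. z k \<omega>))"
  using assms by (auto simp: smooth_along_def intro!: poly_growth_integrable[where I=I])

lemma smooth_along_by_parts:
  assumes "finite I" "j \<in> I" "\<And>k. k \<in> I \<Longrightarrow> z k \<in> V"
    and "\<And>k. k \<in> I \<Longrightarrow> v k = (\<integral>\<omega>. z j \<omega> * z k \<omega> \<partial>M)"
    and G: "smooth_along I v G DG"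
  shows "(\<integral>\<omega>. z j \<omega> *\<^sub>R G (\<lambda>k. z k \<omega>) \<partial>M) = (\<integral>\<omega>. DG (\<lambda>k. z k \<omega>) \<partial>M)"
proof -
  have "poly_growth I G" "poly_growth I DG" using G by (auto simp: smooth_along_def)
  obtain C D where C: "C \<ge> 0" "\<And>p D'. D \<le> D' \<Longrightarrow> norm (G p) \<le> C * (1 + (\<Sum>k\<in>I. \<bar>p k\<bar>)) ^ D'"
    using poly_growthE[OF \<open>poly_growth I G\<close>] by blast
  obtain C' E where E: "C' \<ge> 0" "\<And>p D'. E \<le> D' \<Longrightarrow> norm (DG p) \<le> C' * (1 + (\<Sum>k\<in>I. \<bar>p k\<bar>)) ^ D'"
    using poly_growthE[OF \<open>poly_growth I DG\<close>] by blast
  have S: "0 \<le> (1 + (\<Sum>k\<in>I. \<bar>p k\<bar>)) ^ (D + E)" for p :: "_ \<Rightarrow> real" by (simp add: sum_nonneg)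
  have 1: "norm (G p) \<le> (C + C') * (1 + (\<Sum>k\<in>I. \<bar>p k\<bar>)) ^ (D + E)" for p
    using C(2)[of "D+E" p] mult_nonneg_nonneg[OF E(1) S[of p]] by (simp add: distrib_right)
  have 2: "norm (DG p) \<le> (C + C') * (1 + (\<Sum>k\<in>I. \<bar>p k\<bar>)) ^ (D + E)" for p
    using E(2)[of "D+E" p] mult_nonneg_nonneg[OF C(1) S[of p]] by (simp add: distrib_right)
  show ?thesis
    by (rule gaussian_integration_by_parts[of I j z v G DG "C + C'" "D + E", OF assms(1-4) _ _ _ _ _ _ 1 2])
      (use G in \<open>auto simp: smooth_along_def\<close>)
qed

section \<open>Wick recursion and decorrelation of mixed moments\<close>

text \<open>Four variables are what the covariance of two products of two powers requires.\<close>

definition mixed_moment :: "('a \<Rightarrow> real) \<Rightarrow> ('a \<Rightarrow> real) \<Rightarrow> ('a \<Rightarrow> real) \<Rightarrow> ('a \<Rightarrow> real) \<Rightarrow>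
    nat \<Rightarrow> nat \<Rightarrow> nat \<Rightarrow> nat \<Rightarrow> real" where
  "mixed_moment x y u w a b c d = (\<integral>\<omega>. x \<omega> ^ a * y \<omega> ^ b * u \<omega> ^ c * w \<omega> ^ d \<partial>M)"

lemma mixed_moment_swap: "mixed_moment x y u w a b c d = mixed_moment y x u w b a c d"
  by (simp add: mixed_moment_def mult_ac)

lemma mixed_moment_integrable:
  assumes "x \<in> V" "y \<in> V" "u \<in> V" "w \<in> V"
  shows "integrable M (\<lambda>\<omega>. x \<omega> ^ a * y \<omega> ^ b * u \<omega> ^ c * w \<omega> ^ d)"
  by (intro all_moments_integrable all_moments_mult all_moments_power V_moments assms)

text \<open>One factor \<open>x\<close> is integrated by parts. Each power that is differentiated
  contributes its covariance with \<open>x\<close> and loses one factor; where its exponent is 0,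
  the coefficient removes the term with the truncated exponent.\<close>

lemma wick_recursion:
  assumes V: "x \<in> V" "y \<in> V" "u \<in> V" "w \<in> V"
  shows "mixed_moment x y u w (Suc a) b c d =
    real a * (\<integral>\<omega>. x \<omega> * x \<omega> \<partial>M) * mixed_moment x y u w (a - 1) b c d +
    real b * (\<integral>\<omega>. x \<omega> * y \<omega> \<partial>M) * mixed_moment x y u w a (b - 1) c d +
    real c * (\<integral>\<omega>. x \<omega> * u \<omega> \<partial>M) * mixed_moment x y u w a b (c - 1) d +
    real d * (\<integral>\<omega>. x \<omega> * w \<omega> \<partial>M) * mixed_moment x y u w a b c (d - 1)"
proof -
  define z :: "nat \<Rightarrow> 'a \<Rightarrow> real" where "z = (\<lambda>k. if k = 0 then x else if k = 1 then y else if k = 2 then u else w)"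
  have z: "z 0 = x" "z 1 = y" "z 2 = u" "z 3 = w" "z (Suc 0) = y" by (auto simp: z_def)
  define v where "v k = (\<integral>\<omega>. z 0 \<omega> * z k \<omega> \<partial>M)" for k
  define I :: "nat set" where "I = {0, 1, 2, 3}"
  have zV: "z k \<in> V" for k using V by (auto simp: z_def)
  have co: "smooth_along I v (\<lambda>p. p k) (\<lambda>p. v k)" if "k \<in> I" for k
    using that by (intro smooth_along_coord) (auto simp: I_def)
  note sm = smooth_along_mult[OF smooth_along_mult[OF smooth_along_mult[OF smooth_along_power[OF co] smooth_along_power[OF co]]
      smooth_along_power[OF co]] smooth_along_power[OF co], of 0 1 2 3 a b c d]
  have "mixed_moment x y u w (Suc a) b c d = (\<integral>\<omega>. z 0 \<omega> *\<^sub>R (z 0 \<omega> ^ a * z 1 \<omega> ^ b * z 2 \<omega> ^ c * z 3 \<omega> ^ d) \<partial>M)"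
    unfolding mixed_moment_def by (intro Bochner_Integration.integral_cong refl) (simp add: z mult_ac)
  also have "\<dots> = (\<integral>\<omega>. real a * v 0 * (z 0 \<omega> ^ (a-1) * z 1 \<omega> ^ b * z 2 \<omega> ^ c * z 3 \<omega> ^ d)
     + real b * v 1 * (z 0 \<omega> ^ a * z 1 \<omega> ^ (b-1) * z 2 \<omega> ^ c * z 3 \<omega> ^ d)
     + real c * v 2 * (z 0 \<omega> ^ a * z 1 \<omega> ^ b * z 2 \<omega> ^ (c-1) * z 3 \<omega> ^ d)
     + real d * v 3 * (z 0 \<omega> ^ a * z 1 \<omega> ^ b * z 2 \<omega> ^ c * z 3 \<omega> ^ (d-1)) \<partial>M)"
    by (subst smooth_along_by_parts[where I = I and j = 0 and z = z and v = v, OF _ _ _ _ sm])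
      (auto simp: I_def zV v_def algebra_simps)
  also have "\<dots> = real a * (\<integral>\<omega>. x \<omega> * x \<omega> \<partial>M) * mixed_moment x y u w (a - 1) b c d +
    real b * (\<integral>\<omega>. x \<omega> * y \<omega> \<partial>M) * mixed_moment x y u w a (b - 1) c d +
    real c * (\<integral>\<omega>. x \<omega> * u \<omega> \<partial>M) * mixed_moment x y u w a b (c - 1) d +
    real d * (\<integral>\<omega>. x \<omega> * w \<omega> \<partial>M) * mixed_moment x y u w a b c (d - 1)"
    unfolding z mixed_moment_def v_def
    by (simp add: Bochner_Integration.integral_add mixed_moment_integrable V)
  finally show ?thesis .
qed

text \<open>The point is uniformity: \<open>B\<close> depends on the exponents and on the variance
  bound \<open>K\<close>, but not on the variables. Even Gaussian moments are powers of the
  variance, and every monomial of degree n is dominated by moments of order 2 n.\<close>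

lemma mixed_moment_bound:
  "\<exists>B\<ge>0. \<forall>x\<in>V. \<forall>y\<in>V. \<forall>u\<in>V. \<forall>w\<in>V.
     (\<integral>\<omega>. x \<omega> * x \<omega> \<partial>M) \<le> K \<and> (\<integral>\<omega>. y \<omega> * y \<omega> \<partial>M) \<le> K \<and>
     (\<integral>\<omega>. u \<omega> * u \<omega> \<partial>M) \<le> K \<and> (\<integral>\<omega>. w \<omega> * w \<omega> \<partial>M) \<le> K \<longrightarrow>
     \<bar>mixed_moment x y u w a b c d\<bar> \<le> B"
proof -
  define n where "n = a + b + c + d"
  define \<kappa> where "\<kappa> = fact (2 * n) / (2 ^ n * fact n) * \<bar>K\<bar> ^ n"
  have mom: "(\<integral>\<omega>. x \<omega> ^ (2 * n) \<partial>M) \<le> \<kappa>" if x: "x \<in> V" and K: "(\<integral>\<omega>. x \<omega> * x \<omega> \<partial>M) \<le> K" for x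
  proof -
    have "(\<integral>\<omega>. x \<omega> ^ (2 * n) \<partial>M) = fact (2 * n) / (2 ^ n * fact n) * (\<integral>\<omega>. (x \<omega>)\<^sup>2 \<partial>M) ^ n"
      by (rule centered_gaussian_even_moment[OF gaussian[OF x]])
    also have "\<dots> \<le> \<kappa>" unfolding \<kappa>_def
      using K by (intro mult_left_mono power_mono) (auto simp: power2_eq_square)
    finally show ?thesis .
  qed
  have pw: "\<bar>x ^ a * y ^ b * u ^ c * w ^ d\<bar> \<le> 5 ^ n * (1 + x ^ (2*n) + y ^ (2*n) + u ^ (2*n) + w ^ (2*n))" for x y u w :: real
  proof -
    \<comment> \<open>Since \<open>m\<close> is at least 1 and at least each square, it bounds each
      absolute value. As it is itself 1 or one of the squares, its n-th power is at most the sum of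
      1 and the powers of order 2 n.\<close>
    define m where "m = Max {1, x\<^sup>2, y\<^sup>2, u\<^sup>2, w\<^sup>2}"
    have m: "1 \<le> m" "x\<^sup>2 \<le> m" "y\<^sup>2 \<le> m" "u\<^sup>2 \<le> m" "w\<^sup>2 \<le> m" unfolding m_def by auto
    have le: "\<bar>t\<bar> \<le> m" if "t\<^sup>2 \<le> m" for t :: real
    proof (cases "\<bar>t\<bar> \<le> 1")
      case False
      then have "\<bar>t\<bar> * 1 \<le> \<bar>t\<bar> * \<bar>t\<bar>" by (intro mult_left_mono) auto
      then show ?thesis using that by (simp add: power2_eq_square)
    qed (use m in simp)
    have "\<bar>x ^ a * y ^ b * u ^ c * w ^ d\<bar> = \<bar>x\<bar> ^ a * \<bar>y\<bar> ^ b * \<bar>u\<bar> ^ c * \<bar>w\<bar> ^ d"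
      by (simp add: abs_mult power_abs)
    also have "\<dots> \<le> m ^ a * m ^ b * m ^ c * m ^ d"
      using m le by (intro mult_mono power_mono) auto
    also have "\<dots> = m ^ n" by (simp add: n_def power_add)
    also have "m ^ n \<le> 1 + x ^ (2*n) + y ^ (2*n) + u ^ (2*n) + w ^ (2*n)"
    proof -
      have "m \<in> {1, x\<^sup>2, y\<^sup>2, u\<^sup>2, w\<^sup>2}" unfolding m_def by (rule Max_in) auto
      moreover have "0 \<le> t ^ (2 * n)" for t :: real by (simp add: power_mult)
      ultimately show ?thesis
        using \<open>\<And>t. 0 \<le> t ^ (2 * n)\<close>[of x] \<open>\<And>t. 0 \<le> t ^ (2 * n)\<close>[of y] \<open>\<And>t. 0 \<le> t ^ (2 * n)\<close>[of u] \<open>\<And>t. 0 \<le> t ^ (2 * n)\<close>[of w]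
        by (auto simp: power_mult[symmetric])
    qed
    also have "\<dots> \<le> 5 ^ n * (1 + x ^ (2*n) + y ^ (2*n) + u ^ (2*n) + w ^ (2*n))"
    proof -
      have "0 \<le> 1 + x ^ (2*n) + y ^ (2*n) + u ^ (2*n) + w ^ (2*n)"
        by (intro add_nonneg_nonneg) (auto simp: power_mult)
      then show ?thesis using mult_right_mono[OF one_le_power[of "5::real" n]] by simp
    qed
    finally show ?thesis .
  qed
  define B where "B = 5 ^ n * (1 + \<kappa> + \<kappa> + \<kappa> + \<kappa>)"
  have \<kappa>0: "\<kappa> \<ge> 0" unfolding \<kappa>_def by simp
  show ?thesis
  proof (intro exI[of _ B] conjI ballI impI)
    show "B \<ge> 0" unfolding B_def using \<kappa>0 by simp
    fix x y u w
    assume V: "x \<in> V" "y \<in> V" "u \<in> V" "w \<in> V" and K: "(\<integral>\<omega>. x \<omega> * x \<omega> \<partial>M) \<le> K \<and> (\<integral>\<omega>. y \<omega> * y \<omega> \<partial>M) \<le> K \<and>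
     (\<integral>\<omega>. u \<omega> * u \<omega> \<partial>M) \<le> K \<and> (\<integral>\<omega>. w \<omega> * w \<omega> \<partial>M) \<le> K"
    have i: "integrable M (\<lambda>\<omega>. t \<omega> ^ (2 * n))" if "t \<in> V" for t
      using V_moments[OF that] by (rule all_moments_integrable_power)
    have "\<bar>mixed_moment x y u w a b c d\<bar> \<le> (\<integral>\<omega>. \<bar>x \<omega> ^ a * y \<omega> ^ b * u \<omega> ^ c * w \<omega> ^ d\<bar> \<partial>M)"
      unfolding mixed_moment_def by (rule integral_abs_bound)
    also have "\<dots> \<le> (\<integral>\<omega>. 5 ^ n * (1 + x \<omega> ^ (2*n) + y \<omega> ^ (2*n) + u \<omega> ^ (2*n) + w \<omega> ^ (2*n)) \<partial>M)"
      using i[OF V(1)] i[OF V(2)] i[OF V(3)] i[OF V(4)] mixed_moment_integrable[OF V] pw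
      by (intro integral_mono) auto
    also have "\<dots> = 5 ^ n * (1 + (\<integral>\<omega>. x \<omega> ^ (2*n) \<partial>M) + (\<integral>\<omega>. y \<omega> ^ (2*n) \<partial>M) + (\<integral>\<omega>. u \<omega> ^ (2*n) \<partial>M) + (\<integral>\<omega>. w \<omega> ^ (2*n) \<partial>M))"
      using i[OF V(1)] i[OF V(2)] i[OF V(3)] i[OF V(4)] by (simp add: prob_space)
    also have "\<dots> \<le> B" unfolding B_def
      using mom V K by (intro mult_left_mono add_mono) auto
    finally show "\<bar>mixed_moment x y u w a b c d\<bar> \<le> B" .
  qed
qed

text \<open>Induction on \<open>a + b\<close> by the Wick recursion in \<open>x\<close>. Pairing
  \<open>x\<close> with \<open>x\<close> or \<open>y\<close> reproduces the same difference at
  smaller exponents. Pairing \<open>x\<close> with \<open>u\<close> or \<open>w\<close> yields one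
  of the cross covariances on the right times a moment that is bounded uniformly, and has no
  counterpart in the subtracted product.\<close>

lemma covariance_bound_aux:
  assumes K: "K \<ge> 0"
  shows "\<exists>C\<ge>0. \<forall>x\<in>V. \<forall>y\<in>V. \<forall>u\<in>V. \<forall>w\<in>V.
     (\<integral>\<omega>. x \<omega> * x \<omega> \<partial>M) \<le> K \<and> (\<integral>\<omega>. y \<omega> * y \<omega> \<partial>M) \<le> K \<and>
     (\<integral>\<omega>. u \<omega> * u \<omega> \<partial>M) \<le> K \<and> (\<integral>\<omega>. w \<omega> * w \<omega> \<partial>M) \<le> K \<and> \<bar>\<integral>\<omega>. x \<omega> * y \<omega> \<partial>M\<bar> \<le> K \<longrightarrow>
     \<bar>mixed_moment x y u w a b c d - mixed_moment x y u w a b 0 0 * mixed_moment x y u w 0 0 c d\<bar>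
       \<le> C * (\<bar>\<integral>\<omega>. x \<omega> * u \<omega> \<partial>M\<bar> + \<bar>\<integral>\<omega>. x \<omega> * w \<omega> \<partial>M\<bar> + \<bar>\<integral>\<omega>. y \<omega> * u \<omega> \<partial>M\<bar> + \<bar>\<integral>\<omega>. y \<omega> * w \<omega> \<partial>M\<bar>)"
proof -
  let ?H = "\<lambda>x y u w. (\<integral>\<omega>. x \<omega> * x \<omega> \<partial>M) \<le> K \<and> (\<integral>\<omega>. y \<omega> * y \<omega> \<partial>M) \<le> K \<and>
     (\<integral>\<omega>. u \<omega> * u \<omega> \<partial>M) \<le> K \<and> (\<integral>\<omega>. w \<omega> * w \<omega> \<partial>M) \<le> K \<and> \<bar>\<integral>\<omega>. x \<omega> * y \<omega> \<partial>M\<bar> \<le> K"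
  define eps where "eps x y u w = \<bar>\<integral>\<omega>. x \<omega> * u \<omega> \<partial>M\<bar> + \<bar>\<integral>\<omega>. x \<omega> * w \<omega> \<partial>M\<bar> + \<bar>\<integral>\<omega>. y \<omega> * u \<omega> \<partial>M\<bar> + \<bar>\<integral>\<omega>. y \<omega> * w \<omega> \<partial>M\<bar>" for x y u w :: "'a \<Rightarrow> real"
  define D where "D x y u w a b = mixed_moment x y u w a b c d - mixed_moment x y u w a b 0 0 * mixed_moment x y u w 0 0 c d" for x y u w a b
  have sw: "D x y u w a b = D y x u w b a" "eps x y u w = eps y x u w" for x y u w a b
    unfolding D_def eps_def by (simp_all add: mixed_moment_swap[of x y] add_ac)
  have e0: "eps x y u w \<ge> 0" for x y u w unfolding eps_def by simp
  have "\<exists>C\<ge>0. \<forall>x\<in>V. \<forall>y\<in>V. \<forall>u\<in>V. \<forall>w\<in>V. ?H x y u w \<longrightarrow> \<bar>D x y u w a b\<bar> \<le> C * eps x y u w"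
  proof (induction "a + b" arbitrary: a b rule: less_induct)
    case less
    have abs4: "\<bar>p + q + r + s\<bar> \<le> P + Q + R + S"
      if "\<bar>p\<bar> \<le> P" "\<bar>q\<bar> \<le> Q" "\<bar>r\<bar> \<le> R" "\<bar>s\<bar> \<le> S" for p q r s P Q R S :: real
      using that by linarith
    \<comment> \<open>The recursion lowers the first exponent only. When it is 0, the roles of
      \<open>x\<close> and \<open>y\<close> are exchanged below.\<close>
    have pos: "\<exists>C\<ge>0. \<forall>x\<in>V. \<forall>y\<in>V. \<forall>u\<in>V. \<forall>w\<in>V. ?H x y u w \<longrightarrow> \<bar>D x y u w (Suc e) f\<bar> \<le> C * eps x y u w"
      if ef: "Suc e + f = a + b" for e f
    proof -
      have l1: "e - 1 + f < a + b" and l2: "e + (f - 1) < a + b" using ef by arith+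
      obtain C1 where C1: "C1 \<ge> 0" "\<And>x y u w. x \<in> V \<Longrightarrow> y \<in> V \<Longrightarrow> u \<in> V \<Longrightarrow> w \<in> V \<Longrightarrow> ?H x y u w \<Longrightarrow> \<bar>D x y u w (e - 1) f\<bar> \<le> C1 * eps x y u w"
        using less[of "e - 1" f, OF l1] by blast
      obtain C2 where C2: "C2 \<ge> 0" "\<And>x y u w. x \<in> V \<Longrightarrow> y \<in> V \<Longrightarrow> u \<in> V \<Longrightarrow> w \<in> V \<Longrightarrow> ?H x y u w \<Longrightarrow> \<bar>D x y u w e (f - 1)\<bar> \<le> C2 * eps x y u w"
        using less[of e "f - 1", OF l2] by blast
      obtain B1 where B1: "B1 \<ge> 0" "\<And>x y u w. x \<in> V \<Longrightarrow> y \<in> V \<Longrightarrow> u \<in> V \<Longrightarrow> w \<in> V \<Longrightarrow> ?H x y u w \<Longrightarrow> \<bar>mixed_moment x y u w e f (c - 1) d\<bar> \<le> B1"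
        using mixed_moment_bound[of K e f "c - 1" d] by blast
      obtain B2 where B2: "B2 \<ge> 0" "\<And>x y u w. x \<in> V \<Longrightarrow> y \<in> V \<Longrightarrow> u \<in> V \<Longrightarrow> w \<in> V \<Longrightarrow> ?H x y u w \<Longrightarrow> \<bar>mixed_moment x y u w e f c (d - 1)\<bar> \<le> B2"
        using mixed_moment_bound[of K e f c "d - 1"] by blast
      define C where "C = real e * K * C1 + real f * K * C2 + real c * B1 + real d * B2"
      show ?thesis
      proof (intro exI[of _ C] conjI ballI impI)
        show "C \<ge> 0" unfolding C_def using K C1 C2 B1 B2 by simp
        fix x y u w assume V: "x \<in> V" "y \<in> V" "u \<in> V" "w \<in> V" and H: "?H x y u w"
        let ?e = "eps x y u w"
        have Deq: "D x y u w (Suc e) f = real e * (\<integral>\<omega>. x \<omega> * x \<omega> \<partial>M) * D x y u w (e - 1) f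
          + real f * (\<integral>\<omega>. x \<omega> * y \<omega> \<partial>M) * D x y u w e (f - 1)
          + real c * (\<integral>\<omega>. x \<omega> * u \<omega> \<partial>M) * mixed_moment x y u w e f (c - 1) d
          + real d * (\<integral>\<omega>. x \<omega> * w \<omega> \<partial>M) * mixed_moment x y u w e f c (d - 1)"
          unfolding D_def wick_recursion[OF V] by (simp add: algebra_simps)
        have "\<bar>D x y u w (Suc e) f\<bar> \<le> real e * K * (C1 * ?e) + real f * K * (C2 * ?e) + real c * ?e * B1 + real d * ?e * B2"
        proof -
          have "\<bar>real e * (\<integral>\<omega>. x \<omega> * x \<omega> \<partial>M) * D x y u w (e - 1) f\<bar> \<le> real e * K * (C1 * ?e)"
            using C1(2)[OF V H] H K unfolding abs_mult by (intro mult_mono) auto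
          moreover have "\<bar>real f * (\<integral>\<omega>. x \<omega> * y \<omega> \<partial>M) * D x y u w e (f - 1)\<bar> \<le> real f * K * (C2 * ?e)"
            using C2(2)[OF V H] H K unfolding abs_mult by (intro mult_mono) auto
          moreover have "\<bar>real c * (\<integral>\<omega>. x \<omega> * u \<omega> \<partial>M) * mixed_moment x y u w e f (c - 1) d\<bar> \<le> real c * ?e * B1"
            using B1(2)[OF V H] e0 unfolding abs_mult by (intro mult_mono) (auto simp: eps_def)
          moreover have "\<bar>real d * (\<integral>\<omega>. x \<omega> * w \<omega> \<partial>M) * mixed_moment x y u w e f c (d - 1)\<bar> \<le> real d * ?e * B2"
            using B2(2)[OF V H] e0 unfolding abs_mult by (intro mult_mono) (auto simp: eps_def)
          ultimately show ?thesis unfolding Deq by (rule abs4)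
        qed
        also have "\<dots> = C * ?e" unfolding C_def by (simp add: algebra_simps)
        finally show "\<bar>D x y u w (Suc e) f\<bar> \<le> C * ?e" .
      qed
    qed
    show ?case
    proof (cases a)
      case (Suc e)
      then show ?thesis using pos[of e b] by simp
    next
      case a: 0
      show ?thesis
      proof (cases b)
        case 0
        have "D x y u w 0 0 = 0" for x y u w unfolding D_def by (simp add: mixed_moment_def prob_space)
        then show ?thesis using a 0 e0 by (intro exI[of _ 0]) auto
      next
        case (Suc f)
        obtain C where C: "C \<ge> 0" "\<And>x y u w. x \<in> V \<Longrightarrow> y \<in> V \<Longrightarrow> u \<in> V \<Longrightarrow> w \<in> V \<Longrightarrow> ?H x y u w \<Longrightarrow> \<bar>D x y u w (Suc f) 0\<bar> \<le> C * eps x y u w"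
          using pos[of f 0] a Suc by auto
        show ?thesis unfolding a Suc
        proof (intro exI[of _ C] conjI ballI impI C(1))
          fix x y u w assume V: "x \<in> V" "y \<in> V" "u \<in> V" "w \<in> V" and H: "?H x y u w"
          show "\<bar>D x y u w 0 (Suc f)\<bar> \<le> C * eps x y u w"
            unfolding sw[of x y] using C(2)[OF V(2,1,3,4)] H by (simp add: mult.commute)
        qed
      qed
    qed
  qed
  then show ?thesis unfolding D_def eps_def .
qed

lemma V_abs_covariance_le:
  assumes "x \<in> V" "y \<in> V" "(\<integral>\<omega>. x \<omega> * x \<omega> \<partial>M) \<le> K" "(\<integral>\<omega>. y \<omega> * y \<omega> \<partial>M) \<le> K"
  shows "\<bar>\<integral>\<omega>. x \<omega> * y \<omega> \<partial>M\<bar> \<le> K"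
proof -
  have "\<bar>\<integral>\<omega>. x \<omega> * y \<omega> \<partial>M\<bar> \<le> (\<integral>\<omega>. \<bar>x \<omega> * y \<omega>\<bar> \<partial>M)" by (rule integral_abs_bound)
  also have "\<dots> \<le> (\<integral>\<omega>. (x \<omega> * x \<omega> + y \<omega> * y \<omega>) / 2 \<partial>M)"
  proof (rule integral_mono)
    show "\<bar>x \<omega> * y \<omega>\<bar> \<le> (x \<omega> * x \<omega> + y \<omega> * y \<omega>) / 2" for \<omega>
      using sum_squares_bound[of "\<bar>x \<omega>\<bar>" "\<bar>y \<omega>\<bar>"] by (simp add: power2_eq_square abs_mult)
  qed (use V_integrable_mult assms in auto)
  also have "\<dots> \<le> K" using V_integrable_mult assms by simp
  finally show ?thesis .
qed

lemma covariance_bound: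
  assumes K: "K \<ge> 0"
  obtains C where "C \<ge> 0" "\<And>x y u w. x \<in> V \<Longrightarrow> y \<in> V \<Longrightarrow> u \<in> V \<Longrightarrow> w \<in> V \<Longrightarrow>
     (\<integral>\<omega>. x \<omega> * x \<omega> \<partial>M) \<le> K \<Longrightarrow> (\<integral>\<omega>. y \<omega> * y \<omega> \<partial>M) \<le> K \<Longrightarrow>
     (\<integral>\<omega>. u \<omega> * u \<omega> \<partial>M) \<le> K \<Longrightarrow> (\<integral>\<omega>. w \<omega> * w \<omega> \<partial>M) \<le> K \<Longrightarrow>
     \<bar>(\<integral>\<omega>. (x \<omega> ^ a * y \<omega> ^ b) * (u \<omega> ^ c * w \<omega> ^ d) \<partial>M) - (\<integral>\<omega>. x \<omega> ^ a * y \<omega> ^ b \<partial>M) * (\<integral>\<omega>. u \<omega> ^ c * w \<omega> ^ d \<partial>M)\<bar>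
       \<le> C * (\<bar>\<integral>\<omega>. x \<omega> * u \<omega> \<partial>M\<bar> + \<bar>\<integral>\<omega>. x \<omega> * w \<omega> \<partial>M\<bar> + \<bar>\<integral>\<omega>. y \<omega> * u \<omega> \<partial>M\<bar> + \<bar>\<integral>\<omega>. y \<omega> * w \<omega> \<partial>M\<bar>)"
proof -
  obtain C where "C \<ge> 0" and C: "\<forall>x\<in>V. \<forall>y\<in>V. \<forall>u\<in>V. \<forall>w\<in>V.
     (\<integral>\<omega>. x \<omega> * x \<omega> \<partial>M) \<le> K \<and> (\<integral>\<omega>. y \<omega> * y \<omega> \<partial>M) \<le> K \<and>
     (\<integral>\<omega>. u \<omega> * u \<omega> \<partial>M) \<le> K \<and> (\<integral>\<omega>. w \<omega> * w \<omega> \<partial>M) \<le> K \<and> \<bar>\<integral>\<omega>. x \<omega> * y \<omega> \<partial>M\<bar> \<le> K \<longrightarrow>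
     \<bar>mixed_moment x y u w a b c d - mixed_moment x y u w a b 0 0 * mixed_moment x y u w 0 0 c d\<bar>
       \<le> C * (\<bar>\<integral>\<omega>. x \<omega> * u \<omega> \<partial>M\<bar> + \<bar>\<integral>\<omega>. x \<omega> * w \<omega> \<partial>M\<bar> + \<bar>\<integral>\<omega>. y \<omega> * u \<omega> \<partial>M\<bar> + \<bar>\<integral>\<omega>. y \<omega> * w \<omega> \<partial>M\<bar>)"
    using covariance_bound_aux[OF K, of a b c d] by blast
  show ?thesis
  proof (rule that[OF \<open>C \<ge> 0\<close>])
    fix x y u w
    assume V: "x \<in> V" "y \<in> V" "u \<in> V" "w \<in> V"
      and H: "(\<integral>\<omega>. x \<omega> * x \<omega> \<partial>M) \<le> K" "(\<integral>\<omega>. y \<omega> * y \<omega> \<partial>M) \<le> K"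
        "(\<integral>\<omega>. u \<omega> * u \<omega> \<partial>M) \<le> K" "(\<integral>\<omega>. w \<omega> * w \<omega> \<partial>M) \<le> K"
    show "\<bar>(\<integral>\<omega>. (x \<omega> ^ a * y \<omega> ^ b) * (u \<omega> ^ c * w \<omega> ^ d) \<partial>M) - (\<integral>\<omega>. x \<omega> ^ a * y \<omega> ^ b \<partial>M) * (\<integral>\<omega>. u \<omega> ^ c * w \<omega> ^ d \<partial>M)\<bar>
       \<le> C * (\<bar>\<integral>\<omega>. x \<omega> * u \<omega> \<partial>M\<bar> + \<bar>\<integral>\<omega>. x \<omega> * w \<omega> \<partial>M\<bar> + \<bar>\<integral>\<omega>. y \<omega> * u \<omega> \<partial>M\<bar> + \<bar>\<integral>\<omega>. y \<omega> * w \<omega> \<partial>M\<bar>)"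
      using C[rule_format, OF V] H V_abs_covariance_le[OF V(1,2) H(1,2)]
      by (simp add: mixed_moment_def mult.assoc)
  qed
qed

end

section \<open>Integration by parts of odd powers\<close>

lemma smooth_along_of_real:
  assumes "smooth_along I v G DG"
  shows "smooth_along I v (\<lambda>p. of_real (G p) :: 'b::{real_normed_field, euclidean_space}) (\<lambda>p. of_real (DG p))"
proof -
  have "poly_growth I (\<lambda>p. of_real (G p) :: 'b)" "poly_growth I (\<lambda>p. of_real (DG p) :: 'b)"
    using assms by (auto simp: smooth_along_def intro: poly_growth_norm[of I G] poly_growth_norm[of I DG])
  then show ?thesis using assms unfolding smooth_along_def
    by (auto intro!: bounded_linear.has_vector_derivative[OF bounded_linear_of_real] continuous_on_of_real
      borel_measurable_of_real)
qed

text \<open>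
  \<open>p = odd_stein l s\<close> solves the Stein equation \<open>x p(x) - s p'(x) = x\<^sup>2\<^sup>l\<^sup>+\<^sup>1\<close>.
\<close>
primrec odd_stein :: "nat \<Rightarrow> real \<Rightarrow> real \<Rightarrow> real" where
  "odd_stein 0 s x = 1"
| "odd_stein (Suc l) s x = x ^ (2 * l + 2) + (2 * real l + 2) * s * odd_stein l s x"

lemma borel_measurable_odd_stein [measurable]: "odd_stein l s \<in> borel_measurable borel"
  by (induction l) auto

context gaussian_space
begin

lemma all_moments_odd_stein: "x \<in> V \<Longrightarrow> all_moments M (\<lambda>\<omega>. odd_stein l s (x \<omega>))"
proof (induction l)
  case (Suc l)
  show ?case unfolding odd_stein.simps
    by (intro all_moments_add all_moments_power V_moments Suc.prems all_moments_cmult Suc.IH)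
qed (simp add: all_moments_const)

text \<open>The whole odd power is traded for a derivative of \<open>H\<close>, with no term left in
  which \<open>H\<close> is not differentiated. One integration by parts of the power 2 l + 3 leaves
  (2 l + 2) \<open>v j\<close> times the statement for \<open>l\<close>, which is exactly what the
  recursion of \<open>odd_stein\<close> adds. Integrability is carried along because the induction
  step needs it.\<close>

lemma odd_power_by_parts:
  fixes H DH :: "('i \<Rightarrow> real) \<Rightarrow> 'b::{real_normed_field, euclidean_space}"
  assumes I: "finite I" "j \<in> I" and z: "\<And>k. k \<in> I \<Longrightarrow> z k \<in> V"
    and v: "\<And>k. k \<in> I \<Longrightarrow> v k = (\<integral>\<omega>. z j \<omega> * z k \<omega> \<partial>M)"
    and H: "smooth_along I v H DH"
  shows "integrable M (\<lambda>\<omega>. odd_stein l (v j) (z j \<omega>) *\<^sub>R DH (\<lambda>k. z k \<omega>)) \<and>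
    (\<integral>\<omega>. z j \<omega> ^ (2 * l + 1) *\<^sub>R H (\<lambda>k. z k \<omega>) \<partial>M) = (\<integral>\<omega>. odd_stein l (v j) (z j \<omega>) *\<^sub>R DH (\<lambda>k. z k \<omega>) \<partial>M)"
proof (induction l)
  case 0
  then show ?case using smooth_along_by_parts[of I j z v, OF I z v H] smooth_along_integrable(2)[OF z H] by simp
next
  case (Suc l)
  let ?m = "2 * l + 2"
  have G: "smooth_along I v (\<lambda>p. of_real (p j) ^ m * H p)
      (\<lambda>p. of_real (p j) ^ m * DH p + (of_nat m * of_real (p j) ^ (m - 1) * of_real (v j)) * H p)" for m
    by (intro smooth_along_mult smooth_along_power smooth_along_of_real smooth_along_coord I H)
  have i1: "integrable M (\<lambda>\<omega>. z j \<omega> ^ ?m *\<^sub>R DH (\<lambda>k. z k \<omega>))"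
  proof -
    have "integrable M (\<lambda>\<omega>. of_real (z j \<omega>) ^ ?m * DH (\<lambda>k. z k \<omega>))"
    proof (rule poly_growth_integrable[OF z, where I=I and G="\<lambda>p. of_real (p j) ^ ?m * DH p"])
      show "poly_growth I (\<lambda>p. of_real (p j) ^ ?m * DH p)"
        using smooth_along_power[OF smooth_along_of_real[OF smooth_along_coord[OF I]], of v ?m] H
        by (intro poly_growth_mult) (auto simp: smooth_along_def)
    qed (use H I in \<open>auto simp: smooth_along_def\<close>)
    then show ?thesis by (simp add: scaleR_conv_of_real)
  qed
  have i2: "integrable M (\<lambda>\<omega>. z j \<omega> ^ (2 * l + 1) *\<^sub>R H (\<lambda>k. z k \<omega>))"
    using smooth_along_integrable(1)[OF z G[of "2 * l + 1"]] by (simp add: scaleR_conv_of_real)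
  have "(\<integral>\<omega>. z j \<omega> ^ (2 * Suc l + 1) *\<^sub>R H (\<lambda>k. z k \<omega>) \<partial>M) = (\<integral>\<omega>. z j \<omega> *\<^sub>R (of_real (z j \<omega>) ^ ?m * H (\<lambda>k. z k \<omega>)) \<partial>M)"
    by (simp add: scaleR_conv_of_real mult_ac)
  also have "\<dots> = (\<integral>\<omega>. of_real (z j \<omega>) ^ ?m * DH (\<lambda>k. z k \<omega>) + (of_nat ?m * of_real (z j \<omega>) ^ (?m - 1) * of_real (v j)) * H (\<lambda>k. z k \<omega>) \<partial>M)"
    by (rule smooth_along_by_parts[of I j z v, OF I z v G])
  also have "\<dots> = (\<integral>\<omega>. z j \<omega> ^ ?m *\<^sub>R DH (\<lambda>k. z k \<omega>) + ((2 * real l + 2) * v j) *\<^sub>R (z j \<omega> ^ (2 * l + 1) *\<^sub>R H (\<lambda>k. z k \<omega>)) \<partial>M)"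
    by (simp add: scaleR_conv_of_real algebra_simps)
  also have "\<dots> = (\<integral>\<omega>. z j \<omega> ^ ?m *\<^sub>R DH (\<lambda>k. z k \<omega>) \<partial>M) + ((2 * real l + 2) * v j) *\<^sub>R (\<integral>\<omega>. z j \<omega> ^ (2 * l + 1) *\<^sub>R H (\<lambda>k. z k \<omega>) \<partial>M)"
    using i1 i2 by (simp add: Bochner_Integration.integral_add del: scaleR_scaleR)
  also have "\<dots> = (\<integral>\<omega>. z j \<omega> ^ ?m *\<^sub>R DH (\<lambda>k. z k \<omega>) + ((2 * real l + 2) * v j) *\<^sub>R (odd_stein l (v j) (z j \<omega>) *\<^sub>R DH (\<lambda>k. z k \<omega>)) \<partial>M)"
    using i1 Suc by (simp add: Bochner_Integration.integral_add del: scaleR_scaleR)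
  also have "\<dots> = (\<integral>\<omega>. odd_stein (Suc l) (v j) (z j \<omega>) *\<^sub>R DH (\<lambda>k. z k \<omega>) \<partial>M)"
    by (simp add: scaleR_add_left)
  finally have 1: "(\<integral>\<omega>. z j \<omega> ^ (2 * Suc l + 1) *\<^sub>R H (\<lambda>k. z k \<omega>) \<partial>M) = (\<integral>\<omega>. odd_stein (Suc l) (v j) (z j \<omega>) *\<^sub>R DH (\<lambda>k. z k \<omega>) \<partial>M)" .
  have "integrable M (\<lambda>\<omega>. z j \<omega> ^ ?m *\<^sub>R DH (\<lambda>k. z k \<omega>) + ((2 * real l + 2) * v j) *\<^sub>R (odd_stein l (v j) (z j \<omega>) *\<^sub>R DH (\<lambda>k. z k \<omega>)))"
    using i1 Suc by (intro Bochner_Integration.integrable_add integrable_scaleR_right) auto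
  then have "integrable M (\<lambda>\<omega>. odd_stein (Suc l) (v j) (z j \<omega>) *\<^sub>R DH (\<lambda>k. z k \<omega>))"
    by (simp add: scaleR_add_left)
  with 1 show ?case by blast
qed

text \<open>\<open>odd_stein\<close> has degree \<open>l\<close> in the variance when x^2 counts as
  a variance, so its mean is a constant depending on \<open>l\<close> alone times the power
  \<open>l\<close> of the variance. This mean is also the coefficient of x in the first chaos of
  x^(2 l + 1): testing the odd power against x itself shows it. It turns the mean of the linear
  functional R into the covariance of one linear form with B.\<close>

lemma odd_stein_mean: "\<exists>\<kappa>. \<forall>x\<in>V. (\<integral>\<omega>. odd_stein l (\<integral>\<omega>. x \<omega> * x \<omega> \<partial>M) (x \<omega>) \<partial>M) = \<kappa> * (\<integral>\<omega>. x \<omega> * x \<omega> \<partial>M) ^ l"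
proof (induction l)
  case 0
  show ?case by (rule exI[of _ 1]) (simp add: prob_space)
next
  case (Suc l)
  then obtain \<kappa> where \<kappa>: "\<And>x. x \<in> V \<Longrightarrow> (\<integral>\<omega>. odd_stein l (\<integral>\<omega>. x \<omega> * x \<omega> \<partial>M) (x \<omega>) \<partial>M) = \<kappa> * (\<integral>\<omega>. x \<omega> * x \<omega> \<partial>M) ^ l" by blast
  show ?case
  proof (intro exI[of _ "fact (2 * Suc l) / (2 ^ Suc l * fact (Suc l)) + (2 * real l + 2) * \<kappa>"] ballI)
    fix x assume x: "x \<in> V"
    let ?s = "\<integral>\<omega>. x \<omega> * x \<omega> \<partial>M"
    have "(\<integral>\<omega>. odd_stein (Suc l) ?s (x \<omega>) \<partial>M) = (\<integral>\<omega>. x \<omega> ^ (2 * Suc l) \<partial>M) + (2 * real l + 2) * ?s * (\<integral>\<omega>. odd_stein l ?s (x \<omega>) \<partial>M)"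
    proof -
      have e: "odd_stein (Suc l) s u = u ^ (2 * Suc l) + (2 * real l + 2) * s * odd_stein l s u" for s u by simp
      show ?thesis unfolding e
        using all_moments_integrable_power[OF V_moments[OF x], of "2 * Suc l"] all_moments_integrable[OF all_moments_odd_stein[OF x]]
        by (subst Bochner_Integration.integral_add) (auto simp del: power_Suc mult_Suc_right)
    qed
    also have "(\<integral>\<omega>. x \<omega> ^ (2 * Suc l) \<partial>M) = fact (2 * Suc l) / (2 ^ Suc l * fact (Suc l)) * ?s ^ Suc l"
      by (subst centered_gaussian_even_moment[OF gaussian[OF x]]) (simp only: power2_eq_square)
    finally show "(\<integral>\<omega>. odd_stein (Suc l) ?s (x \<omega>) \<partial>M) = (fact (2 * Suc l) / (2 ^ Suc l * fact (Suc l)) + (2 * real l + 2) * \<kappa>) * ?s ^ Suc l"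
      by (simp only: \<kappa>[OF x]) (simp only: power_Suc algebra_simps)
  qed
qed

section \<open>Hermite polynomials of correlated Gaussian variables\<close>

lemma all_moments_hermite_rec: "x \<in> V \<Longrightarrow> all_moments M (\<lambda>\<omega>. hermite_rec q (x \<omega>))"
proof (induction q rule: less_induct)
  case (less q)
  consider "q = 0" | "q = 1" | i where "q = Suc (Suc i)" by (metis One_nat_def not0_implies_Suc)
  then show ?case
  proof cases
    case 3
    then show ?thesis using less by (simp add: all_moments_diff all_moments_mult all_moments_cmult V_moments)
  qed (use less in \<open>auto simp: all_moments_const V_moments\<close>)
qed

text \<open>Integrating the factor \<open>x\<close> of the three-term recursion by parts
  differentiates both Hermite polynomials. As \<open>x\<close> has variance 1, the derivative of the
  first one cancels the second term of the recursion, and only the derivative in \<open>y\<close>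
  remains.\<close>

lemma hermite_covariance_Suc:
  assumes V: "x \<in> V" "y \<in> V" and x1: "(\<integral>\<omega>. x \<omega> * x \<omega> \<partial>M) = 1"
  shows "(\<integral>\<omega>. hermite_rec (Suc q) (x \<omega>) * hermite_rec p (y \<omega>) \<partial>M) =
    (\<integral>\<omega>. x \<omega> * y \<omega> \<partial>M) * real p * (\<integral>\<omega>. hermite_rec q (x \<omega>) * hermite_rec (p - 1) (y \<omega>) \<partial>M)"
proof -
  define z :: "nat \<Rightarrow> 'a \<Rightarrow> real" where "z = (\<lambda>k. if k = 0 then x else y)"
  have z: "z 0 = x" "z 1 = y" "z (Suc 0) = y" by (auto simp: z_def)
  define v where "v k = (\<integral>\<omega>. z 0 \<omega> * z k \<omega> \<partial>M)" for k
  define I :: "nat set" where "I = {0, 1}"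
  have zV: "z k \<in> V" for k using V by (auto simp: z_def)
  have i: "integrable M (\<lambda>\<omega>. hermite_rec i (x \<omega>) * hermite_rec j (y \<omega>))" for i j
    by (intro all_moments_integrable all_moments_mult all_moments_hermite_rec V)
  have i': "integrable M (\<lambda>\<omega>. x \<omega> * (hermite_rec i (x \<omega>) * hermite_rec j (y \<omega>)))" for i j
    by (intro all_moments_integrable all_moments_mult all_moments_hermite_rec V_moments V)
  have I: "finite I" "0 \<in> I" "1 \<in> I" by (auto simp: I_def)
  note sm = smooth_along_mult[OF smooth_along_hermite_rec[OF I(1,2), of v q] smooth_along_hermite_rec[OF I(1,3), of v p]]
  have H: "hermite_rec (Suc q) u = u * hermite_rec q u - real q * hermite_rec (q - 1) u" for u
    by (cases q) auto
  have "(\<integral>\<omega>. x \<omega> * (hermite_rec q (x \<omega>) * hermite_rec p (y \<omega>)) \<partial>M) =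
    (\<integral>\<omega>. v 1 * real p * (hermite_rec q (x \<omega>) * hermite_rec (p - 1) (y \<omega>)) + real q * (hermite_rec (q - 1) (x \<omega>) * hermite_rec p (y \<omega>)) \<partial>M)"
    using smooth_along_by_parts[where I = I and j = 0 and z = z and v = v, OF I(1,2) _ _ sm] zV x1
    by (simp add: z v_def algebra_simps)
  also have "\<dots> = v 1 * real p * (\<integral>\<omega>. hermite_rec q (x \<omega>) * hermite_rec (p - 1) (y \<omega>) \<partial>M) + real q * (\<integral>\<omega>. hermite_rec (q - 1) (x \<omega>) * hermite_rec p (y \<omega>) \<partial>M)"
    using i by simp
  finally have 1: "(\<integral>\<omega>. x \<omega> * (hermite_rec q (x \<omega>) * hermite_rec p (y \<omega>)) \<partial>M) = \<dots>" .
  have "(\<integral>\<omega>. hermite_rec (Suc q) (x \<omega>) * hermite_rec p (y \<omega>) \<partial>M)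
    = (\<integral>\<omega>. x \<omega> * (hermite_rec q (x \<omega>) * hermite_rec p (y \<omega>)) - real q * (hermite_rec (q - 1) (x \<omega>) * hermite_rec p (y \<omega>)) \<partial>M)"
    unfolding H by (simp add: algebra_simps)
  also have "\<dots> = (\<integral>\<omega>. x \<omega> * (hermite_rec q (x \<omega>) * hermite_rec p (y \<omega>)) \<partial>M) - real q * (\<integral>\<omega>. hermite_rec (q - 1) (x \<omega>) * hermite_rec p (y \<omega>) \<partial>M)"
    using i i' by simp
  finally show ?thesis unfolding 1 by (simp add: v_def z)
qed

lemma hermite_covariance:
  assumes V: "x \<in> V" "y \<in> V" and x1: "(\<integral>\<omega>. x \<omega> * x \<omega> \<partial>M) = 1" and y1: "(\<integral>\<omega>. y \<omega> * y \<omega> \<partial>M) = 1"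
  shows "(\<integral>\<omega>. hermite_rec q (x \<omega>) * hermite_rec p (y \<omega>) \<partial>M) = (if p = q then fact q * (\<integral>\<omega>. x \<omega> * y \<omega> \<partial>M) ^ q else 0)"
proof (induction q arbitrary: p)
  case 0
  show ?case
  proof (cases p)
    case 0
    then show ?thesis by (simp add: prob_space)
  next
    case (Suc i)
    have "(\<integral>\<omega>. hermite_rec (Suc i) (y \<omega>) * hermite_rec 0 (x \<omega>) \<partial>M) = 0"
      unfolding hermite_covariance_Suc[OF V(2,1) y1] by simp
    then show ?thesis using Suc by simp
  qed
next
  case (Suc q)
  show ?case unfolding hermite_covariance_Suc[OF V x1] Suc.IH by (cases p) auto
qed

text \<open>After normalisation to variance 1 both powers are expanded in Hermite polynomials, and
  orthogonality leaves the diagonal terms. Undoing the normalisation with 2 l + 1 = 2 r + q, where q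
  = 2 (l - r) + 1, gives the product of the variances to the power r and the covariance to the power
  q. If a variance is 0, both sides vanish because q is at least 1.\<close>

lemma odd_power_covariance:
  assumes V: "x \<in> V" "y \<in> V"
  shows "(\<integral>\<omega>. x \<omega> ^ (2 * l + 1) * y \<omega> ^ (2 * l + 1) \<partial>M) =
    (\<Sum>r\<le>l. (of_int (hermite_coeff r l))\<^sup>2 * fact (2 * (l - r) + 1) *
       ((\<integral>\<omega>. x \<omega> * x \<omega> \<partial>M) * (\<integral>\<omega>. y \<omega> * y \<omega> \<partial>M)) ^ r * (\<integral>\<omega>. x \<omega> * y \<omega> \<partial>M) ^ (2 * (l - r) + 1))"
    (is "?L = ?R")
proof -
  have deg: ?thesis if "AE \<omega> in M. x \<omega> * y \<omega> = 0"
  proof -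
    have [measurable]: "x \<in> borel_measurable M" "y \<in> borel_measurable M" using V_measurable V by auto
    have "?L = (\<integral>\<omega>. 0 \<partial>M)" by (rule integral_cong_AE) (use that in auto)
    moreover have "(\<integral>\<omega>. x \<omega> * y \<omega> \<partial>M) = (\<integral>\<omega>. 0 \<partial>M)" by (rule integral_cong_AE) (use that in auto)
    ultimately show ?thesis by simp
  qed
  define a where "a = (\<integral>\<omega>. x \<omega> * x \<omega> \<partial>M)"
  define b where "b = (\<integral>\<omega>. y \<omega> * y \<omega> \<partial>M)"
  define c where "c = (\<integral>\<omega>. x \<omega> * y \<omega> \<partial>M)"
  have ab: "a \<ge> 0" "b \<ge> 0" by (auto simp: a_def b_def)
  show ?thesis
  proof (cases "a = 0 \<or> b = 0")
    case True
    then have "AE \<omega> in M. x \<omega> * y \<omega> = 0"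
    proof
      assume "a = 0"
      then have "AE \<omega> in M. x \<omega> = 0" using V_degenerate[OF V(1)] a_def by simp
      then show ?thesis by auto
    next
      assume "b = 0"
      then have "AE \<omega> in M. y \<omega> = 0" using V_degenerate[OF V(2)] b_def by simp
      then show ?thesis by auto
    qed
    then show ?thesis by (rule deg)
  next
    case False
    then have pos: "a > 0" "b > 0" using ab by auto
    define s where "s = sqrt a"
    define t where "t = sqrt b"
    have st: "s > 0" "t > 0" "s * s = a" "t * t = b" using pos by (auto simp: s_def t_def)
    define x' where "x' = (\<lambda>\<omega>. (1 / s) * x \<omega>)"
    define y' where "y' = (\<lambda>\<omega>. (1 / t) * y \<omega>)"
    have V': "x' \<in> V" "y' \<in> V" unfolding x'_def y'_def using V V_cmult by blast+
    have x1: "(\<integral>\<omega>. x' \<omega> * x' \<omega> \<partial>M) = 1" and y1: "(\<integral>\<omega>. y' \<omega> * y' \<omega> \<partial>M) = 1"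
    proof -
      have "(\<integral>\<omega>. x' \<omega> * x' \<omega> \<partial>M) = (\<integral>\<omega>. (1 / (s * s)) * (x \<omega> * x \<omega>) \<partial>M)" by (simp add: x'_def mult_ac)
      also have "\<dots> = 1" using st pos by (simp add: a_def)
      finally show "(\<integral>\<omega>. x' \<omega> * x' \<omega> \<partial>M) = 1" .
      have "(\<integral>\<omega>. y' \<omega> * y' \<omega> \<partial>M) = (\<integral>\<omega>. (1 / (t * t)) * (y \<omega> * y \<omega>) \<partial>M)" by (simp add: y'_def mult_ac)
      also have "\<dots> = 1" using st pos by (simp add: b_def)
      finally show "(\<integral>\<omega>. y' \<omega> * y' \<omega> \<partial>M) = 1" .
    qed
    have c': "(\<integral>\<omega>. x' \<omega> * y' \<omega> \<partial>M) = c / (s * t)"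
    proof -
      have "(\<integral>\<omega>. x' \<omega> * y' \<omega> \<partial>M) = (\<integral>\<omega>. (1 / (s * t)) * (x \<omega> * y \<omega>) \<partial>M)" by (simp add: x'_def y'_def mult_ac)
      then show ?thesis by (simp add: c_def)
    qed
    define h where "h r = (of_int (hermite_coeff r l) :: real)" for r
    have "is_hermite_expansion l (\<lambda>r. hermite_coeff r l)"
      unfolding hermite_coeff_def using someI_ex[OF hermite_expansion_exists] by simp
    then have ex: "u ^ (2 * l + 1) = (\<Sum>r\<le>l. h r * hermite_rec (2 * (l - r) + 1) u)" for u
      unfolding is_hermite_expansion_def hermite_eq_rec h_def by blast
    have i: "integrable M (\<lambda>\<omega>. hermite_rec i (x' \<omega>) * hermite_rec j (y' \<omega>))" for i j
      by (intro all_moments_integrable all_moments_mult all_moments_hermite_rec V')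
    have "?L = (\<integral>\<omega>. (s * t) ^ (2 * l + 1) * (x' \<omega> ^ (2 * l + 1) * y' \<omega> ^ (2 * l + 1)) \<partial>M)"
      using st(1,2) by (intro Bochner_Integration.integral_cong refl) (simp add: x'_def y'_def power_mult_distrib power_divide)
    also have "\<dots> = (s * t) ^ (2 * l + 1) * (\<integral>\<omega>. x' \<omega> ^ (2 * l + 1) * y' \<omega> ^ (2 * l + 1) \<partial>M)" by simp
    also have "(\<integral>\<omega>. x' \<omega> ^ (2 * l + 1) * y' \<omega> ^ (2 * l + 1) \<partial>M)
      = (\<integral>\<omega>. (\<Sum>r\<le>l. \<Sum>r'\<le>l. h r * h r' * (hermite_rec (2 * (l - r) + 1) (x' \<omega>) * hermite_rec (2 * (l - r') + 1) (y' \<omega>))) \<partial>M)"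
      unfolding ex sum_product by (simp add: mult_ac)
    also have "\<dots> = (\<Sum>r\<le>l. \<Sum>r'\<le>l. h r * h r' * (if 2 * (l - r') + 1 = 2 * (l - r) + 1 then fact (2 * (l - r) + 1) * (c / (s * t)) ^ (2 * (l - r) + 1) else 0))"
      using i by (subst Bochner_Integration.integral_sum, simp, subst Bochner_Integration.integral_sum, simp)
        (simp only: hermite_covariance[OF V' x1 y1] c' Bochner_Integration.integral_mult_right_zero)
    also have "\<dots> = (\<Sum>r\<le>l. h r * h r * (fact (2 * (l - r) + 1) * (c / (s * t)) ^ (2 * (l - r) + 1)))"
    proof (rule sum.cong[OF refl])
      fix r assume r: "r \<in> {..l}"
      have "(\<Sum>r'\<le>l. h r * h r' * (if 2 * (l - r') + 1 = 2 * (l - r) + 1 then fact (2 * (l - r) + 1) * (c / (s * t)) ^ (2 * (l - r) + 1) else 0))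
        = (\<Sum>r'\<le>l. if r' = r then h r * h r * (fact (2 * (l - r) + 1) * (c / (s * t)) ^ (2 * (l - r) + 1)) else 0)"
        using r by (intro sum.cong refl) auto
      then show "(\<Sum>r'\<le>l. h r * h r' * (if 2 * (l - r') + 1 = 2 * (l - r) + 1 then fact (2 * (l - r) + 1) * (c / (s * t)) ^ (2 * (l - r) + 1) else 0))
        = h r * h r * (fact (2 * (l - r) + 1) * (c / (s * t)) ^ (2 * (l - r) + 1))"
        using r by simp
    qed
    also have "(s * t) ^ (2 * l + 1) * \<dots> = ?R"
      unfolding sum_distrib_left
    proof (rule sum.cong[OF refl])
      fix r assume r: "r \<in> {..l}"
      let ?q = "2 * (l - r) + 1"
      have "(s * t) ^ (2 * l + 1) * (c / (s * t)) ^ ?q = (s * t) ^ (2 * r) * ((s * t) ^ ?q * (c / (s * t)) ^ ?q)"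
      proof -
        have "2 * l + 1 = 2 * r + ?q" using r by auto
        then show ?thesis by (metis mult.assoc power_add)
      qed
      also have "(s * t) ^ ?q * (c / (s * t)) ^ ?q = c ^ ?q"
        using st by (simp add: power_mult_distrib[symmetric] del: power_Suc)
      also have "(s * t) ^ (2 * r) = (a * b) ^ r"
        unfolding power_mult st(3,4)[symmetric] by (simp add: power2_eq_square mult_ac)
      finally show "(s * t) ^ (2 * l + 1) * (h r * h r * (fact ?q * (c / (s * t)) ^ ?q)) =
         (of_int (hermite_coeff r l))\<^sup>2 * fact ?q * ((\<integral>\<omega>. x \<omega> * x \<omega> \<partial>M) * (\<integral>\<omega>. y \<omega> * y \<omega> \<partial>M)) ^ r * (\<integral>\<omega>. x \<omega> * y \<omega> \<partial>M) ^ ?q"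
        unfolding a_def[symmetric] b_def[symmetric] c_def[symmetric] h_def[symmetric]
        by (simp only: power2_eq_square) (metis (no_types, lifting) mult.assoc mult.left_commute)
    qed
    finally show ?thesis .
  qed
qed

end

section \<open>Limits of short range arrays\<close>

definition nat_dist :: "nat \<Rightarrow> nat \<Rightarrow> nat" where
  "nat_dist j k = (j - k) + (k - j)"

lemma nat_dist_commute: "nat_dist j k = nat_dist k j"
  by (simp add: nat_dist_def)

lemma nat_dist_self [simp]: "nat_dist j j = 0"
  by (simp add: nat_dist_def)

lemma (in prob_space) mean_abs_le_sqrt:
  fixes Z :: "'a \<Rightarrow> real"
  assumes Z: "all_moments M Z"
  shows "(\<integral>\<omega>. \<bar>Z \<omega>\<bar> \<partial>M) \<le> sqrt (\<integral>\<omega>. (Z \<omega>)\<^sup>2 \<partial>M)"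
proof -
  let ?m = "\<integral>\<omega>. \<bar>Z \<omega>\<bar> \<partial>M"
  have i: "integrable M (\<lambda>\<omega>. \<bar>Z \<omega>\<bar>)" "integrable M (\<lambda>\<omega>. (Z \<omega>)\<^sup>2)"
    using Z all_moments_integrable[OF all_moments_abs[OF Z]] all_moments_integrable_power[OF Z] by auto
  have "0 \<le> (\<integral>\<omega>. (\<bar>Z \<omega>\<bar> - ?m)\<^sup>2 \<partial>M)" by simp
  also have "\<dots> = (\<integral>\<omega>. (Z \<omega>)\<^sup>2 - 2 * ?m * \<bar>Z \<omega>\<bar> + ?m\<^sup>2 \<partial>M)"
    by (intro Bochner_Integration.integral_cong refl) (simp add: power2_eq_square algebra_simps)
  also have "\<dots> = (\<integral>\<omega>. (Z \<omega>)\<^sup>2 \<partial>M) - ?m\<^sup>2"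
    using i by (simp add: prob_space power2_eq_square)
  finally show ?thesis by (simp add: real_le_rsqrt)
qed

lemma (in prob_space) mean_mult_square_le:
  fixes Z B :: "'a \<Rightarrow> real"
  assumes Z: "all_moments M Z" and B: "all_moments M B"
  shows "(\<integral>\<omega>. Z \<omega> * B \<omega> \<partial>M)\<^sup>2 \<le> (\<integral>\<omega>. Z \<omega> * Z \<omega> \<partial>M) * (\<integral>\<omega>. B \<omega> * B \<omega> \<partial>M)"
proof -
  define a where "a = (\<integral>\<omega>. Z \<omega> * Z \<omega> \<partial>M)"
  define b where "b = (\<integral>\<omega>. B \<omega> * B \<omega> \<partial>M)"
  define c where "c = (\<integral>\<omega>. Z \<omega> * B \<omega> \<partial>M)"
  have i: "integrable M (\<lambda>\<omega>. Z \<omega> * Z \<omega>)" "integrable M (\<lambda>\<omega>. B \<omega> * B \<omega>)" "integrable M (\<lambda>\<omega>. Z \<omega> * B \<omega>)"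
    by (intro all_moments_integrable all_moments_mult Z B)+
  have q: "0 \<le> b * t\<^sup>2 + (- 2 * c) * t + a" for t
  proof -
    have "0 \<le> (\<integral>\<omega>. (Z \<omega> - t * B \<omega>)\<^sup>2 \<partial>M)" by simp
    also have "\<dots> = (\<integral>\<omega>. Z \<omega> * Z \<omega> - 2 * t * (Z \<omega> * B \<omega>) + t\<^sup>2 * (B \<omega> * B \<omega>) \<partial>M)"
      by (intro Bochner_Integration.integral_cong refl) (simp add: power2_eq_square algebra_simps)
    also have "\<dots> = a - 2 * t * c + t\<^sup>2 * b" using i by (simp add: a_def b_def c_def)
    finally show ?thesis by (simp add: algebra_simps)
  qed
  have "c\<^sup>2 \<le> a * b"
  proof (cases "b = 0")
    case True
    have "c = 0"
    proof (rule ccontr)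
      assume "c \<noteq> 0"
      \<comment> \<open>At this t the quadratic expression, whose leading coefficient is 0, takes
        the value -1.\<close>
      then show False using q[of "(a + 1) / (2 * c)"] True by (simp add: field_simps)
    qed
    then show ?thesis using True by simp
  next
    case False
    then have "b > 0" by (simp add: b_def less_le)
    then show ?thesis using q[of "c / b"] by (simp add: power2_eq_square field_simps)
  qed
  then show ?thesis by (simp add: a_def b_def c_def)
qed

lemma integral_double_sum:
  fixes f :: "'i \<Rightarrow> 'j \<Rightarrow> 'a \<Rightarrow> real"
  assumes "\<And>i j. i \<in> A \<Longrightarrow> j \<in> B \<Longrightarrow> integrable M (f i j)"
  shows "(\<integral>\<omega>. (\<Sum>i\<in>A. \<Sum>j\<in>B. c i j * f i j \<omega>) \<partial>M) = (\<Sum>i\<in>A. \<Sum>j\<in>B. c i j * (\<integral>\<omega>. f i j \<omega> \<partial>M))"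
proof -
  have "(\<integral>\<omega>. (\<Sum>i\<in>A. \<Sum>j\<in>B. c i j * f i j \<omega>) \<partial>M) = (\<Sum>i\<in>A. \<integral>\<omega>. (\<Sum>j\<in>B. c i j * f i j \<omega>) \<partial>M)"
    using assms by (intro Bochner_Integration.integral_sum Bochner_Integration.integrable_sum integrable_mult_right) auto
  also have "\<dots> = (\<Sum>i\<in>A. \<Sum>j\<in>B. \<integral>\<omega>. c i j * f i j \<omega> \<partial>M)"
    using assms by (intro sum.cong refl Bochner_Integration.integral_sum integrable_mult_right) auto
  finally show ?thesis by simp
qed

lemma (in prob_space) variance_linear_combination:
  fixes Z :: "'i \<Rightarrow> 'a \<Rightarrow> real"
  assumes "\<And>i. i \<in> A \<Longrightarrow> all_moments M (Z i)"
  shows "(\<integral>\<omega>. ((\<Sum>i\<in>A. u i * Z i \<omega>) - (\<integral>\<omega>. (\<Sum>i\<in>A. u i * Z i \<omega>) \<partial>M))\<^sup>2 \<partial>M)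
    = (\<Sum>i\<in>A. \<Sum>j\<in>A. u i * u j * ((\<integral>\<omega>. Z i \<omega> * Z j \<omega> \<partial>M) - (\<integral>\<omega>. Z i \<omega> \<partial>M) * (\<integral>\<omega>. Z j \<omega> \<partial>M)))"
proof -
  define m where "m i = (\<integral>\<omega>. Z i \<omega> \<partial>M)" for i
  have i: "integrable M (Z i)" "integrable M (\<lambda>\<omega>. Z i \<omega> * Z j \<omega>)" if "i \<in> A" "j \<in> A" for i j
    using that assms by (auto intro!: all_moments_integrable all_moments_mult)
  have ii: "integrable M (\<lambda>\<omega>. Z i \<omega> * Z j \<omega> - m j * Z i \<omega> - m i * Z j \<omega> + m i * m j)"
    and ei: "(\<integral>\<omega>. Z i \<omega> * Z j \<omega> - m j * Z i \<omega> - m i * Z j \<omega> + m i * m j \<partial>M)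
      = (\<integral>\<omega>. Z i \<omega> * Z j \<omega> \<partial>M) - m j * m i - m i * m j + m i * m j" if "i \<in> A" "j \<in> A" for i j
    using i[OF that] i(1)[OF that(2,1)] by (auto simp: m_def prob_space)
  have "(\<integral>\<omega>. (\<Sum>i\<in>A. u i * Z i \<omega>) \<partial>M) = (\<Sum>i\<in>A. u i * m i)"
    using i by (subst Bochner_Integration.integral_sum) (auto simp: m_def)
  then have "(\<integral>\<omega>. ((\<Sum>i\<in>A. u i * Z i \<omega>) - (\<integral>\<omega>. (\<Sum>i\<in>A. u i * Z i \<omega>) \<partial>M))\<^sup>2 \<partial>M)
    = (\<integral>\<omega>. (\<Sum>i\<in>A. u i * (Z i \<omega> - m i)) * (\<Sum>j\<in>A. u j * (Z j \<omega> - m j)) \<partial>M)"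
    by (simp add: power2_eq_square sum_subtractf right_diff_distrib)
  also have "\<dots> = (\<integral>\<omega>. (\<Sum>i\<in>A. \<Sum>j\<in>A. u i * u j * (Z i \<omega> * Z j \<omega> - m j * Z i \<omega> - m i * Z j \<omega> + m i * m j)) \<partial>M)"
    by (intro Bochner_Integration.integral_cong refl) (simp add: sum_product algebra_simps)
  also have "\<dots> = (\<Sum>i\<in>A. \<Sum>j\<in>A. u i * u j * ((\<integral>\<omega>. Z i \<omega> * Z j \<omega> \<partial>M) - m j * m i - m i * m j + m i * m j))"
    using ii ei by (subst integral_double_sum) auto
  also have "\<dots> = (\<Sum>i\<in>A. \<Sum>j\<in>A. u i * u j * ((\<integral>\<omega>. Z i \<omega> * Z j \<omega> \<partial>M) - m i * m j))"
    by (simp add: algebra_simps)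
  finally show ?thesis unfolding m_def .
qed

section \<open>Concentration of quadratic and linear functionals\<close>

context gaussian_space
begin

text \<open>\<open>r\<close> bounds the covariances through the index distance alone, and
  \<open>\<rho>\<close> bounds its row sums. Both stay fixed along an array, so constants built from
  them are uniform in \<open>N\<close>.\<close>

definition short_range :: "(nat \<Rightarrow> real) \<Rightarrow> real \<Rightarrow> nat \<Rightarrow> (nat \<Rightarrow> 'a \<Rightarrow> real) \<Rightarrow> bool" where
  "short_range r \<rho> N y \<longleftrightarrow> (\<forall>j<N. y j \<in> V) \<and>
     (\<forall>j<N. \<forall>k<N. \<bar>\<integral>\<omega>. y j \<omega> * y k \<omega> \<partial>M\<bar> \<le> r (nat_dist j k)) \<and> (\<forall>k. 0 \<le> r k) \<and>
     (\<forall>j. (\<Sum>k<N. r (nat_dist j k)) \<le> \<rho>)"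

lemma short_range_var: "short_range r \<rho> N y \<Longrightarrow> j < N \<Longrightarrow> (\<integral>\<omega>. y j \<omega> * y j \<omega> \<partial>M) \<le> r 0"
  unfolding short_range_def by (metis abs_le_D1 nat_dist_self)

text \<open>By \<open>covariance_bound\<close> the covariance of two summands with index pairs (j,
  k) and (j', k') is at most a sum of four cross terms. Together with the coefficients each of them
  is a chain of three factors \<open>r\<close> linking the four indices; summing along the chain
  gives \<rho>^3, and the one free index gives \<open>N\<close>. The variance is therefore of order
  D^2 N, not D^2 N^2.\<close>

lemma quadratic_deviation:
  assumes r0: "r 0 \<ge> 0"
  shows "\<exists>C\<ge>0. \<forall>N y u D. short_range r \<rho> N y \<and> D \<ge> 0 \<and> (\<forall>j<N. \<forall>k<N. \<bar>u j k\<bar> \<le> D * r (nat_dist j k)) \<longrightarrow>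
    (\<integral>\<omega>. \<bar>(\<Sum>j<N. \<Sum>k<N. u j k * (y j \<omega> ^ a * y k \<omega> ^ b)) - (\<integral>\<omega>. (\<Sum>j<N. \<Sum>k<N. u j k * (y j \<omega> ^ a * y k \<omega> ^ b)) \<partial>M)\<bar> \<partial>M)
      \<le> C * D * sqrt (real N)"
proof -
  obtain C where C: "C \<ge> 0" "\<And>x y u w. x \<in> V \<Longrightarrow> y \<in> V \<Longrightarrow> u \<in> V \<Longrightarrow> w \<in> V \<Longrightarrow>
     (\<integral>\<omega>. x \<omega> * x \<omega> \<partial>M) \<le> r 0 \<Longrightarrow> (\<integral>\<omega>. y \<omega> * y \<omega> \<partial>M) \<le> r 0 \<Longrightarrow>
     (\<integral>\<omega>. u \<omega> * u \<omega> \<partial>M) \<le> r 0 \<Longrightarrow> (\<integral>\<omega>. w \<omega> * w \<omega> \<partial>M) \<le> r 0 \<Longrightarrow>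
     \<bar>(\<integral>\<omega>. (x \<omega> ^ a * y \<omega> ^ b) * (u \<omega> ^ a * w \<omega> ^ b) \<partial>M) - (\<integral>\<omega>. x \<omega> ^ a * y \<omega> ^ b \<partial>M) * (\<integral>\<omega>. u \<omega> ^ a * w \<omega> ^ b \<partial>M)\<bar>
       \<le> C * (\<bar>\<integral>\<omega>. x \<omega> * u \<omega> \<partial>M\<bar> + \<bar>\<integral>\<omega>. x \<omega> * w \<omega> \<partial>M\<bar> + \<bar>\<integral>\<omega>. y \<omega> * u \<omega> \<partial>M\<bar> + \<bar>\<integral>\<omega>. y \<omega> * w \<omega> \<partial>M\<bar>)"
    using covariance_bound[OF r0, of a b a b] by blast
  show ?thesis
  \<comment> \<open>The absolute value makes the constant nonnegative before
    \<open>short_range\<close>, which forces \<rho> \<ge> 0, is available.\<close>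
  proof (intro exI[of _ "sqrt (4 * C * \<bar>\<rho>\<bar> ^ 3)"] conjI allI impI)
    fix N :: nat and y :: "nat \<Rightarrow> 'a \<Rightarrow> real" and u :: "nat \<Rightarrow> nat \<Rightarrow> real" and D :: real
    assume H: "short_range r \<rho> N y \<and> D \<ge> 0 \<and> (\<forall>j<N. \<forall>k<N. \<bar>u j k\<bar> \<le> D * r (nat_dist j k))"
    let ?R = "\<lambda>j k. r (nat_dist j k)"
    have sr: "short_range r \<rho> N y" and D: "D \<ge> 0" and u: "\<And>j k. j < N \<Longrightarrow> k < N \<Longrightarrow> \<bar>u j k\<bar> \<le> D * ?R j k"
      using H by auto
    have y: "\<And>j. j < N \<Longrightarrow> y j \<in> V" and R: "\<And>j k. j < N \<Longrightarrow> k < N \<Longrightarrow> \<bar>\<integral>\<omega>. y j \<omega> * y k \<omega> \<partial>M\<bar> \<le> ?R j k"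
      and Rp: "\<And>k. 0 \<le> r k" and row: "\<And>j. (\<Sum>k<N. ?R j k) \<le> \<rho>"
      using sr by (auto simp: short_range_def)
    have \<rho>0: "\<rho> \<ge> 0" using order_trans[OF sum_nonneg row[of 0]] Rp by simp
    define A where "A = {..<N} \<times> {..<N}"
    define Z where "Z p \<omega> = y (fst p) \<omega> ^ a * y (snd p) \<omega> ^ b" for p \<omega>
    define U where "U p = u (fst p) (snd p)" for p
    have Z: "all_moments M (Z p)" if "p \<in> A" for p
      using that unfolding Z_def A_def by (intro all_moments_mult all_moments_power V_moments y) auto
    have S: "(\<Sum>j<N. \<Sum>k<N. u j k * (y j \<omega> ^ a * y k \<omega> ^ b)) = (\<Sum>p\<in>A. U p * Z p \<omega>)" for \<omega>
      unfolding A_def U_def Z_def by (simp add: sum.cartesian_product case_prod_beta)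
    have cov: "\<bar>(\<integral>\<omega>. Z p \<omega> * Z q \<omega> \<partial>M) - (\<integral>\<omega>. Z p \<omega> \<partial>M) * (\<integral>\<omega>. Z q \<omega> \<partial>M)\<bar>
      \<le> C * (?R (fst p) (fst q) + ?R (fst p) (snd q) + ?R (snd p) (fst q) + ?R (snd p) (snd q))"
      if "p \<in> A" "q \<in> A" for p q
    proof -
      have l: "fst p < N" "snd p < N" "fst q < N" "snd q < N" using that by (auto simp: A_def)
      show ?thesis unfolding Z_def
        by (rule order_trans[OF C(2)])
          (use y l short_range_var[OF sr] R C(1) in \<open>auto intro!: mult_left_mono add_mono\<close>)
    qed
    have in1: "(\<Sum>j'<N. \<Sum>k'<N. ?R j' k' * ?R m j') \<le> \<rho>\<^sup>2" for m
    proof -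
      have "(\<Sum>j'<N. \<Sum>k'<N. ?R j' k' * ?R m j') = (\<Sum>j'<N. (\<Sum>k'<N. ?R j' k') * ?R m j')"
        by (simp add: sum_distrib_right)
      also have "\<dots> \<le> (\<Sum>j'<N. \<rho> * ?R m j')" by (intro sum_mono mult_right_mono row Rp)
      also have "\<dots> = \<rho> * (\<Sum>j'<N. ?R m j')" by (simp add: sum_distrib_left)
      also have "\<dots> \<le> \<rho> * \<rho>" by (intro mult_left_mono row \<rho>0)
      finally show ?thesis by (simp add: power2_eq_square)
    qed
    have in2: "(\<Sum>j'<N. \<Sum>k'<N. ?R j' k' * ?R m k') \<le> \<rho>\<^sup>2" for m
    proof -
      have "(\<Sum>j'<N. \<Sum>k'<N. ?R j' k' * ?R m k') = (\<Sum>k'<N. \<Sum>j'<N. ?R k' j' * ?R m k')"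
        by (subst sum.swap) (simp add: nat_dist_commute)
      then show ?thesis using in1 by simp
    qed
    have "(\<integral>\<omega>. ((\<Sum>p\<in>A. U p * Z p \<omega>) - (\<integral>\<omega>. (\<Sum>p\<in>A. U p * Z p \<omega>) \<partial>M))\<^sup>2 \<partial>M)
      = (\<Sum>p\<in>A. \<Sum>q\<in>A. U p * U q * ((\<integral>\<omega>. Z p \<omega> * Z q \<omega> \<partial>M) - (\<integral>\<omega>. Z p \<omega> \<partial>M) * (\<integral>\<omega>. Z q \<omega> \<partial>M)))"
      by (rule variance_linear_combination[OF Z])
    also have "\<dots> \<le> (\<Sum>p\<in>A. \<Sum>q\<in>A. (D * ?R (fst p) (snd p)) * (D * ?R (fst q) (snd q)) *
        (C * (?R (fst p) (fst q) + ?R (fst p) (snd q) + ?R (snd p) (fst q) + ?R (snd p) (snd q))))"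
    proof (intro sum_mono)
      fix p q assume pq: "p \<in> A" "q \<in> A"
      have "U p * U q * ((\<integral>\<omega>. Z p \<omega> * Z q \<omega> \<partial>M) - (\<integral>\<omega>. Z p \<omega> \<partial>M) * (\<integral>\<omega>. Z q \<omega> \<partial>M))
        \<le> \<bar>U p\<bar> * \<bar>U q\<bar> * \<bar>(\<integral>\<omega>. Z p \<omega> * Z q \<omega> \<partial>M) - (\<integral>\<omega>. Z p \<omega> \<partial>M) * (\<integral>\<omega>. Z q \<omega> \<partial>M)\<bar>"
        unfolding abs_mult[symmetric] by (rule abs_ge_self)
      also have "\<dots> \<le> (D * ?R (fst p) (snd p)) * (D * ?R (fst q) (snd q)) *
        (C * (?R (fst p) (fst q) + ?R (fst p) (snd q) + ?R (snd p) (fst q) + ?R (snd p) (snd q)))"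
        using pq by (intro mult_mono cov) (auto simp: U_def A_def D Rp intro!: u mult_nonneg_nonneg)
      finally show "U p * U q * ((\<integral>\<omega>. Z p \<omega> * Z q \<omega> \<partial>M) - (\<integral>\<omega>. Z p \<omega> \<partial>M) * (\<integral>\<omega>. Z q \<omega> \<partial>M))
        \<le> (D * ?R (fst p) (snd p)) * (D * ?R (fst q) (snd q)) *
        (C * (?R (fst p) (fst q) + ?R (fst p) (snd q) + ?R (snd p) (fst q) + ?R (snd p) (snd q)))" .
    qed
    also have "\<dots> = (\<Sum>p\<in>A. (D\<^sup>2 * C * ?R (fst p) (snd p)) *
        (\<Sum>q\<in>A. ?R (fst q) (snd q) * ?R (fst p) (fst q) + ?R (fst q) (snd q) * ?R (fst p) (snd q)
            + ?R (fst q) (snd q) * ?R (snd p) (fst q) + ?R (fst q) (snd q) * ?R (snd p) (snd q)))"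
      unfolding sum_distrib_left by (intro sum.cong refl) (simp add: power2_eq_square algebra_simps)
    also have "\<dots> \<le> (\<Sum>p\<in>A. (D\<^sup>2 * C * ?R (fst p) (snd p)) * (\<rho>\<^sup>2 + \<rho>\<^sup>2 + \<rho>\<^sup>2 + \<rho>\<^sup>2))"
    proof (intro sum_mono mult_left_mono)
      fix p
      have e: "(\<Sum>q\<in>A. f (fst q) (snd q)) = (\<Sum>j'<N. \<Sum>k'<N. f j' k')" for f :: "nat \<Rightarrow> nat \<Rightarrow> real"
        unfolding A_def by (simp add: sum.cartesian_product case_prod_beta)
      show "(\<Sum>q\<in>A. ?R (fst q) (snd q) * ?R (fst p) (fst q) + ?R (fst q) (snd q) * ?R (fst p) (snd q)
            + ?R (fst q) (snd q) * ?R (snd p) (fst q) + ?R (fst q) (snd q) * ?R (snd p) (snd q)) \<le> \<rho>\<^sup>2 + \<rho>\<^sup>2 + \<rho>\<^sup>2 + \<rho>\<^sup>2"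
        unfolding sum.distrib
        using in1[of "fst p"] in2[of "fst p"] in1[of "snd p"] in2[of "snd p"]
        by (intro add_mono) (simp_all add: e[of "\<lambda>j' k'. ?R j' k' * ?R _ j'"] e[of "\<lambda>j' k'. ?R j' k' * ?R _ k'"])
    qed (use C Rp in auto)
    also have "\<dots> = D\<^sup>2 * C * (4 * \<rho>\<^sup>2) * (\<Sum>j<N. \<Sum>k<N. ?R j k)"
      unfolding A_def sum.cartesian_product by (simp add: sum_distrib_left sum_distrib_right case_prod_beta mult_ac)
    also have "\<dots> \<le> D\<^sup>2 * C * (4 * \<rho>\<^sup>2) * (\<Sum>j<N. \<rho>)"
      using C by (intro mult_left_mono sum_mono row) auto
    also have "\<dots> = (4 * C * \<bar>\<rho>\<bar> ^ 3) * D\<^sup>2 * real N" using \<rho>0 by (simp add: power2_eq_square power3_eq_cube)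
    finally have var: "(\<integral>\<omega>. ((\<Sum>p\<in>A. U p * Z p \<omega>) - (\<integral>\<omega>. (\<Sum>p\<in>A. U p * Z p \<omega>) \<partial>M))\<^sup>2 \<partial>M) \<le> (4 * C * \<bar>\<rho>\<bar> ^ 3) * D\<^sup>2 * real N" .
    have "all_moments M (\<lambda>\<omega>. (\<Sum>p\<in>A. U p * Z p \<omega>) - (\<integral>\<omega>. (\<Sum>p\<in>A. U p * Z p \<omega>) \<partial>M))"
      by (intro all_moments_diff all_moments_sum all_moments_cmult Z all_moments_const)
    from order_trans[OF mean_abs_le_sqrt[OF this] real_sqrt_le_mono[OF var]]
    show "(\<integral>\<omega>. \<bar>(\<Sum>j<N. \<Sum>k<N. u j k * (y j \<omega> ^ a * y k \<omega> ^ b)) - (\<integral>\<omega>. (\<Sum>j<N. \<Sum>k<N. u j k * (y j \<omega> ^ a * y k \<omega> ^ b)) \<partial>M)\<bar> \<partial>M)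
      \<le> sqrt (4 * C * \<bar>\<rho>\<bar> ^ 3) * D * sqrt (real N)"
      unfolding S using D by (simp add: real_sqrt_mult)
  qed (use C in simp)
qed

text \<open>A Schur test: the product of two coefficients is split into half the sum of their
  squares, and the row sums of \<open>r\<close> absorb the other index. The bound is by the
  Euclidean norm of the coefficients because that is the norm which \<open>bessel_inequality\<close>
  controls.\<close>

lemma linear_deviation:
  assumes r0: "r 0 \<ge> 0"
  shows "\<exists>C\<ge>0. \<forall>N y u. short_range r \<rho> N y \<longrightarrow>
    (\<integral>\<omega>. \<bar>(\<Sum>j<N. u j * y j \<omega> ^ a) - (\<integral>\<omega>. (\<Sum>j<N. u j * y j \<omega> ^ a) \<partial>M)\<bar> \<partial>M) \<le> C * sqrt (\<Sum>j<N. (u j)\<^sup>2)"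
proof -
  \<comment> \<open>The second variable of each pair has exponent 0 and is filled by the zero
    element of \<open>V\<close>.\<close>
  obtain C where C: "C \<ge> 0" "\<And>x y u w. x \<in> V \<Longrightarrow> y \<in> V \<Longrightarrow> u \<in> V \<Longrightarrow> w \<in> V \<Longrightarrow>
     (\<integral>\<omega>. x \<omega> * x \<omega> \<partial>M) \<le> r 0 \<Longrightarrow> (\<integral>\<omega>. y \<omega> * y \<omega> \<partial>M) \<le> r 0 \<Longrightarrow>
     (\<integral>\<omega>. u \<omega> * u \<omega> \<partial>M) \<le> r 0 \<Longrightarrow> (\<integral>\<omega>. w \<omega> * w \<omega> \<partial>M) \<le> r 0 \<Longrightarrow>
     \<bar>(\<integral>\<omega>. (x \<omega> ^ a * y \<omega> ^ 0) * (u \<omega> ^ a * w \<omega> ^ 0) \<partial>M) - (\<integral>\<omega>. x \<omega> ^ a * y \<omega> ^ 0 \<partial>M) * (\<integral>\<omega>. u \<omega> ^ a * w \<omega> ^ 0 \<partial>M)\<bar>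
       \<le> C * (\<bar>\<integral>\<omega>. x \<omega> * u \<omega> \<partial>M\<bar> + \<bar>\<integral>\<omega>. x \<omega> * w \<omega> \<partial>M\<bar> + \<bar>\<integral>\<omega>. y \<omega> * u \<omega> \<partial>M\<bar> + \<bar>\<integral>\<omega>. y \<omega> * w \<omega> \<partial>M\<bar>)"
    using covariance_bound[OF r0, of a 0 a 0] by blast
  show ?thesis
  proof (intro exI[of _ "sqrt (C * \<bar>\<rho>\<bar>)"] conjI allI impI)
    fix N :: nat and y :: "nat \<Rightarrow> 'a \<Rightarrow> real" and u :: "nat \<Rightarrow> real"
    assume sr: "short_range r \<rho> N y"
    let ?R = "\<lambda>j k. r (nat_dist j k)"
    have y: "\<And>j. j < N \<Longrightarrow> y j \<in> V" and R: "\<And>j k. j < N \<Longrightarrow> k < N \<Longrightarrow> \<bar>\<integral>\<omega>. y j \<omega> * y k \<omega> \<partial>M\<bar> \<le> ?R j k"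
      and Rp: "\<And>k. 0 \<le> r k" and row: "\<And>j. (\<Sum>k<N. ?R j k) \<le> \<rho>"
      using sr by (auto simp: short_range_def)
    have \<rho>0: "\<rho> \<ge> 0" using order_trans[OF sum_nonneg row[of 0]] Rp by simp
    have Z: "all_moments M (\<lambda>\<omega>. y j \<omega> ^ a)" if "j \<in> {..<N}" for j
      using that by (intro all_moments_power V_moments y) auto
    have cov: "\<bar>(\<integral>\<omega>. y j \<omega> ^ a * y k \<omega> ^ a \<partial>M) - (\<integral>\<omega>. y j \<omega> ^ a \<partial>M) * (\<integral>\<omega>. y k \<omega> ^ a \<partial>M)\<bar> \<le> C * ?R j k"
      if "j < N" "k < N" for j k
    proof -
      have "\<bar>(\<integral>\<omega>. y j \<omega> ^ a * y k \<omega> ^ a \<partial>M) - (\<integral>\<omega>. y j \<omega> ^ a \<partial>M) * (\<integral>\<omega>. y k \<omega> ^ a \<partial>M)\<bar>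
        \<le> C * \<bar>\<integral>\<omega>. y j \<omega> * y k \<omega> \<partial>M\<bar>"
        using C(2)[OF y[OF that(1)] V_zero y[OF that(2)] V_zero] short_range_var[OF sr] that r0 by simp
      also have "\<dots> \<le> C * ?R j k" using R that C by (intro mult_left_mono) auto
      finally show ?thesis .
    qed
    have sq: "\<bar>u j\<bar> * \<bar>u k\<bar> \<le> (u j)\<^sup>2 / 2 + (u k)\<^sup>2 / 2" for j k
      using sum_squares_bound[of "\<bar>u j\<bar>" "\<bar>u k\<bar>"] by simp
    have "(\<integral>\<omega>. ((\<Sum>j<N. u j * y j \<omega> ^ a) - (\<integral>\<omega>. (\<Sum>j<N. u j * y j \<omega> ^ a) \<partial>M))\<^sup>2 \<partial>M)
      = (\<Sum>j<N. \<Sum>k<N. u j * u k * ((\<integral>\<omega>. y j \<omega> ^ a * y k \<omega> ^ a \<partial>M) - (\<integral>\<omega>. y j \<omega> ^ a \<partial>M) * (\<integral>\<omega>. y k \<omega> ^ a \<partial>M)))"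
      by (rule variance_linear_combination[OF Z])
    also have "\<dots> \<le> (\<Sum>j<N. \<Sum>k<N. ((u j)\<^sup>2 / 2 + (u k)\<^sup>2 / 2) * (C * ?R j k))"
    proof (intro sum_mono)
      fix j k assume "j \<in> {..<N}" "k \<in> {..<N}"
      then have jk: "j < N" "k < N" by auto
      have "u j * u k * ((\<integral>\<omega>. y j \<omega> ^ a * y k \<omega> ^ a \<partial>M) - (\<integral>\<omega>. y j \<omega> ^ a \<partial>M) * (\<integral>\<omega>. y k \<omega> ^ a \<partial>M))
        \<le> (\<bar>u j\<bar> * \<bar>u k\<bar>) * \<bar>(\<integral>\<omega>. y j \<omega> ^ a * y k \<omega> ^ a \<partial>M) - (\<integral>\<omega>. y j \<omega> ^ a \<partial>M) * (\<integral>\<omega>. y k \<omega> ^ a \<partial>M)\<bar>"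
        unfolding abs_mult[symmetric] by (rule abs_ge_self)
      also have "\<dots> \<le> ((u j)\<^sup>2 / 2 + (u k)\<^sup>2 / 2) * (C * ?R j k)"
        using cov[OF jk] by (intro mult_mono sq) auto
      finally show "u j * u k * ((\<integral>\<omega>. y j \<omega> ^ a * y k \<omega> ^ a \<partial>M) - (\<integral>\<omega>. y j \<omega> ^ a \<partial>M) * (\<integral>\<omega>. y k \<omega> ^ a \<partial>M))
        \<le> ((u j)\<^sup>2 / 2 + (u k)\<^sup>2 / 2) * (C * ?R j k)" .
    qed
    also have "\<dots> = (\<Sum>j<N. \<Sum>k<N. (u j)\<^sup>2 / 2 * (C * ?R j k)) + (\<Sum>j<N. \<Sum>k<N. (u k)\<^sup>2 / 2 * (C * ?R j k))"
      by (simp add: distrib_right sum.distrib)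
    also have "(\<Sum>j<N. \<Sum>k<N. (u k)\<^sup>2 / 2 * (C * ?R j k)) = (\<Sum>j<N. \<Sum>k<N. (u j)\<^sup>2 / 2 * (C * ?R j k))"
      by (subst sum.swap) (simp add: nat_dist_commute)
    also have "(\<Sum>j<N. \<Sum>k<N. (u j)\<^sup>2 / 2 * (C * ?R j k)) = (\<Sum>j<N. (u j)\<^sup>2 / 2 * (C * (\<Sum>k<N. ?R j k)))"
      by (simp add: sum_distrib_left)
    also have "\<dots> \<le> (\<Sum>j<N. (u j)\<^sup>2 / 2 * (C * \<rho>))"
      using C by (intro sum_mono mult_left_mono row) auto
    finally have var: "(\<integral>\<omega>. ((\<Sum>j<N. u j * y j \<omega> ^ a) - (\<integral>\<omega>. (\<Sum>j<N. u j * y j \<omega> ^ a) \<partial>M))\<^sup>2 \<partial>M) \<le> C * \<bar>\<rho>\<bar> * (\<Sum>j<N. (u j)\<^sup>2)"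
      using \<rho>0 by (simp add: sum_distrib_left sum_distrib_right sum.distrib[symmetric] mult_ac)
    have "all_moments M (\<lambda>\<omega>. (\<Sum>j<N. u j * y j \<omega> ^ a) - (\<integral>\<omega>. (\<Sum>j<N. u j * y j \<omega> ^ a) \<partial>M))"
      by (intro all_moments_diff all_moments_sum all_moments_cmult Z all_moments_const)
    from order_trans[OF mean_abs_le_sqrt[OF this] real_sqrt_le_mono[OF var]]
    show "(\<integral>\<omega>. \<bar>(\<Sum>j<N. u j * y j \<omega> ^ a) - (\<integral>\<omega>. (\<Sum>j<N. u j * y j \<omega> ^ a) \<partial>M)\<bar> \<partial>M) \<le> sqrt (C * \<bar>\<rho>\<bar>) * sqrt (\<Sum>j<N. (u j)\<^sup>2)"
      by (simp add: real_sqrt_mult)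
  qed (use C in simp)
qed

text \<open>By the Schur test the Gram matrix of the \<open>y j\<close> has norm at most \<rho>, so
  these variables behave like an orthogonal family up to this factor. The combination
  \<open>T\<close> with coefficients \<open>b j\<close> has covariance s with \<open>B\<close> and
  second moment at most \<rho> s; Cauchy-Schwarz then bounds s.\<close>

lemma bessel_inequality:
  assumes sr: "short_range r \<rho> N y" and B: "B \<in> V"
  shows "(\<Sum>j<N. (\<integral>\<omega>. y j \<omega> * B \<omega> \<partial>M)\<^sup>2) \<le> \<rho> * (\<integral>\<omega>. B \<omega> * B \<omega> \<partial>M)"
proof -
  let ?R = "\<lambda>j k. r (nat_dist j k)"
  have y: "\<And>j. j < N \<Longrightarrow> y j \<in> V" and R: "\<And>j k. j < N \<Longrightarrow> k < N \<Longrightarrow> \<bar>\<integral>\<omega>. y j \<omega> * y k \<omega> \<partial>M\<bar> \<le> ?R j k"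
    and Rp: "\<And>k. 0 \<le> r k" and row: "\<And>j. (\<Sum>k<N. ?R j k) \<le> \<rho>"
    using sr by (auto simp: short_range_def)
  have \<rho>0: "\<rho> \<ge> 0" using order_trans[OF sum_nonneg row[of 0]] Rp by simp
  define b where "b j = (\<integral>\<omega>. y j \<omega> * B \<omega> \<partial>M)" for j
  define s where "s = (\<Sum>j<N. (b j)\<^sup>2)"
  define T where "T \<omega> = (\<Sum>j<N. b j * y j \<omega>)" for \<omega>
  have T: "T \<in> V" unfolding T_def by (intro V_sum V_cmult y) auto
  have sq: "\<bar>b j\<bar> * \<bar>b k\<bar> \<le> (b j)\<^sup>2 / 2 + (b k)\<^sup>2 / 2" for j k
    using sum_squares_bound[of "\<bar>b j\<bar>" "\<bar>b k\<bar>"] by simp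
  have "(\<integral>\<omega>. T \<omega> * B \<omega> \<partial>M) = (\<integral>\<omega>. (\<Sum>j<N. b j * (y j \<omega> * B \<omega>)) \<partial>M)"
    unfolding T_def by (simp add: sum_distrib_right mult.assoc)
  also have "\<dots> = s"
    using V_integrable_mult[OF y B] by (subst Bochner_Integration.integral_sum) (auto simp: s_def b_def power2_eq_square)
  finally have TB: "(\<integral>\<omega>. T \<omega> * B \<omega> \<partial>M) = s" .
  have "(\<integral>\<omega>. T \<omega> * T \<omega> \<partial>M) = (\<integral>\<omega>. (\<Sum>j<N. \<Sum>k<N. b j * b k * (y j \<omega> * y k \<omega>)) \<partial>M)"
    unfolding T_def by (simp add: sum_product mult_ac)
  also have "\<dots> = (\<Sum>j<N. \<Sum>k<N. b j * b k * (\<integral>\<omega>. y j \<omega> * y k \<omega> \<partial>M))"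
    using V_integrable_mult[OF y y] by (subst integral_double_sum) auto
  also have "\<dots> \<le> (\<Sum>j<N. \<Sum>k<N. ((b j)\<^sup>2 / 2 + (b k)\<^sup>2 / 2) * ?R j k)"
  proof (intro sum_mono)
    fix j k assume "j \<in> {..<N}" "k \<in> {..<N}"
    then have jk: "j < N" "k < N" by auto
    have "b j * b k * (\<integral>\<omega>. y j \<omega> * y k \<omega> \<partial>M) \<le> (\<bar>b j\<bar> * \<bar>b k\<bar>) * \<bar>\<integral>\<omega>. y j \<omega> * y k \<omega> \<partial>M\<bar>"
      unfolding abs_mult[symmetric] by (rule abs_ge_self)
    also have "\<dots> \<le> ((b j)\<^sup>2 / 2 + (b k)\<^sup>2 / 2) * ?R j k"
      using R[OF jk] by (intro mult_mono sq) auto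
    finally show "b j * b k * (\<integral>\<omega>. y j \<omega> * y k \<omega> \<partial>M) \<le> ((b j)\<^sup>2 / 2 + (b k)\<^sup>2 / 2) * ?R j k" .
  qed
  also have "\<dots> = (\<Sum>j<N. \<Sum>k<N. (b j)\<^sup>2 / 2 * ?R j k) + (\<Sum>j<N. \<Sum>k<N. (b k)\<^sup>2 / 2 * ?R j k)"
    by (simp add: distrib_right sum.distrib)
  also have "(\<Sum>j<N. \<Sum>k<N. (b k)\<^sup>2 / 2 * ?R j k) = (\<Sum>j<N. \<Sum>k<N. (b j)\<^sup>2 / 2 * ?R j k)"
    by (subst sum.swap) (simp add: nat_dist_commute)
  also have "(\<Sum>j<N. \<Sum>k<N. (b j)\<^sup>2 / 2 * ?R j k) = (\<Sum>j<N. (b j)\<^sup>2 / 2 * (\<Sum>k<N. ?R j k))"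
    by (simp add: sum_distrib_left)
  also have "\<dots> \<le> (\<Sum>j<N. (b j)\<^sup>2 / 2 * \<rho>)"
    by (intro sum_mono mult_left_mono row) auto
  finally have TT: "(\<integral>\<omega>. T \<omega> * T \<omega> \<partial>M) \<le> \<rho> * s"
    by (simp add: s_def sum_distrib_left sum.distrib[symmetric] mult_ac)
  have s0: "s \<ge> 0" unfolding s_def by (simp add: sum_nonneg)
  have "s * s \<le> (\<integral>\<omega>. T \<omega> * T \<omega> \<partial>M) * (\<integral>\<omega>. B \<omega> * B \<omega> \<partial>M)"
    using mean_mult_square_le[OF V_moments[OF T] V_moments[OF B]] TB by (simp add: power2_eq_square)
  also have "\<dots> \<le> (\<rho> * s) * (\<integral>\<omega>. B \<omega> * B \<omega> \<partial>M)" by (intro mult_right_mono TT) simp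
  finally have le: "s * s \<le> s * (\<rho> * (\<integral>\<omega>. B \<omega> * B \<omega> \<partial>M))" by (simp add: mult_ac)
  have "s \<le> \<rho> * (\<integral>\<omega>. B \<omega> * B \<omega> \<partial>M)"
  proof (cases "s = 0")
    case True
    then show ?thesis using \<rho>0 by simp
  next
    case False
    then show ?thesis using le s0 by (simp add: mult_le_cancel_left)
  qed
  then show ?thesis by (simp add: s_def b_def)
qed

end

section \<open>Interpolation of characteristic functions\<close>

lemma norm_integral_le_integral:
  fixes f :: "'a \<Rightarrow> 'b::{banach, second_countable_topology}"
  assumes "integrable M f" "integrable M g" "\<And>x. x \<in> space M \<Longrightarrow> norm (f x) \<le> g x"
  shows "norm (\<integral>x. f x \<partial>M) \<le> (\<integral>x. g x \<partial>M)"
  by (rule order_trans[OF integral_norm_bound integral_mono]) (use assms in auto)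

text \<open>The exponential differs from its first order expansion by at most half the square of the
  argument, so the second moment of \<open>W\<close> controls the difference quotient.\<close>

lemma (in prob_space) char_affine_derivative:
  fixes W B :: "'a \<Rightarrow> real"
  assumes W: "all_moments M W" and [measurable]: "B \<in> borel_measurable M"
  shows "((\<lambda>\<tau>. \<integral>\<omega>. iexp (\<tau> * W \<omega> + B \<omega>) \<partial>M) has_vector_derivative
    (\<integral>\<omega>. \<i> * complex_of_real (W \<omega>) * iexp (\<tau> * W \<omega> + B \<omega>) \<partial>M)) (at \<tau>)"
proof -
  have [measurable]: "W \<in> borel_measurable M" using W by (rule all_moments_measurable)
  have i0: "integrable M (\<lambda>\<omega>. iexp (t * W \<omega> + B \<omega>))" for t
    by (rule integrable_const_bound[where B=1]) (auto simp del: of_real_add of_real_mult)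
  have i1: "integrable M (\<lambda>\<omega>. \<i> * complex_of_real (W \<omega>) * iexp (\<tau> * W \<omega> + B \<omega>))"
    by (rule Bochner_Integration.integrable_bound[OF all_moments_integrable[OF W]])
      (auto simp: norm_mult simp del: of_real_add of_real_mult)
  have i2: "integrable M (\<lambda>\<omega>. (W \<omega>)\<^sup>2)" by (rule all_moments_integrable_power[OF W])
  define K where "K = (\<integral>\<omega>. (W \<omega>)\<^sup>2 \<partial>M)"
  have K: "K \<ge> 0" unfolding K_def by simp
  define \<Phi> where "\<Phi> t = (\<integral>\<omega>. iexp (t * W \<omega> + B \<omega>) \<partial>M)" for t
  define D where "D = (\<integral>\<omega>. \<i> * complex_of_real (W \<omega>) * iexp (\<tau> * W \<omega> + B \<omega>) \<partial>M)"
  have est: "cmod (\<Phi> t - \<Phi> \<tau> - (t - \<tau>) *\<^sub>R D) \<le> (t - \<tau>)\<^sup>2 * K" for t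
  proof -
    have e: "\<Phi> t - \<Phi> \<tau> - (t - \<tau>) *\<^sub>R D = (\<integral>\<omega>. iexp (t * W \<omega> + B \<omega>) - iexp (\<tau> * W \<omega> + B \<omega>)
        - (t - \<tau>) *\<^sub>R (\<i> * complex_of_real (W \<omega>) * iexp (\<tau> * W \<omega> + B \<omega>)) \<partial>M)"
      unfolding \<Phi>_def D_def
      by (simp only: Bochner_Integration.integral_diff[OF Bochner_Integration.integrable_diff[OF i0 i0] integrable_scaleR_right[OF i1]]
        Bochner_Integration.integral_diff[OF i0 i0] integral_scaleR_right)
    have bnd: "cmod (iexp (t * W \<omega> + B \<omega>) - iexp (\<tau> * W \<omega> + B \<omega>)
        - (t - \<tau>) *\<^sub>R (\<i> * complex_of_real (W \<omega>) * iexp (\<tau> * W \<omega> + B \<omega>))) \<le> (t - \<tau>)\<^sup>2 * (W \<omega>)\<^sup>2" for \<omega>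
    proof -
      let ?x = "(t - \<tau>) * W \<omega>"
      have "iexp (t * W \<omega> + B \<omega>) = iexp ?x * iexp (\<tau> * W \<omega> + B \<omega>)"
        unfolding exp_add[symmetric] by (simp add: algebra_simps)
      then have "iexp (t * W \<omega> + B \<omega>) - iexp (\<tau> * W \<omega> + B \<omega>) - (t - \<tau>) *\<^sub>R (\<i> * complex_of_real (W \<omega>) * iexp (\<tau> * W \<omega> + B \<omega>))
        = (iexp ?x - (1 + \<i> * ?x)) * iexp (\<tau> * W \<omega> + B \<omega>)"
        by (simp add: scaleR_conv_of_real algebra_simps)
      also have "cmod \<dots> = cmod (iexp ?x - (1 + \<i> * ?x))"
        unfolding norm_mult by (simp del: of_real_add of_real_mult)
      also have "\<dots> \<le> ?x\<^sup>2 / 2"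
        using iexp_approx1[of ?x 1] by (simp add: numeral_2_eq_2)
      also have "\<dots> \<le> ?x\<^sup>2" by simp
      finally show ?thesis by (simp add: power_mult_distrib)
    qed
    have "cmod (\<integral>\<omega>. iexp (t * W \<omega> + B \<omega>) - iexp (\<tau> * W \<omega> + B \<omega>)
        - (t - \<tau>) *\<^sub>R (\<i> * complex_of_real (W \<omega>) * iexp (\<tau> * W \<omega> + B \<omega>)) \<partial>M) \<le> (\<integral>\<omega>. (t - \<tau>)\<^sup>2 * (W \<omega>)\<^sup>2 \<partial>M)"
      by (rule norm_integral_le_integral)
        (use bnd i2 in \<open>auto intro!: Bochner_Integration.integrable_diff i0 i1 integrable_scaleR_right simp del: of_real_add of_real_mult\<close>)
    then show ?thesis unfolding e K_def by simp
  qed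
  have "(\<Phi> has_vector_derivative D) (at \<tau>)"
    unfolding has_vector_derivative_def has_derivative_at_alt
  proof (intro conjI allI impI)
    show "bounded_linear (\<lambda>x. x *\<^sub>R D)" by (rule bounded_linear_scaleR_left)
    fix e :: real assume e: "e > 0"
    show "\<exists>d>0. \<forall>y. norm (y - \<tau>) < d \<longrightarrow> norm (\<Phi> y - \<Phi> \<tau> - (y - \<tau>) *\<^sub>R D) \<le> e * norm (y - \<tau>)"
    proof (intro exI[of _ "e / (1 + K)"] conjI allI impI)
      show "e / (1 + K) > 0" using e K by simp
      fix t assume t: "norm (t - \<tau>) < e / (1 + K)"
      have "norm (t - \<tau>) * K \<le> norm (t - \<tau>) * (1 + K)" by (intro mult_left_mono) auto
      also have "\<dots> \<le> e" using t K by (simp add: field_simps)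
      finally have "norm (t - \<tau>) * K * norm (t - \<tau>) \<le> e * norm (t - \<tau>)" by (intro mult_right_mono) auto
      moreover have "(t - \<tau>)\<^sup>2 * K = norm (t - \<tau>) * K * norm (t - \<tau>)"
        by (simp add: power2_eq_square mult_ac)
      ultimately show "norm (\<Phi> t - \<Phi> \<tau> - (t - \<tau>) *\<^sub>R D) \<le> e * norm (t - \<tau>)"
        using est[of t] by linarith
    qed
  qed
  then show ?thesis unfolding \<Phi>_def D_def .
qed

lemma (in prob_space) deviation_add:
  fixes Z1 Z2 :: "'a \<Rightarrow> real"
  assumes "integrable M Z1" "integrable M Z2"
  shows "(\<integral>\<omega>. \<bar>(Z1 \<omega> + Z2 \<omega>) - (\<integral>\<omega>. Z1 \<omega> + Z2 \<omega> \<partial>M)\<bar> \<partial>M)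
    \<le> (\<integral>\<omega>. \<bar>Z1 \<omega> - (\<integral>\<omega>. Z1 \<omega> \<partial>M)\<bar> \<partial>M) + (\<integral>\<omega>. \<bar>Z2 \<omega> - (\<integral>\<omega>. Z2 \<omega> \<partial>M)\<bar> \<partial>M)"
proof -
  have "(\<integral>\<omega>. \<bar>(Z1 \<omega> + Z2 \<omega>) - (\<integral>\<omega>. Z1 \<omega> + Z2 \<omega> \<partial>M)\<bar> \<partial>M)
    \<le> (\<integral>\<omega>. \<bar>Z1 \<omega> - (\<integral>\<omega>. Z1 \<omega> \<partial>M)\<bar> + \<bar>Z2 \<omega> - (\<integral>\<omega>. Z2 \<omega> \<partial>M)\<bar> \<partial>M)"
    using assms by (intro integral_mono) auto
  then show ?thesis using assms by simp
qed

context gaussian_space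
begin

text \<open>\<open>odd_stein\<close> depends on the index through the variance of
  \<open>y j\<close>. The recursion splits off a pure power, covered by
  \<open>quadratic_deviation\<close>, and a factor with that variance, which is at most
  \<open>r 0\<close> and goes into the coefficients. The statement therefore quantifies over all
  \<open>u\<close> and \<open>D\<close>.\<close>

lemma quadratic_stein_deviation:
  assumes r0: "r 0 \<ge> 0"
  shows "\<exists>C\<ge>0. \<forall>N y u D. short_range r \<rho> N y \<and> D \<ge> 0 \<and> (\<forall>j<N. \<forall>k<N. \<bar>u j k\<bar> \<le> D * r (nat_dist j k)) \<longrightarrow>
    (\<integral>\<omega>. \<bar>(\<Sum>j<N. \<Sum>k<N. u j k * (odd_stein l (\<integral>\<omega>. y j \<omega> * y j \<omega> \<partial>M) (y j \<omega>) * y k \<omega> ^ b))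
      - (\<integral>\<omega>. (\<Sum>j<N. \<Sum>k<N. u j k * (odd_stein l (\<integral>\<omega>. y j \<omega> * y j \<omega> \<partial>M) (y j \<omega>) * y k \<omega> ^ b)) \<partial>M)\<bar> \<partial>M)
      \<le> C * D * sqrt (real N)"
proof (induction l)
  case 0
  show ?case using quadratic_deviation[of r \<rho> 0 b, OF r0] by simp
next
  case (Suc l)
  obtain C1 where C1: "C1 \<ge> 0" "\<And>N y u D. short_range r \<rho> N y \<Longrightarrow> D \<ge> 0 \<Longrightarrow> (\<forall>j<N. \<forall>k<N. \<bar>u j k\<bar> \<le> D * r (nat_dist j k)) \<Longrightarrow>
    (\<integral>\<omega>. \<bar>(\<Sum>j<N. \<Sum>k<N. u j k * (y j \<omega> ^ (2 * l + 2) * y k \<omega> ^ b)) - (\<integral>\<omega>. (\<Sum>j<N. \<Sum>k<N. u j k * (y j \<omega> ^ (2 * l + 2) * y k \<omega> ^ b)) \<partial>M)\<bar> \<partial>M)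
      \<le> C1 * D * sqrt (real N)"
    using quadratic_deviation[of r \<rho> "2 * l + 2" b, OF r0] by blast
  obtain C2 where C2: "C2 \<ge> 0" "\<And>N y u D. short_range r \<rho> N y \<Longrightarrow> D \<ge> 0 \<Longrightarrow> (\<forall>j<N. \<forall>k<N. \<bar>u j k\<bar> \<le> D * r (nat_dist j k)) \<Longrightarrow>
    (\<integral>\<omega>. \<bar>(\<Sum>j<N. \<Sum>k<N. u j k * (odd_stein l (\<integral>\<omega>. y j \<omega> * y j \<omega> \<partial>M) (y j \<omega>) * y k \<omega> ^ b))
      - (\<integral>\<omega>. (\<Sum>j<N. \<Sum>k<N. u j k * (odd_stein l (\<integral>\<omega>. y j \<omega> * y j \<omega> \<partial>M) (y j \<omega>) * y k \<omega> ^ b)) \<partial>M)\<bar> \<partial>M)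
      \<le> C2 * D * sqrt (real N)"
    using Suc by blast
  show ?case
  proof (intro exI[of _ "C1 + C2 * ((2 * real l + 2) * r 0)"] conjI allI impI)
    show "C1 + C2 * ((2 * real l + 2) * r 0) \<ge> 0" using C1 C2 r0 by simp
    fix N :: nat and y :: "nat \<Rightarrow> 'a \<Rightarrow> real" and u :: "nat \<Rightarrow> nat \<Rightarrow> real" and D :: real
    assume H: "short_range r \<rho> N y \<and> D \<ge> 0 \<and> (\<forall>j<N. \<forall>k<N. \<bar>u j k\<bar> \<le> D * r (nat_dist j k))"
    then have sr: "short_range r \<rho> N y" and D: "D \<ge> 0" and u: "\<And>j k. j < N \<Longrightarrow> k < N \<Longrightarrow> \<bar>u j k\<bar> \<le> D * r (nat_dist j k)"
      by auto
    have y: "\<And>j. j < N \<Longrightarrow> y j \<in> V" using sr by (simp add: short_range_def)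
    define s where "s j = (\<integral>\<omega>. y j \<omega> * y j \<omega> \<partial>M)" for j
    have s: "0 \<le> s j" "s j \<le> r 0" if "j < N" for j
      using short_range_var[OF sr that] by (auto simp: s_def)
    define Q1 where "Q1 \<omega> = (\<Sum>j<N. \<Sum>k<N. u j k * (y j \<omega> ^ (2 * l + 2) * y k \<omega> ^ b))" for \<omega>
    define u' where "u' j k = u j k * ((2 * real l + 2) * s j)" for j k
    define Q2 where "Q2 \<omega> = (\<Sum>j<N. \<Sum>k<N. u' j k * (odd_stein l (s j) (y j \<omega>) * y k \<omega> ^ b))" for \<omega>
    have Q: "(\<Sum>j<N. \<Sum>k<N. u j k * (odd_stein (Suc l) (s j) (y j \<omega>) * y k \<omega> ^ b)) = Q1 \<omega> + Q2 \<omega>" for \<omega>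
      unfolding Q1_def Q2_def u'_def sum.distrib[symmetric] by (intro sum.cong refl) (simp add: algebra_simps)
    have i: "integrable M Q1" "integrable M Q2" unfolding Q1_def Q2_def
      by (intro all_moments_integrable all_moments_sum all_moments_cmult all_moments_mult all_moments_power V_moments y all_moments_odd_stein; simp)+
    have "(\<integral>\<omega>. \<bar>(Q1 \<omega> + Q2 \<omega>) - (\<integral>\<omega>. Q1 \<omega> + Q2 \<omega> \<partial>M)\<bar> \<partial>M)
      \<le> (\<integral>\<omega>. \<bar>Q1 \<omega> - (\<integral>\<omega>. Q1 \<omega> \<partial>M)\<bar> \<partial>M) + (\<integral>\<omega>. \<bar>Q2 \<omega> - (\<integral>\<omega>. Q2 \<omega> \<partial>M)\<bar> \<partial>M)"
      by (rule deviation_add[OF i])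
    also have "\<dots> \<le> C1 * D * sqrt (real N) + C2 * (D * ((2 * real l + 2) * r 0)) * sqrt (real N)"
    proof (rule add_mono)
      show "(\<integral>\<omega>. \<bar>Q1 \<omega> - (\<integral>\<omega>. Q1 \<omega> \<partial>M)\<bar> \<partial>M) \<le> C1 * D * sqrt (real N)"
        unfolding Q1_def by (rule C1(2)[OF sr D]) (use u in auto)
      show "(\<integral>\<omega>. \<bar>Q2 \<omega> - (\<integral>\<omega>. Q2 \<omega> \<partial>M)\<bar> \<partial>M) \<le> C2 * (D * ((2 * real l + 2) * r 0)) * sqrt (real N)"
        unfolding Q2_def s_def
      proof (rule C2(2)[OF sr])
        show "0 \<le> D * ((2 * real l + 2) * r 0)" using D r0 by simp
        show "\<forall>j<N. \<forall>k<N. \<bar>u' j k\<bar> \<le> D * ((2 * real l + 2) * r 0) * r (nat_dist j k)"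
        proof (intro allI impI)
          fix j k assume jk: "j < N" "k < N"
          have rp: "0 \<le> r (nat_dist j k)" using sr by (simp add: short_range_def)
          have "\<bar>u' j k\<bar> = \<bar>u j k\<bar> * ((2 * real l + 2) * s j)"
            unfolding u'_def using s jk by (simp add: abs_mult)
          also have "\<dots> \<le> (D * r (nat_dist j k)) * ((2 * real l + 2) * r 0)"
            using u s jk D rp by (intro mult_mono) auto
          finally show "\<bar>u' j k\<bar> \<le> D * ((2 * real l + 2) * r 0) * r (nat_dist j k)" by (simp add: mult_ac)
        qed
      qed
    qed
    also have "\<dots> = (C1 + C2 * ((2 * real l + 2) * r 0)) * D * sqrt (real N)" by (simp add: algebra_simps)
    finally show "(\<integral>\<omega>. \<bar>(\<Sum>j<N. \<Sum>k<N. u j k * (odd_stein (Suc l) (\<integral>\<omega>. y j \<omega> * y j \<omega> \<partial>M) (y j \<omega>) * y k \<omega> ^ b))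
      - (\<integral>\<omega>. (\<Sum>j<N. \<Sum>k<N. u j k * (odd_stein (Suc l) (\<integral>\<omega>. y j \<omega> * y j \<omega> \<partial>M) (y j \<omega>) * y k \<omega> ^ b)) \<partial>M)\<bar> \<partial>M)
      \<le> (C1 + C2 * ((2 * real l + 2) * r 0)) * D * sqrt (real N)"
      unfolding s_def[symmetric] Q .
  qed
qed

text \<open>The recursion of \<open>quadratic_stein_deviation\<close>, with the variance factor now
  absorbed into the Euclidean norm of the coefficients.\<close>

lemma linear_stein_deviation:
  assumes r0: "r 0 \<ge> 0"
  shows "\<exists>C\<ge>0. \<forall>N y u. short_range r \<rho> N y \<longrightarrow>
    (\<integral>\<omega>. \<bar>(\<Sum>j<N. u j * odd_stein l (\<integral>\<omega>. y j \<omega> * y j \<omega> \<partial>M) (y j \<omega>))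
       - (\<integral>\<omega>. (\<Sum>j<N. u j * odd_stein l (\<integral>\<omega>. y j \<omega> * y j \<omega> \<partial>M) (y j \<omega>)) \<partial>M)\<bar> \<partial>M) \<le> C * sqrt (\<Sum>j<N. (u j)\<^sup>2)"
proof (induction l)
  case 0
  show ?case using linear_deviation[of r \<rho> 0, OF r0] by simp
next
  case (Suc l)
  obtain C1 where C1: "C1 \<ge> 0" "\<And>N y u. short_range r \<rho> N y \<Longrightarrow>
    (\<integral>\<omega>. \<bar>(\<Sum>j<N. u j * y j \<omega> ^ (2 * l + 2)) - (\<integral>\<omega>. (\<Sum>j<N. u j * y j \<omega> ^ (2 * l + 2)) \<partial>M)\<bar> \<partial>M) \<le> C1 * sqrt (\<Sum>j<N. (u j)\<^sup>2)"
    using linear_deviation[of r \<rho> "2 * l + 2", OF r0] by blast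
  obtain C2 where C2: "C2 \<ge> 0" "\<And>N y u. short_range r \<rho> N y \<Longrightarrow>
    (\<integral>\<omega>. \<bar>(\<Sum>j<N. u j * odd_stein l (\<integral>\<omega>. y j \<omega> * y j \<omega> \<partial>M) (y j \<omega>))
       - (\<integral>\<omega>. (\<Sum>j<N. u j * odd_stein l (\<integral>\<omega>. y j \<omega> * y j \<omega> \<partial>M) (y j \<omega>)) \<partial>M)\<bar> \<partial>M) \<le> C2 * sqrt (\<Sum>j<N. (u j)\<^sup>2)"
    using Suc by blast
  define L where "L = (2 * real l + 2) * r 0"
  have L: "L \<ge> 0" using r0 by (simp add: L_def)
  show ?case
  proof (intro exI[of _ "C1 + C2 * L"] conjI allI impI)
    show "C1 + C2 * L \<ge> 0" using C1 C2 L by simp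
    fix N :: nat and y :: "nat \<Rightarrow> 'a \<Rightarrow> real" and u :: "nat \<Rightarrow> real"
    assume sr: "short_range r \<rho> N y"
    have y: "\<And>j. j < N \<Longrightarrow> y j \<in> V" using sr by (simp add: short_range_def)
    define s where "s j = (\<integral>\<omega>. y j \<omega> * y j \<omega> \<partial>M)" for j
    have s: "0 \<le> s j" "s j \<le> r 0" if "j < N" for j
      using short_range_var[OF sr that] by (auto simp: s_def)
    define Q1 where "Q1 \<omega> = (\<Sum>j<N. u j * y j \<omega> ^ (2 * l + 2))" for \<omega>
    define u' where "u' j = u j * ((2 * real l + 2) * s j)" for j
    define Q2 where "Q2 \<omega> = (\<Sum>j<N. u' j * odd_stein l (s j) (y j \<omega>))" for \<omega>
    have Q: "(\<Sum>j<N. u j * odd_stein (Suc l) (s j) (y j \<omega>)) = Q1 \<omega> + Q2 \<omega>" for \<omega>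
      unfolding Q1_def Q2_def u'_def sum.distrib[symmetric] by (intro sum.cong refl) (simp add: algebra_simps)
    have i: "integrable M Q1" "integrable M Q2" unfolding Q1_def Q2_def
      by (intro all_moments_integrable all_moments_sum all_moments_cmult all_moments_mult all_moments_power V_moments y all_moments_odd_stein; simp)+
    have "(\<Sum>j<N. (u' j)\<^sup>2) \<le> (\<Sum>j<N. L\<^sup>2 * (u j)\<^sup>2)"
    proof (intro sum_mono)
      fix j assume j: "j \<in> {..<N}"
      have "(u' j)\<^sup>2 = (u j)\<^sup>2 * ((2 * real l + 2) * s j)\<^sup>2" by (simp add: u'_def power_mult_distrib)
      also have "\<dots> \<le> (u j)\<^sup>2 * L\<^sup>2" unfolding L_def
        using s j by (intro mult_left_mono power_mono) auto
      finally show "(u' j)\<^sup>2 \<le> L\<^sup>2 * (u j)\<^sup>2" by (simp add: mult.commute)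
    qed
    then have "sqrt (\<Sum>j<N. (u' j)\<^sup>2) \<le> sqrt (L\<^sup>2 * (\<Sum>j<N. (u j)\<^sup>2))"
      by (simp add: sum_distrib_left)
    then have sq: "sqrt (\<Sum>j<N. (u' j)\<^sup>2) \<le> L * sqrt (\<Sum>j<N. (u j)\<^sup>2)"
      using L by (simp add: real_sqrt_mult)
    have "(\<integral>\<omega>. \<bar>(Q1 \<omega> + Q2 \<omega>) - (\<integral>\<omega>. Q1 \<omega> + Q2 \<omega> \<partial>M)\<bar> \<partial>M)
      \<le> (\<integral>\<omega>. \<bar>Q1 \<omega> - (\<integral>\<omega>. Q1 \<omega> \<partial>M)\<bar> \<partial>M) + (\<integral>\<omega>. \<bar>Q2 \<omega> - (\<integral>\<omega>. Q2 \<omega> \<partial>M)\<bar> \<partial>M)"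
      by (rule deviation_add[OF i])
    also have "\<dots> \<le> C1 * sqrt (\<Sum>j<N. (u j)\<^sup>2) + C2 * sqrt (\<Sum>j<N. (u' j)\<^sup>2)"
      unfolding Q1_def Q2_def s_def by (intro add_mono C1(2)[OF sr] C2(2)[OF sr])
    also have "\<dots> \<le> C1 * sqrt (\<Sum>j<N. (u j)\<^sup>2) + C2 * (L * sqrt (\<Sum>j<N. (u j)\<^sup>2))"
      using sq C2 by (intro add_left_mono mult_left_mono) auto
    also have "\<dots> = (C1 + C2 * L) * sqrt (\<Sum>j<N. (u j)\<^sup>2)" by (simp add: algebra_simps)
    finally show "(\<integral>\<omega>. \<bar>(\<Sum>j<N. u j * odd_stein (Suc l) (\<integral>\<omega>. y j \<omega> * y j \<omega> \<partial>M) (y j \<omega>))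
       - (\<integral>\<omega>. (\<Sum>j<N. u j * odd_stein (Suc l) (\<integral>\<omega>. y j \<omega> * y j \<omega> \<partial>M) (y j \<omega>)) \<partial>M)\<bar> \<partial>M) \<le> (C1 + C2 * L) * sqrt (\<Sum>j<N. (u j)\<^sup>2)"
      unfolding s_def[symmetric] Q .
  qed
qed

text \<open>
  Follows \<open>exp(\<tau>\<^sup>2 S/2) E exp(i(\<tau> W + B))\<close> from \<open>\<tau> = 0\<close> to \<open>\<tau> = 1\<close>.
\<close>
lemma gaussian_interpolation_bound:
  fixes w :: "nat \<Rightarrow> real" and c S :: real and l :: nat
  assumes y: "\<And>j. j < N \<Longrightarrow> y j \<in> V" and B: "B \<in> V"
  defines "s \<equiv> \<lambda>j. \<integral>\<omega>. y j \<omega> * y j \<omega> \<partial>M"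
  defines "Q \<equiv> \<lambda>\<omega>. \<Sum>j<N. \<Sum>k<N. (c\<^sup>2 * w j * w k * (\<integral>\<omega>. y j \<omega> * y k \<omega> \<partial>M) * (2 * real l + 1))
      * (odd_stein l (s j) (y j \<omega>) * y k \<omega> ^ (2 * l))"
  defines "R \<equiv> \<lambda>\<omega>. \<Sum>j<N. (c * w j * (\<integral>\<omega>. y j \<omega> * B \<omega> \<partial>M)) * odd_stein l (s j) (y j \<omega>)"
  shows "cmod (exp (S / 2) *\<^sub>R (\<integral>\<omega>. iexp (c * (\<Sum>j<N. w j * y j \<omega> ^ (2 * l + 1)) + B \<omega>) \<partial>M) - (\<integral>\<omega>. iexp (B \<omega>) \<partial>M))
    \<le> exp (\<bar>S\<bar> / 2) * ((\<integral>\<omega>. \<bar>Q \<omega> - S\<bar> \<partial>M) + (\<integral>\<omega>. \<bar>R \<omega>\<bar> \<partial>M))"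
proof -
  define I where "I = {..N}"
  \<comment> \<open>Index \<open>N\<close> is reserved for \<open>B\<close>, so that one finite
    family contains all variables.\<close>
  define z where "z k = (if k < N then y k else B)" for k
  have z: "z k \<in> V" for k using y B by (simp add: z_def)
  have zj: "z j = y j" if "j < N" for j using that by (simp add: z_def)
  have zN: "z N = B" by (simp add: z_def)
  have I: "finite I" "N \<in> I" "\<And>j. j < N \<Longrightarrow> j \<in> I" by (auto simp: I_def)
  define W where "W p = c * (\<Sum>k<N. w k * p k ^ (2 * l + 1))" for p :: "nat \<Rightarrow> real"
  define DW where "DW v p = c * (\<Sum>k<N. w k * (real (2 * l + 1) * p k ^ (2 * l + 1 - 1) * v k))" for v p :: "nat \<Rightarrow> real"
  define h where "h \<tau> p = iexp (\<tau> * W p + p N)" for \<tau> and p :: "nat \<Rightarrow> real"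
  define v where "v j k = (\<integral>\<omega>. z j \<omega> * z k \<omega> \<partial>M)" for j k
  define zz where "zz \<omega> = (\<lambda>k. z k \<omega>)" for \<omega>
  have smW: "smooth_along I v' W (DW v')" for v' unfolding W_def DW_def
    by (intro smooth_along_cmult smooth_along_sum smooth_along_power smooth_along_coord I) auto
  have smh: "smooth_along I v' (h \<tau>) (\<lambda>p. \<i> * complex_of_real (\<tau> * DW v' p + v' N) * h \<tau> p)" for v' \<tau>
    unfolding h_def by (intro smooth_along_iexp smooth_along_add smooth_along_cmult smW smooth_along_coord I)
  have am: "all_moments M (\<lambda>\<omega>. odd_stein l (s j) (y j \<omega>))" if "j < N" for j
    by (rule all_moments_odd_stein[OF y[OF that]])
  have amQ: "all_moments M Q" unfolding Q_def
    by (intro all_moments_sum all_moments_cmult all_moments_mult all_moments_power V_moments y am) auto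
  have amR: "all_moments M R" unfolding R_def
    by (intro all_moments_sum all_moments_cmult am) auto
  have amW: "all_moments M (\<lambda>\<omega>. W (zz \<omega>))" unfolding W_def zz_def
    by (intro all_moments_sum all_moments_cmult all_moments_power V_moments z)
  have hm: "(\<lambda>\<omega>. h \<tau> (zz \<omega>)) \<in> borel_measurable M" for \<tau>
    unfolding h_def using all_moments_measurable[OF amW] V_measurable[OF z[of N]] by (simp add: zz_def)
  have h1: "cmod (h \<tau> p) = 1" for \<tau> p unfolding h_def by (simp del: of_real_add of_real_mult)
  have ih: "integrable M (\<lambda>\<omega>. complex_of_real (Z \<omega>) * h \<tau> (zz \<omega>))" if "all_moments M Z" for Z \<tau>
    by (rule Bochner_Integration.integrable_bound[OF all_moments_integrable[OF that]])
      (use hm all_moments_measurable[OF that] in \<open>auto simp: norm_mult h1\<close>)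
  define \<Phi> where "\<Phi> \<tau> = (\<integral>\<omega>. h \<tau> (zz \<omega>) \<partial>M)" for \<tau>
  \<comment> \<open>The derivative after integration by parts. The sign is the square of the
    imaginary unit: one factor comes from differentiating in \<tau>, the other from differentiating
    the exponential in the Gaussian variables.\<close>
  define D where "D \<tau> = - (\<integral>\<omega>. complex_of_real (\<tau> * Q \<omega> + R \<omega>) * h \<tau> (zz \<omega>) \<partial>M)" for \<tau>
  have d\<Phi>: "(\<Phi> has_vector_derivative D \<tau>) (at \<tau>)" for \<tau>
  proof -
    have "((\<lambda>\<tau>. \<integral>\<omega>. iexp (\<tau> * W (zz \<omega>) + B \<omega>) \<partial>M) has_vector_derivative
      (\<integral>\<omega>. \<i> * complex_of_real (W (zz \<omega>)) * iexp (\<tau> * W (zz \<omega>) + B \<omega>) \<partial>M)) (at \<tau>)"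
      by (rule char_affine_derivative[OF amW V_measurable[OF B]])
    moreover have "(\<lambda>\<tau>. \<integral>\<omega>. iexp (\<tau> * W (zz \<omega>) + B \<omega>) \<partial>M) = \<Phi>"
      unfolding \<Phi>_def h_def by (simp add: zz_def zN)
    moreover have "(\<integral>\<omega>. \<i> * complex_of_real (W (zz \<omega>)) * iexp (\<tau> * W (zz \<omega>) + B \<omega>) \<partial>M) = D \<tau>"
    proof -
      have t: "(\<integral>\<omega>. complex_of_real (y j \<omega> ^ (2 * l + 1)) * h \<tau> (zz \<omega>) \<partial>M)
         = \<i> * (\<integral>\<omega>. complex_of_real (odd_stein l (s j) (y j \<omega>) * (\<tau> * DW (v j) (zz \<omega>) + v j N)) * h \<tau> (zz \<omega>) \<partial>M)"
        if j: "j < N" for j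
      proof -
        have "(\<integral>\<omega>. z j \<omega> ^ (2 * l + 1) *\<^sub>R h \<tau> (\<lambda>k. z k \<omega>) \<partial>M)
          = (\<integral>\<omega>. odd_stein l (v j j) (z j \<omega>) *\<^sub>R (\<i> * complex_of_real (\<tau> * DW (v j) (\<lambda>k. z k \<omega>) + v j N) * h \<tau> (\<lambda>k. z k \<omega>)) \<partial>M)"
          by (rule odd_power_by_parts[of I j z "v j", OF I(1) I(3)[OF j] z _ smh, THEN conjunct2]) (simp add: v_def)
        moreover have "v j j = s j" using j by (simp add: v_def s_def zj)
        moreover have "(\<integral>\<omega>. odd_stein l (s j) (z j \<omega>) *\<^sub>R (\<i> * complex_of_real (\<tau> * DW (v j) (\<lambda>k. z k \<omega>) + v j N) * h \<tau> (\<lambda>k. z k \<omega>)) \<partial>M)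
          = (\<integral>\<omega>. \<i> * (complex_of_real (odd_stein l (s j) (z j \<omega>) * (\<tau> * DW (v j) (\<lambda>k. z k \<omega>) + v j N)) * h \<tau> (\<lambda>k. z k \<omega>)) \<partial>M)"
          by (intro Bochner_Integration.integral_cong refl) (simp add: scaleR_conv_of_real algebra_simps)
        ultimately show ?thesis
          using j by (simp only: zj zz_def scaleR_conv_of_real Bochner_Integration.integral_mult_right_zero)
      qed
      have amj: "all_moments M (\<lambda>\<omega>. y j \<omega> ^ (2 * l + 1))" if "j < N" for j
        by (intro all_moments_power V_moments y that)
      have amDW: "all_moments M (\<lambda>\<omega>. odd_stein l (s j) (y j \<omega>) * (\<tau> * DW (v j) (zz \<omega>) + v j N))" if "j < N" for j
        unfolding DW_def zz_def
        by (intro all_moments_mult am that all_moments_add all_moments_cmult all_moments_sum all_moments_const all_moments_power V_moments z)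
      have "(\<integral>\<omega>. \<i> * complex_of_real (W (zz \<omega>)) * iexp (\<tau> * W (zz \<omega>) + B \<omega>) \<partial>M)
        = (\<integral>\<omega>. (\<Sum>j<N. (\<i> * complex_of_real (c * w j)) * (complex_of_real (y j \<omega> ^ (2 * l + 1)) * h \<tau> (zz \<omega>))) \<partial>M)"
        unfolding W_def h_def zz_def zN
        by (intro Bochner_Integration.integral_cong refl)
          (simp add: zj sum_distrib_left sum_distrib_right mult_ac)
      also have "\<dots> = (\<Sum>j<N. (\<i> * complex_of_real (c * w j)) * (\<integral>\<omega>. complex_of_real (y j \<omega> ^ (2 * l + 1)) * h \<tau> (zz \<omega>) \<partial>M))"
        using ih[OF amj] by (subst Bochner_Integration.integral_sum) (auto simp del: of_real_power)
      also have "\<dots> = (\<Sum>j<N. (\<i> * complex_of_real (c * w j)) * (\<i> * (\<integral>\<omega>. complex_of_real (odd_stein l (s j) (y j \<omega>) * (\<tau> * DW (v j) (zz \<omega>) + v j N)) * h \<tau> (zz \<omega>) \<partial>M)))"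
        by (intro sum.cong refl arg_cong[where f="\<lambda>u. _ * u"] t) simp
      also have "\<dots> = (\<Sum>j<N. \<integral>\<omega>. - complex_of_real (c * w j) * (complex_of_real (odd_stein l (s j) (y j \<omega>) * (\<tau> * DW (v j) (zz \<omega>) + v j N)) * h \<tau> (zz \<omega>)) \<partial>M)"
        by (intro sum.cong refl, subst Bochner_Integration.integral_mult_right_zero) (simp add: mult_ac)
      also have "\<dots> = (\<integral>\<omega>. (\<Sum>j<N. - complex_of_real (c * w j) * (complex_of_real (odd_stein l (s j) (y j \<omega>) * (\<tau> * DW (v j) (zz \<omega>) + v j N)) * h \<tau> (zz \<omega>))) \<partial>M)"
        using ih[OF amDW] by (subst Bochner_Integration.integral_sum) auto
      also have "\<dots> = (\<integral>\<omega>. - (complex_of_real (\<tau> * Q \<omega> + R \<omega>) * h \<tau> (zz \<omega>)) \<partial>M)"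
      proof (intro Bochner_Integration.integral_cong refl)
        fix \<omega>
        have eq: "(\<Sum>j<N. (c * w j) * (odd_stein l (s j) (y j \<omega>) * (\<tau> * DW (v j) (zz \<omega>) + v j N))) = \<tau> * Q \<omega> + R \<omega>"
        proof -
          have "(c * w j) * (odd_stein l (s j) (y j \<omega>) * (\<tau> * DW (v j) (zz \<omega>) + v j N))
            = \<tau> * (\<Sum>k<N. (c\<^sup>2 * w j * w k * (\<integral>\<omega>. y j \<omega> * y k \<omega> \<partial>M) * (2 * real l + 1)) * (odd_stein l (s j) (y j \<omega>) * y k \<omega> ^ (2 * l)))
              + (c * w j * (\<integral>\<omega>. y j \<omega> * B \<omega> \<partial>M)) * odd_stein l (s j) (y j \<omega>)" if j: "j < N" for j
          proof -
            have "DW (v j) (zz \<omega>) = c * (\<Sum>k<N. w k * ((2 * real l + 1) * y k \<omega> ^ (2 * l) * (\<integral>\<omega>. y j \<omega> * y k \<omega> \<partial>M)))"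
              unfolding DW_def zz_def v_def by (intro arg_cong[where f="\<lambda>u. c * u"] sum.cong refl) (simp add: zj j)
            moreover have "v j N = (\<integral>\<omega>. y j \<omega> * B \<omega> \<partial>M)" by (simp add: v_def zj j zN)
            ultimately show ?thesis
              by (simp add: sum_distrib_left algebra_simps power2_eq_square)
          qed
          then show ?thesis unfolding Q_def R_def by (simp add: sum.distrib sum_distrib_left[symmetric])
        qed
        then have "complex_of_real (\<tau> * Q \<omega> + R \<omega>) = (\<Sum>j<N. complex_of_real ((c * w j) * (odd_stein l (s j) (y j \<omega>) * (\<tau> * DW (v j) (zz \<omega>) + v j N))))"
          by (simp only: eq[symmetric] of_real_sum)
        then show "(\<Sum>j<N. - complex_of_real (c * w j) * (complex_of_real (odd_stein l (s j) (y j \<omega>) * (\<tau> * DW (v j) (zz \<omega>) + v j N)) * h \<tau> (zz \<omega>)))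
           = - (complex_of_real (\<tau> * Q \<omega> + R \<omega>) * h \<tau> (zz \<omega>))"
          by (simp only: of_real_mult[symmetric] mult.assoc[symmetric] mult_minus_left sum_negf sum_distrib_right)
      qed
      also have "\<dots> = D \<tau>" unfolding D_def by simp
      finally show ?thesis .
    qed
    ultimately show ?thesis by metis
  qed
  \<comment> \<open>An integrating factor: it cancels the part - \<tau> S of the derivative, so that
    \<open>G'\<close> contains Q only through Q - S.\<close>
  define G where "G \<tau> = exp (S * \<tau>\<^sup>2 / 2) *\<^sub>R \<Phi> \<tau>" for \<tau>
  define G' where "G' \<tau> = exp (S * \<tau>\<^sup>2 / 2) *\<^sub>R D \<tau> + (exp (S * \<tau>\<^sup>2 / 2) * (S * \<tau>)) *\<^sub>R \<Phi> \<tau>" for \<tau>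
  have dG: "(G has_vector_derivative G' \<tau>) (at \<tau>)" for \<tau>
  proof -
    have "((\<lambda>\<tau>. exp (S * \<tau>\<^sup>2 / 2)) has_real_derivative exp (S * \<tau>\<^sup>2 / 2) * (S * \<tau>)) (at \<tau>)"
      by (auto intro!: derivative_eq_intros)
    from has_vector_derivative_scaleR[OF this d\<Phi>] show ?thesis unfolding G_def G'_def .
  qed
  define E where "E = exp (\<bar>S\<bar> / 2) * ((\<integral>\<omega>. \<bar>Q \<omega> - S\<bar> \<partial>M) + (\<integral>\<omega>. \<bar>R \<omega>\<bar> \<partial>M))"
  have amQS: "all_moments M (\<lambda>\<omega>. Q \<omega> - S)" by (intro all_moments_diff amQ all_moments_const)
  have bG: "norm (G' \<tau>) \<le> E" if \<tau>: "0 < \<tau>" "\<tau> < 1" for \<tau>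
  proof -
    have am1: "all_moments M (\<lambda>\<omega>. \<tau> * (Q \<omega> - S) + R \<omega>)" by (intro all_moments_add all_moments_cmult amQS amR)
    have "D \<tau> + (S * \<tau>) *\<^sub>R \<Phi> \<tau> = (\<integral>\<omega>. complex_of_real (S * \<tau>) * h \<tau> (zz \<omega>) - complex_of_real (\<tau> * Q \<omega> + R \<omega>) * h \<tau> (zz \<omega>) \<partial>M)"
      unfolding D_def \<Phi>_def
      by (subst Bochner_Integration.integral_diff[OF ih ih])
        (auto intro!: all_moments_const all_moments_add all_moments_cmult amQ amR simp: scaleR_conv_of_real)
    also have "\<dots> = (\<integral>\<omega>. - (complex_of_real (\<tau> * (Q \<omega> - S) + R \<omega>) * h \<tau> (zz \<omega>)) \<partial>M)"
      by (simp add: algebra_simps)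
    also have "cmod \<dots> \<le> (\<integral>\<omega>. \<bar>\<tau> * (Q \<omega> - S) + R \<omega>\<bar> \<partial>M)"
      by (rule norm_integral_le_integral)
        (use ih[OF am1, of \<tau>] all_moments_integrable[OF all_moments_abs[OF am1]] in
          \<open>auto simp: norm_mult h1 simp del: of_real_add of_real_mult of_real_diff\<close>)
    also have "\<dots> \<le> (\<integral>\<omega>. \<bar>Q \<omega> - S\<bar> + \<bar>R \<omega>\<bar> \<partial>M)"
    proof (rule integral_mono)
      show "\<bar>\<tau> * (Q \<omega> - S) + R \<omega>\<bar> \<le> \<bar>Q \<omega> - S\<bar> + \<bar>R \<omega>\<bar>" for \<omega>
        using \<tau> mult_right_mono[of \<tau> 1 "\<bar>Q \<omega> - S\<bar>"] abs_triangle_ineq[of "\<tau> * (Q \<omega> - S)" "R \<omega>"]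
        by (simp add: abs_mult)
    qed (intro all_moments_integrable all_moments_add all_moments_abs am1 amQS amR)+
    also have "\<dots> = (\<integral>\<omega>. \<bar>Q \<omega> - S\<bar> \<partial>M) + (\<integral>\<omega>. \<bar>R \<omega>\<bar> \<partial>M)"
      by (intro Bochner_Integration.integral_add all_moments_integrable all_moments_abs amQS amR)
    finally have 1: "cmod (D \<tau> + (S * \<tau>) *\<^sub>R \<Phi> \<tau>) \<le> (\<integral>\<omega>. \<bar>Q \<omega> - S\<bar> \<partial>M) + (\<integral>\<omega>. \<bar>R \<omega>\<bar> \<partial>M)" .
    have "\<tau>\<^sup>2 \<le> 1" using \<tau> by (simp add: power_le_one)
    then have "S * \<tau>\<^sup>2 \<le> \<bar>S\<bar>"
      by (metis abs_ge_self abs_ge_zero abs_mult abs_power2 mult.right_neutral mult_left_mono order_trans)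
    then have 2: "exp (S * \<tau>\<^sup>2 / 2) \<le> exp (\<bar>S\<bar> / 2)" by simp
    have "G' \<tau> = exp (S * \<tau>\<^sup>2 / 2) *\<^sub>R (D \<tau> + (S * \<tau>) *\<^sub>R \<Phi> \<tau>)" by (simp add: G'_def scaleR_add_right)
    then have "norm (G' \<tau>) = exp (S * \<tau>\<^sup>2 / 2) * cmod (D \<tau> + (S * \<tau>) *\<^sub>R \<Phi> \<tau>)" by simp
    also have "\<dots> \<le> E" unfolding E_def using 1 2 by (intro mult_mono) auto
    finally show ?thesis .
  qed
  have "norm (G 1 - G 0) \<le> E * 1 - E * 0"
  proof (rule differentiable_bound_general[where f' = G' and \<phi>' = "\<lambda>_. E"])
    show "continuous_on {0..1} G"
      using dG by (auto intro!: continuous_at_imp_continuous_on has_vector_derivative_continuous)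
    show "((*) E has_vector_derivative E) (at x)" for x
      unfolding has_real_derivative_iff_has_vector_derivative[symmetric] by (auto intro!: derivative_eq_intros)
  qed (use dG bG in \<open>auto intro!: continuous_intros\<close>)
  moreover have "\<Phi> 1 = (\<integral>\<omega>. iexp (c * (\<Sum>j<N. w j * y j \<omega> ^ (2 * l + 1)) + B \<omega>) \<partial>M)"
    unfolding \<Phi>_def h_def W_def zz_def zN
    by (intro Bochner_Integration.integral_cong refl) (simp add: zj)
  moreover have "\<Phi> 0 = (\<integral>\<omega>. iexp (B \<omega>) \<partial>M)"
    unfolding \<Phi>_def h_def zz_def zN by simp
  ultimately show ?thesis unfolding G_def E_def by simp
qed

text \<open>Integration by parts applied to the covariance itself. It identifies the mean of Q with
  the variance of the normalised sum, so Q needs no limit computation of its own.\<close>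

lemma odd_power_covariance_by_parts:
  assumes y: "y \<in> V" "x \<in> V"
  shows "(\<integral>\<omega>. y \<omega> ^ (2 * l + 1) * x \<omega> ^ (2 * l + 1) \<partial>M) =
    (\<integral>\<omega>. y \<omega> * x \<omega> \<partial>M) * (2 * real l + 1) * (\<integral>\<omega>. odd_stein l (\<integral>\<omega>. y \<omega> * y \<omega> \<partial>M) (y \<omega>) * x \<omega> ^ (2 * l) \<partial>M)"
proof -
  define z :: "nat \<Rightarrow> 'a \<Rightarrow> real" where "z = (\<lambda>k. if k = 0 then y else x)"
  have z: "z 0 = y" "z 1 = x" "z (Suc 0) = x" by (auto simp: z_def)
  define v where "v k = (\<integral>\<omega>. z 0 \<omega> * z k \<omega> \<partial>M)" for k
  define I :: "nat set" where "I = {0, 1}"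
  have zV: "z k \<in> V" for k using y by (auto simp: z_def)
  have I: "finite I" "0 \<in> I" "1 \<in> I" by (auto simp: I_def)
  have sm: "smooth_along I v (\<lambda>p. p 1 ^ (2 * l + 1)) (\<lambda>p. real (2 * l + 1) * p 1 ^ (2 * l + 1 - 1) * v 1)"
    by (rule smooth_along_power[OF smooth_along_coord[OF I(1,3)]])
  have "(\<integral>\<omega>. y \<omega> ^ (2 * l + 1) * x \<omega> ^ (2 * l + 1) \<partial>M)
    = (\<integral>\<omega>. odd_stein l (v 0) (y \<omega>) * (real (2 * l + 1) * x \<omega> ^ (2 * l + 1 - 1) * v 1) \<partial>M)"
    using odd_power_by_parts[of I 0 z v, OF I(1,2) zV _ sm, of l] by (simp add: v_def z)
  also have "\<dots> = (\<integral>\<omega>. (v 1 * (2 * real l + 1)) * (odd_stein l (v 0) (y \<omega>) * x \<omega> ^ (2 * l)) \<partial>M)"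
    by (intro Bochner_Integration.integral_cong refl) (simp add: mult_ac)
  finally show ?thesis by (simp add: v_def z)
qed

text \<open>\<open>S\<close> is the limiting variance. The expression in \<open>S1\<close> is, up to
  a constant factor, the variance of the first chaos component of the normalised sum; its
  convergence to 0 sends the mean of R to 0 and removes the correlation with \<open>B\<close>. Q and
  R then concentrate at \<open>S\<close> and 0, and \<open>gaussian_interpolation_bound\<close>
  concludes.\<close>

theorem gaussian_array_clt:
  fixes y :: "nat \<Rightarrow> nat \<Rightarrow> 'a \<Rightarrow> real" and w :: "nat \<Rightarrow> nat \<Rightarrow> real" and N :: "nat \<Rightarrow> nat"
  assumes sr: "\<And>n. short_range r \<rho> (N n) (y n)" and B: "B \<in> V"
    and w: "\<And>n j. \<bar>w n j\<bar> \<le> A" and N: "\<And>n. real (N n) \<le> T * real n"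
    and S: "(\<lambda>n. (1 / real n) * (\<Sum>j<N n. \<Sum>k<N n. w n j * w n k *
        (\<integral>\<omega>. y n j \<omega> ^ (2 * l + 1) * y n k \<omega> ^ (2 * l + 1) \<partial>M))) \<longlonglongrightarrow> S"
    and S1: "(\<lambda>n. (1 / real n) * (\<Sum>j<N n. \<Sum>k<N n. w n j * w n k *
        ((\<integral>\<omega>. y n j \<omega> * y n j \<omega> \<partial>M) ^ l * (\<integral>\<omega>. y n k \<omega> * y n k \<omega> \<partial>M) ^ l * (\<integral>\<omega>. y n j \<omega> * y n k \<omega> \<partial>M)))) \<longlonglongrightarrow> 0"
  shows "(\<lambda>n. \<integral>\<omega>. iexp ((\<Sum>j<N n. w n j * y n j \<omega> ^ (2 * l + 1)) / sqrt (real n) + B \<omega>) \<partial>M)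
     \<longlonglongrightarrow> exp (- S / 2) *\<^sub>R (\<integral>\<omega>. iexp (B \<omega>) \<partial>M)"
proof -
  have r0: "r 0 \<ge> 0" and yV: "\<And>n j. j < N n \<Longrightarrow> y n j \<in> V" using sr by (auto simp: short_range_def)
  have A0: "A \<ge> 0" using order_trans[OF abs_ge_zero w[of 0 0]] .
  define s where "s n j = (\<integral>\<omega>. y n j \<omega> * y n j \<omega> \<partial>M)" for n j
  define c where "c n = 1 / sqrt (real n)" for n
  have c2: "(c n)\<^sup>2 = 1 / real n" for n by (simp add: c_def power_divide)
  define u where "u n j k = (c n)\<^sup>2 * w n j * w n k * (\<integral>\<omega>. y n j \<omega> * y n k \<omega> \<partial>M) * (2 * real l + 1)" for n j k
  define Q where "Q n \<omega> = (\<Sum>j<N n. \<Sum>k<N n. u n j k * (odd_stein l (s n j) (y n j \<omega>) * y n k \<omega> ^ (2 * l)))" for n \<omega>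
  define b where "b n j = (\<integral>\<omega>. y n j \<omega> * B \<omega> \<partial>M)" for n j
  define R where "R n \<omega> = (\<Sum>j<N n. (c n * w n j * b n j) * odd_stein l (s n j) (y n j \<omega>))" for n \<omega>
  have am: "all_moments M (\<lambda>\<omega>. odd_stein l (s n j) (y n j \<omega>))" if "j < N n" for n j
    by (rule all_moments_odd_stein[OF yV[OF that]])
  have amQ: "all_moments M (Q n)" for n unfolding Q_def
    by (intro all_moments_sum all_moments_cmult all_moments_mult all_moments_power V_moments yV am) auto
  have amR: "all_moments M (R n)" for n unfolding R_def
    by (intro all_moments_sum all_moments_cmult am) auto
  have EQ: "(\<integral>\<omega>. Q n \<omega> \<partial>M) = (1 / real n) * (\<Sum>j<N n. \<Sum>k<N n. w n j * w n k *
        (\<integral>\<omega>. y n j \<omega> ^ (2 * l + 1) * y n k \<omega> ^ (2 * l + 1) \<partial>M))" for n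
  proof -
    have "(\<integral>\<omega>. Q n \<omega> \<partial>M) = (\<Sum>j<N n. \<Sum>k<N n. u n j k * (\<integral>\<omega>. odd_stein l (s n j) (y n j \<omega>) * y n k \<omega> ^ (2 * l) \<partial>M))"
      unfolding Q_def
      by (rule integral_double_sum) (intro all_moments_integrable all_moments_mult all_moments_power V_moments yV am; simp)
    also have "\<dots> = (\<Sum>j<N n. \<Sum>k<N n. (c n)\<^sup>2 * (w n j * w n k *
        (\<integral>\<omega>. y n j \<omega> ^ (2 * l + 1) * y n k \<omega> ^ (2 * l + 1) \<partial>M)))"
    proof (intro sum.cong refl)
      fix j k assume "j \<in> {..<N n}" "k \<in> {..<N n}"
      then have jk: "j < N n" "k < N n" by auto
      show "u n j k * (\<integral>\<omega>. odd_stein l (s n j) (y n j \<omega>) * y n k \<omega> ^ (2 * l) \<partial>M) = (c n)\<^sup>2 * (w n j * w n k *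
        (\<integral>\<omega>. y n j \<omega> ^ (2 * l + 1) * y n k \<omega> ^ (2 * l + 1) \<partial>M))"
        unfolding odd_power_covariance_by_parts[OF yV[OF jk(1)] yV[OF jk(2)]] u_def s_def
        by (simp only: mult_ac)
    qed
    finally show ?thesis unfolding c2 by (simp add: sum_distrib_left)
  qed
  have devQ: "(\<lambda>n. \<integral>\<omega>. \<bar>Q n \<omega> - (\<integral>\<omega>. Q n \<omega> \<partial>M)\<bar> \<partial>M) \<longlonglongrightarrow> 0"
  proof -
    obtain C where C: "C \<ge> 0" "\<And>N y u D. short_range r \<rho> N y \<Longrightarrow> D \<ge> 0 \<Longrightarrow> (\<forall>j<N. \<forall>k<N. \<bar>u j k\<bar> \<le> D * r (nat_dist j k)) \<Longrightarrow>
    (\<integral>\<omega>. \<bar>(\<Sum>j<N. \<Sum>k<N. u j k * (odd_stein l (\<integral>\<omega>. y j \<omega> * y j \<omega> \<partial>M) (y j \<omega>) * y k \<omega> ^ (2 * l)))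
      - (\<integral>\<omega>. (\<Sum>j<N. \<Sum>k<N. u j k * (odd_stein l (\<integral>\<omega>. y j \<omega> * y j \<omega> \<partial>M) (y j \<omega>) * y k \<omega> ^ (2 * l))) \<partial>M)\<bar> \<partial>M)
      \<le> C * D * sqrt (real N)"
      using quadratic_stein_deviation[of r \<rho> l "2 * l", OF r0] by blast
    \<comment> \<open>The coefficients of Q carry 1 / n, while
      \<open>quadratic_stein_deviation\<close> costs a factor of order sqrt n; the product still
      tends to 0.\<close>
    define D where "D n = A\<^sup>2 * (2 * real l + 1) / real n" for n
    have D0: "D n \<ge> 0" for n unfolding D_def by simp
    have bnd: "(\<integral>\<omega>. \<bar>Q n \<omega> - (\<integral>\<omega>. Q n \<omega> \<partial>M)\<bar> \<partial>M) \<le> C * D n * sqrt (T * real n)" for n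
    proof -
      have "(\<integral>\<omega>. \<bar>Q n \<omega> - (\<integral>\<omega>. Q n \<omega> \<partial>M)\<bar> \<partial>M) \<le> C * D n * sqrt (real (N n))"
        unfolding Q_def s_def
      proof (rule C(2)[OF sr D0], intro allI impI)
        fix j k assume jk: "j < N n" "k < N n"
        have cb: "\<bar>\<integral>\<omega>. y n j \<omega> * y n k \<omega> \<partial>M\<bar> \<le> r (nat_dist j k)" and rp: "0 \<le> r (nat_dist j k)"
          using sr[of n] jk by (auto simp: short_range_def)
        have "\<bar>u n j k\<bar> = (1 / real n) * (\<bar>w n j\<bar> * \<bar>w n k\<bar>) * \<bar>\<integral>\<omega>. y n j \<omega> * y n k \<omega> \<partial>M\<bar> * (2 * real l + 1)"
          unfolding u_def c2 by (simp add: abs_mult)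
        also have "\<dots> \<le> (1 / real n) * (A * A) * r (nat_dist j k) * (2 * real l + 1)"
          using w A0 cb rp by (intro mult_right_mono mult_mono mult_left_mono mult_nonneg_nonneg) auto
        finally show "\<bar>u n j k\<bar> \<le> D n * r (nat_dist j k)" by (simp add: D_def power2_eq_square mult_ac)
      qed
      also have "\<dots> \<le> C * D n * sqrt (T * real n)"
        using C(1) D0 N by (intro mult_left_mono) auto
      finally show ?thesis .
    qed
    have "(\<lambda>n. C * D n * sqrt (T * real n)) \<longlonglongrightarrow> 0"
    proof -
      have "(\<lambda>n. (1 / real n) * sqrt (real n)) \<longlonglongrightarrow> 0" by real_asymp
      from tendsto_mult_left[OF this, of "C * (A\<^sup>2 * (2 * real l + 1)) * sqrt T"]
      show ?thesis by (simp add: D_def real_sqrt_mult mult_ac)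
    qed
    then show ?thesis
      by (rule Lim_null_comparison[rotated]) (use bnd in auto)
  qed
  have devR: "(\<lambda>n. \<integral>\<omega>. \<bar>R n \<omega> - (\<integral>\<omega>. R n \<omega> \<partial>M)\<bar> \<partial>M) \<longlonglongrightarrow> 0"
  proof -
    obtain C where C: "C \<ge> 0" "\<And>N y u. short_range r \<rho> N y \<Longrightarrow>
    (\<integral>\<omega>. \<bar>(\<Sum>j<N. u j * odd_stein l (\<integral>\<omega>. y j \<omega> * y j \<omega> \<partial>M) (y j \<omega>))
       - (\<integral>\<omega>. (\<Sum>j<N. u j * odd_stein l (\<integral>\<omega>. y j \<omega> * y j \<omega> \<partial>M) (y j \<omega>)) \<partial>M)\<bar> \<partial>M) \<le> C * sqrt (\<Sum>j<N. (u j)\<^sup>2)"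
      using linear_stein_deviation[of r \<rho> l, OF r0] by blast
    \<comment> \<open>The squared covariances with \<open>B\<close> have a sum bounded uniformly in
      n, so the factor 1 / n from the normalisation survives.\<close>
    define E where "E = A\<^sup>2 * (\<rho> * (\<integral>\<omega>. B \<omega> * B \<omega> \<partial>M))"
    have bnd: "(\<integral>\<omega>. \<bar>R n \<omega> - (\<integral>\<omega>. R n \<omega> \<partial>M)\<bar> \<partial>M) \<le> C * sqrt (1 / real n * E)" for n
    proof -
      have "(\<integral>\<omega>. \<bar>R n \<omega> - (\<integral>\<omega>. R n \<omega> \<partial>M)\<bar> \<partial>M) \<le> C * sqrt (\<Sum>j<N n. (c n * w n j * b n j)\<^sup>2)"
        unfolding R_def s_def by (rule C(2)[OF sr])
      also have "\<dots> \<le> C * sqrt (1 / real n * E)"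
      proof (intro mult_left_mono real_sqrt_le_mono C(1))
        have "(\<Sum>j<N n. (c n * w n j * b n j)\<^sup>2) \<le> (\<Sum>j<N n. (1 / real n) * A\<^sup>2 * (b n j)\<^sup>2)"
          unfolding power_mult_distrib c2
          using w A0 by (intro sum_mono mult_right_mono mult_left_mono) (auto simp: abs_le_square_iff[symmetric])
        also have "\<dots> = (1 / real n) * A\<^sup>2 * (\<Sum>j<N n. (b n j)\<^sup>2)" by (simp add: sum_distrib_left)
        also have "\<dots> \<le> (1 / real n) * A\<^sup>2 * (\<rho> * (\<integral>\<omega>. B \<omega> * B \<omega> \<partial>M))"
          unfolding b_def by (intro mult_left_mono bessel_inequality[OF sr B]) auto
        finally show "(\<Sum>j<N n. (c n * w n j * b n j)\<^sup>2) \<le> 1 / real n * E" by (simp add: E_def)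
      qed
      finally show ?thesis .
    qed
    have "(\<lambda>n. C * sqrt (1 / real n * E)) \<longlonglongrightarrow> C * sqrt (0 * E)"
      by (intro tendsto_intros lim_1_over_n)
    then show ?thesis
      by (intro Lim_null_comparison[of "\<lambda>n. \<integral>\<omega>. \<bar>R n \<omega> - (\<integral>\<omega>. R n \<omega> \<partial>M)\<bar> \<partial>M" "\<lambda>n. C * sqrt (1 / real n * E)"]) (use bnd in auto)
  qed
  have ER: "(\<lambda>n. \<integral>\<omega>. R n \<omega> \<partial>M) \<longlonglongrightarrow> 0"
  proof -
    obtain \<kappa> where \<kappa>: "\<And>x. x \<in> V \<Longrightarrow> (\<integral>\<omega>. odd_stein l (\<integral>\<omega>. x \<omega> * x \<omega> \<partial>M) (x \<omega>) \<partial>M) = \<kappa> * (\<integral>\<omega>. x \<omega> * x \<omega> \<partial>M) ^ l"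
      using odd_stein_mean by blast
    \<comment> \<open>Up to \<open>\<kappa>\<close> the first chaos component of the normalised
      sum.\<close>
    define Z where "Z n \<omega> = (\<Sum>j<N n. (c n * w n j * s n j ^ l) * y n j \<omega>)" for n \<omega>
    have Z: "Z n \<in> V" for n unfolding Z_def by (intro V_sum V_cmult yV) auto
    have 1: "(\<integral>\<omega>. R n \<omega> \<partial>M) = \<kappa> * (\<integral>\<omega>. Z n \<omega> * B \<omega> \<partial>M)" for n
    proof -
      have "(\<integral>\<omega>. R n \<omega> \<partial>M) = (\<Sum>j<N n. (c n * w n j * b n j) * (\<integral>\<omega>. odd_stein l (s n j) (y n j \<omega>) \<partial>M))"
        unfolding R_def using all_moments_integrable[OF am] by (subst Bochner_Integration.integral_sum) auto
      also have "\<dots> = (\<Sum>j<N n. \<kappa> * ((c n * w n j * s n j ^ l) * (\<integral>\<omega>. y n j \<omega> * B \<omega> \<partial>M)))"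
        using \<kappa>[OF yV] by (intro sum.cong refl) (simp add: s_def b_def)
      also have "\<dots> = \<kappa> * (\<Sum>j<N n. (\<integral>\<omega>. (c n * w n j * s n j ^ l) * (y n j \<omega> * B \<omega>) \<partial>M))"
        by (simp add: sum_distrib_left)
      also have "(\<Sum>j<N n. (\<integral>\<omega>. (c n * w n j * s n j ^ l) * (y n j \<omega> * B \<omega>) \<partial>M)) = (\<integral>\<omega>. (\<Sum>j<N n. (c n * w n j * s n j ^ l) * (y n j \<omega> * B \<omega>)) \<partial>M)"
        using V_integrable_mult[OF yV B] by (subst Bochner_Integration.integral_sum) auto
      also have "\<dots> = (\<integral>\<omega>. Z n \<omega> * B \<omega> \<partial>M)" unfolding Z_def by (simp add: sum_distrib_right mult.assoc)
      finally show ?thesis .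
    qed
    have 2: "(\<integral>\<omega>. Z n \<omega> * Z n \<omega> \<partial>M) = (1 / real n) * (\<Sum>j<N n. \<Sum>k<N n. w n j * w n k *
        (s n j ^ l * s n k ^ l * (\<integral>\<omega>. y n j \<omega> * y n k \<omega> \<partial>M)))" for n
    proof -
      have "(\<integral>\<omega>. Z n \<omega> * Z n \<omega> \<partial>M) = (\<integral>\<omega>. (\<Sum>j<N n. \<Sum>k<N n. ((c n)\<^sup>2 * (w n j * w n k * (s n j ^ l * s n k ^ l))) * (y n j \<omega> * y n k \<omega>)) \<partial>M)"
        unfolding Z_def by (simp add: sum_product power2_eq_square mult_ac)
      also have "\<dots> = (\<Sum>j<N n. \<Sum>k<N n. ((c n)\<^sup>2 * (w n j * w n k * (s n j ^ l * s n k ^ l))) * (\<integral>\<omega>. y n j \<omega> * y n k \<omega> \<partial>M))"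
        using V_integrable_mult[OF yV yV] by (intro integral_double_sum) auto
      finally show ?thesis unfolding c2 by (simp add: sum_distrib_left mult_ac)
    qed
    have "(\<lambda>n. (\<integral>\<omega>. Z n \<omega> * Z n \<omega> \<partial>M) * (\<integral>\<omega>. B \<omega> * B \<omega> \<partial>M)) \<longlonglongrightarrow> 0"
      using tendsto_mult_left_zero[OF S1[folded s_def]] unfolding 2 .
    then have "(\<lambda>n. (\<integral>\<omega>. Z n \<omega> * B \<omega> \<partial>M)\<^sup>2) \<longlonglongrightarrow> 0"
      by (rule Lim_null_comparison[rotated]) (use mean_mult_square_le[OF V_moments[OF Z] V_moments[OF B]] in auto)
    from tendsto_real_sqrt[OF this] have "(\<lambda>n. \<integral>\<omega>. Z n \<omega> * B \<omega> \<partial>M) \<longlonglongrightarrow> 0"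
      by (simp add: tendsto_rabs_zero_iff)
    from tendsto_mult_right_zero[OF this, of \<kappa>] show ?thesis unfolding 1 .
  qed
  define err where "err n = (\<integral>\<omega>. \<bar>Q n \<omega> - S\<bar> \<partial>M) + (\<integral>\<omega>. \<bar>R n \<omega>\<bar> \<partial>M)" for n
  have err: "err \<longlonglongrightarrow> 0"
  proof -
    define e where "e n = ((\<integral>\<omega>. \<bar>Q n \<omega> - (\<integral>\<omega>. Q n \<omega> \<partial>M)\<bar> \<partial>M) + \<bar>(\<integral>\<omega>. Q n \<omega> \<partial>M) - S\<bar>)
      + ((\<integral>\<omega>. \<bar>R n \<omega> - (\<integral>\<omega>. R n \<omega> \<partial>M)\<bar> \<partial>M) + \<bar>\<integral>\<omega>. R n \<omega> \<partial>M\<bar>)" for n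
    have sh: "(\<integral>\<omega>. \<bar>Z \<omega> - a\<bar> \<partial>M) \<le> (\<integral>\<omega>. \<bar>Z \<omega> - m\<bar> \<partial>M) + \<bar>m - a\<bar>" if Z: "all_moments M Z" for Z a m
    proof -
      have i: "integrable M (\<lambda>\<omega>. \<bar>Z \<omega> - a\<bar>)" for a
        by (intro all_moments_integrable all_moments_abs all_moments_diff Z all_moments_const)
      have "(\<integral>\<omega>. \<bar>Z \<omega> - a\<bar> \<partial>M) \<le> (\<integral>\<omega>. \<bar>Z \<omega> - m\<bar> + \<bar>m - a\<bar> \<partial>M)"
        using i by (intro integral_mono) auto
      also have "\<dots> = (\<integral>\<omega>. \<bar>Z \<omega> - m\<bar> \<partial>M) + \<bar>m - a\<bar>" using i by (simp add: prob_space)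
      finally show ?thesis .
    qed
    have le: "err n \<le> e n" for n
      unfolding err_def e_def using sh[OF amQ, of n S] sh[OF amR, of n 0 "\<integral>\<omega>. R n \<omega> \<partial>M"]
      by (intro add_mono) auto
    have "(\<lambda>n. (\<integral>\<omega>. Q n \<omega> \<partial>M) - S) \<longlonglongrightarrow> 0" unfolding EQ using S by (simp add: LIM_zero_iff)
    then have "e \<longlonglongrightarrow> 0 + \<bar>0\<bar> + (0 + \<bar>0\<bar>)" unfolding e_def
      by (intro tendsto_add devQ devR ER tendsto_rabs)
    then have "e \<longlonglongrightarrow> 0" by simp
    then show ?thesis
    proof (rule Lim_null_comparison[rotated], intro always_eventually allI)
      fix n
      have "0 \<le> err n" unfolding err_def by simp
      then show "norm (err n) \<le> e n" using le[of n] by simp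
    qed
  qed
  define \<Psi> where "\<Psi> n = (\<integral>\<omega>. iexp (c n * (\<Sum>j<N n. w n j * y n j \<omega> ^ (2 * l + 1)) + B \<omega>) \<partial>M)" for n
  define \<Psi>0 where "\<Psi>0 = (\<integral>\<omega>. iexp (B \<omega>) \<partial>M)"
  have "cmod (exp (S / 2) *\<^sub>R \<Psi> n - \<Psi>0) \<le> exp (\<bar>S\<bar> / 2) * err n" for n
    unfolding err_def \<Psi>_def \<Psi>0_def Q_def R_def u_def b_def s_def
    by (rule gaussian_interpolation_bound[OF yV B])
  then have "(\<lambda>n. exp (S / 2) *\<^sub>R \<Psi> n - \<Psi>0) \<longlonglongrightarrow> 0"
    by (intro Lim_null_comparison[OF _ tendsto_mult_right_zero[OF err, of "exp (\<bar>S\<bar> / 2)"]]) auto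
  then have "(\<lambda>n. exp (S / 2) *\<^sub>R \<Psi> n) \<longlonglongrightarrow> \<Psi>0" by (simp add: LIM_zero_iff)
  from tendsto_scaleR[OF tendsto_const this, of "exp (- S / 2)"]
  have "\<Psi> \<longlonglongrightarrow> exp (- S / 2) *\<^sub>R \<Psi>0" by (simp add: exp_minus)
  then show ?thesis unfolding \<Psi>_def \<Psi>0_def c_def by simp
qed

end

section \<open>Increments of a self-similar kernel\<close>

text \<open>A derivative bounded below by a positive number forces linear growth, which an upper
  bound by y^b with b < 1 excludes.\<close>

lemma derivative_nonpos_from_growth:
  fixes f f' :: "real \<Rightarrow> real"
  assumes d: "\<And>y. y > x \<Longrightarrow> (f has_real_derivative f' y) (at y)"
    and lower: "\<And>y. y > x \<Longrightarrow> f' y \<ge> \<delta>" and growth: "\<And>y. y > x \<Longrightarrow> f y \<le> K * y powr b"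
    and x: "x > 0" and b: "b < 1"
  shows "\<delta> \<le> 0"
proof (rule ccontr)
  assume "\<not> \<delta> \<le> 0"
  then have \<delta>: "\<delta> > 0" by simp
  have "f (x + 1) + (y - (x + 1)) * \<delta> \<le> K * y powr b" if y: "y > x + 1" for y
  proof -
    have "\<exists>z>x + 1. z < y \<and> f y - f (x + 1) = (y - (x + 1)) * f' z"
      by (rule MVT2) (use y d in auto)
    then obtain z where "z > x + 1" "f y - f (x + 1) = (y - (x + 1)) * f' z" by blast
    moreover have "(y - (x + 1)) * \<delta> \<le> (y - (x + 1)) * f' z"
      using lower[of z] \<open>z > x + 1\<close> y by (intro mult_left_mono) auto
    ultimately show ?thesis using growth[of y] y by linarith
  qed
  then have "eventually (\<lambda>y. f (x + 1) + (y - (x + 1)) * \<delta> \<le> K * y powr b) at_top"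
    using eventually_gt_at_top[of "x + 1"] by (rule eventually_mono[rotated])
  moreover have "filterlim (\<lambda>y. f (x + 1) + (y - (x + 1)) * \<delta> - K * y powr b) at_top at_top"
    using \<delta> b by real_asymp
  then have "eventually (\<lambda>y. f (x + 1) + (y - (x + 1)) * \<delta> - K * y powr b > 0) at_top"
    by (rule filterlim_at_top_dense[THEN iffD1, rule_format])
  ultimately have "eventually (\<lambda>y::real. False) at_top" by eventually_elim simp
  then show False by simp
qed

text \<open>The number x^a lies between 1 and x.\<close>

lemma powr_minus_one_le:
  fixes x a :: real
  assumes "x > 0" "0 < a" "a \<le> 1"
  shows "\<bar>x powr a - 1\<bar> \<le> \<bar>x - 1\<bar>"
proof (cases "x \<ge> 1")
  case True
  then have "1 powr a \<le> x powr a" "x powr a \<le> x powr 1" using assms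
    by (intro powr_mono2 powr_mono; simp)+
  then show ?thesis using True by simp
next
  case False
  then have "x powr a \<le> 1 powr a" "x powr 1 \<le> x powr a" using assms
    by (intro powr_mono2 powr_mono'; simp)+
  then show ?thesis using False assms by simp
qed

text \<open>The hypotheses on the profile in quantitative form. \<open>L\<close> bounds the
  derivative of \<psi>: \<open>near1\<close> restates this for \<phi>, and \<open>near0\<close> is
  its integrated version, which describes the singularity at 1. \<open>growth\<close> will come from
  Cauchy-Schwarz and self-similarity.\<close>

locale kernel_profile =
  fixes \<alpha> \<beta> lam C1 C2 \<theta> L K :: real and \<phi> \<phi>1 \<phi>2 :: "real \<Rightarrow> real"
  assumes \<alpha>: "0 < \<alpha>" "\<alpha> < 1" and \<beta>: "0 < \<beta>" "\<beta> \<le> 1 / 2" "\<alpha> \<le> 2 * \<beta>"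
    and \<theta>: "1 < \<theta>" and cpos: "lam > 0" "C1 > 0" "C2 > 0" "L \<ge> 0"
    and d1: "\<And>x. x > 1 \<Longrightarrow> (\<phi> has_real_derivative \<phi>1 x) (at x)"
    and d2: "\<And>x. x > 1 \<Longrightarrow> (\<phi>1 has_real_derivative \<phi>2 x) (at x)"
    and near2: "\<And>x. 1 < x \<Longrightarrow> x \<le> 2 \<Longrightarrow> \<bar>\<phi>2 x\<bar> \<le> C1 * (x - 1) powr (\<alpha> - 2)"
    and far2: "\<And>x. x > 2 \<Longrightarrow> \<bar>\<phi>2 x\<bar> \<le> C2 * x powr (- \<theta> - 1)"
    and near1: "\<And>x. 1 < x \<Longrightarrow> x \<le> 2 \<Longrightarrow> \<bar>\<phi>1 x\<bar> \<le> L + lam * (x - 1) powr (\<alpha> - 1)"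
    and near0: "\<And>x. 1 \<le> x \<Longrightarrow> x \<le> 2 \<Longrightarrow> \<bar>\<phi> x + lam * (x - 1) powr \<alpha> - \<phi> 1\<bar> \<le> L * (x - 1)"
    and growth: "\<And>x. x \<ge> 1 \<Longrightarrow> \<bar>\<phi> x\<bar> \<le> K * x powr \<beta>"
begin

text \<open>By \<open>far2\<close> the function \<phi>' minus its claimed bound is nondecreasing, so
  its value at x bounds \<phi>' from below on the whole half line beyond x. Were this value
  positive, \<phi> would grow linearly, against \<open>growth\<close> with \<beta> \<le> 1/2. The
  lower bound is the same argument for - \<phi>.\<close>

lemma profile_derivative_far_bound:
  assumes x: "x > 2"
  shows "\<bar>\<phi>1 x\<bar> \<le> C2 / \<theta> * x powr (- \<theta>)"
proof -
  have dp: "((\<lambda>z. C2 / \<theta> * z powr (- \<theta>)) has_real_derivative - C2 * z powr (- \<theta> - 1)) (at z)" if "z > 0" for z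
    using that \<theta> by (auto intro!: derivative_eq_intros)
  have le: "z powr (- \<theta>) \<ge> 0" for z :: real by simp
  have "\<phi>1 x - C2 / \<theta> * x powr (- \<theta>) \<le> 0"
  proof (rule derivative_nonpos_from_growth[of x \<phi> \<phi>1 _ K \<beta>])
    show "\<phi>1 x - C2 / \<theta> * x powr (- \<theta>) \<le> \<phi>1 y" if y: "y > x" for y
    proof -
      have "\<phi>1 x - C2 / \<theta> * x powr (- \<theta>) \<le> \<phi>1 y - C2 / \<theta> * y powr (- \<theta>)"
      proof (rule DERIV_nonneg_imp_nondecreasing[of x y "\<lambda>z. \<phi>1 z - C2 / \<theta> * z powr (- \<theta>)"])
        fix z assume "x \<le> z" "z \<le> y"
        then show "\<exists>d. ((\<lambda>z. \<phi>1 z - C2 / \<theta> * z powr (- \<theta>)) has_real_derivative d) (at z) \<and> 0 \<le> d"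
          using DERIV_diff[OF d2 dp, of z] far2[of z] x by (intro exI[of _ "\<phi>2 z - - C2 * z powr (- \<theta> - 1)"]) auto
      qed (use y in auto)
      then show ?thesis using le[of y] cpos \<theta> by (smt (verit) divide_nonneg_pos mult_nonneg_nonneg)
    qed
    show "\<phi> y \<le> K * y powr \<beta>" if "y > x" for y using growth[of y] that x by auto
  qed (use d1 x \<beta> in auto)
  moreover have "- \<phi>1 x - C2 / \<theta> * x powr (- \<theta>) \<le> 0"
  proof (rule derivative_nonpos_from_growth[of x "\<lambda>z. - \<phi> z" "\<lambda>z. - \<phi>1 z" _ K \<beta>])
    show "- \<phi>1 x - C2 / \<theta> * x powr (- \<theta>) \<le> - \<phi>1 y" if y: "y > x" for y
    proof -
      have "- \<phi>1 x - C2 / \<theta> * x powr (- \<theta>) \<le> - \<phi>1 y - C2 / \<theta> * y powr (- \<theta>)"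
      proof (rule DERIV_nonneg_imp_nondecreasing[of x y "\<lambda>z. - \<phi>1 z - C2 / \<theta> * z powr (- \<theta>)"])
        fix z assume "x \<le> z" "z \<le> y"
        then show "\<exists>d. ((\<lambda>z. - \<phi>1 z - C2 / \<theta> * z powr (- \<theta>)) has_real_derivative d) (at z) \<and> 0 \<le> d"
          using DERIV_diff[OF DERIV_minus[OF d2] dp, of z] far2[of z] x by (intro exI[of _ "- \<phi>2 z - - C2 * z powr (- \<theta> - 1)"]) auto
      qed (use y in auto)
      then show ?thesis using le[of y] cpos \<theta> by (smt (verit) divide_nonneg_pos mult_nonneg_nonneg)
    qed
    show "- \<phi> y \<le> K * y powr \<beta>" if "y > x" for y using growth[of y] that x by auto
    show "((\<lambda>z. - \<phi> z) has_real_derivative - \<phi>1 y) (at y)" if "y > x" for y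
      using d1[of y] that x by (auto intro!: DERIV_minus)
  qed (use x \<beta> in auto)
  ultimately show ?thesis by linarith
qed

section \<open>The covariance kernel and its mixed differences\<close>

text \<open>By self-similarity this is the covariance of the process at times \<open>s\<close> and
  \<open>t\<close>; the value 0 at time 0 reflects X_0 = 0.\<close>

definition kern :: "real \<Rightarrow> real \<Rightarrow> real" where
  "kern s t = (if min s t = 0 then 0 else min s t powr (2 * \<beta>) * \<phi> (max s t / min s t))"

lemma kern_commute: "kern s t = kern t s"
  by (simp add: kern_def min.commute max.commute)

lemma kern_le: "0 < s \<Longrightarrow> s \<le> t \<Longrightarrow> kern s t = s powr (2 * \<beta>) * \<phi> (t / s)"
  by (simp add: kern_def)

lemma kern_0 [simp]: "t \<ge> 0 \<Longrightarrow> kern 0 t = 0" "t \<ge> 0 \<Longrightarrow> kern t 0 = 0"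
  by (simp_all add: kern_def)

text \<open>
  The covariance of the increments over \<open>[j, j+1]\<close> and \<open>[k, k+1]\<close>.
\<close>
definition gam :: "nat \<Rightarrow> nat \<Rightarrow> real" where
  "gam j k = kern (real j + 1) (real k + 1) - kern (real j + 1) (real k) - kern (real j) (real k + 1) + kern (real j) (real k)"

lemma gam_commute: "gam j k = gam k j"
  by (simp add: gam_def kern_commute)

text \<open>Decay exponent of the increment covariances in the index distance: 2 - \<alpha> comes
  from the singularity of \<phi>'' at 1, and \<theta> from its decay at infinity. Being larger than
  1, it gives summability.\<close>

definition \<eta> :: real where "\<eta> = min \<theta> (2 - \<alpha>)"

lemma \<eta>_gt_1: "\<eta> > 1"
  using \<alpha> \<theta> by (simp add: \<eta>_def)

text \<open>Two applications of the mean value theorem. The first acts in s on the difference in t,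
  so a single intermediate s serves both values of t; the second acts in t on the derivative in s.
  The result is the mixed derivative of the kernel. The gap in \<open>jk\<close> keeps the rectangle
  away from the diagonal, where \<phi>' is singular, and \<open>j \<ge> 1\<close> keeps it away from
  time 0.\<close>

lemma mixed_difference:
  assumes j: "j \<ge> 1" and jk: "real j + 2 \<le> k"
  obtains s t where "real j < s" "s < real j + 1" "k < t" "t < k + 1"
    "kern (real j + 1) (k + 1) - kern (real j + 1) k - kern (real j) (k + 1) + kern (real j) k
      = (2 * \<beta> - 1) * s powr (2 * \<beta> - 2) * \<phi>1 (t / s) - s powr (2 * \<beta> - 2) * (t / s) * \<phi>2 (t / s)"
proof -
  define H where "H s = s powr (2 * \<beta>) * \<phi> ((k + 1) / s) - s powr (2 * \<beta>) * \<phi> (k / s)" for s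
  define P where "P s t = 2 * \<beta> * s powr (2 * \<beta> - 1) * \<phi> (t / s) - s powr (2 * \<beta> - 2) * t * \<phi>1 (t / s)" for s t
  have dh: "((\<lambda>s. s powr (2 * \<beta>) * \<phi> (t / s)) has_real_derivative P s t) (at s)" if "0 < s" "s < t" for s t
  proof -
    have ts: "t / s > 1" using that by simp
    have q: "((\<lambda>s. t / s) has_real_derivative - t / s\<^sup>2) (at s)"
      using that by (auto intro!: derivative_eq_intros simp: power2_eq_square)
    have "((\<lambda>s. s powr (2 * \<beta>) * \<phi> (t / s)) has_real_derivative
       (2 * \<beta> * s powr (2 * \<beta> - 1)) * \<phi> (t / s) + (\<phi>1 (t / s) * (- t / s\<^sup>2)) * s powr (2 * \<beta>)) (at s)"
      by (rule DERIV_mult[OF _ DERIV_chain2[OF d1[OF ts] q]]) (use that in \<open>auto intro!: derivative_eq_intros\<close>)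
    moreover have "s powr (2 * \<beta> - 2) = s powr (2 * \<beta>) / s\<^sup>2"
      using that by (simp add: powr_diff powr_numeral)
    ultimately show ?thesis unfolding P_def by (simp add: mult_ac)
  qed
  have "\<exists>s. real j < s \<and> s < real j + 1 \<and> H (real j + 1) - H (real j) = (real j + 1 - real j) * (P s (k + 1) - P s k)"
    by (rule MVT2) (use j jk in \<open>auto simp: H_def[abs_def] intro!: DERIV_diff dh\<close>)
  then obtain s where s: "real j < s" "s < real j + 1" "H (real j + 1) - H (real j) = P s (k + 1) - P s k" by auto
  have s0: "s > 0" using s j by simp
  have dP: "(P s has_real_derivative ((2 * \<beta> - 1) * s powr (2 * \<beta> - 2) * \<phi>1 (t / s) - s powr (2 * \<beta> - 2) * (t / s) * \<phi>2 (t / s))) (at t)"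
    if "s < t" for t
  proof -
    have ts: "t / s > 1" using that s0 by simp
    have q: "((\<lambda>t. t / s) has_real_derivative 1 / s) (at t)" by (rule DERIV_cdivide[OF DERIV_ident])
    have 1: "((\<lambda>t. \<phi> (t / s)) has_real_derivative \<phi>1 (t / s) * (1 / s)) (at t)"
      by (rule DERIV_chain2[OF d1[OF ts] q])
    have 2: "((\<lambda>t. \<phi>1 (t / s)) has_real_derivative \<phi>2 (t / s) * (1 / s)) (at t)"
      by (rule DERIV_chain2[OF d2[OF ts] q])
    have e: "s powr (2 * \<beta> - 1) = s powr (2 * \<beta> - 2) * s"
      using s0 powr_mult_base[of s "2 * \<beta> - 2"] by (simp add: mult.commute)
    then have e2: "s powr (\<beta> * 2 - 1) = s * s powr (\<beta> * 2 - 2)" by (simp add: mult.commute)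
    show ?thesis unfolding P_def[abs_def]
      by (rule DERIV_cong, (rule derivative_intros 1 2)+) (use s0 e2 in \<open>simp add: e field_simps\<close>)
  qed
  have "\<exists>t. k < t \<and> t < k + 1 \<and> P s (k + 1) - P s k = (k + 1 - k) * ((2 * \<beta> - 1) * s powr (2 * \<beta> - 2) * \<phi>1 (t / s) - s powr (2 * \<beta> - 2) * (t / s) * \<phi>2 (t / s))"
    by (rule MVT2, simp, rule dP, use s jk in linarith)
  then obtain t where t: "k < t" "t < k + 1" "P s (k + 1) - P s k = (2 * \<beta> - 1) * s powr (2 * \<beta> - 2) * \<phi>1 (t / s) - s powr (2 * \<beta> - 2) * (t / s) * \<phi>2 (t / s)" by auto
  have "kern (real j + 1) (k + 1) - kern (real j + 1) k - kern (real j) (k + 1) + kern (real j) k = H (real j + 1) - H (real j)"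
    unfolding H_def using j jk by (simp add: kern_le)
  then show ?thesis using that[OF s(1,2) t(1,2)] s(3) t(3) by simp
qed

text \<open>Two regimes for x = t / s. For x \<le> 2 both derivatives are dominated by the power
  \<alpha> - 2 of x - 1 = (t - s) / s, which contributes L + lam from \<phi>' and 2 C1 from x
  \<phi>''. For x > 2 both decay like x^(-\<theta>), which contributes C2 / \<theta> and C2. As t -
  s \<ge> 1, each decay exponent may be weakened to \<eta>.\<close>

lemma mixed_derivative_bound:
  assumes s: "1 \<le> s" and st: "1 \<le> t - s"
  shows "\<bar>(2 * \<beta> - 1) * s powr (2 * \<beta> - 2) * \<phi>1 (t / s) - s powr (2 * \<beta> - 2) * (t / s) * \<phi>2 (t / s)\<bar>
    \<le> (L + lam + 2 * C1 + C2 / \<theta> + C2) * s powr (2 * \<beta> - \<alpha>) * (t - s) powr (- \<eta>)"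
proof -
  define x where "x = t / s"
  have x1: "x > 1" using s st by (simp add: x_def)
  have C: "0 \<le> L + lam + 2 * C1" "0 \<le> C2 / \<theta> + C2" "0 \<le> C2 / \<theta>" using cpos \<theta> by auto
  have "\<bar>(2 * \<beta> - 1) * s powr (2 * \<beta> - 2) * \<phi>1 x - s powr (2 * \<beta> - 2) * x * \<phi>2 x\<bar>
    \<le> \<bar>(2 * \<beta> - 1) * s powr (2 * \<beta> - 2) * \<phi>1 x\<bar> + \<bar>s powr (2 * \<beta> - 2) * x * \<phi>2 x\<bar>"
    by (rule abs_triangle_ineq4)
  also have "\<dots> \<le> s powr (2 * \<beta> - 2) * \<bar>\<phi>1 x\<bar> + s powr (2 * \<beta> - 2) * (x * \<bar>\<phi>2 x\<bar>)"
  proof (rule add_mono)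
    have "\<bar>(2 * \<beta> - 1) * s powr (2 * \<beta> - 2) * \<phi>1 x\<bar> = \<bar>2 * \<beta> - 1\<bar> * (s powr (2 * \<beta> - 2) * \<bar>\<phi>1 x\<bar>)" by (simp add: abs_mult)
    also have "\<dots> \<le> 1 * (s powr (2 * \<beta> - 2) * \<bar>\<phi>1 x\<bar>)" using \<beta> by (intro mult_right_mono) auto
    finally show "\<bar>(2 * \<beta> - 1) * s powr (2 * \<beta> - 2) * \<phi>1 x\<bar> \<le> s powr (2 * \<beta> - 2) * \<bar>\<phi>1 x\<bar>" by simp
  qed (use x1 in \<open>simp add: abs_mult\<close>)
  also have "\<dots> = s powr (2 * \<beta> - 2) * (\<bar>\<phi>1 x\<bar> + x * \<bar>\<phi>2 x\<bar>)" by (simp add: distrib_left)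
  finally have 1: "\<bar>(2 * \<beta> - 1) * s powr (2 * \<beta> - 2) * \<phi>1 x - s powr (2 * \<beta> - 2) * x * \<phi>2 x\<bar> \<le> s powr (2 * \<beta> - 2) * (\<bar>\<phi>1 x\<bar> + x * \<bar>\<phi>2 x\<bar>)" .
  have ts: "t - s > 0" "t > 0" using s st by auto
  have \<eta>le: "(t - s) powr (- \<eta>) \<ge> 0" "s powr (2 * \<beta> - \<alpha>) \<ge> 0" by simp_all
  show ?thesis
  proof (cases "x \<le> 2")
    case True
    have x0: "0 < x - 1" "x - 1 \<le> 1" using True x1 by auto
    have p: "1 \<le> (x - 1) powr (\<alpha> - 2)" "(x - 1) powr (\<alpha> - 1) \<le> (x - 1) powr (\<alpha> - 2)"
      using x0 \<alpha> powr_mono'[of "\<alpha> - 2" 0 "x - 1"] by (auto intro!: powr_mono')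
    have "\<bar>\<phi>1 x\<bar> \<le> L * (x - 1) powr (\<alpha> - 2) + lam * (x - 1) powr (\<alpha> - 2)"
      using near1[OF x1 True] mult_left_mono[OF p(1), of L] mult_left_mono[OF p(2), of lam] cpos by linarith
    moreover have "x * \<bar>\<phi>2 x\<bar> \<le> 2 * (C1 * (x - 1) powr (\<alpha> - 2))"
      using near2[OF x1 True] True x1 by (intro mult_mono) auto
    ultimately have "\<bar>\<phi>1 x\<bar> + x * \<bar>\<phi>2 x\<bar> \<le> (L + lam + 2 * C1) * (x - 1) powr (\<alpha> - 2)" by (simp add: algebra_simps)
    then have "s powr (2 * \<beta> - 2) * (\<bar>\<phi>1 x\<bar> + x * \<bar>\<phi>2 x\<bar>) \<le> s powr (2 * \<beta> - 2) * ((L + lam + 2 * C1) * (x - 1) powr (\<alpha> - 2))"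
      by (intro mult_left_mono) auto
    also have "(x - 1) powr (\<alpha> - 2) = (t - s) powr (\<alpha> - 2) * s powr (2 - \<alpha>)"
    proof -
      have "x - 1 = (t - s) / s" using s by (simp add: x_def field_simps)
      moreover have "s powr (2 - \<alpha>) = 1 / s powr (\<alpha> - 2)"
        using powr_minus_divide[of s "\<alpha> - 2"] by simp
      ultimately show ?thesis using s ts by (simp add: powr_divide)
    qed
    also have "s powr (2 * \<beta> - 2) * ((L + lam + 2 * C1) * ((t - s) powr (\<alpha> - 2) * s powr (2 - \<alpha>))) = (L + lam + 2 * C1) * s powr (2 * \<beta> - \<alpha>) * (t - s) powr (\<alpha> - 2)"
    proof -
      have "s powr (2 * \<beta> - \<alpha>) = s powr (2 * \<beta> - 2) * s powr (2 - \<alpha>)" by (simp add: powr_add[symmetric])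
      then show ?thesis by simp
    qed
    also have "\<dots> \<le> (L + lam + 2 * C1) * s powr (2 * \<beta> - \<alpha>) * (t - s) powr (- \<eta>)"
      using C st by (intro mult_left_mono powr_mono) (auto simp: \<eta>_def)
    also have "\<dots> \<le> (L + lam + 2 * C1 + (C2 / \<theta> + C2)) * s powr (2 * \<beta> - \<alpha>) * (t - s) powr (- \<eta>)"
      using C \<eta>le by (intro mult_right_mono) auto
    finally show ?thesis using 1 by (simp add: x_def add.assoc)
  next
    case False
    then have x2: "x > 2" by simp
    have "x * \<bar>\<phi>2 x\<bar> \<le> x * (C2 * x powr (- \<theta> - 1))" using far2[OF x2] x2 by (intro mult_left_mono) auto
    also have "\<dots> = C2 * x powr (- \<theta>)" using x2 powr_mult_base[of x "- \<theta> - 1"] by simp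
    finally have "\<bar>\<phi>1 x\<bar> + x * \<bar>\<phi>2 x\<bar> \<le> (C2 / \<theta> + C2) * x powr (- \<theta>)"
      using profile_derivative_far_bound[OF x2] by (simp add: distrib_right)
    then have "s powr (2 * \<beta> - 2) * (\<bar>\<phi>1 x\<bar> + x * \<bar>\<phi>2 x\<bar>) \<le> s powr (2 * \<beta> - 2) * ((C2 / \<theta> + C2) * x powr (- \<theta>))"
      by (intro mult_left_mono) auto
    also have "s powr (2 * \<beta> - 2) * ((C2 / \<theta> + C2) * x powr (- \<theta>)) = (C2 / \<theta> + C2) * s powr (2 * \<beta> - \<alpha>) * (s powr (\<theta> - 2 + \<alpha>) * t powr (- \<theta>))"
    proof -
      have "x powr (- \<theta>) = t powr (- \<theta>) * s powr \<theta>" 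
        using s ts powr_minus_divide[of s "- \<theta>"] by (simp add: x_def powr_divide[of t s] del: powr_minus_divide)
      moreover have "s powr (2 * \<beta> - 2) * s powr \<theta> = s powr (2 * \<beta> - \<alpha>) * s powr (\<theta> - 2 + \<alpha>)"
        unfolding powr_add[symmetric] by (simp add: algebra_simps)
      then have "s powr (2 * \<beta> - 2) * ((C2 / \<theta> + C2) * (t powr (- \<theta>) * s powr \<theta>)) = (C2 / \<theta> + C2) * s powr (2 * \<beta> - \<alpha>) * (s powr (\<theta> - 2 + \<alpha>) * t powr (- \<theta>))"
        by algebra
      ultimately show ?thesis by simp
    qed
    \<comment> \<open>If \<theta> \<ge> 2 - \<alpha>, the power of s is increasing and may be taken
      at t, which leaves the exponent \<alpha> - 2. Otherwise that power is at most 1 because s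
      \<ge> 1, and -\<theta> remains. Both exponents equal - \<eta> in their case.\<close>
    also have "s powr (\<theta> - 2 + \<alpha>) * t powr (- \<theta>) \<le> (t - s) powr (- \<eta>)"
    proof -
      have "s powr (\<theta> - 2 + \<alpha>) * t powr (- \<theta>) \<le> t powr (- \<eta>)"
      proof (cases "\<theta> \<ge> 2 - \<alpha>")
        case True
        then have "s powr (\<theta> - 2 + \<alpha>) * t powr (- \<theta>) \<le> t powr (\<theta> - 2 + \<alpha>) * t powr (- \<theta>)"
          using s ts by (intro mult_right_mono powr_mono2) auto
        also have "\<dots> = t powr (- \<eta>)" using True by (simp add: powr_add[symmetric] \<eta>_def)
        finally show ?thesis .
      next
        case False
        then have "s powr (\<theta> - 2 + \<alpha>) \<le> s powr 0" using s by (intro powr_mono) auto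
        then have "s powr (\<theta> - 2 + \<alpha>) * t powr (- \<theta>) \<le> 1 * t powr (- \<theta>)" using s by (intro mult_right_mono) auto
        then show ?thesis using False by (simp add: \<eta>_def)
      qed
      also have "\<dots> \<le> (t - s) powr (- \<eta>)" using ts s \<eta>_gt_1 by (intro powr_mono2') auto
      finally show ?thesis .
    qed
    then have "(C2 / \<theta> + C2) * s powr (2 * \<beta> - \<alpha>) * (s powr (\<theta> - 2 + \<alpha>) * t powr (- \<theta>)) \<le> (C2 / \<theta> + C2) * s powr (2 * \<beta> - \<alpha>) * (t - s) powr (- \<eta>)"
      using C by (intro mult_left_mono) auto
    also have "\<dots> \<le> (L + lam + 2 * C1 + (C2 / \<theta> + C2)) * s powr (2 * \<beta> - \<alpha>) * (t - s) powr (- \<eta>)"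
      using C \<eta>le by (intro mult_right_mono) auto
    finally show ?thesis using 1 by (simp add: x_def add.assoc)
  qed
qed

end

section \<open>Asymptotics and summable bounds of the increment covariances\<close>

lemma powr_difference_le:
  fixes s m a :: real
  assumes "s > 0" "m > 0" "0 < a" "a \<le> 1"
  shows "\<bar>s powr a - m powr a\<bar> \<le> \<bar>s - m\<bar> * m powr (a - 1)"
proof -
  have m: "m powr a = m * m powr (a - 1)" using assms powr_mult_base[of m "a - 1"] by simp
  have "s powr a - m powr a = m powr a * ((s / m) powr a - 1)"
    using assms by (simp add: powr_divide right_diff_distrib)
  then have "\<bar>s powr a - m powr a\<bar> = m powr a * \<bar>(s / m) powr a - 1\<bar>" by (simp add: abs_mult)
  also have "\<dots> \<le> m powr a * \<bar>s / m - 1\<bar>"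
    using assms by (intro mult_left_mono powr_minus_one_le) auto
  also have "\<bar>s / m - 1\<bar> = \<bar>s - m\<bar> / m"
  proof -
    have "s / m - 1 = (s - m) / m" using assms by (simp add: field_simps)
    then show ?thesis using assms by simp
  qed
  also have "m powr a * (\<bar>s - m\<bar> / m) = \<bar>s - m\<bar> * m powr (a - 1)" using assms by (simp add: m)
  finally show ?thesis .
qed

text \<open>\<open>p - 1\<close> is the gap between two unit intervals at offset \<open>p\<close>;
  overlapping or touching intervals get the value 1.\<close>

definition offset_decay :: "real \<Rightarrow> nat \<Rightarrow> real" where
  "offset_decay e p = (if p \<le> 1 then 1 else (real p - 1) powr (- e))"

lemma offset_decay_nonneg: "offset_decay e p \<ge> 0"
  by (simp add: offset_decay_def)

lemma offset_decay_le_1: "e > 0 \<Longrightarrow> offset_decay e p \<le> 1"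
  using powr_mono2'[of "-e" 1 "real p - 1"] by (auto simp: offset_decay_def)

lemma summable_offset_decay:
  assumes "e > 1"
  shows "summable (offset_decay e)"
proof -
  have "summable (\<lambda>n. real n powr (- e))" using assms by (simp add: summable_real_powr_iff)
  then have "summable (\<lambda>n. real (n + 1) powr (- e))" by (rule summable_ignore_initial_segment)
  moreover have "offset_decay e (n + 2) = real (n + 1) powr (- e)" for n by (simp add: offset_decay_def)
  ultimately have "summable (\<lambda>n. offset_decay e (n + 2))" by simp
  then show ?thesis by (simp only: summable_iff_shift)
qed

context kernel_profile
begin

text \<open>This is \<open>near0\<close> at 1 + d / s multiplied by s^(2 \<beta>); the condition
  \<open>d \<le> s\<close> keeps that point in [1, 2].\<close>

lemma kern_near:
  assumes s: "s > 0" and d: "0 \<le> d" "d \<le> s"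
  shows "\<bar>kern s (s + d) - (s powr (2 * \<beta>) * \<phi> 1 - lam * s powr (2 * \<beta> - \<alpha>) * d powr \<alpha>)\<bar> \<le> L * d * s powr (2 * \<beta> - 1)"
proof -
  define x where "x = 1 + d / s"
  have x: "1 \<le> x" "x \<le> 2" "x - 1 = d / s" using s d by (auto simp: x_def)
  have k: "kern s (s + d) = s powr (2 * \<beta>) * \<phi> x"
    using s d by (simp add: kern_le x_def add_divide_distrib)
  have p: "s powr (2 * \<beta>) * (x - 1) powr \<alpha> = s powr (2 * \<beta> - \<alpha>) * d powr \<alpha>"
    unfolding x(3) using s d by (simp add: powr_divide powr_diff)
  have q: "s powr (2 * \<beta>) * (x - 1) = d * s powr (2 * \<beta> - 1)"
  proof -
    have "s powr (2 * \<beta>) = s * s powr (2 * \<beta> - 1)" using s powr_mult_base[of s "2 * \<beta> - 1"] by simp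
    then show ?thesis unfolding x(3) using s by simp
  qed
  have "kern s (s + d) - (s powr (2 * \<beta>) * \<phi> 1 - lam * s powr (2 * \<beta> - \<alpha>) * d powr \<alpha>)
    = s powr (2 * \<beta>) * (\<phi> x + lam * (x - 1) powr \<alpha> - \<phi> 1)"
    unfolding k using p by (simp add: algebra_simps)
  then have "\<bar>kern s (s + d) - (s powr (2 * \<beta>) * \<phi> 1 - lam * s powr (2 * \<beta> - \<alpha>) * d powr \<alpha>)\<bar>
    = s powr (2 * \<beta>) * \<bar>\<phi> x + lam * (x - 1) powr \<alpha> - \<phi> 1\<bar>" by (simp add: abs_mult)
  also have "\<dots> \<le> s powr (2 * \<beta>) * (L * (x - 1))" by (intro mult_left_mono near0 x) simp
  also have "\<dots> = L * (s powr (2 * \<beta>) * (x - 1))" by simp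
  also have "\<dots> = L * d * s powr (2 * \<beta> - 1)" unfolding q by simp
  finally show ?thesis .
qed

text \<open>Covariances of unit increments at a fixed offset are of order j^c near index j.\<close>

definition c :: real where "c = 2 * \<beta> - \<alpha>"

lemma c_nonneg: "c \<ge> 0"
  using \<beta> by (simp add: c_def)

lemma powr_shift_ratio: "(\<lambda>j. (real j + b) powr e / real j powr e) \<longlonglongrightarrow> 1"
  by real_asymp

text \<open>The kernel near the diagonal is of order j^(2 \<beta>), larger than the order j^c of its
  second differences. The subtracted term does not depend on \<open>i\<close> and \<open>i'\<close>,
  so it cancels in the difference over four corners. What remains is the singular term of
  \<open>kern_near\<close>; relative to j^c the errors are of order j^(\<alpha> - 1), which tends to
  0.\<close>

lemma kern_limit_le:
  fixes i i' :: real
  assumes i: "0 \<le> i" "i \<le> i'"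
  shows "(\<lambda>j. (kern (real j + i) (real j + i') - real j powr (2 * \<beta>) * \<phi> 1) / real j powr c) \<longlonglongrightarrow> - lam * \<bar>i - i'\<bar> powr \<alpha>"
proof -
  define d where "d = i' - i"
  define main where "main j = - lam * d powr \<alpha> * ((real j + i) powr c / real j powr c)" for j
  define er where "er j = L * d * ((real j + i) powr (2 * \<beta> - 1) / real j powr c) + \<bar>\<phi> 1\<bar> * i * (real j powr (2 * \<beta> - 1) / real j powr c)" for j
  have m: "main \<longlonglongrightarrow> - lam * d powr \<alpha> * 1"
    unfolding main_def by (intro tendsto_intros powr_shift_ratio)
  have e: "er \<longlonglongrightarrow> 0"
  proof -
    have "(\<lambda>j. real j powr (\<alpha> - 1)) \<longlonglongrightarrow> 0" using \<alpha> by real_asymp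
    moreover have "eventually (\<lambda>j. real j powr (2 * \<beta> - 1) / real j powr c = real j powr (\<alpha> - 1)) sequentially"
      using eventually_gt_at_top[of 0] by eventually_elim (simp add: c_def powr_diff[symmetric])
    ultimately have a: "(\<lambda>j. real j powr (2 * \<beta> - 1) / real j powr c) \<longlonglongrightarrow> 0"
      by (simp cong: tendsto_cong)
    have "(\<lambda>j. ((real j + i) powr (2 * \<beta> - 1) / real j powr (2 * \<beta> - 1)) * (real j powr (2 * \<beta> - 1) / real j powr c)) \<longlonglongrightarrow> 1 * 0"
      by (intro tendsto_mult powr_shift_ratio a)
    moreover have "eventually (\<lambda>j. ((real j + i) powr (2 * \<beta> - 1) / real j powr (2 * \<beta> - 1)) * (real j powr (2 * \<beta> - 1) / real j powr c)
      = (real j + i) powr (2 * \<beta> - 1) / real j powr c) sequentially"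
      using eventually_gt_at_top[of 0] by eventually_elim simp
    ultimately have "(\<lambda>j. (real j + i) powr (2 * \<beta> - 1) / real j powr c) \<longlonglongrightarrow> 1 * 0"
      by (rule Lim_transform_eventually)
    then have b: "(\<lambda>j. (real j + i) powr (2 * \<beta> - 1) / real j powr c) \<longlonglongrightarrow> 0" by simp
    have "er \<longlonglongrightarrow> L * d * 0 + \<bar>\<phi> 1\<bar> * i * 0" unfolding er_def by (intro tendsto_intros a b)
    then show ?thesis by simp
  qed
  have bnd: "eventually (\<lambda>j. norm ((kern (real j + i) (real j + i') - real j powr (2 * \<beta>) * \<phi> 1) / real j powr c - main j) \<le> er j) sequentially"
    using eventually_gt_at_top[of "nat \<lceil>d\<rceil>"] eventually_gt_at_top[of 0]
  proof eventually_elim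
    case (elim j)
    have j0: "real j > 0" using elim by simp
    have dj: "d \<le> real j + i" using elim i by linarith
    let ?s = "real j + i"
    have s0: "?s > 0" using j0 i by simp
    have "\<bar>kern ?s (?s + d) - (?s powr (2 * \<beta>) * \<phi> 1 - lam * ?s powr (2 * \<beta> - \<alpha>) * d powr \<alpha>)\<bar> \<le> L * d * ?s powr (2 * \<beta> - 1)"
      by (rule kern_near) (use s0 dj i in \<open>auto simp: d_def\<close>)
    moreover have "\<bar>?s powr (2 * \<beta>) * \<phi> 1 - real j powr (2 * \<beta>) * \<phi> 1\<bar> \<le> \<bar>\<phi> 1\<bar> * i * real j powr (2 * \<beta> - 1)"
    proof -
      have "\<bar>?s powr (2 * \<beta>) * \<phi> 1 - real j powr (2 * \<beta>) * \<phi> 1\<bar> = \<bar>?s powr (2 * \<beta>) - real j powr (2 * \<beta>)\<bar> * \<bar>\<phi> 1\<bar>"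
        by (simp add: abs_mult[symmetric] left_diff_distrib)
      also have "\<dots> \<le> (\<bar>?s - real j\<bar> * real j powr (2 * \<beta> - 1)) * \<bar>\<phi> 1\<bar>"
        using s0 j0 \<beta> by (intro mult_right_mono powr_difference_le) auto
      finally show ?thesis using i by (simp add: mult_ac)
    qed
    ultimately have 1: "\<bar>kern ?s (?s + d) - real j powr (2 * \<beta>) * \<phi> 1 - - lam * d powr \<alpha> * ?s powr c\<bar>
      \<le> L * d * ?s powr (2 * \<beta> - 1) + \<bar>\<phi> 1\<bar> * i * real j powr (2 * \<beta> - 1)"
      unfolding c_def by (simp add: mult_ac) 
    have "(kern ?s (?s + d) - real j powr (2 * \<beta>) * \<phi> 1) / real j powr c - main j
      = (kern ?s (?s + d) - real j powr (2 * \<beta>) * \<phi> 1 - - lam * d powr \<alpha> * ?s powr c) / real j powr c"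
      unfolding main_def by (simp add: diff_divide_distrib add_divide_distrib)
    then have "norm ((kern ?s (?s + d) - real j powr (2 * \<beta>) * \<phi> 1) / real j powr c - main j)
      = \<bar>kern ?s (?s + d) - real j powr (2 * \<beta>) * \<phi> 1 - - lam * d powr \<alpha> * ?s powr c\<bar> / real j powr c" by simp
    also have "\<dots> \<le> (L * d * ?s powr (2 * \<beta> - 1) + \<bar>\<phi> 1\<bar> * i * real j powr (2 * \<beta> - 1)) / real j powr c"
      using 1 by (intro divide_right_mono) auto
    also have "\<dots> = er j" unfolding er_def by (simp add: add_divide_distrib)
    finally show ?case by (simp add: d_def)
  qed
  have "(\<lambda>j. (kern (real j + i) (real j + i') - real j powr (2 * \<beta>) * \<phi> 1) / real j powr c - main j) \<longlonglongrightarrow> 0"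
    by (rule Lim_null_comparison[OF bnd e])
  from tendsto_add[OF this m] show ?thesis using i by (simp add: d_def abs_minus_commute)
qed

lemma kern_limit:
  fixes i i' :: real
  assumes i: "0 \<le> i" "0 \<le> i'"
  shows "(\<lambda>j. (kern (real j + i) (real j + i') - real j powr (2 * \<beta>) * \<phi> 1) / real j powr c) \<longlonglongrightarrow> - lam * \<bar>i - i'\<bar> powr \<alpha>"
proof (cases "i \<le> i'")
  case False
  then have "i' \<le> i" by simp
  from kern_limit_le[OF i(2) this] show ?thesis
    unfolding kern_commute[of "_ + i'"] by (simp add: abs_minus_commute)
qed (use kern_limit_le i in blast)

text \<open>Twice the autocovariance of fractional Gaussian noise with Hurst index \<alpha> /
  2.\<close>

definition second_difference :: "int \<Rightarrow> real" where
  "second_difference p = \<bar>of_int p + 1\<bar> powr \<alpha> + \<bar>of_int p - 1\<bar> powr \<alpha> - 2 * \<bar>of_int p\<bar> powr \<alpha>"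

lemma second_difference_minus: "second_difference (- p) = second_difference p"
proof -
  have "\<bar>- of_int p + 1\<bar> = \<bar>of_int p - 1 :: real\<bar>" "\<bar>- of_int p - 1\<bar> = \<bar>of_int p + 1 :: real\<bar>" by linarith+
  then show ?thesis by (simp add: second_difference_def)
qed

lemma gam_limit: "(\<lambda>j. gam j (j + p) / real j powr c) \<longlonglongrightarrow> lam * second_difference (int p)"
proof -
  define f where "f i i' j = (kern (real j + i) (real j + i') - real j powr (2 * \<beta>) * \<phi> 1) / real j powr c" for i i' :: real and j
  have f: "f i i' \<longlonglongrightarrow> - lam * \<bar>i - i'\<bar> powr \<alpha>" if "0 \<le> i" "0 \<le> i'" for i i'
    unfolding f_def by (rule kern_limit[OF that])
  have e: "gam j (j + p) / real j powr c = f 1 (real p + 1) j - f 1 (real p) j - f 0 (real p + 1) j + f 0 (real p) j" for j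
    unfolding gam_def f_def by (simp add: diff_divide_distrib add_divide_distrib add.assoc)
  have "(\<lambda>j. f 1 (real p + 1) j - f 1 (real p) j - f 0 (real p + 1) j + f 0 (real p) j) \<longlonglongrightarrow>
    - lam * \<bar>1 - (real p + 1)\<bar> powr \<alpha> - - lam * \<bar>1 - real p\<bar> powr \<alpha> - - lam * \<bar>0 - (real p + 1)\<bar> powr \<alpha> + - lam * \<bar>0 - real p\<bar> powr \<alpha>"
    by (intro tendsto_intros f) auto
  also have "- lam * \<bar>1 - (real p + 1)\<bar> powr \<alpha> - - lam * \<bar>1 - real p\<bar> powr \<alpha> - - lam * \<bar>0 - (real p + 1)\<bar> powr \<alpha> + - lam * \<bar>0 - real p\<bar> powr \<alpha>
    = lam * second_difference (int p)"
    by (simp add: second_difference_def algebra_simps abs_minus_commute)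
  finally show ?thesis unfolding e .
qed

lemma gam_near_bound: "\<exists>C\<ge>0. \<forall>j. \<bar>gam j (j + p)\<bar> \<le> C * (real j + 1) powr c"
proof -
  have "Bseq (\<lambda>j. gam j (j + p) / real j powr c)"
    using gam_limit convergent_def convergent_imp_Bseq by blast
  then obtain C where C: "C > 0" "\<And>j. \<bar>gam j (j + p) / real j powr c\<bar> \<le> C"
    unfolding Bseq_def by auto
  show ?thesis
  \<comment> \<open>At \<open>j = 0\<close> the quotient by \<open>0 powr c\<close> is 0 by
    convention and carries no information, so \<open>gam 0 p\<close> enters the constant.\<close>
  proof (intro exI[of _ "C + \<bar>gam 0 p\<bar>"] conjI allI)
    fix j
    show "\<bar>gam j (j + p)\<bar> \<le> (C + \<bar>gam 0 p\<bar>) * (real j + 1) powr c"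
    proof (cases "j = 0")
      case False
      then have "\<bar>gam j (j + p)\<bar> \<le> C * real j powr c" using C(2)[of j] by (simp add: abs_divide field_simps)
      also have "\<dots> \<le> (C + \<bar>gam 0 p\<bar>) * (real j + 1) powr c"
        using C(1) c_nonneg by (intro mult_mono powr_mono2) auto
      finally show ?thesis .
    qed (use C in simp)
  qed (use C in simp)
qed

lemma gam_far_bound:
  assumes jk: "j + 2 \<le> k"
  shows "\<bar>gam j k\<bar> \<le> (L + lam + 2 * C1 + C2 / \<theta> + C2) * (real j + 1) powr c * (real k - real j - 1) powr (- \<eta>)"
proof -
  let ?C = "L + lam + 2 * C1 + C2 / \<theta> + C2"
  have C: "?C \<ge> 0" "C2 / \<theta> \<le> ?C" "C2 / \<theta> \<ge> 0" using cpos \<theta> by auto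
  have k1: "real k - real j - 1 \<ge> 1" using jk by linarith
  show ?thesis
  proof (cases "j = 0")
    \<comment> \<open>Two of the four corners lie at time 0 and vanish, which leaves a first
      difference of \<phi>.\<close>
    case True
    have "\<exists>z>real k. z < real k + 1 \<and> \<phi> (real k + 1) - \<phi> (real k) = (real k + 1 - real k) * \<phi>1 z"
      by (rule MVT2) (use jk in \<open>auto intro!: d1\<close>)
    then obtain z where z: "z > real k" "\<phi> (real k + 1) - \<phi> (real k) = \<phi>1 z" by auto
    have z2: "z > 2" using z jk by linarith
    have "gam j k = \<phi>1 z" using True z(2) jk by (simp add: gam_def kern_le)
    then have "\<bar>gam j k\<bar> \<le> C2 / \<theta> * z powr (- \<theta>)" using profile_derivative_far_bound[OF z2] by simp
    also have "\<dots> \<le> C2 / \<theta> * (real k - 1) powr (- \<theta>)"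
      using z jk \<theta> C by (intro mult_left_mono powr_mono2') auto
    also have "\<dots> \<le> ?C * (real k - 1) powr (- \<eta>)"
      using C jk by (intro mult_mono powr_mono) (auto simp: \<eta>_def)
    finally show ?thesis using True by simp
  next
    case False
    obtain s t where st: "real j < s" "s < real j + 1" "real k < t" "t < real k + 1"
      and e: "kern (real j + 1) (real k + 1) - kern (real j + 1) (real k) - kern (real j) (real k + 1) + kern (real j) (real k)
      = (2 * \<beta> - 1) * s powr (2 * \<beta> - 2) * \<phi>1 (t / s) - s powr (2 * \<beta> - 2) * (t / s) * \<phi>2 (t / s)"
      using mixed_difference[of j "real k"] False jk by auto
    have s1: "1 \<le> s" "1 \<le> t - s" using st False jk by linarith+
    have "\<bar>gam j k\<bar> \<le> ?C * s powr (2 * \<beta> - \<alpha>) * (t - s) powr (- \<eta>)"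
      unfolding gam_def e by (rule mixed_derivative_bound[OF s1])
    also have "\<dots> \<le> ?C * (real j + 1) powr c * (real k - real j - 1) powr (- \<eta>)"
      unfolding c_def using s1 st C k1 \<beta> \<eta>_gt_1
      by (intro mult_mono mult_left_mono powr_mono2 powr_mono2') auto
    finally show ?thesis .
  qed
qed

lemma gam_bound:
  obtains C where "C \<ge> 0" "\<And>j k. \<bar>gam j k\<bar> \<le> C * (real (min j k) + 1) powr c * offset_decay \<eta> (nat_dist j k)"
proof -
  obtain A0 where A0: "A0 \<ge> 0" "\<And>j. \<bar>gam j (j + 0)\<bar> \<le> A0 * (real j + 1) powr c" using gam_near_bound[of 0] by blast
  obtain A1 where A1: "A1 \<ge> 0" "\<And>j. \<bar>gam j (j + 1)\<bar> \<le> A1 * (real j + 1) powr c" using gam_near_bound[of 1] by blast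
  let ?C = "L + lam + 2 * C1 + C2 / \<theta> + C2"
  have C: "?C \<ge> 0" using cpos \<theta> by auto
  define D where "D = A0 + A1 + ?C"
  have D: "D \<ge> 0" "A0 \<le> D" "A1 \<le> D" "?C \<le> D" using A0 A1 C by (auto simp: D_def)
  have le: "\<bar>gam j k\<bar> \<le> D * (real j + 1) powr c * offset_decay \<eta> (k - j)" if "j \<le> k" for j k
  proof -
    have "k = j + 0 \<or> k = j + 1 \<or> j + 2 \<le> k" using that by arith
    then consider "k = j + 0" | "k = j + 1" | "j + 2 \<le> k" by blast
    then show ?thesis
    proof cases
      case 1
      then show ?thesis using order_trans[OF A0(2)[of j] mult_right_mono[OF D(2)]] by (simp add: offset_decay_def)
    next
      case 2
      then show ?thesis using order_trans[OF A1(2)[of j] mult_right_mono[OF D(3)]] by (simp add: offset_decay_def)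
    next
      case 3
      have "\<bar>gam j k\<bar> \<le> D * (real j + 1) powr c * (real k - real j - 1) powr (- \<eta>)"
        using D by (intro order_trans[OF gam_far_bound[OF 3]] mult_right_mono) auto
      moreover have "\<not> k - j \<le> 1" using 3 by linarith
      ultimately show ?thesis using 3 by (simp add: offset_decay_def of_nat_diff)
    qed
  qed
  show ?thesis
  proof (rule that[OF D(1)])
    fix j k
    show "\<bar>gam j k\<bar> \<le> D * (real (min j k) + 1) powr c * offset_decay \<eta> (nat_dist j k)"
    proof (cases "j \<le> k")
      case True
      then show ?thesis using le[OF True] by (simp add: nat_dist_def min_def)
    next
      case False
      then have "k \<le> j" by simp
      then show ?thesis using le[of k j] gam_commute[of j k] False by (simp add: nat_dist_def min_def)
    qed
  qed
qed

text \<open>On a bounded time horizon the factor n^(-c) compensates the growth of the covariances.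
  Since \<open>c\<close> is nonnegative, the growing power may be taken at the right end, which
  yields T^c.\<close>

lemma gam_scaled_bound:
  assumes T: "T \<ge> 0"
  obtains C where "C \<ge> 0" "\<And>n j k. real j + 1 \<le> T * real n \<Longrightarrow> real k + 1 \<le> T * real n \<Longrightarrow>
    \<bar>real n powr (- c) * gam j k\<bar> \<le> C * offset_decay \<eta> (nat_dist j k)"
proof -
  obtain C where C: "C \<ge> 0" "\<And>j k. \<bar>gam j k\<bar> \<le> C * (real (min j k) + 1) powr c * offset_decay \<eta> (nat_dist j k)"
    using gam_bound by blast
  show ?thesis
  proof (rule that[of "C * T powr c"])
    fix n j k :: nat
    assume a: "real j + 1 \<le> T * real n" "real k + 1 \<le> T * real n"
    then have n: "real n > 0" using T by (cases "n = 0") auto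
    have m: "real (min j k) + 1 \<le> T * real n" using a by (simp add: min_def)
    have "\<bar>real n powr (- c) * gam j k\<bar> = real n powr (- c) * \<bar>gam j k\<bar>" by (simp add: abs_mult)
    also have "\<dots> \<le> real n powr (- c) * (C * (real (min j k) + 1) powr c * offset_decay \<eta> (nat_dist j k))"
      by (intro mult_left_mono C) auto
    also have "\<dots> \<le> real n powr (- c) * (C * (T * real n) powr c * offset_decay \<eta> (nat_dist j k))"
      using m c_nonneg C offset_decay_nonneg
      by (intro mult_left_mono mult_right_mono powr_mono2) auto
    also have "\<dots> = (C * T powr c) * offset_decay \<eta> (nat_dist j k)"
      using n T by (simp add: powr_mult powr_minus field_simps)
    finally show "\<bar>real n powr (- c) * gam j k\<bar> \<le> (C * T powr c) * offset_decay \<eta> (nat_dist j k)" .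
  qed (use C in simp)
qed

end

section \<open>Power asymptotics of partial sums and summation along diagonals\<close>

lemma stolz_cesaro:
  fixes A b :: "nat \<Rightarrow> real"
  assumes inc: "\<And>n. b n < b (Suc n)" and b: "filterlim b at_top sequentially"
    and lim: "(\<lambda>n. (A (Suc n) - A n) / (b (Suc n) - b n)) \<longlonglongrightarrow> l"
  shows "(\<lambda>n. A n / b n) \<longlonglongrightarrow> l"
proof (rule LIMSEQ_I)
  fix e :: real assume e: "e > 0"
  \<comment> \<open>One half of \<open>e\<close> bounds the increments beyond \<open>N\<close>; the
    other half absorbs the fixed error \<open>R\<close> once \<open>b n\<close> exceeds R /
    d.\<close>
  define d where "d = e / 2"
  have d: "d > 0" using e by (simp add: d_def)
  obtain N0 where N0: "\<And>n. n \<ge> N0 \<Longrightarrow> \<bar>(A (Suc n) - A n) / (b (Suc n) - b n) - l\<bar> < d"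
    using LIMSEQ_D[OF lim d] by auto
  have "eventually (\<lambda>n. b n > 0) sequentially" using b by (simp add: filterlim_at_top_dense)
  then obtain N1 where N1: "\<And>n. n \<ge> N1 \<Longrightarrow> b n > 0" by (auto simp: eventually_sequentially)
  define N where "N = max N0 N1"
  have bN: "b N > 0" using N1 by (simp add: N_def)
  have step: "\<bar>A (Suc n) - A n - l * (b (Suc n) - b n)\<bar> \<le> d * (b (Suc n) - b n)" if "n \<ge> N" for n
  proof -
    let ?D = "b (Suc n) - b n"
    have D: "?D > 0" using inc[of n] by simp
    have "A (Suc n) - A n - l * ?D = ((A (Suc n) - A n) / ?D - l) * ?D" using D by (simp add: field_simps)
    then have "\<bar>A (Suc n) - A n - l * ?D\<bar> = \<bar>(A (Suc n) - A n) / ?D - l\<bar> * ?D" using D by (simp add: abs_mult)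
    also have "\<dots> \<le> d * ?D" using N0[of n] that D by (intro mult_right_mono) (auto simp: N_def less_imp_le)
    finally show ?thesis .
  qed
  have tele: "\<bar>A n - A N - l * (b n - b N)\<bar> \<le> d * (b n - b N)" if "n \<ge> N" for n
    using that
  proof (induction n rule: dec_induct)
    case (step n)
    have "\<bar>A (Suc n) - A N - l * (b (Suc n) - b N)\<bar> \<le> \<bar>A n - A N - l * (b n - b N)\<bar> + \<bar>A (Suc n) - A n - l * (b (Suc n) - b n)\<bar>"
      by (simp add: algebra_simps)
    also have "\<dots> \<le> d * (b n - b N) + d * (b (Suc n) - b n)"
      using step.IH \<open>\<And>n. N \<le> n \<Longrightarrow> \<bar>A (Suc n) - A n - l * (b (Suc n) - b n)\<bar> \<le> d * (b (Suc n) - b n)\<close>[OF step.hyps(1)] by linarith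
    finally show ?case by (simp add: algebra_simps)
  qed simp
  define R where "R = \<bar>A N - l * b N\<bar>"
  have "eventually (\<lambda>n. b n > R / d) sequentially" using b by (simp add: filterlim_at_top_dense)
  then have "eventually (\<lambda>n. b n > R / d \<and> n \<ge> N) sequentially" by (intro eventually_conj eventually_ge_at_top)
  then obtain M where M: "\<And>n. n \<ge> M \<Longrightarrow> b n > R / d \<and> n \<ge> N" by (auto simp: eventually_sequentially)
  show "\<exists>no. \<forall>n\<ge>no. norm (A n / b n - l) < e"
  proof (intro exI allI impI)
    fix n assume "M \<le> n"
    then have n: "b n > R / d" "n \<ge> N" using M by auto
    have bn: "b n > 0" using N1 n by (simp add: N_def)
    have "\<bar>A n - l * b n\<bar> \<le> \<bar>A n - A N - l * (b n - b N)\<bar> + R"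
      unfolding R_def by (simp add: algebra_simps)
    also have "\<dots> \<le> d * (b n - b N) + R" using tele[OF n(2)] by simp
    also have "\<dots> < d * b n + d * b n"
    proof -
      have "R < d * b n" using n(1) d by (simp add: field_simps)
      moreover have "d * (b n - b N) \<le> d * b n" using d bN by (intro mult_left_mono) auto
      ultimately show ?thesis by linarith
    qed
    also have "\<dots> = e * b n" by (simp add: d_def)
    finally have "\<bar>A n - l * b n\<bar> < e * b n" .
    moreover have "A n / b n - l = (A n - l * b n) / b n" using bn by (simp add: field_simps)
    ultimately show "norm (A n / b n - l) < e" using bn by (simp add: abs_divide field_simps)
  qed
qed

text \<open>Stolz-Cesaro against n^a, whose increments behave like a n^(a - 1).\<close>

lemma sum_powr_asymptotics:
  fixes g :: "nat \<Rightarrow> real"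
  assumes a: "a > 0" and g: "(\<lambda>j. g j / real j powr (a - 1)) \<longlonglongrightarrow> \<kappa>"
  shows "(\<lambda>J. (\<Sum>j<J. g j) / real J powr a) \<longlonglongrightarrow> \<kappa> / a"
proof (rule stolz_cesaro)
  show "real n powr a < real (Suc n) powr a" for n using a by (intro powr_less_mono2) auto
  show "filterlim (\<lambda>n. real n powr a) at_top sequentially" using a by real_asymp
  have "(\<lambda>n. ((real n + 1) powr a - real n powr a) / real n powr (a - 1)) \<longlonglongrightarrow> a" using a by real_asymp
  from tendsto_divide[OF g this] a
  have 1: "(\<lambda>n. (g n / real n powr (a - 1)) / (((real n + 1) powr a - real n powr a) / real n powr (a - 1))) \<longlonglongrightarrow> \<kappa> / a" by simp
  show "(\<lambda>n. ((\<Sum>j<Suc n. g j) - (\<Sum>j<n. g j)) / (real (Suc n) powr a - real n powr a)) \<longlonglongrightarrow> \<kappa> / a"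
    by (rule Lim_transform_eventually[OF 1]) (use eventually_gt_at_top[of 0] in eventually_elim, simp add: add.commute)
qed

lemma sum_powr_asymptotics_scaled:
  fixes g :: "nat \<Rightarrow> real" and J :: "nat \<Rightarrow> nat"
  assumes a: "a > 0" and g: "(\<lambda>j. g j / real j powr (a - 1)) \<longlonglongrightarrow> \<kappa>"
    and J: "(\<lambda>n. real (J n) / real n) \<longlonglongrightarrow> m" and m: "m \<ge> 0"
  shows "(\<lambda>n. (\<Sum>j<J n. g j) / real n powr a) \<longlonglongrightarrow> \<kappa> / a * m powr a"
proof -
  define q where "q k = (\<Sum>j<k. g j) / real k powr a" for k
  have q: "q \<longlonglongrightarrow> \<kappa> / a" unfolding q_def by (rule sum_powr_asymptotics[OF a g])
  have e: "eventually (\<lambda>n. q (J n) * (real (J n) / real n) powr a = (\<Sum>j<J n. g j) / real n powr a) sequentially"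
    using eventually_gt_at_top[of 0]
    by eventually_elim (auto simp: q_def powr_divide)
  have p: "(\<lambda>n. (real (J n) / real n) powr a) \<longlonglongrightarrow> m powr a"
    using a by (intro tendsto_powr2 J tendsto_const) auto
  have "(\<lambda>n. q (J n) * (real (J n) / real n) powr a) \<longlonglongrightarrow> \<kappa> / a * m powr a"
  \<comment> \<open>For \<open>m = 0\<close> the lengths \<open>J n\<close> need not tend to
    infinity. Then boundedness of \<open>q\<close> suffices, since the factor beside it tends to
    0.\<close>
  proof (cases "m = 0")
    case True
    have "Bseq q" using q convergent_def convergent_imp_Bseq by blast
    then obtain C where C: "\<And>k. \<bar>q k\<bar> \<le> C" unfolding Bseq_def by auto
    have "(\<lambda>n. C * (real (J n) / real n) powr a) \<longlonglongrightarrow> C * m powr a" by (intro tendsto_intros p)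
    then have "(\<lambda>n. C * (real (J n) / real n) powr a) \<longlonglongrightarrow> 0" using True a by simp
    then have "(\<lambda>n. q (J n) * (real (J n) / real n) powr a) \<longlonglongrightarrow> 0"
      by (rule Lim_null_comparison[rotated]) (use C in \<open>auto simp: abs_mult intro!: always_eventually mult_right_mono\<close>)
    then show ?thesis using True a by simp
  next
    case False
    then have m0: "m > 0" using m by simp
    have "filterlim (\<lambda>n. real (J n) / real n * real n) at_top sequentially"
      by (rule filterlim_tendsto_pos_mult_at_top[OF J m0 filterlim_real_sequentially])
    moreover have "eventually (\<lambda>n. real (J n) / real n * real n = real (J n)) sequentially"
      using eventually_gt_at_top[of 0] by eventually_elim simp
    ultimately have "filterlim (\<lambda>n. real (J n)) at_top sequentially"
      by (rule filterlim_mono_eventually[OF _ order_refl order_refl])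
    then have "filterlim J at_top sequentially"
      by (simp add: filterlim_sequentially_iff_filterlim_real)
    from filterlim_compose[OF q this] have "(\<lambda>n. q (J n)) \<longlonglongrightarrow> \<kappa> / a" .
    then show ?thesis by (intro tendsto_mult p)
  qed
  then show ?thesis by (rule Lim_transform_eventually[OF _ e])
qed

lemma int_summable_of_nat:
  fixes f :: "nat \<Rightarrow> real"
  assumes "summable f" "\<And>n. f n \<ge> 0"
  shows "integrable (count_space (UNIV :: int set)) (\<lambda>p. f (nat \<bar>p\<bar>))"
proof -
  have n: "Infinite_Set_Sum.abs_summable_on f (UNIV :: nat set)"
    using assms by (simp add: abs_summable_on_nat_iff')
  have 1: "Infinite_Set_Sum.abs_summable_on (\<lambda>p. f (nat \<bar>p\<bar>)) (range int)"
    by (rule abs_summable_on_reindex) (use n in simp)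
  have 2: "Infinite_Set_Sum.abs_summable_on (\<lambda>p. f (nat \<bar>p\<bar>)) (range (\<lambda>n. - int n))"
    by (rule abs_summable_on_reindex) (use n in simp)
  have "(UNIV :: int set) = range int \<union> range (\<lambda>n. - int n)"
    by (auto intro: int_cases2)
  then show ?thesis using abs_summable_on_union[OF 1 2] by (simp add: Infinite_Set_Sum.abs_summable_on_def)
qed

lemma count_space_integral_eq_infsum:
  fixes f :: "int \<Rightarrow> real"
  assumes "integrable (count_space UNIV) f"
  shows "(\<integral>p. f p \<partial>count_space UNIV) = infsum f UNIV"
  using infsetsum_infsum[of f UNIV] assms by (simp add: Infinite_Set_Sum.abs_summable_on_def infsetsum_def)

text \<open>Regrouping by the offset p = k - j turns the double sum into an integral over the
  integers, to which dominated convergence applies. Negative second indices are excluded by a zero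
  entry and not by the range, so every inner sum starts at 0.\<close>

lemma double_sum_diagonals:
  fixes f :: "nat \<Rightarrow> nat \<Rightarrow> real"
  shows "(\<Sum>j<A. \<Sum>k<B. f j k) =
    (\<integral>p. (\<Sum>j<nat (min (int A) (int B - p)). if 0 \<le> int j + p then f j (nat (int j + p)) else 0) \<partial>count_space UNIV)"
proof -
  define h where "h p = (\<Sum>j<nat (min (int A) (int B - p)). if 0 \<le> int j + p then f j (nat (int j + p)) else 0)" for p
  define P where "P = {- int A..int B}"
  have fin: "finite P" by (simp add: P_def)
  have out: "h p = 0" if "p \<notin> P" for p
    using that unfolding h_def P_def by (intro sum.neutral) auto
  have "(\<integral>p. h p \<partial>count_space UNIV) = (\<Sum>p\<in>P. h p)"
    using fin out by (intro lebesgue_integral_count_space_finite_support[THEN trans] sum.mono_neutral_cong_left) (auto intro: finite_subset[OF _ fin])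
  also have "\<dots> = (\<Sum>p\<in>P. \<Sum>j<A. if 0 \<le> int j + p \<and> int j + p < int B then f j (nat (int j + p)) else 0)"
  proof (intro sum.cong refl)
    fix p
    show "h p = (\<Sum>j<A. if 0 \<le> int j + p \<and> int j + p < int B then f j (nat (int j + p)) else 0)"
      unfolding h_def by (rule sum.mono_neutral_cong_left) auto
  qed
  also have "\<dots> = (\<Sum>j<A. \<Sum>p\<in>P. if 0 \<le> int j + p \<and> int j + p < int B then f j (nat (int j + p)) else 0)"
    by (rule sum.swap)
  also have "\<dots> = (\<Sum>j<A. \<Sum>k<B. f j k)"
  proof (intro sum.cong refl)
    fix j assume j: "j \<in> {..<A}"
    have "(\<Sum>p\<in>P. if 0 \<le> int j + p \<and> int j + p < int B then f j (nat (int j + p)) else 0)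
      = (\<Sum>p\<in>{p\<in>P. 0 \<le> int j + p \<and> int j + p < int B}. f j (nat (int j + p)))"
      using fin by (simp add: sum.inter_filter)
    also have "\<dots> = (\<Sum>k<B. f j k)"
      by (rule sum.reindex_bij_witness[of _ "\<lambda>k. int k - int j" "\<lambda>p. nat (int j + p)"]) (use j in \<open>auto simp: P_def\<close>)
    finally show "(\<Sum>p\<in>P. if 0 \<le> int j + p \<and> int j + p < int B then f j (nat (int j + p)) else 0) = (\<Sum>k<B. f j k)" .
  qed
  finally show ?thesis unfolding h_def by simp
qed

text \<open>The upper end of the range of j on diagonal \<open>p\<close> differs from n min t t' by
  at most 1 + |p|.\<close>

lemma min_floor_limit:
  fixes t t' :: real and p :: int
  assumes "t \<ge> 0" "t' \<ge> 0"
  shows "(\<lambda>n. real (nat (min (int (nat \<lfloor>real n * t\<rfloor>)) (int (nat \<lfloor>real n * t'\<rfloor>) - p))) / real n) \<longlonglongrightarrow> min t t'"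
proof -
  define J where "J n = nat (min (int (nat \<lfloor>real n * t\<rfloor>)) (int (nat \<lfloor>real n * t'\<rfloor>) - p))" for n
  have b: "\<bar>real (J n) - real n * min t t'\<bar> \<le> 1 + \<bar>real_of_int p\<bar>" for n
  proof -
    have nn: "real n * t \<ge> 0" "real n * t' \<ge> 0" using assms by auto
    have m: "real n * min t t' = min (real n * t) (real n * t')" by (simp add: min_mult_distrib_left)
    have J: "real (J n) = max 0 (min (real_of_int \<lfloor>real n * t\<rfloor>) (real_of_int \<lfloor>real n * t'\<rfloor> - real_of_int p))"
      unfolding J_def using nn by (auto simp: min_def max_def)
    have "real_of_int \<lfloor>real n * t\<rfloor> \<le> real n * t" "real n * t < real_of_int \<lfloor>real n * t\<rfloor> + 1"
      "real_of_int \<lfloor>real n * t'\<rfloor> \<le> real n * t'" "real n * t' < real_of_int \<lfloor>real n * t'\<rfloor> + 1" by linarith+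
    then show ?thesis unfolding m J using nn by (simp add: min_def max_def abs_if) linarith
  qed
  have l: "(\<lambda>n. (1 + \<bar>real_of_int p\<bar>) * (1 / real n)) \<longlonglongrightarrow> 0"
    by (intro tendsto_mult_right_zero lim_1_over_n)
  have "(\<lambda>n. real (J n) / real n - min t t') \<longlonglongrightarrow> 0"
  proof (rule Lim_null_comparison[OF _ l])
    show "eventually (\<lambda>n. norm (real (J n) / real n - min t t') \<le> (1 + \<bar>real_of_int p\<bar>) * (1 / real n)) sequentially"
      using eventually_gt_at_top[of 0]
    proof eventually_elim
      case (elim n)
      have "real (J n) / real n - min t t' = (real (J n) - real n * min t t') / real n" using elim by (simp add: field_simps)
      then show ?case using b[of n] elim by (simp add: abs_divide divide_right_mono)
    qed
  qed
  then show ?thesis unfolding J_def by (simp add: LIM_zero_iff)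
qed

section \<open>Limits of double sums of increment covariances\<close>

context kernel_profile
begin

text \<open>The decay is inherited from \<open>gam_bound\<close> in the limit of
  \<open>gam_limit\<close>, so the second differences need no direct estimate.\<close>

lemma second_difference_bound:
  obtains C where "C \<ge> 0" "\<And>p. \<bar>second_difference p\<bar> \<le> C * offset_decay \<eta> (nat \<bar>p\<bar>)"
proof -
  obtain C where C: "C \<ge> 0" "\<And>j k. \<bar>gam j k\<bar> \<le> C * (real (min j k) + 1) powr c * offset_decay \<eta> (nat_dist j k)"
    using gam_bound by blast
  have nn: "\<bar>lam * second_difference (int p)\<bar> \<le> C * offset_decay \<eta> p" for p
  proof -
    have l1: "(\<lambda>j. \<bar>gam j (j + p) / real j powr c\<bar>) \<longlonglongrightarrow> \<bar>lam * second_difference (int p)\<bar>"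
      by (intro tendsto_rabs gam_limit)
    have l2: "(\<lambda>j. C * ((real j + 1) powr c / real j powr c) * offset_decay \<eta> p) \<longlonglongrightarrow> C * 1 * offset_decay \<eta> p"
      by (intro tendsto_intros powr_shift_ratio)
    have "\<bar>gam j (j + p) / real j powr c\<bar> \<le> C * ((real j + 1) powr c / real j powr c) * offset_decay \<eta> p" for j
    proof -
      have "\<bar>gam j (j + p) / real j powr c\<bar> = \<bar>gam j (j + p)\<bar> / real j powr c" by simp
      also have "\<dots> \<le> (C * (real (min j (j + p)) + 1) powr c * offset_decay \<eta> (nat_dist j (j + p))) / real j powr c"
        by (intro divide_right_mono C) simp
      finally show ?thesis by (simp add: nat_dist_def)
    qed
    then show ?thesis using LIMSEQ_le[OF l1 l2] by simp
  qed
  show ?thesis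
  proof (rule that[of "C / lam"])
    fix p
    have "second_difference (int (nat \<bar>p\<bar>)) = second_difference p"
      using second_difference_minus[of p] by (cases "p \<ge> 0") auto
    then have "lam * \<bar>second_difference p\<bar> \<le> C * offset_decay \<eta> (nat \<bar>p\<bar>)"
      using nn[of "nat \<bar>p\<bar>"] cpos by (simp add: abs_mult)
    then show "\<bar>second_difference p\<bar> \<le> C / lam * offset_decay \<eta> (nat \<bar>p\<bar>)"
      using cpos by (simp add: field_simps)
  qed (use C cpos in simp)
qed

lemma second_difference_power_integrable:
  assumes "q \<ge> 1"
  shows "integrable (count_space UNIV) (\<lambda>p. second_difference p ^ q)"
proof -
  obtain C where C: "C \<ge> 0" "\<And>p. \<bar>second_difference p\<bar> \<le> C * offset_decay \<eta> (nat \<bar>p\<bar>)"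
    using second_difference_bound by blast
  have i: "integrable (count_space UNIV) (\<lambda>p::int. C ^ q * offset_decay \<eta> (nat \<bar>p\<bar>))"
    using int_summable_of_nat[OF summable_offset_decay[OF \<eta>_gt_1] offset_decay_nonneg]
    by (rule integrable_mult_right)
  show ?thesis
  proof (rule Bochner_Integration.integrable_bound[OF i])
    show "AE p in count_space UNIV. norm (second_difference p ^ q) \<le> norm (C ^ q * offset_decay \<eta> (nat \<bar>p\<bar>))"
    proof (intro AE_I2)
      fix p
      have r: "0 \<le> offset_decay \<eta> (nat \<bar>p\<bar>)" "offset_decay \<eta> (nat \<bar>p\<bar>) \<le> 1"
        using offset_decay_nonneg offset_decay_le_1 \<eta>_gt_1 by auto
      have "norm (second_difference p ^ q) = \<bar>second_difference p\<bar> ^ q" by (simp add: power_abs)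
      also have "\<dots> \<le> (C * offset_decay \<eta> (nat \<bar>p\<bar>)) ^ q" by (intro power_mono C) simp
      also have "\<dots> = C ^ q * offset_decay \<eta> (nat \<bar>p\<bar>) ^ q" by (simp add: power_mult_distrib)
      also have "\<dots> \<le> C ^ q * offset_decay \<eta> (nat \<bar>p\<bar>)"
        using power_decreasing[of 1 q "offset_decay \<eta> (nat \<bar>p\<bar>)"] r assms C by (intro mult_left_mono) auto
      also have "\<dots> = norm (C ^ q * offset_decay \<eta> (nat \<bar>p\<bar>))" using C r by simp
      finally show "norm (second_difference p ^ q) \<le> norm (C ^ q * offset_decay \<eta> (nat \<bar>p\<bar>))" .
    qed
  qed simp
qed

text \<open>The symmetric partial sums telescope to 2 ((M + 1)^\<alpha> - M^\<alpha>), which tends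
  to 0 because \<alpha> < 1.\<close>

lemma infsum_second_difference: "infsum second_difference UNIV = 0"
proof -
  have i: "integrable (count_space UNIV) second_difference"
    using second_difference_power_integrable[of 1] by simp
  define f where "f M p = (if p \<in> {- int M..int M} then second_difference p else 0)" for M :: nat and p
  have "(\<lambda>M. \<integral>p. f M p \<partial>count_space UNIV) \<longlonglongrightarrow> (\<integral>p. second_difference p \<partial>count_space UNIV)"
  proof (rule integral_dominated_convergence[where w = "\<lambda>p. \<bar>second_difference p\<bar>"])
    show "AE p in count_space UNIV. (\<lambda>M. f M p) \<longlonglongrightarrow> second_difference p"
    proof (intro AE_I2)
      fix p
      have "eventually (\<lambda>M. f M p = second_difference p) sequentially"
        using eventually_ge_at_top[of "nat \<bar>p\<bar>"] by eventually_elim (auto simp: f_def)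
      then show "(\<lambda>M. f M p) \<longlonglongrightarrow> second_difference p" by (rule tendsto_eventually)
    qed
  qed (use i in \<open>auto simp: f_def\<close>)
  moreover have "(\<integral>p. f M p \<partial>count_space UNIV) = 2 * ((real M + 1) powr \<alpha> - real M powr \<alpha>)" for M
  proof -
    have "(\<integral>p. f M p \<partial>count_space UNIV) = (\<Sum>p\<in>{- int M..int M}. f M p)"
      by (subst lebesgue_integral_count_space_finite_support)
        (auto simp: f_def intro: finite_subset[of _ "{- int M..int M}"] intro!: sum.mono_neutral_left)
    also have "\<dots> = (\<Sum>p\<in>{- int M..int M}. second_difference p)" by (intro sum.cong) (auto simp: f_def)
    also have "\<dots> = 2 * ((real M + 1) powr \<alpha> - real M powr \<alpha>)"
    proof (induction M)
      case 0
      show ?case by (simp add: second_difference_def)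
    next
      case (Suc M)
      have e: "{- int (Suc M)..int (Suc M)} = insert (int (Suc M)) (insert (- int (Suc M)) {- int M..int M})" by auto
      have "(\<Sum>p\<in>{- int (Suc M)..int (Suc M)}. second_difference p)
        = 2 * second_difference (int (Suc M)) + (\<Sum>p\<in>{- int M..int M}. second_difference p)"
        unfolding e by (simp add: second_difference_minus[of "int (Suc M)", simplified])
      also have "\<dots> = 2 * ((real (Suc M) + 1) powr \<alpha> - real (Suc M) powr \<alpha>)"
        unfolding Suc.IH by (simp add: second_difference_def add.commute)
      finally show ?case .
    qed
    finally show ?thesis .
  qed
  moreover have "(\<lambda>M. 2 * ((real M + 1) powr \<alpha> - real M powr \<alpha>)) \<longlonglongrightarrow> 0" using \<alpha> by real_asymp
  ultimately have "(\<integral>p. second_difference p \<partial>count_space UNIV) = 0" using LIMSEQ_unique by auto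
  then show ?thesis using count_space_integral_eq_infsum[OF i] by simp
qed

text \<open>Along the diagonal at offset p the summands grow like j^(a - 1) with a = 2 \<beta> /
  \<alpha>, so the scaled sum tends to a constant times (min t t')^a / a. The decay in the offset
  then permits summation over p by dominated convergence. The factor 1 / a is \<alpha> / (2
  \<beta>).\<close>

lemma profile_sum_limit:
  fixes l r q :: nat and t t' :: real
  assumes al: "\<alpha> = 1 / (2 * real l + 1)" and q: "q \<ge> 1" and qr: "2 * r + q = 2 * l + 1"
    and t: "t \<ge> 0" "t' \<ge> 0"
  defines "g \<equiv> \<lambda>n j k. real n powr (- c) * gam j k"
  shows "(\<lambda>n. (1 / real n) * (\<Sum>j<nat \<lfloor>real n * t\<rfloor>. \<Sum>k<nat \<lfloor>real n * t'\<rfloor>. (g n j j * g n k k) ^ r * g n j k ^ q))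
    \<longlonglongrightarrow> 2 ^ (2 * r) * lam ^ (2 * l + 1) * (\<alpha> / (2 * \<beta>)) * infsum (\<lambda>p. second_difference p ^ q) UNIV * min t t' powr (2 * \<beta> / \<alpha>)"
proof -
  define a where "a = 2 * \<beta> / \<alpha>"
  have a0: "a > 0" using \<alpha> \<beta> by (simp add: a_def)
  \<comment> \<open>The relation \<alpha> (2 l + 1) = 1 enters here.\<close>
  have ac: "a - 1 = c * real (2 * l + 1)"
  proof -
    have 1: "\<alpha> * (2 * real l + 1) = 1" by (subst al) simp
    have "1 / \<alpha> = 2 * real l + 1" by (subst al) simp
    then have "a = 2 * \<beta> * (2 * real l + 1)" unfolding a_def by (metis mult.right_neutral times_divide_eq_right)
    moreover have "c * real (2 * l + 1) = 2 * \<beta> * (2 * real l + 1) - \<alpha> * (2 * real l + 1)" by (simp add: c_def algebra_simps)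
    ultimately show ?thesis using 1 by simp
  qed
  define e where "e j k = (gam j j * gam k k) ^ r * gam j k ^ q" for j k
  have e_commute: "e j k = e k j" for j k unfolding e_def by (simp add: gam_commute[of j k] mult.commute)
  define \<Gamma> where "\<Gamma> p j = (if 0 \<le> int j + p then e j (nat (int j + p)) else 0)" for p j
  define \<kappa> where "\<kappa> p = (lam * 2 * (lam * 2)) ^ r * (lam * second_difference p) ^ q" for p
  \<comment> \<open>The scaled variances tend to twice \<open>lam\<close>, which is the origin of
    the factor 2^(2 r).\<close>
  have sd0: "second_difference (int 0) = 2" by (simp add: second_difference_def)
  have pp: "(x powr d) ^ m = x powr (d * real m)" if "x > 0" for x d :: real and m
    unfolding powr_powr[symmetric] using that by (subst powr_realpow) auto
  have pw: "x powr (a - 1) = (x powr c) ^ (2 * l + 1)" if "x > 0" for x :: real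
    unfolding ac by (rule pp[OF that, symmetric])
  have diag: "(\<lambda>j. gam (j + m) (j + m) / real j powr c) \<longlonglongrightarrow> lam * 2" for m
  proof -
    have "(\<lambda>j. gam j j / real j powr c) \<longlonglongrightarrow> lam * 2" using gam_limit[of 0] unfolding sd0 by simp
    then have "(\<lambda>j. gam (j + m) (j + m) / real (j + m) powr c) \<longlonglongrightarrow> lam * 2" by (rule LIMSEQ_ignore_initial_segment)
    from tendsto_mult[OF this powr_shift_ratio[of "real m" c]]
    have "(\<lambda>j. gam (j + m) (j + m) / real (j + m) powr c * ((real j + real m) powr c / real j powr c)) \<longlonglongrightarrow> lam * 2" by simp
    then show ?thesis
      by (rule Lim_transform_eventually) (use eventually_gt_at_top[of 0] in eventually_elim, simp)
  qed
  have e_lim: "(\<lambda>j. e j (j + m) / real j powr (a - 1)) \<longlonglongrightarrow> \<kappa> (int m)" for m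
  proof -
    have "(\<lambda>j. ((gam j j / real j powr c) * (gam (j + m) (j + m) / real j powr c)) ^ r * (gam j (j + m) / real j powr c) ^ q) \<longlonglongrightarrow> \<kappa> (int m)"
      unfolding \<kappa>_def using diag[of 0] by (intro tendsto_intros diag gam_limit) auto
    then show ?thesis
    proof (rule Lim_transform_eventually)
      show "\<forall>\<^sub>F j in sequentially. ((gam j j / real j powr c) * (gam (j + m) (j + m) / real j powr c)) ^ r * (gam j (j + m) / real j powr c) ^ q
        = e j (j + m) / real j powr (a - 1)"
        using eventually_gt_at_top[of 0]
      proof eventually_elim
        case (elim j)
        have "real j powr (a - 1) = (real j powr c * real j powr c) ^ r * (real j powr c) ^ q"
          using pw[of "real j"] elim unfolding qr[symmetric] by (simp add: power_add power_mult power2_eq_square power_mult_distrib)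
        then show ?case unfolding e_def by (simp add: power_divide)
      qed
    qed
  qed
  have \<Gamma>_lim: "(\<lambda>j. \<Gamma> p j / real j powr (a - 1)) \<longlonglongrightarrow> \<kappa> p" for p
  proof (cases "p \<ge> 0")
    case True
    then obtain m where m: "p = int m" using nonneg_int_cases by blast
    have "nat (int j + int m) = j + m" for j by (simp add: nat_int_add)
    then show ?thesis using e_lim[of m] by (simp add: \<Gamma>_def m)
  next
    \<comment> \<open>A negative offset is reduced to a positive one by symmetry. The necessary
      shift of the index by \<open>m\<close> changes the normalising power only by a factor tending
      to 1.\<close>
    case False
    define m where "m = nat (- p)"
    have m: "p = - int m" using False by (simp add: m_def)
    have \<kappa>m: "\<kappa> p = \<kappa> (int m)" unfolding \<kappa>_def m by (simp add: second_difference_minus)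
    have r1: "(\<lambda>j. 1 / ((real j + real m) powr (a - 1) / real j powr (a - 1))) \<longlonglongrightarrow> 1 / 1"
      by (intro tendsto_intros powr_shift_ratio) simp
    have "(\<lambda>j. e j (j + m) / real j powr (a - 1) * (1 / ((real j + real m) powr (a - 1) / real j powr (a - 1)))) \<longlonglongrightarrow> \<kappa> (int m) * (1 / 1)"
      by (intro tendsto_mult e_lim r1)
    then have "(\<lambda>j. \<Gamma> p (j + m) / real (j + m) powr (a - 1)) \<longlonglongrightarrow> \<kappa> (int m) * (1 / 1)"
    proof (rule Lim_transform_eventually)
      show "\<forall>\<^sub>F j in sequentially. e j (j + m) / real j powr (a - 1) * (1 / ((real j + real m) powr (a - 1) / real j powr (a - 1)))
        = \<Gamma> p (j + m) / real (j + m) powr (a - 1)"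
        using eventually_gt_at_top[of 0]
        by eventually_elim (simp add: \<Gamma>_def m e_commute)
    qed
    then have "(\<lambda>j. \<Gamma> p j / real j powr (a - 1)) \<longlonglongrightarrow> \<kappa> (int m) * (1 / 1)" by (rule LIMSEQ_offset)
    then show ?thesis by (simp add: \<kappa>m)
  qed
  define J where "J n p = nat (min (int (nat \<lfloor>real n * t\<rfloor>)) (int (nat \<lfloor>real n * t'\<rfloor>) - p))" for n p
  define b where "b n p = (\<Sum>j<J n p. \<Gamma> p j) / real n powr a" for n p
  have b_lim: "(\<lambda>n. b n p) \<longlonglongrightarrow> \<kappa> p / a * min t t' powr a" for p
    unfolding b_def
    by (rule sum_powr_asymptotics_scaled[OF a0 \<Gamma>_lim min_floor_limit[OF t, of p, folded J_def]]) (use t in auto)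
  have gpow: "(1 / real n) * ((g n j j * g n k k) ^ r * g n j k ^ q) = e j k / real n powr a" if "n > 0" for n j k
  proof -
    have n0: "real n > 0" using that by simp
    have "(g n j j * g n k k) ^ r * g n j k ^ q = (real n powr (- c)) ^ (2 * r + q) * e j k"
      unfolding g_def e_def by (simp add: power_mult_distrib power_add power_mult power2_eq_square)
    also have "(real n powr (- c)) ^ (2 * r + q) = real n powr (- (a - 1))"
      unfolding qr ac pp[OF n0] by (simp only: mult_minus_left)
    also have "real n powr (- (a - 1)) = real n / real n powr a"
      using n0 by (simp add: powr_diff)
    finally show ?thesis using n0 by simp
  qed
  have S: "(1 / real n) * (\<Sum>j<nat \<lfloor>real n * t\<rfloor>. \<Sum>k<nat \<lfloor>real n * t'\<rfloor>. (g n j j * g n k k) ^ r * g n j k ^ q) = (\<integral>p. b n p \<partial>count_space UNIV)" for n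
  proof (cases "n = 0")
    case True
    then show ?thesis by (simp add: b_def)
  next
    case False
    have "(1 / real n) * (\<Sum>j<nat \<lfloor>real n * t\<rfloor>. \<Sum>k<nat \<lfloor>real n * t'\<rfloor>. (g n j j * g n k k) ^ r * g n j k ^ q)
      = (\<Sum>j<nat \<lfloor>real n * t\<rfloor>. \<Sum>k<nat \<lfloor>real n * t'\<rfloor>. e j k) / real n powr a"
      unfolding sum_distrib_left sum_divide_distrib using gpow False by (intro sum.cong refl) auto
    also have "(\<Sum>j<nat \<lfloor>real n * t\<rfloor>. \<Sum>k<nat \<lfloor>real n * t'\<rfloor>. e j k) = (\<integral>p. (\<Sum>j<J n p. \<Gamma> p j) \<partial>count_space UNIV)"
      unfolding J_def \<Gamma>_def by (rule double_sum_diagonals)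
    finally show ?thesis unfolding b_def by simp
  qed
  define T where "T = max t t'"
  have T: "T \<ge> 0" "t \<le> T" "t' \<le> T" using t by (auto simp: T_def)
  obtain C where C: "C \<ge> 0" "\<And>n j k. real j + 1 \<le> T * real n \<Longrightarrow> real k + 1 \<le> T * real n \<Longrightarrow>
    \<bar>real n powr (- c) * gam j k\<bar> \<le> C * offset_decay \<eta> (nat_dist j k)"
    using gam_scaled_bound[OF T(1)] by blast
  \<comment> \<open>Among the \<open>q\<close> factors with indices j and k only one keeps its
    decay, since \<open>offset_decay\<close> is at most 1; every other factor is bounded by
    \<open>C\<close>. Each diagonal has at most T n terms, each with weight 1 / n.\<close>
  have dom: "\<bar>b n p\<bar> \<le> T * C ^ (2 * l + 1) * offset_decay \<eta> (nat \<bar>p\<bar>)" for n p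
  proof (cases "n = 0")
    case True
    then show ?thesis using T C offset_decay_nonneg by (simp add: b_def)
  next
    case False
    let ?d = "offset_decay \<eta> (nat \<bar>p\<bar>)"
    have r: "0 \<le> ?d" "?d \<le> 1" using offset_decay_nonneg offset_decay_le_1 \<eta>_gt_1 by auto
    have n0: "real n > 0" using False by simp
    have fl: "real (i + 1) \<le> T * real n" if "i < nat \<lfloor>real n * s\<rfloor>" "s \<le> T" for i s
    proof -
      have "int i + 1 \<le> \<lfloor>real n * s\<rfloor>" using that(1) by linarith
      then have "real (i + 1) \<le> real n * s" by (simp add: le_floor_iff)
      also have "\<dots> \<le> real n * T" using that(2) by (intro mult_left_mono) auto
      finally show ?thesis by (simp add: mult.commute)
    qed
    have trm: "\<bar>\<Gamma> p j / real n powr a\<bar> \<le> (1 / real n) * (C ^ (2 * l + 1) * ?d)" if j: "j < J n p" for j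
    proof (cases "0 \<le> int j + p")
      case True
      define k where "k = nat (int j + p)"
      have jt: "j < nat \<lfloor>real n * t\<rfloor>" and kt: "k < nat \<lfloor>real n * t'\<rfloor>"
      proof -
        have "j < A \<and> nat (int j + p) < B" if "j < nat (min (int A) (int B - p))" for A B
          using that True by (auto simp: min_def split: if_splits)
        then show "j < nat \<lfloor>real n * t\<rfloor>" "k < nat \<lfloor>real n * t'\<rfloor>"
          using j unfolding J_def k_def by blast+
      qed
      have jk: "real j + 1 \<le> T * real n" "real k + 1 \<le> T * real n"
        using fl[OF jt T(2)] fl[OF kt T(3)] by auto
      have nd: "nat_dist j k = nat \<bar>p\<bar>" using True unfolding nat_dist_def k_def by linarith
      have gb: "\<bar>g n j j\<bar> \<le> C" "\<bar>g n k k\<bar> \<le> C" "\<bar>g n j k\<bar> \<le> C * ?d"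
        unfolding g_def using C(2)[OF jk(1) jk(1)] C(2)[OF jk(2) jk(2)] C(2)[OF jk] nd
        by (auto simp: offset_decay_def)
      have "\<bar>\<Gamma> p j / real n powr a\<bar> = (1 / real n) * \<bar>(g n j j * g n k k) ^ r * g n j k ^ q\<bar>"
      proof -
        have "\<Gamma> p j / real n powr a = (1 / real n) * ((g n j j * g n k k) ^ r * g n j k ^ q)"
          using True gpow[of n j k] False by (simp add: \<Gamma>_def k_def)
        then have "\<bar>\<Gamma> p j / real n powr a\<bar> = \<bar>1 / real n\<bar> * \<bar>(g n j j * g n k k) ^ r * g n j k ^ q\<bar>"
          by (simp only: abs_mult)
        then show ?thesis by (simp only: abs_divide abs_of_nat abs_one)
      qed
      also have "\<bar>(g n j j * g n k k) ^ r * g n j k ^ q\<bar> = (\<bar>g n j j\<bar> * \<bar>g n k k\<bar>) ^ r * \<bar>g n j k\<bar> ^ q"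
        by (simp add: abs_mult power_abs)
      also have "\<dots> \<le> (C * C) ^ r * (C * ?d) ^ q" using gb C r by (intro mult_mono power_mono) auto
      also have "\<dots> = C ^ (2 * l + 1) * ?d ^ q"
        unfolding qr[symmetric] by (simp add: power_mult_distrib power_add power_mult power2_eq_square)
      also have "\<dots> \<le> C ^ (2 * l + 1) * ?d"
        using power_decreasing[of 1 q ?d] r q C by (intro mult_left_mono) auto
      finally show ?thesis using n0 by (simp add: divide_right_mono)
    next
      case F: False
      then show ?thesis using r C n0 by (simp add: \<Gamma>_def)
    qed
    have "real (J n p) \<le> T * real n"
    proof (cases "J n p = 0")
      case J: False
      have "m - 1 < A" if "m = nat (min (int A) x)" "m \<noteq> 0" for m A x
        using that by (auto simp: min_def split: if_splits)
      from this[OF _ J] have "J n p - 1 < nat \<lfloor>real n * t\<rfloor>" unfolding J_def by blast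
      from fl[OF this T(2)] show ?thesis using J by (simp add: of_nat_diff)
    qed (use T in simp)
    have "\<bar>b n p\<bar> \<le> (\<Sum>j<J n p. \<bar>\<Gamma> p j / real n powr a\<bar>)"
      unfolding b_def sum_divide_distrib by (rule sum_abs)
    also have "\<dots> \<le> (\<Sum>j<J n p. (1 / real n) * (C ^ (2 * l + 1) * ?d))" by (intro sum_mono trm) auto
    also have "\<dots> = real (J n p) * ((1 / real n) * (C ^ (2 * l + 1) * ?d))" by simp
    also have "\<dots> \<le> (T * real n) * ((1 / real n) * (C ^ (2 * l + 1) * ?d))"
      using \<open>real (J n p) \<le> T * real n\<close> C r n0 by (intro mult_right_mono) auto
    also have "\<dots> = T * C ^ (2 * l + 1) * ?d" using n0 by simp
    finally show ?thesis .
  qed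
  have "(\<lambda>n. \<integral>p. b n p \<partial>count_space UNIV) \<longlonglongrightarrow> (\<integral>p. \<kappa> p / a * min t t' powr a \<partial>count_space UNIV)"
  proof (rule integral_dominated_convergence[where w = "\<lambda>p. T * C ^ (2 * l + 1) * offset_decay \<eta> (nat \<bar>p\<bar>)"])
    show "integrable (count_space UNIV) (\<lambda>p::int. T * C ^ (2 * l + 1) * offset_decay \<eta> (nat \<bar>p\<bar>))"
      using int_summable_of_nat[OF summable_offset_decay[OF \<eta>_gt_1] offset_decay_nonneg] by (rule integrable_mult_right)
  qed (use b_lim dom in auto)
  also have "(\<integral>p. \<kappa> p / a * min t t' powr a \<partial>count_space UNIV)
    = (\<integral>p. ((lam * 2 * (lam * 2)) ^ r * lam ^ q / a * min t t' powr a) * second_difference p ^ q \<partial>count_space UNIV)"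
    unfolding \<kappa>_def by (simp add: power_mult_distrib mult_ac)
  also have "\<dots> = ((lam * 2 * (lam * 2)) ^ r * lam ^ q / a * min t t' powr a) * infsum (\<lambda>p. second_difference p ^ q) UNIV"
    unfolding count_space_integral_eq_infsum[OF second_difference_power_integrable[OF q], symmetric]
    by (rule integral_mult_right_zero)
  also have "(lam * 2 * (lam * 2)) ^ r = lam ^ (2 * r) * 2 ^ (2 * r)"
    unfolding power_mult power2_eq_square by (simp add: power_mult_distrib[symmetric] mult_ac)
  also have "lam ^ (2 * r) * 2 ^ (2 * r) * lam ^ q / a * min t t' powr a * infsum (\<lambda>p. second_difference p ^ q) UNIV
    = 2 ^ (2 * r) * lam ^ (2 * l + 1) * (\<alpha> / (2 * \<beta>)) * infsum (\<lambda>p. second_difference p ^ q) UNIV * min t t' powr (2 * \<beta> / \<alpha>)"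
    unfolding qr[symmetric] a_def by (simp add: power_add mult_ac)
  finally show ?thesis unfolding S .
qed

end

section \<open>Stable convergence and characteristic functions\<close>

text \<open>Products are derived in \<open>trig_poly_mult\<close> and are no constructor. An
  induction thus meets only characters and linear operations, and convergence of weighted
  expectations passes through these.\<close>

inductive trig_poly :: "('e::real_inner \<Rightarrow> complex) \<Rightarrow> bool" where
  char: "trig_poly (\<lambda>x. iexp (a \<bullet> x))"
| add: "trig_poly f \<Longrightarrow> trig_poly g \<Longrightarrow> trig_poly (\<lambda>x. f x + g x)"
| scale: "trig_poly f \<Longrightarrow> trig_poly (\<lambda>x. c * f x)"

lemma trig_poly_const: "trig_poly (\<lambda>_. c)"
  using trig_poly.scale[OF trig_poly.char[of 0], of c] by simp

lemma trig_poly_mult_char: "trig_poly g \<Longrightarrow> trig_poly (\<lambda>x. iexp (a \<bullet> x) * g x)"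
proof (induction rule: trig_poly.induct)
  case (char b)
  have "(\<lambda>x. iexp (a \<bullet> x) * iexp (b \<bullet> x)) = (\<lambda>x. iexp ((a + b) \<bullet> x))"
    by (simp add: exp_add[symmetric] inner_add_left distrib_left)
  then show ?case using trig_poly.char[of "a + b"] by simp
next
  case (add f g)
  then show ?case using trig_poly.add[OF add.IH] by (simp add: distrib_left)
next
  case (scale f c)
  then show ?case using trig_poly.scale[OF scale.IH, of c] by (simp add: mult_ac)
qed

lemma trig_poly_mult: "trig_poly f \<Longrightarrow> trig_poly g \<Longrightarrow> trig_poly (\<lambda>x. f x * g x)"
proof (induction rule: trig_poly.induct)
  case (char a)
  then show ?case by (rule trig_poly_mult_char)
next
  case (add f1 f2)
  then show ?case using trig_poly.add[OF add.IH] by (simp add: distrib_right)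
next
  case (scale f c)
  then show ?case using trig_poly.scale[OF scale.IH, of c] by (simp add: mult_ac)
qed

lemma trig_poly_sum: "(\<And>i. i \<in> A \<Longrightarrow> trig_poly (f i)) \<Longrightarrow> trig_poly (\<lambda>x. \<Sum>i\<in>A. f i x)"
  by (induction A rule: infinite_finite_induct) (auto intro: trig_poly.add trig_poly_const)

lemma trig_poly_cos: "trig_poly (\<lambda>x. complex_of_real (cos (a \<bullet> x)))"
proof -
  have "complex_of_real (cos u) = (1 / 2) * iexp u + (1 / 2) * iexp (- u)" for u
    by (simp add: cos_exp_eq cos_of_real[symmetric])
  then have "(\<lambda>x. complex_of_real (cos (a \<bullet> x))) = (\<lambda>x. (1 / 2) * iexp (a \<bullet> x) + (1 / 2) * iexp ((- a) \<bullet> x))"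
    by simp
  moreover have "trig_poly (\<lambda>x. (1 / 2) * iexp (a \<bullet> x) + (1 / 2) * iexp ((- a) \<bullet> x))"
    by (intro trig_poly.intros)
  ultimately show ?thesis by simp
qed

lemma trig_poly_sin: "trig_poly (\<lambda>x. complex_of_real (sin (a \<bullet> x)))"
proof -
  have "complex_of_real (sin u) = (1 / (2 * \<i>)) * iexp u + (- 1 / (2 * \<i>)) * iexp (- u)" for u
    by (simp add: sin_exp_eq sin_of_real[symmetric] field_simps)
  then have "(\<lambda>x. complex_of_real (sin (a \<bullet> x))) = (\<lambda>x. (1 / (2 * \<i>)) * iexp (a \<bullet> x) + (- 1 / (2 * \<i>)) * iexp ((- a) \<bullet> x))"
    by simp
  moreover have "trig_poly (\<lambda>x. (1 / (2 * \<i>)) * iexp (a \<bullet> x) + (- 1 / (2 * \<i>)) * iexp ((- a) \<bullet> x))"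
    by (intro trig_poly.intros)
  ultimately show ?thesis by simp
qed

lemma trig_poly_measurable:
  fixes f :: "'e::euclidean_space \<Rightarrow> complex"
  shows "trig_poly f \<Longrightarrow> f \<in> borel_measurable borel"
  by (induction rule: trig_poly.induct) auto

text \<open>
  Wrapping a large box around a torus makes Stone-Weierstrass produce approximants that stay
  bounded outside of the box.
\<close>
definition circle_map :: "real \<Rightarrow> 'e::euclidean_space \<Rightarrow> 'e \<times> 'e" where
  "circle_map R x = ((\<Sum>b\<in>Basis. cos (x \<bullet> b / R) *\<^sub>R b), (\<Sum>b\<in>Basis. sin (x \<bullet> b / R) *\<^sub>R b))"

lemma circle_map_inner:
  assumes "b \<in> Basis"
  shows "fst (circle_map R x) \<bullet> b = cos (x \<bullet> b / R)" "snd (circle_map R x) \<bullet> b = sin (x \<bullet> b / R)"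
  using assms by (simp_all add: circle_map_def inner_sum_left_Basis)

lemma trig_poly_circle_map:
  fixes p :: "'e::euclidean_space \<times> 'e \<Rightarrow> real"
  assumes "real_polynomial_function p"
  shows "trig_poly (\<lambda>x. complex_of_real (p (circle_map R x)))"
  using assms
proof (induction rule: real_polynomial_function.induct)
  case (linear f)
  interpret bounded_linear f by fact
  have e: "f (circle_map R x) = (\<Sum>b\<in>Basis. cos ((b /\<^sub>R R) \<bullet> x) * f (b, 0)) + (\<Sum>b\<in>Basis. sin ((b /\<^sub>R R) \<bullet> x) * f (0, b))" for x
  proof -
    have s: "((\<Sum>b\<in>Basis. u b *\<^sub>R b), (\<Sum>b\<in>Basis. w b *\<^sub>R b)) = (\<Sum>b\<in>Basis. u b *\<^sub>R (b, 0 :: 'e)) + (\<Sum>b\<in>Basis. w b *\<^sub>R (0 :: 'e, b))"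
      for u w :: "'e \<Rightarrow> real"
      by (simp add: prod_eq_iff fst_sum snd_sum)
    show ?thesis unfolding circle_map_def s add sum scaleR
      by (simp add: inner_commute divide_inverse mult.commute)
  qed
  show ?case unfolding e of_real_add of_real_sum of_real_mult
    by (intro trig_poly.add trig_poly_sum trig_poly_mult trig_poly_cos trig_poly_sin trig_poly_const)
qed (auto intro: trig_poly_const trig_poly.add trig_poly_mult)

text \<open>Stone-Weierstrass on a compact box containing the image of \<open>circle_map\<close>
  gives an error that is uniform over the whole space. So the bound \<open>K + e\<close> holds
  everywhere, although \<open>h\<close> is close to \<open>f\<close> only on the ball.\<close>

lemma trig_approximation:
  fixes f :: "'e::euclidean_space \<Rightarrow> real"
  assumes f: "continuous_on UNIV f" and K: "\<And>x. \<bar>f x\<bar> \<le> K" and e: "e > 0" and \<rho>: "\<rho> > 0"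
  obtains h where "trig_poly h" "\<And>x. cmod (h x) \<le> K + e" "\<And>x. norm x \<le> \<rho> \<Longrightarrow> cmod (h x - complex_of_real (f x)) \<le> e"
proof -
  have K0: "K \<ge> 0" using order_trans[OF abs_ge_zero K] .
  define d where "d = DIM('e)"
  \<comment> \<open>The scale n is chosen so large that the cosine factors of \<open>g\<close> cost
    less than e / 2 on the ball, and that \<rho> / n < 1 < pi / 2, where \<open>arcsin\<close>
    inverts \<open>sin\<close>.\<close>
  have lim: "(\<lambda>n. K * (1 - cos (\<rho> / real n) ^ d)) \<longlonglongrightarrow> K * (1 - cos 0 ^ d)"
    by (intro tendsto_intros lim_const_over_n)
  then have "eventually (\<lambda>n. K * (1 - cos (\<rho> / real n) ^ d) < e / 2) sequentially"
    using order_tendstoD(2)[OF lim, of "e / 2"] e by simp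
  moreover have "(\<lambda>n. \<rho> / real n) \<longlonglongrightarrow> 0" by (rule lim_const_over_n)
  then have "eventually (\<lambda>n. \<rho> / real n < 1) sequentially" by (rule order_tendstoD) simp
  ultimately have "eventually (\<lambda>n. K * (1 - cos (\<rho> / real n) ^ d) < e / 2 \<and> \<rho> / real n < 1 \<and> n > 0) sequentially"
    using eventually_gt_at_top[of 0] by eventually_elim auto
  then obtain n where n: "K * (1 - cos (\<rho> / real n) ^ d) < e / 2" "\<rho> / real n < 1" "n > 0"
    by (auto simp: eventually_sequentially)
  define R where "R = real n"
  have R: "R > 0" "\<rho> / R < 1" "K * (1 - cos (\<rho> / R) ^ d) < e / 2" using n by (auto simp: R_def)
  \<comment> \<open>The arcsine of the sine coordinates recovers x on the ball; the product of the
    cosine coordinates is the cutoff called \<open>P\<close> below.\<close>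
  define g where "g z = f (\<Sum>b\<in>Basis. (R * arcsin (snd z \<bullet> b)) *\<^sub>R b) * (\<Prod>b\<in>Basis. max 0 (fst z \<bullet> b))" for z :: "'e \<times> 'e"
  define S :: "('e \<times> 'e) set" where "S = cbox (- One, - One) (One, One)"
  have S: "compact S" unfolding S_def by (rule compact_cbox)
  have inS: "- 1 \<le> fst z \<bullet> b \<and> fst z \<bullet> b \<le> 1 \<and> - 1 \<le> snd z \<bullet> b \<and> snd z \<bullet> b \<le> 1" if "z \<in> S" "b \<in> Basis" for z and b :: 'e
    using that unfolding S_def by (cases z) (auto simp: cbox_Pair_eq mem_box inner_sum_left_Basis)
  have cS: "circle_map R x \<in> S" for x
    unfolding S_def circle_map_def by (auto simp: cbox_Pair_eq mem_box inner_sum_left_Basis)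
  have gc: "continuous_on S g"
    unfolding g_def using inS
    by (intro continuous_intros continuous_on_compose2[OF f] continuous_on_arcsin) auto
  obtain p where p: "real_polynomial_function p" "\<And>z. z \<in> S \<Longrightarrow> \<bar>g z - p z\<bar> < e / 2"
    using Stone_Weierstrass_real_polynomial_function[OF S gc, of "e / 2"] e by auto
  define P where "P x = (\<Prod>b\<in>Basis. max 0 (cos (x \<bullet> b / R)))" for x :: 'e
  have P01: "0 \<le> P x" "P x \<le> 1" for x unfolding P_def by (auto intro!: prod_nonneg prod_le_1)
  have gx: "g (circle_map R x) = f (\<Sum>b\<in>Basis. (R * arcsin (sin (x \<bullet> b / R))) *\<^sub>R b) * P x" for x
    unfolding g_def P_def by (simp add: circle_map_inner cong: sum.cong prod.cong)
  have gb: "\<bar>g (circle_map R x)\<bar> \<le> K" for x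
  proof -
    have "\<bar>g (circle_map R x)\<bar> = \<bar>f (\<Sum>b\<in>Basis. (R * arcsin (sin (x \<bullet> b / R))) *\<^sub>R b)\<bar> * P x"
      unfolding gx using P01 by (simp add: abs_mult)
    also have "\<dots> \<le> K * 1" using K P01 K0 by (intro mult_mono) auto
    finally show ?thesis by simp
  qed
  have gf: "\<bar>g (circle_map R x) - f x\<bar> \<le> e / 2" if x: "norm x \<le> \<rho>" for x
  proof -
    have xb: "\<bar>x \<bullet> b / R\<bar> \<le> \<rho> / R" if "b \<in> Basis" for b
      using Basis_le_norm[OF that, of x] x R by (simp add: divide_right_mono)
    have pi1: "1 < pi / 2" using pi_gt3 by simp
    have as: "R * arcsin (sin (x \<bullet> b / R)) = x \<bullet> b" if "b \<in> Basis" for b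
    proof -
      have "\<bar>x \<bullet> b / R\<bar> \<le> pi / 2" using xb[OF that] R pi1 by linarith
      then have "arcsin (sin (x \<bullet> b / R)) = x \<bullet> b / R" by (intro arcsin_sin) linarith+
      then show ?thesis using R by simp
    qed
    have "(\<Sum>b\<in>Basis. (R * arcsin (sin (x \<bullet> b / R))) *\<^sub>R b) = (\<Sum>b\<in>Basis. (x \<bullet> b) *\<^sub>R b)"
      using as by (intro sum.cong refl) simp
    then have g: "g (circle_map R x) = f x * P x" unfolding gx by (simp add: euclidean_representation)
    have "cos (\<rho> / R) ^ d \<le> P x"
    proof -
      have "cos (\<rho> / R) ^ d = (\<Prod>b\<in>(Basis :: 'e set). cos (\<rho> / R))" by (simp add: d_def)
      also have "\<dots> \<le> P x" unfolding P_def
      proof (intro prod_mono conjI)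
        fix b :: 'e assume b: "b \<in> Basis"
        have rR: "0 \<le> \<rho> / R" using \<rho> R(1) by simp
        show "0 \<le> cos (\<rho> / R)" using R(2) rR pi1 by (intro cos_ge_zero) linarith+
        have "cos (\<rho> / R) \<le> cos \<bar>x \<bullet> b / R\<bar>"
          using xb[OF b] R(2) pi1 by (intro cos_monotone_0_pi_le abs_ge_zero) linarith+
        then show "cos (\<rho> / R) \<le> max 0 (cos (x \<bullet> b / R))" unfolding cos_abs_real by simp
      qed
      finally show ?thesis .
    qed
    then have "\<bar>f x\<bar> * (1 - P x) \<le> K * (1 - cos (\<rho> / R) ^ d)"
      using K P01[of x] K0 by (intro mult_mono) auto
    moreover have "\<bar>g (circle_map R x) - f x\<bar> = \<bar>f x\<bar> * (1 - P x)"
    proof -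
      have "g (circle_map R x) - f x = - (f x * (1 - P x))" unfolding g by (simp add: algebra_simps)
      then show ?thesis using P01[of x] by (simp add: abs_mult)
    qed
    ultimately show ?thesis using R(3) by linarith
  qed
  show ?thesis
  proof (rule that[OF trig_poly_circle_map[OF p(1), of R]])
    fix x
    have d: "\<bar>g (circle_map R x) - p (circle_map R x)\<bar> < e / 2" by (rule p(2)[OF cS])
    show "cmod (complex_of_real (p (circle_map R x))) \<le> K + e"
      unfolding norm_of_real using gb[of x] d e by linarith
    assume "norm x \<le> \<rho>"
    then have "\<bar>p (circle_map R x) - f x\<bar> \<le> e" using gf[of x] d by linarith
    then show "cmod (complex_of_real (p (circle_map R x)) - complex_of_real (f x)) \<le> e"
      by (metis norm_of_real of_real_diff)
  qed
qed

text \<open>The radius solves 2 K + e = e \<rho>^2. Outside the ball the trivial bound 2 K + e is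
  then at most e times the squared norm, so an error of any small size becomes controllable by
  second moments.\<close>

lemma trig_approximation_quadratic:
  fixes f :: "'e::euclidean_space \<Rightarrow> real"
  assumes f: "continuous_on UNIV f" and K: "\<And>x. \<bar>f x\<bar> \<le> K" and e: "0 < e"
  obtains h B where "trig_poly h" "\<And>x. cmod (h x) \<le> B" "\<And>x. cmod (h x - complex_of_real (f x)) \<le> e * (1 + (norm x)\<^sup>2)"
proof -
  have K0: "K \<ge> 0" using order_trans[OF abs_ge_zero K] .
  define \<rho> where "\<rho> = sqrt ((2 * K + e) / e)"
  have \<rho>: "\<rho> > 0" "(2 * K + e) = e * \<rho>\<^sup>2" using K0 e by (auto simp: \<rho>_def intro!: divide_pos_pos)
  obtain h where h: "trig_poly h" "\<And>x. cmod (h x) \<le> K + e" "\<And>x. norm x \<le> \<rho> \<Longrightarrow> cmod (h x - complex_of_real (f x)) \<le> e"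
    using trig_approximation[OF f K e \<rho>(1)] by blast
  show ?thesis
  proof (rule that[OF h(1,2)])
    fix x
    show "cmod (h x - complex_of_real (f x)) \<le> e * (1 + (norm x)\<^sup>2)"
    proof (cases "norm x \<le> \<rho>")
      case True
      have "0 \<le> e * (norm x)\<^sup>2" using e by simp
      then show ?thesis unfolding distrib_left using h(3)[OF True] by linarith
    next
      case False
      have "cmod (h x - complex_of_real (f x)) \<le> cmod (h x) + \<bar>f x\<bar>"
        using norm_triangle_ineq4[of "h x" "complex_of_real (f x)"] by simp
      also have "\<dots> \<le> 2 * K + e" using h(2)[of x] K[of x] by simp
      also have "\<dots> \<le> e * (norm x)\<^sup>2" unfolding \<rho>(2) using False \<rho>(1) e by (intro mult_left_mono power_mono) auto
      also have "\<dots> \<le> e * (1 + (norm x)\<^sup>2)" using e by simp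
      finally show ?thesis .
    qed
  qed
qed

section \<open>From exponentials to weights measurable with respect to the process\<close>

text \<open>
  The test functions \<open>W\<close> with \<open>E[Z\<^sub>n W] \<rightarrow> 0\<close> need not be closed under multiplication. Those for
  which all \<open>W exp(i (b\<^sub>1 X\<^sub>1 + \<dots>))\<close> are such test functions admit further exponential factors, and
  hence, by approximation, indicators of cylinder sets, one coordinate after the other.
\<close>
locale vanishing_test = prob_space M for M :: "'a measure" +
  fixes Z :: "nat \<Rightarrow> 'a \<Rightarrow> complex" and KZ :: real and X :: "real \<Rightarrow> 'a \<Rightarrow> real"
  assumes Zm: "Z n \<in> borel_measurable M" and Zb: "cmod (Z n \<omega>) \<le> KZ"
    and X2: "s \<ge> 0 \<Longrightarrow> integrable M (\<lambda>\<omega>. (X s \<omega>)\<^sup>2)"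
    and Xm: "s \<ge> 0 \<Longrightarrow> X s \<in> borel_measurable M"
begin

lemma KZ_nonneg: "KZ \<ge> 0"
  using order_trans[OF norm_ge_zero Zb] .

definition null :: "('a \<Rightarrow> complex) \<Rightarrow> bool" where
  "null W \<longleftrightarrow> integrable M W \<and> (\<lambda>n. \<integral>\<omega>. Z n \<omega> * W \<omega> \<partial>M) \<longlonglongrightarrow> 0"

lemma integrable_Z_mult: "integrable M W \<Longrightarrow> integrable M (\<lambda>\<omega>. Z n \<omega> * W \<omega>)"
  by (rule Bochner_Integration.integrable_bound[of M "\<lambda>\<omega>. KZ * cmod (W \<omega>)"])
    (use Zm Zb KZ_nonneg in \<open>auto simp: norm_mult intro!: mult_right_mono\<close>)

lemma null_add: "null W \<Longrightarrow> null W' \<Longrightarrow> null (\<lambda>\<omega>. W \<omega> + W' \<omega>)"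
  unfolding null_def using tendsto_add[of _ "0 :: complex" sequentially _ 0]
  by (auto simp: distrib_left Bochner_Integration.integral_add[OF integrable_Z_mult integrable_Z_mult])

lemma null_cmult: "null W \<Longrightarrow> null (\<lambda>\<omega>. a * W \<omega>)"
  unfolding null_def using tendsto_mult_right_zero[of _ sequentially a]
  by (auto simp: mult.left_commute[of _ a])

text \<open>\<open>Z\<close> is bounded uniformly in n, so an error \<open>e\<close> of the weight
  in mean costs at most \<open>KZ\<close> times \<open>e\<close> for all n at once.\<close>

lemma null_approx:
  assumes W: "integrable M W"
    and ap: "\<And>e. e > 0 \<Longrightarrow> \<exists>W'. null W' \<and> (\<integral>\<omega>. cmod (W \<omega> - W' \<omega>) \<partial>M) \<le> e"
  shows "null W"
  unfolding null_def
proof (intro conjI W LIMSEQ_I)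
  fix r :: real assume r: "r > 0"
  define e where "e = r / (2 * (KZ + 1))"
  have e: "e > 0" using r KZ_nonneg by (simp add: e_def)
  obtain W' where W': "null W'" "(\<integral>\<omega>. cmod (W \<omega> - W' \<omega>) \<partial>M) \<le> e" using ap[OF e] by blast
  have iW': "integrable M W'" and lim: "(\<lambda>n. \<integral>\<omega>. Z n \<omega> * W' \<omega> \<partial>M) \<longlonglongrightarrow> 0" using W' by (auto simp: null_def)
  obtain N where N: "\<And>n. n \<ge> N \<Longrightarrow> cmod (\<integral>\<omega>. Z n \<omega> * W' \<omega> \<partial>M) < r / 2"
    using LIMSEQ_D[OF lim, of "r / 2"] r by auto
  show "\<exists>no. \<forall>n\<ge>no. norm ((\<integral>\<omega>. Z n \<omega> * W \<omega> \<partial>M) - 0) < r"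
  proof (intro exI allI impI)
    fix n assume n: "N \<le> n"
    have i: "integrable M (\<lambda>\<omega>. W \<omega> - W' \<omega>)" using W iW' by simp
    have "(\<integral>\<omega>. Z n \<omega> * W \<omega> \<partial>M) = (\<integral>\<omega>. Z n \<omega> * W' \<omega> \<partial>M) + (\<integral>\<omega>. Z n \<omega> * (W \<omega> - W' \<omega>) \<partial>M)"
      using integrable_Z_mult[OF W, of n] integrable_Z_mult[OF iW', of n] by (simp add: right_diff_distrib)
    moreover have "cmod (\<integral>\<omega>. Z n \<omega> * (W \<omega> - W' \<omega>) \<partial>M) \<le> (\<integral>\<omega>. KZ * cmod (W \<omega> - W' \<omega>) \<partial>M)"
      by (rule norm_integral_le_integral[OF integrable_Z_mult[OF i]])
        (use i Zb in \<open>auto simp: norm_mult intro!: mult_right_mono\<close>)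
    moreover have "(\<integral>\<omega>. KZ * cmod (W \<omega> - W' \<omega>) \<partial>M) \<le> KZ * e" using W'(2) KZ_nonneg by (simp add: mult_left_mono)
    moreover have "KZ * e \<le> r / 2" using r KZ_nonneg by (simp add: e_def field_simps)
    ultimately show "norm ((\<integral>\<omega>. Z n \<omega> * W \<omega> \<partial>M) - 0) < r"
      using N[OF n] norm_triangle_ineq[of "\<integral>\<omega>. Z n \<omega> * W' \<omega> \<partial>M" "\<integral>\<omega>. Z n \<omega> * (W \<omega> - W' \<omega>) \<partial>M"] by simp
  qed
qed

definition good :: "('a \<Rightarrow> complex) \<Rightarrow> bool" where
  "good W \<longleftrightarrow> W \<in> borel_measurable M \<and> (\<exists>K. \<forall>\<omega>. cmod (W \<omega>) \<le> K) \<and>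
     (\<forall>I b. finite I \<and> I \<subseteq> {0..} \<longrightarrow> null (\<lambda>\<omega>. W \<omega> * iexp (\<Sum>s\<in>I. b s * X s \<omega>)))"

lemma bounded_integrable:
  fixes W :: "'a \<Rightarrow> complex"
  assumes "W \<in> borel_measurable M" "\<And>\<omega>. cmod (W \<omega>) \<le> K"
  shows "integrable M W"
  by (rule integrable_const_bound[where B = K]) (use assms in auto)

lemma goodD:
  assumes "good W"
  shows "W \<in> borel_measurable M" "\<exists>K. \<forall>\<omega>. cmod (W \<omega>) \<le> K" "integrable M W" "null W"
proof -
  show 1: "W \<in> borel_measurable M" "\<exists>K. \<forall>\<omega>. cmod (W \<omega>) \<le> K" using assms by (auto simp: good_def)
  then show "integrable M W" using bounded_integrable by blast
  have "\<forall>I b. finite I \<and> I \<subseteq> {0..} \<longrightarrow> null (\<lambda>\<omega>. W \<omega> * iexp (\<Sum>s\<in>I. b s * X s \<omega>))"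
    using assms by (simp add: good_def)
  from this[rule_format, of "{}" "\<lambda>_. 0"] have "null (\<lambda>\<omega>. W \<omega> * iexp (\<Sum>s\<in>{}. 0 * X s \<omega>))" by simp
  then show "null W" by simp
qed

lemma good_add: "good W \<Longrightarrow> good W' \<Longrightarrow> good (\<lambda>\<omega>. W \<omega> + W' \<omega>)"
proof -
  assume W: "good W" and W': "good W'"
  obtain K K' where K: "\<And>\<omega>. cmod (W \<omega>) \<le> K" "\<And>\<omega>. cmod (W' \<omega>) \<le> K'" using goodD(2)[OF W] goodD(2)[OF W'] by blast
  have "cmod (W \<omega> + W' \<omega>) \<le> K + K'" for \<omega> using norm_triangle_mono[OF K] .
  moreover have "null (\<lambda>\<omega>. (W \<omega> + W' \<omega>) * iexp (\<Sum>s\<in>I. b s * X s \<omega>))" if "finite I" "I \<subseteq> {0..}" for I b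
    using null_add[of "\<lambda>\<omega>. W \<omega> * iexp (\<Sum>s\<in>I. b s * X s \<omega>)" "\<lambda>\<omega>. W' \<omega> * iexp (\<Sum>s\<in>I. b s * X s \<omega>)"] W W' that
    by (simp add: good_def distrib_right)
  ultimately show ?thesis using goodD(1)[OF W] goodD(1)[OF W'] unfolding good_def by (auto intro: exI[of _ "K + K'"])
qed

lemma good_cmult: "good W \<Longrightarrow> good (\<lambda>\<omega>. a * W \<omega>)"
proof -
  assume W: "good W"
  obtain K where K: "\<And>\<omega>. cmod (W \<omega>) \<le> K" using goodD(2)[OF W] by blast
  have "cmod (a * W \<omega>) \<le> cmod a * K" for \<omega> using K by (simp add: norm_mult mult_left_mono)
  moreover have "null (\<lambda>\<omega>. a * W \<omega> * iexp (\<Sum>s\<in>I. b s * X s \<omega>))" if "finite I" "I \<subseteq> {0..}" for I b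
    using null_cmult[of "\<lambda>\<omega>. W \<omega> * iexp (\<Sum>s\<in>I. b s * X s \<omega>)" a] W that by (simp add: good_def mult.assoc)
  ultimately show ?thesis using goodD(1)[OF W] unfolding good_def by (auto intro: exI[of _ "cmod a * K"])
qed

lemma good_diff: "good W \<Longrightarrow> good W' \<Longrightarrow> good (\<lambda>\<omega>. W \<omega> - W' \<omega>)"
  using good_add[of W "\<lambda>\<omega>. -1 * W' \<omega>"] good_cmult[of W' "-1"] by simp

lemma good_zero: "good (\<lambda>_. 0)"
  unfolding good_def null_def by auto

lemma good_sum: "(\<And>i. i \<in> A \<Longrightarrow> good (W i)) \<Longrightarrow> good (\<lambda>\<omega>. \<Sum>i\<in>A. W i \<omega>)"
  by (induction A rule: infinite_finite_induct) (auto intro: good_add good_zero)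

lemma good_exp:
  assumes W: "good W" and s: "s \<ge> 0"
  shows "good (\<lambda>\<omega>. W \<omega> * iexp (u * X s \<omega>))"
proof -
  obtain K where K: "\<And>\<omega>. cmod (W \<omega>) \<le> K" using goodD(2)[OF W] by blast
  have "cmod (W \<omega> * iexp (u * X s \<omega>)) \<le> K" for \<omega> using K by (simp add: norm_mult del: of_real_mult)
  moreover have "null (\<lambda>\<omega>. W \<omega> * iexp (u * X s \<omega>) * iexp (\<Sum>r\<in>I. b r * X r \<omega>))" if I: "finite I" "I \<subseteq> {0..}" for I b
  proof -
    define b' where "b' r = (if r \<in> I then b r else 0) + (if r = s then u else 0)" for r
    have "(\<Sum>r\<in>insert s I. b' r * X r \<omega>) = u * X s \<omega> + (\<Sum>r\<in>I. b r * X r \<omega>)" for \<omega>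
    proof -
      have "(\<Sum>r\<in>insert s I. b' r * X r \<omega>) = (\<Sum>r\<in>insert s I. (if r \<in> I then b r * X r \<omega> else 0)) + (\<Sum>r\<in>insert s I. (if r = s then u * X r \<omega> else 0))"
        unfolding sum.distrib[symmetric] b'_def by (intro sum.cong refl) (simp add: distrib_right)
      also have "(\<Sum>r\<in>insert s I. (if r \<in> I then b r * X r \<omega> else 0)) = (\<Sum>r\<in>I. b r * X r \<omega>)"
        using I by (intro sum.mono_neutral_cong_right) auto
      also have "(\<Sum>r\<in>insert s I. (if r = s then u * X r \<omega> else 0)) = u * X s \<omega>" using I by simp
      finally show ?thesis by simp
    qed
    then have "W \<omega> * iexp (\<Sum>r\<in>insert s I. b' r * X r \<omega>) = W \<omega> * iexp (u * X s \<omega>) * iexp (\<Sum>r\<in>I. b r * X r \<omega>)" for \<omega>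
      by (simp add: exp_add distrib_left mult.assoc del: sum.insert)
    moreover have "null (\<lambda>\<omega>. W \<omega> * iexp (\<Sum>r\<in>insert s I. b' r * X r \<omega>))"
    proof -
      have "\<forall>I b. finite I \<and> I \<subseteq> {0..} \<longrightarrow> null (\<lambda>\<omega>. W \<omega> * iexp (\<Sum>s\<in>I. b s * X s \<omega>))"
        using W by (simp add: good_def)
      from this[rule_format, of "insert s I" b'] I s show ?thesis by auto
    qed
    ultimately show ?thesis by (simp only:)
  qed
  ultimately show ?thesis using goodD(1)[OF W] Xm[OF s] unfolding good_def by (auto intro: exI[of _ K])
qed

text \<open>Multiplication by an exponential of modulus 1 preserves the distance in mean. One
  approximation of \<open>W\<close> therefore serves all the products occurring in
  \<open>good\<close>.\<close>

lemma good_approx: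
  assumes W: "W \<in> borel_measurable M" "\<And>\<omega>. cmod (W \<omega>) \<le> K"
    and ap: "\<And>e. e > 0 \<Longrightarrow> \<exists>W'. good W' \<and> (\<integral>\<omega>. cmod (W \<omega> - W' \<omega>) \<partial>M) \<le> e"
  shows "good W"
  unfolding good_def
proof (intro conjI allI impI)
  fix I :: "real set" and b :: "real \<Rightarrow> real" assume I: "finite I \<and> I \<subseteq> {0..}"
  have [measurable]: "(\<lambda>\<omega>. \<Sum>s\<in>I. b s * X s \<omega>) \<in> borel_measurable M"
    using Xm I by (intro borel_measurable_sum borel_measurable_times borel_measurable_const) auto
  have E: "(\<lambda>\<omega>. iexp (\<Sum>s\<in>I. b s * X s \<omega>)) \<in> borel_measurable M"
    by measurable
  show "null (\<lambda>\<omega>. W \<omega> * iexp (\<Sum>s\<in>I. b s * X s \<omega>))"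
  proof (rule null_approx)
    show "integrable M (\<lambda>\<omega>. W \<omega> * iexp (\<Sum>s\<in>I. b s * X s \<omega>))"
      by (rule bounded_integrable[of _ K]) (use W E in \<open>auto simp: norm_mult simp del: of_real_sum\<close>)
    fix e :: real assume "e > 0"
    then obtain W' where W': "good W'" "(\<integral>\<omega>. cmod (W \<omega> - W' \<omega>) \<partial>M) \<le> e" using ap by blast
    have "cmod (W \<omega> * iexp (\<Sum>s\<in>I. b s * X s \<omega>) - W' \<omega> * iexp (\<Sum>s\<in>I. b s * X s \<omega>)) = cmod (W \<omega> - W' \<omega>)" for \<omega>
      by (simp add: norm_mult flip: left_diff_distrib del: of_real_sum)
    then show "\<exists>W'. null W' \<and> (\<integral>\<omega>. cmod (W \<omega> * iexp (\<Sum>s\<in>I. b s * X s \<omega>) - W' \<omega>) \<partial>M) \<le> e"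
      using W' I by (intro exI[of _ "\<lambda>\<omega>. W' \<omega> * iexp (\<Sum>s\<in>I. b s * X s \<omega>)"]) (auto simp: good_def)
  qed
qed (use W in auto)

lemma good_trig:
  assumes "trig_poly h" and W: "good W" and s: "s \<ge> 0"
  shows "good (\<lambda>\<omega>. W \<omega> * h (X s \<omega>))"
  using assms(1)
proof (induction rule: trig_poly.induct)
  case (char a)
  then show ?case using good_exp[OF W s, of a] by simp
next
  case (add f g)
  then show ?case using good_add by (simp add: distrib_left)
next
  case (scale f c)
  then show ?case using good_cmult[OF scale.IH, of c] by (simp add: mult.left_commute)
qed

text \<open>The error of \<open>trig_approximation_quadratic\<close> is integrable because
  \<open>X s\<close> has a second moment; its size is made small through \<open>d\<close>.\<close>

lemma good_continuous:
  assumes f: "continuous_on UNIV f" and K: "\<And>x. \<bar>f x\<bar> \<le> K" and W: "good W" and s: "s \<ge> 0"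
  shows "good (\<lambda>\<omega>. W \<omega> * complex_of_real (f (X s \<omega>)))"
proof -
  obtain KW where KW: "\<And>\<omega>. cmod (W \<omega>) \<le> KW" using goodD(2)[OF W] by blast
  have KW0: "KW \<ge> 0" using order_trans[OF norm_ge_zero KW] .
  have [measurable]: "f \<in> borel_measurable borel" by (rule borel_measurable_continuous_onI[OF f])
  have [measurable]: "W \<in> borel_measurable M" "X s \<in> borel_measurable M" using goodD(1)[OF W] Xm[OF s] by auto
  show ?thesis
  proof (rule good_approx)
    show "(\<lambda>\<omega>. W \<omega> * complex_of_real (f (X s \<omega>))) \<in> borel_measurable M" by measurable
    show "cmod (W \<omega> * complex_of_real (f (X s \<omega>))) \<le> KW * K" for \<omega>
      using KW K KW0 by (auto simp: norm_mult intro!: mult_mono)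
    fix e :: real assume e: "e > 0"
    define m where "m = (\<integral>\<omega>. 1 + (X s \<omega>)\<^sup>2 \<partial>M)"
    have m: "m \<ge> 0" unfolding m_def by simp
    define d where "d = e / ((KW + 1) * (m + 1))"
    have d: "d > 0" using e KW0 m by (simp add: d_def)
    obtain h B where h: "trig_poly h" "\<And>x. cmod (h x) \<le> B" "\<And>x. cmod (h x - complex_of_real (f x)) \<le> d * (1 + (norm x)\<^sup>2)"
      using trig_approximation_quadratic[OF f K d] by blast
    have [measurable]: "h \<in> borel_measurable borel" by (rule trig_poly_measurable[OF h(1)])
    have "(\<integral>\<omega>. cmod (W \<omega> * complex_of_real (f (X s \<omega>)) - W \<omega> * h (X s \<omega>)) \<partial>M) \<le> (\<integral>\<omega>. KW * (d * (1 + (X s \<omega>)\<^sup>2)) \<partial>M)"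
    proof (rule integral_mono)
      show i: "integrable M (\<lambda>\<omega>. KW * (d * (1 + (X s \<omega>)\<^sup>2)))" using X2[OF s] by simp
      show le: "cmod (W \<omega> * complex_of_real (f (X s \<omega>)) - W \<omega> * h (X s \<omega>)) \<le> KW * (d * (1 + (X s \<omega>)\<^sup>2))" for \<omega>
      proof -
        have "cmod (W \<omega> * complex_of_real (f (X s \<omega>)) - W \<omega> * h (X s \<omega>)) = cmod (W \<omega>) * cmod (h (X s \<omega>) - complex_of_real (f (X s \<omega>)))"
          by (simp add: norm_mult norm_minus_commute flip: right_diff_distrib)
        also have "\<dots> \<le> KW * (d * (1 + (X s \<omega>)\<^sup>2))"
          using h(3)[of "X s \<omega>"] KW KW0 by (intro mult_mono) auto
        finally show ?thesis .
      qed
      show "integrable M (\<lambda>\<omega>. cmod (W \<omega> * complex_of_real (f (X s \<omega>)) - W \<omega> * h (X s \<omega>)))"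
        by (rule Bochner_Integration.integrable_bound[OF i]) (use le in \<open>auto intro: order_trans[OF _ abs_ge_self]\<close>)
    qed
    also have "\<dots> = KW * (d * m)" unfolding m_def by simp
    also have "\<dots> \<le> (KW + 1) * (d * (m + 1))" using KW0 d m by (intro mult_mono) auto
    also have "\<dots> = e"
    proof -
      have "P * (e / (P * Q) * Q) = e" if "P > 0" "Q > 0" for P Q using that by simp
      from this[of "KW + 1" "m + 1"] show ?thesis unfolding d_def using KW0 m by simp
    qed
    finally show "\<exists>W'. good W' \<and> (\<integral>\<omega>. cmod (W \<omega> * complex_of_real (f (X s \<omega>)) - W' \<omega>) \<partial>M) \<le> e"
      using good_trig[OF h(1) W s] by blast
  qed
qed

lemma good_limit:
  assumes W: "W \<in> borel_measurable M" and K: "\<And>n \<omega>. cmod (w n \<omega>) \<le> K"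
    and w: "\<And>n. good (w n)" and lim: "\<And>\<omega>. (\<lambda>n. w n \<omega>) \<longlonglongrightarrow> W \<omega>"
  shows "good W"
proof (rule good_approx[OF W])
  show KW: "cmod (W \<omega>) \<le> K" for \<omega>
    by (rule LIMSEQ_le_const2[OF tendsto_norm[OF lim]]) (use K in auto)
  have wm: "w n \<in> borel_measurable M" for n by (rule goodD(1)[OF w])
  have "(\<lambda>n. \<integral>\<omega>. cmod (W \<omega> - w n \<omega>) \<partial>M) \<longlonglongrightarrow> (\<integral>\<omega>. 0 \<partial>M)"
  proof (rule integral_dominated_convergence[where w = "\<lambda>_. 2 * K"])
    show "AE \<omega> in M. (\<lambda>n. cmod (W \<omega> - w n \<omega>)) \<longlonglongrightarrow> 0"
      using tendsto_norm_zero[OF LIM_zero[OF lim]] by (simp add: norm_minus_commute)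
    show "AE \<omega> in M. norm (cmod (W \<omega> - w n \<omega>)) \<le> 2 * K" for n
      using order_trans[OF norm_triangle_ineq4 add_mono[OF KW K]] by simp
  qed (use W wm in auto)
  then have l0: "(\<lambda>n. \<integral>\<omega>. cmod (W \<omega> - w n \<omega>) \<partial>M) \<longlonglongrightarrow> 0" by simp
  fix e :: real assume e: "e > 0"
  obtain n where "(\<integral>\<omega>. cmod (W \<omega> - w n \<omega>) \<partial>M) < e"
    using order_tendstoD(2)[OF l0 e] by (auto simp: eventually_sequentially)
  then show "\<exists>W'. good W' \<and> (\<integral>\<omega>. cmod (W \<omega> - W' \<omega>) \<partial>M) \<le> e" using w less_imp_le by blast
qed

lemma good_atMost:
  assumes W: "good W" and s: "s \<ge> 0"
  shows "good (\<lambda>\<omega>. W \<omega> * indicator {..a} (X s \<omega>))"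
proof -
  obtain K where K: "\<And>\<omega>. cmod (W \<omega>) \<le> K" using goodD(2)[OF W] by blast
  have [measurable]: "W \<in> borel_measurable M" "X s \<in> borel_measurable M" using goodD(1)[OF W] Xm[OF s] by auto
  \<comment> \<open>For n > 0 this equals 1 up to \<open>a\<close>, vanishes beyond a + 1 / n, and
    is linear between.\<close>
  define f where "f n x = max 0 (min 1 (1 - real n * (x - a)))" for n and x :: real
  have f: "continuous_on UNIV (f n)" "\<bar>f n x\<bar> \<le> 1" for n x unfolding f_def by (auto intro!: continuous_intros)
  have fl: "(\<lambda>n. f n x) \<longlonglongrightarrow> indicator {..a} x" for x
  proof (cases "x \<le> a")
    case True
    then have "f n x = 1" for n unfolding f_def by (simp add: mult_nonneg_nonpos)
    then show ?thesis using True by simp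
  next
    case False
    have "eventually (\<lambda>n. f n x = 0) sequentially"
      using eventually_ge_at_top[of "nat \<lceil>1 / (x - a)\<rceil>"]
    proof eventually_elim
      case (elim n)
      then have "1 / (x - a) \<le> real n" by linarith
      then have "1 \<le> real n * (x - a)" using False by (simp add: field_simps)
      then show ?case by (simp add: f_def)
    qed
    then show ?thesis using False by (simp add: tendsto_eventually)
  qed
  show ?thesis
  proof (rule good_limit)
    show "good (\<lambda>\<omega>. W \<omega> * complex_of_real (f n (X s \<omega>)))" for n by (rule good_continuous[OF f W s])
    show "cmod (W \<omega> * complex_of_real (f n (X s \<omega>))) \<le> K" for n \<omega>
      using mult_mono[OF K[of \<omega>] f(2)[of n "X s \<omega>"]] order_trans[OF norm_ge_zero K[of \<omega>]] by (simp add: norm_mult)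
    show "(\<lambda>n. W \<omega> * complex_of_real (f n (X s \<omega>))) \<longlonglongrightarrow> W \<omega> * indicator {..a} (X s \<omega>)" for \<omega>
    proof -
      have "(\<lambda>n. complex_of_real (f n (X s \<omega>))) \<longlonglongrightarrow> complex_of_real (indicator {..a} (X s \<omega>))"
        by (intro tendsto_of_real fl)
      moreover have "complex_of_real (indicator {..a} (X s \<omega>)) = indicator {..a} (X s \<omega>)" by (simp add: indicator_def)
      ultimately show ?thesis by (intro tendsto_mult tendsto_const) simp
    qed
  qed measurable
qed

text \<open>With \<open>W\<close> fixed, the sets whose indicators may multiply \<open>W\<close>
  form a Dynkin system: complements by linearity, disjoint unions by \<open>good_limit\<close>. A
  stable generator therefore suffices.\<close>

lemma good_dynkin:
  assumes W: "good W" and Y: "Y \<in> M \<rightarrow>\<^sub>M N" and gen: "sets N = sigma_sets (space N) E" "Int_stable E" "E \<subseteq> Pow (space N)"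
    and base: "\<And>A. A \<in> E \<Longrightarrow> good (\<lambda>\<omega>. W \<omega> * indicator (Y -` A \<inter> space M) \<omega>)"
    and A: "A \<in> sets N"
  shows "good (\<lambda>\<omega>. W \<omega> * indicator (Y -` A \<inter> space M) \<omega>)"
proof -
  obtain K where K: "\<And>\<omega>. cmod (W \<omega>) \<le> K" using goodD(2)[OF W] by blast
  have K0: "K \<ge> 0" using order_trans[OF norm_ge_zero K] .
  have [measurable]: "W \<in> borel_measurable M" using goodD(1)[OF W] .
  let ?I = "\<lambda>A \<omega>. (indicator (Y -` A \<inter> space M) \<omega> :: complex)"
  have bd: "cmod (W \<omega> * indicator B \<omega>) \<le> K" for \<omega> and B :: "'a set"
    using K[of \<omega>] K0 by (simp add: norm_mult indicator_def)
  have ms: "Y -` A \<inter> space M \<in> sets M" if "A \<in> sets N" for A using measurable_sets[OF Y that] .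
  \<comment> \<open>\<open>good\<close> concerns functions on the whole type, while the set
    identities hold only on \<open>space M\<close>. Approximation in mean ignores the
    difference.\<close>
  have cong: "good f" if "good g" "f \<in> borel_measurable M" "\<And>\<omega>. cmod (f \<omega>) \<le> K" "\<And>\<omega>. \<omega> \<in> space M \<Longrightarrow> f \<omega> = g \<omega>" for f g
  proof (rule good_approx[OF that(2,3)])
    fix e :: real assume e: "e > 0"
    have "(\<integral>\<omega>. cmod (f \<omega> - g \<omega>) \<partial>M) = (\<integral>\<omega>. 0 \<partial>M)" by (rule Bochner_Integration.integral_cong) (use that(4) in auto)
    then show "\<exists>W'. good W' \<and> (\<integral>\<omega>. cmod (f \<omega> - W' \<omega>) \<partial>M) \<le> e" using that(1) e by auto
  qed
  from gen(2,3) A[unfolded gen(1)] show ?thesis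
  proof (induction rule: sigma_sets_induct_disjoint)
    case (basic A)
    then show ?case by (rule base)
  next
    case empty
    then show ?case using good_zero by simp
  next
    case (compl A)
    have AN: "A \<in> sets N" using compl gen by simp
    show ?case
    proof (rule cong[OF good_diff[OF W compl.IH]])
      show "(\<lambda>\<omega>. W \<omega> * ?I (space N - A) \<omega>) \<in> borel_measurable M"
        using ms[OF sets.compl_sets[OF AN]] by simp
      show "W \<omega> * ?I (space N - A) \<omega> = W \<omega> - W \<omega> * ?I A \<omega>" if "\<omega> \<in> space M" for \<omega>
        using measurable_space[OF Y that] that by (auto simp: indicator_def)
    qed (rule bd)
  next
    case (union A)
    have AN: "A i \<in> sets N" for i using union gen by auto
    have UN: "\<Union> (range A) \<in> sets N" using AN by auto
    have lim: "(\<lambda>n. \<Sum>i<n. W \<omega> * ?I (A i) \<omega>) \<longlonglongrightarrow> W \<omega> * ?I (\<Union> (range A)) \<omega>" for \<omega>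
    proof -
      have d: "disjoint_family (\<lambda>i. Y -` A i \<inter> space M)" using union.hyps(1) unfolding disjoint_family_on_def by auto
      have "(\<lambda>i. indicator (Y -` A i \<inter> space M) \<omega> :: real) sums indicator (\<Union>i. Y -` A i \<inter> space M) \<omega>"
        by (rule indicator_sums) (use d in \<open>auto simp: disjoint_family_on_def\<close>)
      then have "(\<lambda>i. complex_of_real (indicator (Y -` A i \<inter> space M) \<omega>)) sums complex_of_real (indicator (\<Union>i. Y -` A i \<inter> space M) \<omega>)"
        by (rule sums_of_real)
      moreover have "complex_of_real (indicator B \<omega>) = indicator B \<omega>" for B by (simp add: indicator_def)
      moreover have "(\<Union>i. Y -` A i \<inter> space M) = Y -` \<Union> (range A) \<inter> space M" by auto
      ultimately have "(\<lambda>i. ?I (A i) \<omega>) sums ?I (\<Union> (range A)) \<omega>" by simp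
      from sums_mult[OF this, of "W \<omega>"] show ?thesis by (simp add: sums_def)
    qed
    show ?case
    proof (rule good_limit[OF _ _ good_sum lim])
      show "(\<lambda>\<omega>. W \<omega> * ?I (\<Union> (range A)) \<omega>) \<in> borel_measurable M" using ms[OF UN] by simp
      show "good (\<lambda>\<omega>. W \<omega> * ?I (A i) \<omega>)" for i by (rule union.IH)
      show "cmod (\<Sum>i<n. W \<omega> * ?I (A i) \<omega>) \<le> K" for n \<omega>
      proof -
        have "(\<Sum>i<n. ?I (A i) \<omega>) = indicator (\<Union>i<n. Y -` A i \<inter> space M) \<omega>"
          using union.hyps(1) by (subst indicator_UN_disjoint) (auto simp: disjoint_family_on_def)
        then show ?thesis using bd by (simp add: sum_distrib_left[symmetric])
      qed
    qed
  qed
qed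

lemma good_borel:
  assumes W: "good W" and s: "s \<ge> 0" and B: "B \<in> sets borel"
  shows "good (\<lambda>\<omega>. W \<omega> * indicator (X s -` B \<inter> space M) \<omega>)"
proof (rule good_dynkin[OF W Xm[OF s] _ _ _ _ B])
  show "sets borel = sigma_sets (space borel) (range (\<lambda>a::real. {..a}))"
    by (subst borel_eq_atMost) (simp add: sets_measure_of)
  show "Int_stable (range (\<lambda>a::real. {..a}))" by (auto simp: Int_stable_def)
  fix A assume "A \<in> range (\<lambda>a::real. {..a})"
  then obtain a where a: "A = {..a}" by auto
  obtain K where K: "\<And>\<omega>. cmod (W \<omega>) \<le> K" using goodD(2)[OF W] by blast
  have [measurable]: "W \<in> borel_measurable M" "X s \<in> borel_measurable M" using goodD(1)[OF W] Xm[OF s] by auto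
  show "good (\<lambda>\<omega>. W \<omega> * indicator (X s -` A \<inter> space M) \<omega>)"
  proof (rule good_approx)
    show "cmod (W \<omega> * indicator (X s -` A \<inter> space M) \<omega>) \<le> K" for \<omega>
      using K[of \<omega>] order_trans[OF norm_ge_zero K[of \<omega>]] by (simp add: norm_mult indicator_def)
    fix e :: real assume e: "e > 0"
    have "(\<integral>\<omega>. cmod (W \<omega> * indicator (X s -` A \<inter> space M) \<omega> - W \<omega> * indicator {..a} (X s \<omega>)) \<partial>M) = (\<integral>\<omega>. 0 \<partial>M)"
      by (rule Bochner_Integration.integral_cong) (auto simp: a indicator_def)
    then show "\<exists>W'. good W' \<and> (\<integral>\<omega>. cmod (W \<omega> * indicator (X s -` A \<inter> space M) \<omega> - W' \<omega>) \<partial>M) \<le> e"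
      using good_atMost[OF W s, of a] e by auto
  qed (simp add: a)
qed auto

lemma good_cylinder:
  assumes J: "finite J" "J \<subseteq> {0..}" and E: "\<And>j. j \<in> J \<Longrightarrow> E j \<in> sets borel" and 1: "good (\<lambda>_. 1)"
  shows "good (\<lambda>\<omega>. \<Prod>j\<in>J. indicator (X j -` E j \<inter> space M) \<omega>)"
  using J E
proof (induction J rule: finite_induct)
  case (insert j J)
  then have "good (\<lambda>\<omega>. \<Prod>j\<in>J. indicator (X j -` E j \<inter> space M) \<omega>)" by auto
  from good_borel[OF this, of j "E j"] insert show ?case by (simp add: mult.commute)
qed (use 1 in simp)

lemma path_map_measurable: "path_map X \<in> M \<rightarrow>\<^sub>M path_space"
  unfolding path_map_def[abs_def] path_space_def by (intro measurable_restrict Xm) auto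

lemma good_generated_set:
  assumes 1: "good (\<lambda>_. 1)" and A: "A \<in> sets path_space"
  shows "good (indicator (path_map X -` A \<inter> space M))"
proof -
  have "good (\<lambda>\<omega>. 1 * indicator (path_map X -` A \<inter> space M) \<omega>)"
  proof (rule good_dynkin[OF 1 path_map_measurable _ _ _ _ A])
    show "sets path_space = sigma_sets (space path_space) (prod_algebra ({0..} :: real set) (\<lambda>_. borel :: real measure))"
      unfolding path_space_def sets_PiM space_PiM by simp
    show "Int_stable (prod_algebra ({0..} :: real set) (\<lambda>_. borel :: real measure))" by (rule Int_stable_prod_algebra)
    show "prod_algebra ({0..} :: real set) (\<lambda>_. borel :: real measure) \<subseteq> Pow (space path_space)"
      unfolding path_space_def space_PiM by (rule prod_algebra_sets_into_space)
    fix B assume "B \<in> prod_algebra ({0..} :: real set) (\<lambda>_. borel :: real measure)"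
    then obtain J E where B: "B = prod_emb {0..} (\<lambda>_. borel) J (Pi\<^sub>E J E)" and J: "finite J" "J \<subseteq> {0..}" "\<And>j. j \<in> J \<Longrightarrow> E j \<in> sets borel"
      by (force elim!: prod_algebraE)
    have me: "B \<in> sets path_space" unfolding B path_space_def using J by (intro sets_PiM_I) auto
    show "good (\<lambda>\<omega>. 1 * indicator (path_map X -` B \<inter> space M) \<omega>)"
    proof (rule good_approx[where K = 1])
      fix e :: real assume e: "e > 0"
      have "(\<integral>\<omega>. cmod (1 * indicator (path_map X -` B \<inter> space M) \<omega> - (\<Prod>j\<in>J. indicator (X j -` E j \<inter> space M) \<omega>)) \<partial>M) = (\<integral>\<omega>. 0 \<partial>M)"
      proof (rule Bochner_Integration.integral_cong)
        fix \<omega> assume \<omega>: "\<omega> \<in> space M"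
        have "path_map X \<omega> \<in> B \<longleftrightarrow> (\<forall>j\<in>J. X j \<omega> \<in> E j)"
          unfolding B path_map_def prod_emb_iff using J(2) by (auto simp: restrict_PiE_iff PiE_iff Int_absorb2 extensional_def)
        then show "cmod (1 * indicator (path_map X -` B \<inter> space M) \<omega> - (\<Prod>j\<in>J. indicator (X j -` E j \<inter> space M) \<omega>)) = 0"
          using \<omega> J(1) by (auto simp: indicator_def prod_zero_iff)
      qed simp
      then show "\<exists>W'. good W' \<and> (\<integral>\<omega>. cmod (1 * indicator (path_map X -` B \<inter> space M) \<omega> - W' \<omega>) \<partial>M) \<le> e"
        using good_cylinder[OF J(1,2), of E] J(3) 1 e by auto
    next
      show "cmod (1 * indicator (path_map X -` B \<inter> space M) \<omega>) \<le> 1" for \<omega> by (simp add: indicator_def)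
    qed (use measurable_sets[OF path_map_measurable me] in simp)
  qed
  then show ?thesis by simp
qed

text \<open>Indicators of sets in the generated \<sigma>-algebra are good, hence null. From here on
  no exponential factors are needed, and \<open>null\<close> passes to integrable weights by
  approximation in mean with simple functions.\<close>

theorem null_generated:
  assumes gen: "generated_by M X" and 1: "good (\<lambda>_. 1)" and W: "integrable M W"
  shows "null W"
  using W
proof (induction rule: integrable_induct)
  case (base A c)
  have "A \<in> sets (vimage_algebra (space M) (path_map X) path_space)" using base gen by (simp add: generated_by_def)
  then obtain B where B: "B \<in> sets path_space" "A = path_map X -` B \<inter> space M"
    using path_map_measurable by (subst (asm) sets_vimage_algebra2) (auto dest: measurable_space)
  have "null (\<lambda>\<omega>. c * indicator A \<omega>)"
    using null_cmult[OF goodD(4)[OF good_generated_set[OF 1 B(1)]], of c] B(2) by simp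
  moreover have "(\<lambda>\<omega>. indicator A \<omega> *\<^sub>R c) = (\<lambda>\<omega>. c * indicator A \<omega>)" by (auto simp: indicator_def)
  ultimately show ?case by simp
next
  case (add f g)
  then show ?case by (intro null_add)
next
  case (lim f s)
  have int_s: "integrable M (s i)" and ns: "null (s i)" for i by (fact lim)+
  have ls: "(\<lambda>i. s i \<omega>) \<longlonglongrightarrow> f \<omega>" if "\<omega> \<in> space M" for \<omega> using that by (fact lim)
  have bs: "cmod (s i \<omega>) \<le> 2 * cmod (f \<omega>)" if "\<omega> \<in> space M" for i \<omega> using that by (fact lim)
  have if': "integrable M f" by (fact lim)
  show ?case
  proof (rule null_approx[OF if'])
    fix e :: real assume e: "e > 0"
    have "(\<lambda>i. \<integral>\<omega>. cmod (f \<omega> - s i \<omega>) \<partial>M) \<longlonglongrightarrow> (\<integral>\<omega>. 0 \<partial>M)"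
    proof (rule integral_dominated_convergence[where w = "\<lambda>\<omega>. 3 * cmod (f \<omega>)"])
      show "AE \<omega> in M. (\<lambda>i. cmod (f \<omega> - s i \<omega>)) \<longlonglongrightarrow> 0"
        using tendsto_norm_zero[OF LIM_zero[OF ls]] by (auto simp: norm_minus_commute)
      show "AE \<omega> in M. norm (cmod (f \<omega> - s i \<omega>)) \<le> 3 * cmod (f \<omega>)" for i
      proof (rule AE_I2)
        fix \<omega> assume "\<omega> \<in> space M"
        then show "norm (cmod (f \<omega> - s i \<omega>)) \<le> 3 * cmod (f \<omega>)"
          using bs[of \<omega> i] norm_triangle_ineq4[of "f \<omega>" "s i \<omega>"] by simp
      qed
    qed (use int_s if' in auto)
    then have l0: "(\<lambda>i. \<integral>\<omega>. cmod (f \<omega> - s i \<omega>) \<partial>M) \<longlonglongrightarrow> 0" by simp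
    obtain i where "(\<integral>\<omega>. cmod (f \<omega> - s i \<omega>) \<partial>M) < e"
      using order_tendstoD(2)[OF l0 e] by (auto simp: eventually_sequentially)
    then show "\<exists>W'. null W' \<and> (\<integral>\<omega>. cmod (f \<omega> - W' \<omega>) \<partial>M) \<le> e" using ns less_imp_le by blast
  qed
qed

end

section \<open>Stable convergence from weighted characteristic functions\<close>

lemma trig_poly_bounded: "trig_poly h \<Longrightarrow> \<exists>B. \<forall>x. cmod (h x) \<le> B"
proof (induction rule: trig_poly.induct)
  case (char a)
  show ?case by (intro exI[of _ 1] allI) (simp del: of_real_mult)
next
  case (add f g)
  then obtain A B where "\<And>x. cmod (f x) \<le> A" "\<And>x. cmod (g x) \<le> B" by blast
  then have "\<forall>x. cmod (f x + g x) \<le> A + B" using norm_triangle_mono by blast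
  then show ?case by blast
next
  case (scale f c)
  then obtain A where "\<And>x. cmod (f x) \<le> A" by blast
  then have "\<forall>x. cmod (c * f x) \<le> cmod c * A" by (simp add: norm_mult mult_left_mono)
  then show ?case by blast
qed

lemma prob_enlargement_integral:
  fixes f :: "'a \<Rightarrow> 'b::{banach, second_countable_topology}"
  assumes E: "prob_enlargement F G" and f: "f \<in> borel_measurable F"
  shows "(\<integral>\<omega>. f \<omega> \<partial>G) = (\<integral>\<omega>. f \<omega> \<partial>F)"
proof -
  have sub: "subalgebra G F" and eq: "\<And>A. A \<in> sets F \<Longrightarrow> emeasure G A = emeasure F A"
    using E by (auto simp: prob_enlargement_def)
  have r: "restr_to_subalg G F = F"
  proof (rule measure_eqI)
    show "sets (restr_to_subalg G F) = sets F" by (rule sets_restr_to_subalg[OF sub])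
    fix A assume "A \<in> sets (restr_to_subalg G F)"
    then have A: "A \<in> sets F" by (simp add: sets_restr_to_subalg[OF sub])
    show "emeasure (restr_to_subalg G F) A = emeasure F A"
      using emeasure_restr_to_subalg[OF sub A] eq[OF A] by simp
  qed
  show ?thesis using integral_subalgebra2[OF sub f] unfolding r by simp
qed

text \<open>
  The second moments replace tightness: the approximation error of a trigonometric polynomial is at
  most \<open>e (1 + \<bar>x\<bar>\<^sup>2)\<close>.
\<close>
lemma stably_convergent_from_char:
  fixes \<xi> :: "nat \<Rightarrow> 'a \<Rightarrow> real ^ 'm" and \<zeta> :: "'a \<Rightarrow> real ^ 'm"
  assumes E: "prob_enlargement F G"
    and \<xi>: "\<And>n. \<xi> n \<in> borel_measurable F" and \<zeta>: "\<zeta> \<in> borel_measurable G"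
    and \<xi>2: "\<And>n. integrable F (\<lambda>\<omega>. (norm (\<xi> n \<omega>))\<^sup>2)" "\<And>n. (\<integral>\<omega>. (norm (\<xi> n \<omega>))\<^sup>2 \<partial>F) \<le> C"
    and \<zeta>2: "integrable G (\<lambda>\<omega>. (norm (\<zeta> \<omega>))\<^sup>2)"
    and ch: "\<And>a W. W \<in> borel_measurable F \<Longrightarrow> bounded (W ` space F) \<Longrightarrow>
      (\<lambda>n. \<integral>\<omega>. iexp (a \<bullet> \<xi> n \<omega>) * complex_of_real (W \<omega>) \<partial>F) \<longlonglongrightarrow> (\<integral>\<omega>. iexp (a \<bullet> \<zeta> \<omega>) * complex_of_real (W \<omega>) \<partial>G)"
  shows "converges_stably F G \<xi> \<zeta>"
  unfolding converges_stably_def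
proof (intro conjI allI impI \<xi> \<zeta>)
  fix f :: "real ^ 'm \<Rightarrow> real" and W :: "'a \<Rightarrow> real"
  assume "continuous_on UNIV f \<and> bounded (range f) \<and> W \<in> borel_measurable F \<and> bounded (W ` space F)"
  then have f: "continuous_on UNIV f" "bounded (range f)" and W: "W \<in> borel_measurable F" "bounded (W ` space F)" by auto
  have sub: "subalgebra G F" and pF: "prob_space F" and pG: "prob_space G" using E by (auto simp: prob_enlargement_def)
  interpret F: prob_space F by fact
  interpret G: prob_space G by fact
  have sp: "space G = space F" using sub by (simp add: subalgebra_def)
  have WG: "W \<in> borel_measurable G" by (rule measurable_from_subalg[OF sub W(1)])
  obtain K where K: "\<And>x. \<bar>f x\<bar> \<le> K" using f(2) by (auto simp: bounded_iff)
  obtain KW where KW: "\<And>\<omega>. \<omega> \<in> space F \<Longrightarrow> \<bar>W \<omega>\<bar> \<le> KW" using W(2) by (auto simp: bounded_iff)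
  have KW0: "KW \<ge> 0" using KW F.not_empty order_trans[OF abs_ge_zero] by blast
  have [measurable]: "f \<in> borel_measurable borel" by (rule borel_measurable_continuous_onI[OF f(1)])
  note [measurable] = W(1) WG \<xi> \<zeta>
  have iF: "integrable F (\<lambda>\<omega>. h (\<xi> n \<omega>) * complex_of_real (W \<omega>))" and iG: "integrable G (\<lambda>\<omega>. h (\<zeta> \<omega>) * complex_of_real (W \<omega>))"
    if [measurable]: "h \<in> borel_measurable borel" and B: "\<And>x. cmod (h x) \<le> B" for h n B
  proof -
    have B0: "B \<ge> 0" using order_trans[OF norm_ge_zero B] .
    show "integrable F (\<lambda>\<omega>. h (\<xi> n \<omega>) * complex_of_real (W \<omega>))"
      by (rule F.integrable_const_bound[where B = "B * KW"]) (use B B0 KW in \<open>auto simp: norm_mult intro!: mult_mono\<close>)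
    show "integrable G (\<lambda>\<omega>. h (\<zeta> \<omega>) * complex_of_real (W \<omega>))"
      by (rule G.integrable_const_bound[where B = "B * KW"]) (use B B0 KW sp in \<open>auto simp: norm_mult intro!: mult_mono\<close>)
  qed
  have tr: "(\<lambda>n. \<integral>\<omega>. h (\<xi> n \<omega>) * complex_of_real (W \<omega>) \<partial>F) \<longlonglongrightarrow> (\<integral>\<omega>. h (\<zeta> \<omega>) * complex_of_real (W \<omega>) \<partial>G)"
    if "trig_poly h" for h
    using that
  proof (induction rule: trig_poly.induct)
    case (char a)
    then show ?case using ch[OF W] by simp
  next
    case (add f g)
    obtain A B where AB: "\<And>x. cmod (f x) \<le> A" "\<And>x. cmod (g x) \<le> B"
      using trig_poly_bounded[OF add.hyps(1)] trig_poly_bounded[OF add.hyps(2)] by blast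
    note m = trig_poly_measurable[OF add.hyps(1)] trig_poly_measurable[OF add.hyps(2)]
    show ?case unfolding distrib_right
      using tendsto_add[OF add.IH]
      by (simp add: Bochner_Integration.integral_add[OF iF[OF m(1) AB(1)] iF[OF m(2) AB(2)]]
        Bochner_Integration.integral_add[OF iG[OF m(1) AB(1)] iG[OF m(2) AB(2)]])
  next
    case (scale f c)
    show ?case unfolding mult.assoc by (simp add: tendsto_mult_left[OF scale.IH])
  qed
  define C' where "C' = (\<integral>\<omega>. (norm (\<zeta> \<omega>))\<^sup>2 \<partial>G)"
  have C0: "C \<ge> 0" "C' \<ge> 0" using order_trans[OF _ \<xi>2(2)[of 0]] by (auto simp: C'_def)
  define u where "u n = (\<integral>\<omega>. complex_of_real (f (\<xi> n \<omega>)) * complex_of_real (W \<omega>) \<partial>F)" for n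
  define u0 where "u0 = (\<integral>\<omega>. complex_of_real (f (\<zeta> \<omega>)) * complex_of_real (W \<omega>) \<partial>G)"
  have lim: "u \<longlonglongrightarrow> u0"
  proof (rule LIMSEQ_I)
    fix r :: real assume r: "r > 0"
    \<comment> \<open>Adds up the costs of replacing \<open>f\<close> by a trigonometric polynomial
      along the sequence and at the limit; together they stay below P e = r / 2.\<close>
    define P where "P = (KW + 1) * (2 + C + C')"
    have P: "P > 0" using KW0 C0 by (simp add: P_def)
    define e where "e = r / (2 * P)"
    have e: "e > 0" using r P by (simp add: e_def)
    obtain h B where h: "trig_poly h" "\<And>x. cmod (h x) \<le> B" "\<And>x. cmod (h x - complex_of_real (f x)) \<le> e * (1 + (norm x)\<^sup>2)"
      using trig_approximation_quadratic[OF f(1) K e] by blast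
    have [measurable]: "h \<in> borel_measurable borel" by (rule trig_poly_measurable[OF h(1)])
    have fm: "(\<lambda>x. complex_of_real (f x)) \<in> borel_measurable borel" by measurable
    have fb: "cmod (complex_of_real (f x)) \<le> K" for x using K by simp
    have est: "cmod ((h x - complex_of_real (f x)) * complex_of_real (W \<omega>)) \<le> KW * (e * (1 + (norm x)\<^sup>2))" if "\<omega> \<in> space F" for x \<omega>
      using mult_mono[OF h(3)[of x] KW[OF that]] e by (simp add: norm_mult mult.commute)
    have dF: "cmod ((\<integral>\<omega>. h (\<xi> n \<omega>) * complex_of_real (W \<omega>) \<partial>F) - u n) \<le> KW * (e * (1 + C))" for n
    proof -
      have "(\<integral>\<omega>. h (\<xi> n \<omega>) * complex_of_real (W \<omega>) \<partial>F) - u n = (\<integral>\<omega>. (h (\<xi> n \<omega>) - complex_of_real (f (\<xi> n \<omega>))) * complex_of_real (W \<omega>) \<partial>F)"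
        unfolding u_def left_diff_distrib
        by (rule Bochner_Integration.integral_diff[symmetric, OF iF[OF _ h(2)] iF[OF fm fb]]) measurable
      also have "cmod \<dots> \<le> (\<integral>\<omega>. KW * (e * (1 + (norm (\<xi> n \<omega>))\<^sup>2)) \<partial>F)"
      proof (rule norm_integral_le_integral)
        show "integrable F (\<lambda>\<omega>. (h (\<xi> n \<omega>) - complex_of_real (f (\<xi> n \<omega>))) * complex_of_real (W \<omega>))"
          unfolding left_diff_distrib by (intro Bochner_Integration.integrable_diff iF[OF _ h(2)] iF[OF fm fb]) measurable
      qed (use \<xi>2(1) est in auto)
      also have "\<dots> = KW * (e * (1 + (\<integral>\<omega>. (norm (\<xi> n \<omega>))\<^sup>2 \<partial>F)))" using \<xi>2(1) by (simp add: F.prob_space)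
      also have "\<dots> \<le> KW * (e * (1 + C))" using \<xi>2(2)[of n] KW0 e by (intro mult_left_mono) auto
      finally show ?thesis .
    qed
    have dG: "cmod ((\<integral>\<omega>. h (\<zeta> \<omega>) * complex_of_real (W \<omega>) \<partial>G) - u0) \<le> KW * (e * (1 + C'))"
    proof -
      have "(\<integral>\<omega>. h (\<zeta> \<omega>) * complex_of_real (W \<omega>) \<partial>G) - u0 = (\<integral>\<omega>. (h (\<zeta> \<omega>) - complex_of_real (f (\<zeta> \<omega>))) * complex_of_real (W \<omega>) \<partial>G)"
        unfolding u0_def left_diff_distrib
        by (rule Bochner_Integration.integral_diff[symmetric, OF iG[OF _ h(2)] iG[OF fm fb]]) measurable
      also have "cmod \<dots> \<le> (\<integral>\<omega>. KW * (e * (1 + (norm (\<zeta> \<omega>))\<^sup>2)) \<partial>G)"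
      proof (rule norm_integral_le_integral)
        show "integrable G (\<lambda>\<omega>. (h (\<zeta> \<omega>) - complex_of_real (f (\<zeta> \<omega>))) * complex_of_real (W \<omega>))"
          unfolding left_diff_distrib by (intro Bochner_Integration.integrable_diff iG[OF _ h(2)] iG[OF fm fb]) measurable
      qed (use \<zeta>2 est sp in auto)
      also have "\<dots> = KW * (e * (1 + C'))" using \<zeta>2 by (simp add: G.prob_space C'_def)
      finally show ?thesis .
    qed
    obtain N where N: "\<And>n. n \<ge> N \<Longrightarrow> cmod ((\<integral>\<omega>. h (\<xi> n \<omega>) * complex_of_real (W \<omega>) \<partial>F) - (\<integral>\<omega>. h (\<zeta> \<omega>) * complex_of_real (W \<omega>) \<partial>G)) < r / 2"
      using LIMSEQ_D[OF tr[OF h(1)], of "r / 2"] r by auto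
    have "KW * (e * (1 + C)) + KW * (e * (1 + C')) \<le> r / 2"
    proof -
      have "KW * (e * (1 + C)) + KW * (e * (1 + C')) = KW * (2 + C + C') * e" by (simp add: algebra_simps)
      also have "\<dots> \<le> P * e" unfolding P_def using C0 e by (intro mult_right_mono) auto
      also have "\<dots> = r / 2" using P by (simp add: e_def)
      finally show ?thesis .
    qed
    then have "norm (u n - u0) < r" if "n \<ge> N" for n
      using dF[of n] dG N[OF that]
        norm_triangle_ineq[of "u n - (\<integral>\<omega>. h (\<xi> n \<omega>) * complex_of_real (W \<omega>) \<partial>F)" "(\<integral>\<omega>. h (\<xi> n \<omega>) * complex_of_real (W \<omega>) \<partial>F) - (\<integral>\<omega>. h (\<zeta> \<omega>) * complex_of_real (W \<omega>) \<partial>G)"]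
        norm_triangle_ineq[of "u n - (\<integral>\<omega>. h (\<zeta> \<omega>) * complex_of_real (W \<omega>) \<partial>G)" "(\<integral>\<omega>. h (\<zeta> \<omega>) * complex_of_real (W \<omega>) \<partial>G) - u0"]
      by (simp add: norm_minus_commute)
    then show "\<exists>no. \<forall>n\<ge>no. norm (u n - u0) < r" by blast
  qed
  have "u = (\<lambda>n. complex_of_real (\<integral>\<omega>. f (\<xi> n \<omega>) * W \<omega> \<partial>F))"
    unfolding u_def by (simp flip: of_real_mult)
  moreover have "u0 = complex_of_real (\<integral>\<omega>. f (\<zeta> \<omega>) * W \<omega> \<partial>G)"
    unfolding u0_def by (simp flip: of_real_mult)
  ultimately show "(\<lambda>n. \<integral>\<omega>. f (\<xi> n \<omega>) * W \<omega> \<partial>F) \<longlonglongrightarrow> (\<integral>\<omega>. f (\<zeta> \<omega>) * W \<omega> \<partial>G)"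
    using lim by (simp only: tendsto_of_real_iff)
qed

section \<open>Odd power variations\<close>

text \<open>The indices on each side of \<open>j\<close> contribute at most one full series.\<close>

lemma sum_nat_dist_le:
  assumes r: "\<And>k. r k \<ge> (0 :: real)" and s: "summable r"
  shows "(\<Sum>k<N. r (nat_dist j k)) \<le> 2 * suminf r"
proof -
  have "(\<Sum>k<N. r (nat_dist j k)) = (\<Sum>k\<in>{..<N} \<inter> {..j}. r (nat_dist j k)) + (\<Sum>k\<in>{..<N} - {..j}. r (nat_dist j k))"
    by (rule sum.Int_Diff) simp
  also have "(\<Sum>k\<in>{..<N} \<inter> {..j}. r (nat_dist j k)) = sum r ((\<lambda>k. j - k) ` ({..<N} \<inter> {..j}))"
    by (subst sum.reindex) (auto simp: inj_on_def nat_dist_def)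
  also have "\<dots> \<le> suminf r" by (rule sum_le_suminf[OF s]) (use r in auto)
  also have "(\<Sum>k\<in>{..<N} - {..j}. r (nat_dist j k)) = sum r ((\<lambda>k. k - j) ` ({..<N} - {..j}))"
    by (subst sum.reindex) (auto simp: inj_on_def nat_dist_def)
  also have "\<dots> \<le> suminf r" by (rule sum_le_suminf[OF s]) (use r in auto)
  finally show ?thesis by simp
qed

text \<open>A linear combination of partial sums of different lengths is a single sum with step
  weights. This brings the values of the power variation at several times into the form of
  \<open>gaussian_array_clt\<close>.\<close>

lemma sum_step_weights:
  fixes f :: "nat \<Rightarrow> real"
  assumes m: "\<And>i. i \<in> I \<Longrightarrow> m i \<le> N"
  shows "(\<Sum>j<N. (\<Sum>i\<in>I. a i * (if j < m i then 1 else 0)) * f j) = (\<Sum>i\<in>I. a i * (\<Sum>j<m i. f j))"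
proof -
  have "(\<Sum>j<N. (\<Sum>i\<in>I. a i * (if j < m i then 1 else 0)) * f j) = (\<Sum>i\<in>I. \<Sum>j<N. a i * (if j < m i then f j else 0))"
    unfolding sum_distrib_right by (subst sum.swap) (intro sum.cong refl, simp)
  also have "\<dots> = (\<Sum>i\<in>I. a i * (\<Sum>j<m i. f j))"
  proof (rule sum.cong[OF refl])
    fix i assume "i \<in> I"
    then have "{..<N} \<inter> {j. j < m i} = {..<m i}" using m by fastforce
    then show "(\<Sum>j<N. a i * (if j < m i then f j else 0)) = a i * (\<Sum>j<m i. f j)"
      by (simp add: sum.If_cases flip: sum_distrib_left)
  qed
  finally show ?thesis .
qed

lemma double_sum_step_weights:
  fixes f :: "nat \<Rightarrow> nat \<Rightarrow> real" and a :: "'i \<Rightarrow> real" and m :: "'i \<Rightarrow> nat"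
  assumes m: "\<And>i. i \<in> I \<Longrightarrow> m i \<le> N"
  defines "w \<equiv> \<lambda>j. \<Sum>i\<in>I. a i * (if j < m i then 1 else 0)"
  shows "(\<Sum>j<N. \<Sum>k<N. w j * w k * f j k) = (\<Sum>i\<in>I. \<Sum>i'\<in>I. a i * a i' * (\<Sum>j<m i. \<Sum>k<m i'. f j k))"
proof -
  have "(\<Sum>j<N. \<Sum>k<N. w j * w k * f j k) = (\<Sum>j<N. w j * (\<Sum>k<N. w k * f j k))"
    by (simp add: sum_distrib_left mult.assoc)
  also have "\<dots> = (\<Sum>i\<in>I. a i * (\<Sum>j<m i. \<Sum>i'\<in>I. a i' * (\<Sum>k<m i'. f j k)))"
  proof -
    have "(\<Sum>k<N. w k * f j k) = (\<Sum>i'\<in>I. a i' * (\<Sum>k<m i'. f j k))" for j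
      unfolding w_def by (rule sum_step_weights[OF m])
    then show ?thesis unfolding w_def by (simp only: sum_step_weights[OF m])
  qed
  also have "\<dots> = (\<Sum>i\<in>I. \<Sum>i'\<in>I. a i * a i' * (\<Sum>j<m i. \<Sum>k<m i'. f j k))"
    by (intro sum.cong refl, subst sum.swap) (simp add: sum_distrib_left mult.assoc)
  finally show ?thesis .
qed

lemma (in kernel_profile) kern_scale:
  assumes "a > 0" "s \<ge> 0" "t \<ge> 0"
  shows "kern (a * s) (a * t) = a powr (2 * \<beta>) * kern s t"
proof -
  have "min (a * s) (a * t) = a * min s t" "max (a * s) (a * t) = a * max s t"
    using assms by (auto simp: min_def max_def)
  then show ?thesis using assms unfolding kern_def by (simp add: powr_mult)
qed

section \<open>Normalised increments and their limits\<close>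

locale selfsimilar_gaussian = gaussian_space M V + kernel_profile \<alpha> \<beta> lam C1 C2 \<theta> L K \<phi> \<phi>1 \<phi>2
  for M :: "'a measure" and V \<alpha> \<beta> lam C1 C2 \<theta> L K \<phi> \<phi>1 \<phi>2 +
  fixes X :: "real \<Rightarrow> 'a \<Rightarrow> real" and l :: nat
  assumes X_V: "s \<ge> 0 \<Longrightarrow> X s \<in> V"
    and X_cov: "s \<ge> 0 \<Longrightarrow> t \<ge> 0 \<Longrightarrow> (\<integral>\<omega>. X s \<omega> * X t \<omega> \<partial>M) = kern s t"
    and \<alpha>_eq: "\<alpha> = 1 / (2 * real l + 1)"
begin

text \<open>The exponent makes the power 2 l + 1 of the normalising factor equal to sqrt n, which is
  how the factor 1 / sqrt n of the limit theorem appears.\<close>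

definition incr :: "nat \<Rightarrow> nat \<Rightarrow> 'a \<Rightarrow> real" where
  "incr n j \<omega> = real n powr (\<alpha> / 2) * (X (real (j + 1) / real n) \<omega> - X (real j / real n) \<omega>)"

lemma incr_V: "incr n j \<in> V"
  unfolding incr_def by (intro V_cmult V_diff X_V) auto

lemma incr_cov: "(\<integral>\<omega>. incr n j \<omega> * incr n k \<omega> \<partial>M) = real n powr (- c) * gam j k"
proof (cases "n = 0")
  case True
  then show ?thesis by (simp add: incr_def)
next
  case False
  then have n: "real n > 0" by simp
  define x where "x i = X (real i / real n)" for i :: nat
  have xV: "x i \<in> V" for i unfolding x_def by (rule X_V) simp
  have xc: "(\<integral>\<omega>. x i \<omega> * x i' \<omega> \<partial>M) = real n powr (- (2 * \<beta>)) * kern (real i) (real i')" for i i'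
    using X_cov[of "real i / real n" "real i' / real n"] kern_scale[of "1 / real n" "real i" "real i'"] n
    by (simp add: x_def powr_minus_divide powr_divide)
  have i: "integrable M (\<lambda>\<omega>. x i \<omega> * x i' \<omega>)" for i i' by (intro V_integrable_mult xV)
  have "(\<integral>\<omega>. incr n j \<omega> * incr n k \<omega> \<partial>M) = (\<integral>\<omega>. real n powr \<alpha> * (x (j + 1) \<omega> * x (k + 1) \<omega> - x (j + 1) \<omega> * x k \<omega> - x j \<omega> * x (k + 1) \<omega> + x j \<omega> * x k \<omega>) \<partial>M)"
  proof (rule Bochner_Integration.integral_cong[OF refl])
    fix \<omega>
    have "real n powr (\<alpha> / 2) * real n powr (\<alpha> / 2) = real n powr \<alpha>" by (simp flip: powr_add)
    moreover have "incr n j \<omega> * incr n k \<omega> = (real n powr (\<alpha> / 2) * real n powr (\<alpha> / 2)) * ((x (j + 1) \<omega> - x j \<omega>) * (x (k + 1) \<omega> - x k \<omega>))"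
      by (simp add: incr_def x_def)
    ultimately show "incr n j \<omega> * incr n k \<omega> = real n powr \<alpha> * (x (j + 1) \<omega> * x (k + 1) \<omega> - x (j + 1) \<omega> * x k \<omega> - x j \<omega> * x (k + 1) \<omega> + x j \<omega> * x k \<omega>)"
      by (simp add: algebra_simps)
  qed
  also have "\<dots> = real n powr \<alpha> * (real n powr (- (2 * \<beta>)) * kern (real (j + 1)) (real (k + 1)) - real n powr (- (2 * \<beta>)) * kern (real (j + 1)) (real k)
      - real n powr (- (2 * \<beta>)) * kern (real j) (real (k + 1)) + real n powr (- (2 * \<beta>)) * kern (real j) (real k))"
    using i by (simp only: integral_mult_right_zero Bochner_Integration.integral_add Bochner_Integration.integral_diff
      Bochner_Integration.integrable_add Bochner_Integration.integrable_diff xc)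
  also have "\<dots> = real n powr \<alpha> * (real n powr (- (2 * \<beta>)) * gam j k)"
    by (simp add: gam_def algebra_simps)
  also have "\<dots> = real n powr (- c) * gam j k" by (simp add: c_def flip: powr_add mult.assoc)
  finally show ?thesis .
qed

lemma power_variation_incr: "power_variation X l n t \<omega> = (\<Sum>j<nat \<lfloor>real n * t\<rfloor>. incr n j \<omega> ^ (2 * l + 1)) / sqrt (real n)"
proof (cases "n = 0")
  case True
  then show ?thesis by (simp add: power_variation_def)
next
  case False
  have "(real n powr (\<alpha> / 2)) ^ (2 * l + 1) = real n powr (\<alpha> / 2 * real (2 * l + 1))"
    using False by (subst powr_realpow[symmetric]) (simp_all add: powr_powr)
  also have "\<alpha> / 2 * real (2 * l + 1) = 1 / 2" by (simp add: \<alpha>_eq field_simps)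
  finally have "(real n powr (\<alpha> / 2)) ^ (2 * l + 1) = sqrt (real n)" by (simp add: powr_half_sqrt)
  then show ?thesis using False unfolding power_variation_def incr_def power_mult_distrib
    by (simp add: sum_distrib_left[symmetric])
qed

lemma incr_power_moments: "all_moments M (\<lambda>\<omega>. incr n j \<omega> ^ k)"
  by (intro all_moments_power V_moments incr_V)

lemma power_variation_moments: "all_moments M (power_variation X l n t)"
proof -
  have "power_variation X l n t = (\<lambda>\<omega>. (1 / sqrt (real n)) * (\<Sum>j<nat \<lfloor>real n * t\<rfloor>. incr n j \<omega> ^ (2 * l + 1)))"
    by (simp add: power_variation_incr fun_eq_iff)
  then show ?thesis by (simp only:) (intro all_moments_cmult all_moments_sum incr_power_moments)
qed

abbreviation "kap \<equiv> limit_variance \<alpha> \<beta> lam l"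

lemma profile_incr_limit:
  assumes "q \<ge> 1" "2 * r + q = 2 * l + 1" "t \<ge> 0" "t' \<ge> 0"
  shows "(\<lambda>n. (1 / real n) * (\<Sum>j<nat \<lfloor>real n * t\<rfloor>. \<Sum>k<nat \<lfloor>real n * t'\<rfloor>.
      ((\<integral>\<omega>. incr n j \<omega> * incr n j \<omega> \<partial>M) * (\<integral>\<omega>. incr n k \<omega> * incr n k \<omega> \<partial>M)) ^ r * (\<integral>\<omega>. incr n j \<omega> * incr n k \<omega> \<partial>M) ^ q))
    \<longlonglongrightarrow> 2 ^ (2 * r) * lam ^ (2 * l + 1) * (\<alpha> / (2 * \<beta>)) * infsum (\<lambda>p. second_difference p ^ q) UNIV * min t t' powr (2 * \<beta> / \<alpha>)"
  unfolding incr_cov by (rule profile_sum_limit[OF \<alpha>_eq assms])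

text \<open>\<open>odd_power_covariance\<close> splits the covariance by chaos order q = 2 (l - r) +
  1, and \<open>profile_incr_limit\<close> treats each order separately. The sum of the limits is
  \<open>limit_variance\<close> times the power of min t t'.\<close>

lemma incr_power_covariance_limit:
  assumes t: "t \<ge> 0" "t' \<ge> 0"
  shows "(\<lambda>n. (1 / real n) * (\<Sum>j<nat \<lfloor>real n * t\<rfloor>. \<Sum>k<nat \<lfloor>real n * t'\<rfloor>.
      (\<integral>\<omega>. incr n j \<omega> ^ (2 * l + 1) * incr n k \<omega> ^ (2 * l + 1) \<partial>M))) \<longlonglongrightarrow> kap * min t t' powr (2 * \<beta> / \<alpha>)"
proof -
  define h :: "nat \<Rightarrow> real" where "h r = (of_int (hermite_coeff r l))\<^sup>2 * fact (2 * (l - r) + 1)" for r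
  define v where "v r n = (1 / real n) * (\<Sum>j<nat \<lfloor>real n * t\<rfloor>. \<Sum>k<nat \<lfloor>real n * t'\<rfloor>.
      ((\<integral>\<omega>. incr n j \<omega> * incr n j \<omega> \<partial>M) * (\<integral>\<omega>. incr n k \<omega> * incr n k \<omega> \<partial>M)) ^ r * (\<integral>\<omega>. incr n j \<omega> * incr n k \<omega> \<partial>M) ^ (2 * (l - r) + 1))" for r n
  define u where "u r = 2 ^ (2 * r) * lam ^ (2 * l + 1) * (\<alpha> / (2 * \<beta>)) * infsum (\<lambda>p. second_difference p ^ (2 * (l - r) + 1)) UNIV * min t t' powr (2 * \<beta> / \<alpha>)" for r
  have "v r \<longlonglongrightarrow> u r" if "r \<le> l" for r
    unfolding v_def u_def by (rule profile_incr_limit) (use that t in auto)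
  then have lim: "(\<lambda>n. \<Sum>r\<le>l. h r * v r n) \<longlonglongrightarrow> (\<Sum>r\<le>l. h r * u r)" by (intro tendsto_intros) auto
  have e1: "(1 / real n) * (\<Sum>j<nat \<lfloor>real n * t\<rfloor>. \<Sum>k<nat \<lfloor>real n * t'\<rfloor>.
      (\<integral>\<omega>. incr n j \<omega> ^ (2 * l + 1) * incr n k \<omega> ^ (2 * l + 1) \<partial>M)) = (\<Sum>r\<le>l. h r * v r n)" for n
  proof -
    have "(1 / real n) * (\<Sum>j<a. \<Sum>k<b. \<Sum>r\<le>l. h r * p r j k) = (\<Sum>r\<le>l. h r * ((1 / real n) * (\<Sum>j<a. \<Sum>k<b. p r j k)))" for a b :: nat and p :: "nat \<Rightarrow> nat \<Rightarrow> nat \<Rightarrow> real"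
    proof -
      have "(\<Sum>j<a. \<Sum>k<b. \<Sum>r\<le>l. h r * p r j k) = (\<Sum>r\<le>l. \<Sum>j<a. \<Sum>k<b. h r * p r j k)"
      proof -
        have "(\<Sum>j<a. \<Sum>k<b. \<Sum>r\<le>l. h r * p r j k) = (\<Sum>j<a. \<Sum>r\<le>l. \<Sum>k<b. h r * p r j k)"
          by (intro sum.cong refl sum.swap)
        also have "\<dots> = (\<Sum>r\<le>l. \<Sum>j<a. \<Sum>k<b. h r * p r j k)" by (rule sum.swap)
        finally show ?thesis .
      qed
      then show ?thesis by (simp add: sum_distrib_left mult.left_commute)
    qed
    from this[of "\<lambda>r j k. ((\<integral>\<omega>. incr n j \<omega> * incr n j \<omega> \<partial>M) * (\<integral>\<omega>. incr n k \<omega> * incr n k \<omega> \<partial>M)) ^ r * (\<integral>\<omega>. incr n j \<omega> * incr n k \<omega> \<partial>M) ^ (2 * (l - r) + 1)"]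
    show ?thesis unfolding odd_power_covariance[OF incr_V incr_V] h_def v_def by (simp add: mult.assoc)
  qed
  \<comment> \<open>The first chaos does not contribute.\<close>
  have "u l = 0" by (simp add: u_def infsum_second_difference)
  then have "(\<Sum>r\<le>l. h r * u r) = (\<Sum>r<l. h r * u r)"
    by (simp add: lessThan_Suc_atMost[symmetric])
  also have "\<dots> = kap * min t t' powr (2 * \<beta> / \<alpha>)"
    unfolding limit_variance_def K_coeff_def u_def h_def second_difference_def sum_distrib_left sum_distrib_right
    by (intro sum.cong refl) (simp add: mult_ac)
  finally show ?thesis using lim unfolding e1 by simp
qed

lemma power_variation_second_moment:
  "(\<integral>\<omega>. (power_variation X l n t \<omega>)\<^sup>2 \<partial>M) = (1 / real n) * (\<Sum>j<nat \<lfloor>real n * t\<rfloor>. \<Sum>k<nat \<lfloor>real n * t\<rfloor>.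
      (\<integral>\<omega>. incr n j \<omega> ^ (2 * l + 1) * incr n k \<omega> ^ (2 * l + 1) \<partial>M))"
proof -
  have "(\<integral>\<omega>. (power_variation X l n t \<omega>)\<^sup>2 \<partial>M) = (\<integral>\<omega>. (\<Sum>j<nat \<lfloor>real n * t\<rfloor>. \<Sum>k<nat \<lfloor>real n * t\<rfloor>. (1 / real n) * (incr n j \<omega> ^ (2 * l + 1) * incr n k \<omega> ^ (2 * l + 1))) \<partial>M)"
    by (intro Bochner_Integration.integral_cong refl)
      (simp add: power_variation_incr power_divide power2_eq_square sum_product sum_divide_distrib)
  also have "\<dots> = (\<Sum>j<nat \<lfloor>real n * t\<rfloor>. \<Sum>k<nat \<lfloor>real n * t\<rfloor>. (1 / real n) * (\<integral>\<omega>. incr n j \<omega> ^ (2 * l + 1) * incr n k \<omega> ^ (2 * l + 1) \<partial>M))"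
    by (intro integral_double_sum all_moments_integrable all_moments_mult incr_power_moments)
  finally show ?thesis by (simp only: sum_distrib_left)
qed

lemma power_variation_second_moment_bounded:
  assumes "t \<ge> 0"
  shows "\<exists>C. \<forall>n. (\<integral>\<omega>. (power_variation X l n t \<omega>)\<^sup>2 \<partial>M) \<le> C"
proof -
  have "Bseq (\<lambda>n. \<integral>\<omega>. (power_variation X l n t \<omega>)\<^sup>2 \<partial>M)"
    using incr_power_covariance_limit[OF assms assms] unfolding power_variation_second_moment
    by (intro convergent_imp_Bseq) (auto simp: convergent_def)
  then show ?thesis by (auto simp: Bseq_def dest: abs_le_D1)
qed

text \<open>The series in the limiting variance has terms of both signs, so the sign is read off
  from its role as a limit of second moments.\<close>

lemma limit_variance_nonneg: "kap \<ge> 0"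
proof -
  have "(\<lambda>n. \<integral>\<omega>. (power_variation X l n 1 \<omega>)\<^sup>2 \<partial>M) \<longlonglongrightarrow> kap"
    using incr_power_covariance_limit[of 1 1] unfolding power_variation_second_moment by simp
  then show ?thesis by (rule LIMSEQ_le_const) simp
qed

text \<open>An instance of \<open>gaussian_array_clt\<close> for the normalised increments with step
  weights. Its two variance hypotheses are bilinear in the weights and reduce to pairs of times
  through \<open>double_sum_step_weights\<close>.\<close>

lemma power_variation_char_limit:
  fixes t a :: "'i \<Rightarrow> real"
  assumes I: "finite I" and t: "\<And>i. i \<in> I \<Longrightarrow> t i \<ge> 0" and B: "B \<in> V"
  defines "S \<equiv> kap * (\<Sum>i\<in>I. \<Sum>i'\<in>I. a i * a i' * min (t i) (t i') powr (2 * \<beta> / \<alpha>))"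
  shows "(\<lambda>n. \<integral>\<omega>. iexp ((\<Sum>i\<in>I. a i * power_variation X l n (t i) \<omega>) + B \<omega>) \<partial>M)
    \<longlonglongrightarrow> exp (- S / 2) *\<^sub>R (\<integral>\<omega>. iexp (B \<omega>) \<partial>M)"
proof -
  \<comment> \<open>A common time horizon: the times are nonnegative, so their sum dominates each of
    them.\<close>
  define T where "T = (\<Sum>i\<in>I. t i)"
  have T0: "T \<ge> 0" unfolding T_def using t by (rule sum_nonneg)
  have tT: "t i \<le> T" if "i \<in> I" for i unfolding T_def using member_le_sum[OF that, of t] t I by auto
  define N where "N n = nat \<lfloor>real n * T\<rfloor>" for n
  define m where "m n i = nat \<lfloor>real n * t i\<rfloor>" for n i
  have mN: "m n i \<le> N n" if "i \<in> I" for n i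
    unfolding m_def N_def using tT[OF that] by (intro nat_mono floor_mono mult_left_mono) auto
  have NT: "real (N n) \<le> T * real n" for n
    using T0 unfolding N_def by (simp add: mult.commute of_nat_nat)
  define w where "w n j = (\<Sum>i\<in>I. a i * (if j < m n i then 1 else 0))" for n j
  define A where "A = (\<Sum>i\<in>I. \<bar>a i\<bar>)"
  have w: "\<bar>w n j\<bar> \<le> A" for n j
    unfolding w_def A_def by (rule order_trans[OF sum_abs]) (intro sum_mono, auto)
  obtain C where C: "C \<ge> 0" "\<And>n j k. real j + 1 \<le> T * real n \<Longrightarrow> real k + 1 \<le> T * real n \<Longrightarrow>
      \<bar>real n powr (- c) * gam j k\<bar> \<le> C * offset_decay \<eta> (nat_dist j k)"
    using gam_scaled_bound[OF T0] by blast
  define r where "r p = C * offset_decay \<eta> p" for p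
  have r0: "r p \<ge> 0" for p unfolding r_def using C(1) offset_decay_nonneg by simp
  have rs: "summable r" unfolding r_def by (intro summable_mult summable_offset_decay \<eta>_gt_1)
  have sr: "short_range r (2 * suminf r) (N n) (incr n)" for n
  proof -
    have "real j + 1 \<le> T * real n" if "j < N n" for j using NT[of n] that by linarith
    then show ?thesis unfolding short_range_def incr_cov r_def[symmetric]
      using C(2) r0 sum_nat_dist_le[OF r0 rs] incr_V by (auto simp: r_def)
  qed
  have ds: "(\<lambda>n. (1 / real n) * (\<Sum>j<N n. \<Sum>k<N n. w n j * w n k * f n j k)) \<longlonglongrightarrow> (\<Sum>i\<in>I. \<Sum>i'\<in>I. a i * a i' * v i i')"
    if "\<And>i i'. i \<in> I \<Longrightarrow> i' \<in> I \<Longrightarrow> (\<lambda>n. (1 / real n) * (\<Sum>j<m n i. \<Sum>k<m n i'. f n j k)) \<longlonglongrightarrow> v i i'" for f v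
  proof -
    have "(1 / real n) * (\<Sum>j<N n. \<Sum>k<N n. w n j * w n k * f n j k) = (\<Sum>i\<in>I. \<Sum>i'\<in>I. a i * a i' * ((1 / real n) * (\<Sum>j<m n i. \<Sum>k<m n i'. f n j k)))" for n
    proof -
      have "x * (\<Sum>i\<in>I. \<Sum>i'\<in>I. a i * a i' * s i i') = (\<Sum>i\<in>I. \<Sum>i'\<in>I. a i * a i' * (x * s i i'))" for x :: real and s
        by (simp only: sum_distrib_left mult.left_commute)
      moreover have "(\<Sum>j<N n. \<Sum>k<N n. w n j * w n k * f n j k) = (\<Sum>i\<in>I. \<Sum>i'\<in>I. a i * a i' * (\<Sum>j<m n i. \<Sum>k<m n i'. f n j k))"
        unfolding w_def by (rule double_sum_step_weights) (rule mN)
      ultimately show ?thesis by presburger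
    qed
    moreover have "(\<lambda>n. \<Sum>i\<in>I. \<Sum>i'\<in>I. a i * a i' * ((1 / real n) * (\<Sum>j<m n i. \<Sum>k<m n i'. f n j k))) \<longlonglongrightarrow> (\<Sum>i\<in>I. \<Sum>i'\<in>I. a i * a i' * v i i')"
      by (intro tendsto_intros that)
    ultimately show ?thesis by presburger
  qed
  have S: "(\<lambda>n. (1 / real n) * (\<Sum>j<N n. \<Sum>k<N n. w n j * w n k *
        (\<integral>\<omega>. incr n j \<omega> ^ (2 * l + 1) * incr n k \<omega> ^ (2 * l + 1) \<partial>M))) \<longlonglongrightarrow> S"
  proof -
    have "S = (\<Sum>i\<in>I. \<Sum>i'\<in>I. a i * a i' * (kap * min (t i) (t i') powr (2 * \<beta> / \<alpha>)))"
      unfolding S_def by (simp only: sum_distrib_left mult.left_commute)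
    then show ?thesis using ds[OF incr_power_covariance_limit[OF t t, folded m_def]] by presburger
  qed
  \<comment> \<open>The case q = 1 and r = l, whose limit vanishes because the second differences
    have sum 0.\<close>
  have S1: "(\<lambda>n. (1 / real n) * (\<Sum>j<N n. \<Sum>k<N n. w n j * w n k *
        ((\<integral>\<omega>. incr n j \<omega> * incr n j \<omega> \<partial>M) ^ l * (\<integral>\<omega>. incr n k \<omega> * incr n k \<omega> \<partial>M) ^ l * (\<integral>\<omega>. incr n j \<omega> * incr n k \<omega> \<partial>M)))) \<longlonglongrightarrow> 0"
  proof -
    have "(\<lambda>n. (1 / real n) * (\<Sum>j<m n i. \<Sum>k<m n i'.
        (\<integral>\<omega>. incr n j \<omega> * incr n j \<omega> \<partial>M) ^ l * (\<integral>\<omega>. incr n k \<omega> * incr n k \<omega> \<partial>M) ^ l * (\<integral>\<omega>. incr n j \<omega> * incr n k \<omega> \<partial>M))) \<longlonglongrightarrow> 0"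
      if "i \<in> I" "i' \<in> I" for i i'
      using profile_incr_limit[of 1 l "t i" "t i'"] t that by (simp add: m_def power_mult_distrib infsum_second_difference)
    from ds[OF this] show ?thesis by simp
  qed
  have e: "(\<Sum>i\<in>I. a i * power_variation X l n (t i) \<omega>) = (\<Sum>j<N n. w n j * incr n j \<omega> ^ (2 * l + 1)) / sqrt (real n)" for n \<omega>
  proof -
    have "(\<Sum>j<N n. w n j * incr n j \<omega> ^ (2 * l + 1)) = (\<Sum>i\<in>I. a i * (\<Sum>j<m n i. incr n j \<omega> ^ (2 * l + 1)))"
      unfolding w_def by (rule sum_step_weights) (rule mN)
    then show ?thesis by (simp only: power_variation_incr m_def sum_divide_distrib[of _ I] times_divide_eq_right)
  qed
  show ?thesis unfolding e by (rule gaussian_array_clt[OF sr B w NT S S1])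
qed

text \<open>The limit factorises although the weight \<open>W\<close> may be any bounded function of
  the process. For exponentials of finite combinations of \<open>X\<close> this is
  \<open>power_variation_char_limit\<close>, and \<open>null_generated\<close> extends it to all
  such \<open>W\<close>.\<close>

theorem power_variation_mixing:
  fixes t a :: "'i \<Rightarrow> real"
  assumes gen: "generated_by M X"
    and I: "finite I" and t: "\<And>i. i \<in> I \<Longrightarrow> t i \<ge> 0"
    and W: "W \<in> borel_measurable M" "bounded (W ` space M)"
  defines "S \<equiv> kap * (\<Sum>i\<in>I. \<Sum>i'\<in>I. a i * a i' * min (t i) (t i') powr (2 * \<beta> / \<alpha>))"
  shows "(\<lambda>n. \<integral>\<omega>. iexp (\<Sum>i\<in>I. a i * power_variation X l n (t i) \<omega>) * complex_of_real (W \<omega>) \<partial>M)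
    \<longlonglongrightarrow> complex_of_real (exp (- S / 2) * (\<integral>\<omega>. W \<omega> \<partial>M))"
proof -
  define E where "E = exp (- S / 2)"
  define U where "U n \<omega> = (\<Sum>i\<in>I. a i * power_variation X l n (t i) \<omega>)" for n \<omega>
  have U[measurable]: "U n \<in> borel_measurable M" for n
    unfolding U_def by (intro all_moments_measurable all_moments_sum all_moments_cmult power_variation_moments)
  \<comment> \<open>Subtracting the deterministic limit turns the claim into convergence to 0 of a
    functional that is linear in the weight.\<close>
  define Z where "Z n \<omega> = iexp (U n \<omega>) - complex_of_real E" for n \<omega>
  have Zm: "Z n \<in> borel_measurable M" for n unfolding Z_def by measurable
  have Zb: "cmod (Z n \<omega>) \<le> 1 + E" for n \<omega>
    using norm_triangle_ineq4[of "iexp (U n \<omega>)" "complex_of_real E"] by (simp add: Z_def E_def del: of_real_exp)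
  interpret vanishing_test M Z "1 + E" X
    by unfold_locales (use Zm Zb X_V V_moments in \<open>auto intro!: all_moments_integrable_power all_moments_measurable\<close>)
  have "null (\<lambda>\<omega>. 1 * iexp (\<Sum>s\<in>J. b s * X s \<omega>))" if J: "finite J" "J \<subseteq> {0..}" for J b
  proof -
    define B where "B \<omega> = (\<Sum>s\<in>J. b s * X s \<omega>)" for \<omega>
    have BV: "B \<in> V" unfolding B_def by (intro V_sum V_cmult X_V) (use J in auto)
    have [measurable]: "B \<in> borel_measurable M" by (rule V_measurable[OF BV])
    have iB: "integrable M (\<lambda>\<omega>. iexp (f \<omega>))" if [measurable]: "f \<in> borel_measurable M" for f :: "'a \<Rightarrow> real"
      by (rule integrable_const_bound[where B = 1]) auto
    have "(\<integral>\<omega>. Z n \<omega> * iexp (B \<omega>) \<partial>M) = (\<integral>\<omega>. iexp (U n \<omega> + B \<omega>) \<partial>M) - E *\<^sub>R (\<integral>\<omega>. iexp (B \<omega>) \<partial>M)" for n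
    proof -
      have "(\<integral>\<omega>. Z n \<omega> * iexp (B \<omega>) \<partial>M) = (\<integral>\<omega>. iexp (U n \<omega> + B \<omega>) - complex_of_real E * iexp (B \<omega>) \<partial>M)"
        by (intro Bochner_Integration.integral_cong refl) (simp add: Z_def exp_add algebra_simps)
      also have "\<dots> = (\<integral>\<omega>. iexp (U n \<omega> + B \<omega>) \<partial>M) - (\<integral>\<omega>. complex_of_real E * iexp (B \<omega>) \<partial>M)"
        by (intro Bochner_Integration.integral_diff integrable_mult_right iB) measurable
      finally show ?thesis by (simp add: scaleR_conv_of_real)
    qed
    moreover have "(\<lambda>n. (\<integral>\<omega>. iexp (U n \<omega> + B \<omega>) \<partial>M) - E *\<^sub>R (\<integral>\<omega>. iexp (B \<omega>) \<partial>M)) \<longlonglongrightarrow> 0"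
      using power_variation_char_limit[where t = t and a = a, OF I t BV, folded S_def, folded E_def U_def] by (intro LIM_zero)
    ultimately have "(\<lambda>n. \<integral>\<omega>. Z n \<omega> * iexp (B \<omega>) \<partial>M) \<longlonglongrightarrow> 0" by presburger
    moreover have "integrable M (\<lambda>\<omega>. iexp (B \<omega>))" by (rule iB) measurable
    ultimately show ?thesis unfolding null_def B_def by simp
  qed
  then have 1: "good (\<lambda>_. 1)" unfolding good_def by (auto intro: exI[of _ 1])
  obtain KW where KW: "\<And>\<omega>. \<omega> \<in> space M \<Longrightarrow> \<bar>W \<omega>\<bar> \<le> KW" using W(2) by (auto simp: bounded_iff)
  have iW: "integrable M (\<lambda>\<omega>. complex_of_real (W \<omega>))"
    by (rule integrable_const_bound[where B = KW]) (use KW W(1) in auto)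
  have nW: "null (\<lambda>\<omega>. complex_of_real (W \<omega>))" by (rule null_generated[OF gen 1 iW])
  have iU: "integrable M (\<lambda>\<omega>. iexp (U n \<omega>) * complex_of_real (W \<omega>))" for n
    by (rule Bochner_Integration.integrable_bound[OF iW]) (use W(1) in \<open>auto simp: norm_mult\<close>)
  have "(\<integral>\<omega>. iexp (U n \<omega>) * complex_of_real (W \<omega>) \<partial>M) = (\<integral>\<omega>. Z n \<omega> * complex_of_real (W \<omega>) \<partial>M) + complex_of_real (E * (\<integral>\<omega>. W \<omega> \<partial>M))" for n
  proof -
    have "(\<integral>\<omega>. Z n \<omega> * complex_of_real (W \<omega>) \<partial>M) = (\<integral>\<omega>. iexp (U n \<omega>) * complex_of_real (W \<omega>) \<partial>M) - (\<integral>\<omega>. complex_of_real E * complex_of_real (W \<omega>) \<partial>M)"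
      unfolding Z_def left_diff_distrib
      by (intro Bochner_Integration.integral_diff integrable_mult_right iW iU)
    then show ?thesis by simp
  qed
  moreover have "(\<lambda>n. (\<integral>\<omega>. Z n \<omega> * complex_of_real (W \<omega>) \<partial>M) + complex_of_real (E * (\<integral>\<omega>. W \<omega> \<partial>M))) \<longlonglongrightarrow> 0 + complex_of_real (E * (\<integral>\<omega>. W \<omega> \<partial>M))"
    using nW by (intro tendsto_intros) (simp add: null_def)
  ultimately have "(\<lambda>n. \<integral>\<omega>. iexp (U n \<omega>) * complex_of_real (W \<omega>) \<partial>M) \<longlonglongrightarrow> 0 + complex_of_real (E * (\<integral>\<omega>. W \<omega> \<partial>M))" by presburger
  then show ?thesis by (simp only: U_def E_def add_0)
qed

end

section \<open>From the process to the abstract setting\<close>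

lemma gaussian_space_of_process:
  assumes M: "prob_space M" and X: "centered_gaussian_process M X"
  defines "V \<equiv> {(\<lambda>\<omega>. \<Sum>t\<in>I. a t * X t \<omega>) | I a. finite I \<and> I \<subseteq> {0..}}"
  shows "gaussian_space M V" and "s \<ge> 0 \<Longrightarrow> X s \<in> V"
proof -
  interpret prob_space M by fact
  have mem: "(\<lambda>\<omega>. \<Sum>t\<in>I. a t * X t \<omega>) \<in> V" if "finite I" "I \<subseteq> {0..}" for I a
    unfolding V_def using that by blast
  show "gaussian_space M V"
  proof
    show "centered_gaussian M x" if "x \<in> V" for x
      using that X unfolding V_def centered_gaussian_process_def by blast
    show "(\<lambda>_. 0) \<in> V" using mem[of "{}"] by simp
    show "(\<lambda>\<omega>. c * x \<omega>) \<in> V" if xV: "x \<in> V" for x c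
    proof -
      obtain I a where x: "x = (\<lambda>\<omega>. \<Sum>t\<in>I. a t * X t \<omega>)" "finite I" "I \<subseteq> {0..}" using xV unfolding V_def by blast
      show ?thesis using mem[OF x(2,3), of "\<lambda>t. c * a t"] by (simp add: x(1) sum_distrib_left mult.assoc)
    qed
    show "(\<lambda>\<omega>. x \<omega> + y \<omega>) \<in> V" if xV: "x \<in> V" and yV: "y \<in> V" for x y
    proof -
      obtain I a where x: "x = (\<lambda>\<omega>. \<Sum>t\<in>I. a t * X t \<omega>)" "finite I" "I \<subseteq> {0..}" using xV unfolding V_def by blast
      obtain J b where y: "y = (\<lambda>\<omega>. \<Sum>t\<in>J. b t * X t \<omega>)" "finite J" "J \<subseteq> {0..}" using yV unfolding V_def by blast
      define e where "e t = (if t \<in> I then a t else 0) + (if t \<in> J then b t else 0)" for t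
      have "x \<omega> + y \<omega> = (\<Sum>t\<in>I \<union> J. e t * X t \<omega>)" for \<omega>
      proof -
        have "x \<omega> = (\<Sum>t\<in>I \<union> J. (if t \<in> I then a t else 0) * X t \<omega>)"
          unfolding x(1) by (rule sum.mono_neutral_cong_left) (use x y in auto)
        moreover have "y \<omega> = (\<Sum>t\<in>I \<union> J. (if t \<in> J then b t else 0) * X t \<omega>)"
          unfolding y(1) by (rule sum.mono_neutral_cong_left) (use x y in auto)
        ultimately show ?thesis by (simp add: e_def distrib_right sum.distrib)
      qed
      then show ?thesis using mem[of "I \<union> J" e] x y by simp
    qed
  qed
  show "X s \<in> V" if "s \<ge> 0" using mem[of "{s}" "\<lambda>_. 1"] that by simp
qed

lemma path_component_measurable: "t \<ge> 0 \<Longrightarrow> (\<lambda>p. p t) \<in> borel_measurable path_space"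
  unfolding path_space_def by (rule measurable_component_singleton) simp

lemma self_similar_covariance:
  assumes X: "\<And>t. t \<ge> 0 \<Longrightarrow> X t \<in> borel_measurable M" and ss: "self_similar M X \<beta>"
    and c: "c > 0" and st: "s \<ge> 0" "t \<ge> 0"
  shows "(\<integral>\<omega>. X (c * s) \<omega> * X (c * t) \<omega> \<partial>M) = c powr (2 * \<beta>) * (\<integral>\<omega>. X s \<omega> * X t \<omega> \<partial>M)"
proof -
  note [measurable] = path_component_measurable[OF st(1)] path_component_measurable[OF st(2)]
  let ?X = "\<lambda>t \<omega>. c powr (- \<beta>) * X (c * t) \<omega>"
  have m: "path_map Z \<in> measurable M path_space" if "\<And>t. t \<ge> 0 \<Longrightarrow> Z t \<in> borel_measurable M" for Z
    unfolding path_map_def path_space_def using that by (intro measurable_restrict) auto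
  have I: "(\<integral>p. p s * p t \<partial>distr M path_space (path_map Z)) = (\<integral>\<omega>. Z s \<omega> * Z t \<omega> \<partial>M)"
    if "\<And>t. t \<ge> 0 \<Longrightarrow> Z t \<in> borel_measurable M" for Z
    by (subst integral_distr[OF m[OF that]]) (use st in \<open>auto simp: path_map_def\<close>)
  have "(\<integral>\<omega>. X s \<omega> * X t \<omega> \<partial>M) = (\<integral>\<omega>. ?X s \<omega> * ?X t \<omega> \<partial>M)"
    using I[of X] I[of ?X] X c ss by (simp add: self_similar_def)
  also have "\<dots> = (\<integral>\<omega>. (c powr (- \<beta>))\<^sup>2 * (X (c * s) \<omega> * X (c * t) \<omega>) \<partial>M)"
    by (simp add: power2_eq_square mult_ac)
  also have "\<dots> = c powr (- (2 * \<beta>)) * (\<integral>\<omega>. X (c * s) \<omega> * X (c * t) \<omega> \<partial>M)"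
    by (simp add: power2_eq_square flip: powr_add)
  finally show ?thesis using c by (simp add: powr_minus field_simps)
qed

text \<open>Near 1 everything is read off from \<psi>: the bound on \<phi>' subtracts the derivative
  of the singular term, where \<alpha> < 1 lets the factor \<alpha> be dropped, and
  \<open>near0\<close> is the mean value theorem for \<psi> on [1, x]. The maximum with 0 supplies
  the nonnegativity of the constant \<open>L\<close>.\<close>

lemma kernel_profileI:
  assumes \<alpha>: "0 < \<alpha>" "\<alpha> < 1" and \<beta>: "0 < \<beta>" "\<beta> \<le> 1 / 2" "\<alpha> \<le> 2 * \<beta>"
    and \<theta>: "1 < \<theta>" and cpos: "lam > 0" "C1 > 0" "C2 > 0"
    and \<phi>_cont: "continuous_on {1..} \<phi>"
    and \<phi>_C2: "\<phi> differentiable_on {1<..}" "deriv \<phi> differentiable_on {1<..}"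
    and \<psi>: "\<And>x. x \<ge> 1 \<Longrightarrow> \<psi> x = \<phi> x + lam * (x - 1) powr \<alpha>"
    and \<psi>_deriv: "\<And>x. x \<in> {1<..2} \<Longrightarrow> \<exists>D. (\<psi> has_real_derivative D) (at x) \<and> \<bar>D\<bar> \<le> B"
    and \<phi>_bound: "\<And>x. x > 1 \<Longrightarrow>
      \<bar>deriv (deriv \<phi>) x\<bar> \<le> C1 * indicator {1<..2} x * (x - 1) powr (\<alpha> - 2)
                            + C2 * indicator {2<..} x * x powr (- \<theta> - 1)"
    and growth: "\<And>x. x \<ge> 1 \<Longrightarrow> \<bar>\<phi> x\<bar> \<le> K * x powr \<beta>"
  shows "kernel_profile \<alpha> \<beta> lam C1 C2 \<theta> (max 0 B) K \<phi> (deriv \<phi>) (deriv (deriv \<phi>))"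
proof
  have dd: "(f has_real_derivative deriv f x) (at x)" if "f differentiable_on {1<..}" "x > 1" for f :: "real \<Rightarrow> real" and x
    using that unfolding differentiable_on_def
    by (auto simp: DERIV_deriv_iff_real_differentiable at_within_open[OF _ open_greaterThan])
  show d1: "(\<phi> has_real_derivative deriv \<phi> x) (at x)" if "x > 1" for x by (rule dd[OF \<phi>_C2(1) that])
  show "(deriv \<phi> has_real_derivative deriv (deriv \<phi>) x) (at x)" if "x > 1" for x by (rule dd[OF \<phi>_C2(2) that])
  show "\<bar>deriv (deriv \<phi>) x\<bar> \<le> C1 * (x - 1) powr (\<alpha> - 2)" if "1 < x" "x \<le> 2" for x
    using \<phi>_bound[of x] that by simp
  show "\<bar>deriv (deriv \<phi>) x\<bar> \<le> C2 * x powr (- \<theta> - 1)" if "x > 2" for x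
    using \<phi>_bound[of x] that by simp
  show "\<bar>deriv \<phi> x\<bar> \<le> max 0 B + lam * (x - 1) powr (\<alpha> - 1)" if x: "1 < x" "x \<le> 2" for x
  proof -
    obtain D where D: "(\<psi> has_real_derivative D) (at x)" "\<bar>D\<bar> \<le> B" using \<psi>_deriv[of x] x by auto
    have p: "((\<lambda>x. lam * (x - 1) powr \<alpha>) has_real_derivative lam * (\<alpha> * (x - 1) powr (\<alpha> - 1))) (at x)"
      using x by (auto intro!: derivative_eq_intros)
    have "(\<phi> has_real_derivative D - lam * (\<alpha> * (x - 1) powr (\<alpha> - 1))) (at x)"
      by (rule has_field_derivative_transform_within_open[OF DERIV_diff[OF D(1) p], of "{1<..}"]) (use x \<psi> in auto)
    then have "deriv \<phi> x = D - lam * (\<alpha> * (x - 1) powr (\<alpha> - 1))" by (rule DERIV_imp_deriv)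
    moreover have "\<bar>lam * (\<alpha> * (x - 1) powr (\<alpha> - 1))\<bar> \<le> lam * (1 * (x - 1) powr (\<alpha> - 1))"
      unfolding abs_mult using cpos \<alpha> by (intro mult_mono) auto
    ultimately show ?thesis using D(2) by simp
  qed
  show "\<bar>\<phi> x + lam * (x - 1) powr \<alpha> - \<phi> 1\<bar> \<le> max 0 B * (x - 1)" if x: "1 \<le> x" "x \<le> 2" for x
  proof (cases "x = 1")
    case False
    have "continuous_on {1..x} (\<lambda>x. \<phi> x + lam * (x - 1) powr \<alpha>)"
      using \<alpha> by (intro continuous_intros continuous_on_powr' continuous_on_subset[OF \<phi>_cont]) auto
    then have c: "continuous_on {1..x} \<psi>" by (rule continuous_on_eq) (simp add: \<psi>)
    have "\<exists>D z. 1 < z \<and> z < x \<and> (\<psi> has_real_derivative D) (at z) \<and> \<psi> x - \<psi> 1 = (x - 1) * D"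
      by (rule MVT[OF _ c]) (use x False \<psi>_deriv in \<open>force simp: real_differentiable_def\<close>)+
    then obtain D z where z: "1 < z" "z < x" "(\<psi> has_real_derivative D) (at z)" "\<psi> x - \<psi> 1 = (x - 1) * D" by blast
    obtain D' where "(\<psi> has_real_derivative D') (at z)" "\<bar>D'\<bar> \<le> B" using \<psi>_deriv[of z] z x by auto
    then have D: "\<bar>D\<bar> \<le> max 0 B" using DERIV_unique[OF z(3)] by fastforce
    have "\<psi> x - \<psi> 1 = \<phi> x + lam * (x - 1) powr \<alpha> - \<phi> 1" using \<psi> x by simp
    then have e: "\<phi> x + lam * (x - 1) powr \<alpha> - \<phi> 1 = (x - 1) * D" using z(4) by linarith
    show ?thesis unfolding e abs_mult using x mult_left_mono[OF D, of "x - 1"] by (simp add: mult.commute)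
  qed (use \<alpha> in simp)
qed (use assms in auto)

text \<open>Since \<open>F\<close> is generated by \<open>X\<close>, every set of \<open>F\<close>
  is a preimage under the path map, so \<open>W\<close> depends on the path of \<open>X\<close>
  alone. Independence of the two paths therefore makes \<open>W\<close> independent of any
  functional of the path of \<open>Y\<close>.\<close>

lemma indep_generated_expectation:
  fixes W :: "'a \<Rightarrow> complex"
  assumes G: "prob_space G" and gen: "generated_by F X" and sp: "space F = space G"
    and indep: "prob_space.indep_var G path_space (path_map X) path_space (path_map Y)"
    and W: "W \<in> borel_measurable F" "integrable G W"
    and h: "h \<in> borel_measurable path_space" "integrable G (\<lambda>\<omega>. h (path_map Y \<omega>))"
  shows "(\<integral>\<omega>. h (path_map Y \<omega>) * W \<omega> \<partial>G) = (\<integral>\<omega>. h (path_map Y \<omega>) \<partial>G) * (\<integral>\<omega>. W \<omega> \<partial>G)"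
proof -
  interpret prob_space G by fact
  have mX: "path_map X \<in> measurable G path_space" and mY: "path_map Y \<in> measurable G path_space"
    and ind: "indep_set (sigma_sets (space G) {path_map X -` A \<inter> space G |A. A \<in> sets path_space})
      (sigma_sets (space G) {path_map Y -` A \<inter> space G |A. A \<in> sets path_space})"
    using indep unfolding indep_var_eq by auto
  have F: "sets F = {path_map X -` A \<inter> space G |A. A \<in> sets path_space}"
    using gen mX sp by (auto simp: generated_by_def sets_vimage_algebra2 measurable_space)
  have [measurable]: "W \<in> borel_measurable G" using W(2) by simp
  have [measurable]: "(\<lambda>\<omega>. h (path_map Y \<omega>)) \<in> borel_measurable G" using h(2) by simp
  have "indep_var borel (\<lambda>\<omega>. h (path_map Y \<omega>)) borel W"
    unfolding indep_var_eq
  proof (intro conjI)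
    have FX: "sigma_sets (space G) {path_map X -` A \<inter> space G |A. A \<in> sets path_space} = sets F"
      using sets.sigma_sets_eq[of F] unfolding F sp .
    have s1: "sigma_sets (space G) {W -` A \<inter> space G |A. A \<in> sets borel} \<subseteq> sets F"
      using sets.sigma_sets_subset[of "{W -` A \<inter> space G |A. A \<in> sets borel}" F] measurable_sets[OF W(1)] sp by auto
    have s2: "{(\<lambda>\<omega>. h (path_map Y \<omega>)) -` A \<inter> space G |A. A \<in> sets borel} \<subseteq> {path_map Y -` A \<inter> space G |A. A \<in> sets path_space}"
    proof safe
      fix A :: "complex set" assume "A \<in> sets borel"
      then have "h -` A \<inter> space path_space \<in> sets path_space" by (rule measurable_sets[OF h(1)])
      then show "\<exists>A'. (\<lambda>\<omega>. h (path_map Y \<omega>)) -` A \<inter> space G = path_map Y -` A' \<inter> space G \<and> A' \<in> sets path_space"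
        using measurable_space[OF mY] by (intro exI[of _ "h -` A \<inter> space path_space"]) auto
    qed
    show "indep_set (sigma_sets (space G) {(\<lambda>\<omega>. h (path_map Y \<omega>)) -` A \<inter> space G |A. A \<in> sets borel})
        (sigma_sets (space G) {W -` A \<inter> space G |A. A \<in> sets borel})"
      using ind s1 sigma_sets_mono'[OF s2, of "space G"] unfolding indep_sets2_eq FX
      by (metis (no_types, lifting) Int_commute mult.commute subset_iff)
  qed measurable
  then show ?thesis by (rule indep_var_lebesgue_integral) (use h W in auto)
qed

theorem theorem1p4:
  fixes l :: nat and \<alpha> \<beta> lam C1 C2 \<theta> :: real
    and F G :: "'a measure"
    and X Y :: "real \<Rightarrow> 'a \<Rightarrow> real"
    and \<phi> \<psi> :: "real \<Rightarrow> real"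
  assumes l: "l \<ge> 1"
    and \<alpha>: "\<alpha> = 1 / (2 * real l + 1)"
    and \<beta>: "0 < \<beta>" "\<beta> \<le> 1 / 2" "\<alpha> \<le> 2 * \<beta>"
    and F: "prob_space F" "generated_by F X"
    and X: "centered_gaussian_process F X" "self_similar F X \<beta>" "AE \<omega> in F. X 0 \<omega> = 0"
    and \<phi>: "\<And>x. x \<ge> 1 \<Longrightarrow> \<phi> x = (\<integral>\<omega>. X 1 \<omega> * X x \<omega> \<partial>F)"
    and \<phi>_cont: "continuous_on {1..} \<phi>"
    and \<phi>_C2: "\<phi> differentiable_on {1<..}" "deriv \<phi> differentiable_on {1<..}"
      "continuous_on {1<..} (deriv (deriv \<phi>))"
    and lam: "lam > 0"
    and \<psi>: "\<And>x. x \<ge> 1 \<Longrightarrow> \<psi> x = \<phi> x + lam * (x - 1) powr \<alpha>"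
    and \<psi>_deriv: "\<exists>B. \<forall>x\<in>{1<..2}. \<exists>D. (\<psi> has_real_derivative D) (at x) \<and> \<bar>D\<bar> \<le> B"
    and bound_params: "C1 > 0" "C2 > 0" "1 < \<theta>" "\<theta> \<le> 2"
    and \<phi>_bound: "\<And>x. x > 1 \<Longrightarrow>
      \<bar>deriv (deriv \<phi>) x\<bar> \<le> C1 * indicator {1<..2} x * (x - 1) powr (\<alpha> - 2)
                            + C2 * indicator {2<..} x * x powr (- \<theta> - 1)"
    and G: "prob_enlargement F G"
    and Y: "centered_gaussian_process G Y" "AE \<omega> in G. continuous_on {0..} (\<lambda>t. Y t \<omega>)"
    and Y_cov: "\<And>s t. s \<ge> 0 \<Longrightarrow> t \<ge> 0 \<Longrightarrow>
      (\<integral>\<omega>. Y s \<omega> * Y t \<omega> \<partial>G) = min s t powr (2 * \<beta> / \<alpha>)"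
    and indep: "prob_space.indep_var G path_space (path_map X) path_space (path_map Y)"
  shows "\<exists>\<sigma>\<ge>0. \<sigma>\<^sup>2 = limit_variance \<alpha> \<beta> lam l \<and>
    (\<forall>t :: real ^ 'm. (\<forall>i. 0 \<le> t $ i) \<longrightarrow>
      converges_stably F G
        (\<lambda>n \<omega>. \<chi> i. power_variation X l n (t $ i) \<omega>)
        (\<lambda>\<omega>. \<sigma> *\<^sub>R (\<chi> i. Y (t $ i) \<omega>)))"
proof -
  interpret F: prob_space F by (rule F(1))
  have sub: "subalgebra G F" and pG: "prob_space G" using G by (auto simp: prob_enlargement_def)
  interpret G: prob_space G by (rule pG)
  have sp: "space F = space G" using sub by (simp add: subalgebra_def)
  define VX where "VX = {(\<lambda>\<omega>. \<Sum>t\<in>I. a t * X t \<omega>) | I a. finite I \<and> I \<subseteq> {0..}}"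
  have gX: "gaussian_space F VX" and X_in: "\<And>s. s \<ge> 0 \<Longrightarrow> X s \<in> VX"
    unfolding VX_def using gaussian_space_of_process[OF F(1) X(1)] by auto
  interpret X: gaussian_space F VX by (rule gX)
  define VY where "VY = {(\<lambda>\<omega>. \<Sum>t\<in>I. a t * Y t \<omega>) | I a. finite I \<and> I \<subseteq> {0..}}"
  have gY: "gaussian_space G VY" and Y_in: "\<And>s. s \<ge> 0 \<Longrightarrow> Y s \<in> VY"
    unfolding VY_def using gaussian_space_of_process[OF pG Y(1)] by auto
  interpret Y: gaussian_space G VY by (rule gY)
  note \<alpha>_eq = \<alpha>
  have \<alpha>01: "0 < \<alpha>" "\<alpha> < 1" using l by (auto simp: \<alpha>)
  have scal: "(\<integral>\<omega>. X (c * s) \<omega> * X (c * t) \<omega> \<partial>F) = c powr (2 * \<beta>) * (\<integral>\<omega>. X s \<omega> * X t \<omega> \<partial>F)"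
    if "c > 0" "s \<ge> 0" "t \<ge> 0" for c s t
    by (rule self_similar_covariance[OF X.V_measurable[OF X_in] X(2) that])
  \<comment> \<open>Cauchy-Schwarz for X_1 and X_x, with E X_x^2 = x^(2 \<beta>) \<phi>(1) from
    self-similarity.\<close>
  have growth: "\<bar>\<phi> x\<bar> \<le> \<phi> 1 * x powr \<beta>" if x: "x \<ge> 1" for x
  proof -
    have p: "\<phi> 1 \<ge> 0" using \<phi>[of 1] by simp
    have "(\<phi> x)\<^sup>2 \<le> \<phi> 1 * (\<integral>\<omega>. X x \<omega> * X x \<omega> \<partial>F)"
      using F.mean_mult_square_le[OF X.V_moments[OF X_in[of 1]] X.V_moments[OF X_in[of x]]] \<phi>[of x] \<phi>[of 1] x by simp
    also have "(\<integral>\<omega>. X x \<omega> * X x \<omega> \<partial>F) = x powr (2 * \<beta>) * \<phi> 1" using scal[of x 1 1] x \<phi>[of 1] by simp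
    also have "x powr (2 * \<beta>) = (x powr \<beta>)\<^sup>2" by (simp add: power2_eq_square flip: powr_add)
    also have "\<phi> 1 * ((x powr \<beta>)\<^sup>2 * \<phi> 1) = (\<phi> 1 * x powr \<beta>)\<^sup>2" by (simp add: power2_eq_square mult_ac)
    finally show ?thesis using p by (simp add: abs_le_square_iff[symmetric] abs_mult)
  qed
  obtain B where B: "\<And>x. x \<in> {1<..2} \<Longrightarrow> \<exists>D. (\<psi> has_real_derivative D) (at x) \<and> \<bar>D\<bar> \<le> B"
    using \<psi>_deriv by blast
  have kp: "kernel_profile \<alpha> \<beta> lam C1 C2 \<theta> (max 0 B) (\<phi> 1) \<phi> (deriv \<phi>) (deriv (deriv \<phi>))"
    by (rule kernel_profileI[OF \<alpha>01 \<beta> bound_params(3) lam bound_params(1,2) \<phi>_cont \<phi>_C2(1,2) \<psi> B \<phi>_bound growth])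
  interpret kernel_profile \<alpha> \<beta> lam C1 C2 \<theta> "max 0 B" "\<phi> 1" \<phi> "deriv \<phi>" "deriv (deriv \<phi>)" by (rule kp)
  \<comment> \<open>At time 0 this uses X_0 = 0 almost surely; otherwise scaling by s reduces to the
    times 1 and t / s.\<close>
  have cov_le: "(\<integral>\<omega>. X s \<omega> * X t \<omega> \<partial>F) = kern s t" if "0 \<le> s" "s \<le> t" for s t
  proof (cases "s = 0")
    case True
    have "(\<integral>\<omega>. X s \<omega> * X t \<omega> \<partial>F) = (\<integral>\<omega>. 0 \<partial>F)"
      by (rule integral_cong_AE) (use X(3) True that X.V_measurable[OF X_in] in auto)
    then show ?thesis using True that by (simp add: kern_def)
  next
    case False
    then show ?thesis using scal[of s 1 "t / s"] \<phi>[of "t / s"] that kern_le[of s t] by simp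
  qed
  have cov: "(\<integral>\<omega>. X s \<omega> * X t \<omega> \<partial>F) = kern s t" if "s \<ge> 0" "t \<ge> 0" for s t
    using cov_le[of s t] cov_le[of t s] that kern_commute[of s t] by (cases "s \<le> t") (auto simp: mult.commute)
  interpret S: selfsimilar_gaussian F VX \<alpha> \<beta> lam C1 C2 \<theta> "max 0 B" "\<phi> 1" \<phi> "deriv \<phi>" "deriv (deriv \<phi>)" X l
    by (intro selfsimilar_gaussian.intro gX kp selfsimilar_gaussian_axioms.intro) (fact X_in cov \<alpha>_eq)+
  define \<sigma> where "\<sigma> = sqrt (limit_variance \<alpha> \<beta> lam l)"
  have \<sigma>: "\<sigma> \<ge> 0" "\<sigma>\<^sup>2 = limit_variance \<alpha> \<beta> lam l" using S.limit_variance_nonneg by (auto simp: \<sigma>_def)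
  have "converges_stably F G (\<lambda>n \<omega>. \<chi> i. power_variation X l n (t $ i) \<omega>) (\<lambda>\<omega>. \<sigma> *\<^sub>R (\<chi> i. Y (t $ i) \<omega>))"
    if t: "\<And>i. 0 \<le> t $ i" for t :: "real ^ 'm"
  proof -
    have vec: "(\<lambda>\<omega>. \<chi> i. f i \<omega>) \<in> borel_measurable M" if "\<And>i. f i \<in> borel_measurable M" for f :: "'m \<Rightarrow> 'a \<Rightarrow> real" and M
      using that by (subst borel_measurable_euclidean_space) (auto simp: Basis_vec_def inner_axis)
    have nsq: "(norm (\<chi> i. f i))\<^sup>2 = (\<Sum>i\<in>UNIV. (f i)\<^sup>2)" for f :: "'m \<Rightarrow> real"
      unfolding power2_norm_eq_inner inner_vec_def by (simp add: power2_eq_square)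
    have pvm: "all_moments F (power_variation X l n (t $ i))" for n i by (rule S.power_variation_moments)
    have pv2: "integrable F (\<lambda>\<omega>. (power_variation X l n (t $ i) \<omega>)\<^sup>2)" for n i
      by (rule all_moments_integrable_power[OF pvm])
    obtain C where C: "\<And>i n. (\<integral>\<omega>. (power_variation X l n (t $ i) \<omega>)\<^sup>2 \<partial>F) \<le> C i"
      using S.power_variation_second_moment_bounded[OF t] by metis
    have Y2: "integrable G (\<lambda>\<omega>. (Y (t $ i) \<omega>)\<^sup>2)" for i
      by (rule all_moments_integrable_power[OF Y.V_moments[OF Y_in[OF t]]])
    show ?thesis
    proof (rule stably_convergent_from_char[OF G, where C = "\<Sum>i\<in>UNIV. C i"])
      show "(\<lambda>\<omega>. \<chi> i. power_variation X l n (t $ i) \<omega>) \<in> borel_measurable F" for n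
        by (intro vec all_moments_measurable pvm)
      show "(\<lambda>\<omega>. \<sigma> *\<^sub>R (\<chi> i. Y (t $ i) \<omega>)) \<in> borel_measurable G"
        by (intro borel_measurable_scaleR borel_measurable_const vec Y.V_measurable Y_in t)
      show "integrable F (\<lambda>\<omega>. (norm (\<chi> i. power_variation X l n (t $ i) \<omega>))\<^sup>2)" for n
        unfolding nsq by (intro Bochner_Integration.integrable_sum pv2)
      show "(\<integral>\<omega>. (norm (\<chi> i. power_variation X l n (t $ i) \<omega>))\<^sup>2 \<partial>F) \<le> (\<Sum>i\<in>UNIV. C i)" for n
        unfolding nsq by (subst Bochner_Integration.integral_sum) (auto intro: pv2 sum_mono C)
      show "integrable G (\<lambda>\<omega>. (norm (\<sigma> *\<^sub>R (\<chi> i. Y (t $ i) \<omega>)))\<^sup>2)"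
        unfolding norm_scaleR power_mult_distrib nsq by (intro integrable_mult_right Bochner_Integration.integrable_sum Y2)
      fix a :: "real ^ 'm" and W :: "'a \<Rightarrow> real"
      assume W: "W \<in> borel_measurable F" "bounded (W ` space F)"
      \<comment> \<open>Twice the negative exponent in \<open>power_variation_mixing\<close>; it
        turns out to be the variance of \<open>U\<close>, so the two characteristic functions
        agree.\<close>
      define s where "s = limit_variance \<alpha> \<beta> lam l * (\<Sum>i\<in>UNIV. \<Sum>j\<in>UNIV. a $ i * a $ j * min (t $ i) (t $ j) powr (2 * \<beta> / \<alpha>))"
      define U where "U \<omega> = (\<Sum>i\<in>UNIV. (\<sigma> * a $ i) * Y (t $ i) \<omega>)" for \<omega>
      have UV: "U \<in> VY" unfolding U_def by (intro Y.V_sum Y.V_cmult Y_in t)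
      have U2: "(\<integral>\<omega>. (U \<omega>)\<^sup>2 \<partial>G) = s"
      proof -
        have "(\<integral>\<omega>. (U \<omega>)\<^sup>2 \<partial>G) = (\<integral>\<omega>. (\<Sum>i\<in>UNIV. \<Sum>j\<in>UNIV. (\<sigma>\<^sup>2 * (a $ i * a $ j)) * (Y (t $ i) \<omega> * Y (t $ j) \<omega>)) \<partial>G)"
          by (intro Bochner_Integration.integral_cong refl) (simp add: U_def power2_eq_square sum_product mult_ac)
        also have "\<dots> = (\<Sum>i\<in>UNIV. \<Sum>j\<in>UNIV. (\<sigma>\<^sup>2 * (a $ i * a $ j)) * (\<integral>\<omega>. Y (t $ i) \<omega> * Y (t $ j) \<omega> \<partial>G))"
          by (intro integral_double_sum Y.V_integrable_mult Y_in t)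
        also have "\<dots> = s" unfolding s_def \<sigma>(2)[symmetric] by (simp add: Y_cov t sum_distrib_left mult.assoc)
        finally show ?thesis .
      qed
      have char: "(\<integral>\<omega>. iexp (U \<omega>) \<partial>G) = complex_of_real (exp (- s / 2))"
        using G.centered_gaussian_char[OF Y.gaussian[OF UV]] unfolding U2 .
      define h where "h p = iexp (\<Sum>i\<in>UNIV. (\<sigma> * a $ i) * p (t $ i))" for p :: "real \<Rightarrow> real"
      have hY: "h (path_map Y \<omega>) = iexp (U \<omega>)" for \<omega> by (simp add: h_def U_def path_map_def t)
      have hm: "h \<in> borel_measurable path_space"
      proof -
        note [measurable] = path_component_measurable[OF t]
        show ?thesis unfolding h_def by measurable
      qed
      have hi: "integrable G (\<lambda>\<omega>. h (path_map Y \<omega>))"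
        unfolding hY by (rule G.integrable_const_bound[where B = 1]) (use Y.V_measurable[OF UV] in auto)
      obtain KW where KW: "\<And>\<omega>. \<omega> \<in> space F \<Longrightarrow> \<bar>W \<omega>\<bar> \<le> KW" using W(2) by (auto simp: bounded_iff)
      have Wc: "(\<lambda>\<omega>. complex_of_real (W \<omega>)) \<in> borel_measurable F" using W(1) by measurable
      have Wi: "integrable G (\<lambda>\<omega>. complex_of_real (W \<omega>))"
        by (rule G.integrable_const_bound[where B = KW])
          (use KW sp measurable_from_subalg[OF sub W(1)] in auto)
      \<comment> \<open>Independence of \<open>X\<close> and \<open>Y\<close> factorises the
        weighted characteristic function of the limit, just as mixing factorises that of the
        sequence asymptotically.\<close>
      have "(\<integral>\<omega>. iexp (U \<omega>) * complex_of_real (W \<omega>) \<partial>G) = complex_of_real (exp (- s / 2)) * (\<integral>\<omega>. complex_of_real (W \<omega>) \<partial>G)"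
        using indep_generated_expectation[OF pG F(2) sp indep Wc Wi hm hi] unfolding hY char .
      also have "\<dots> = complex_of_real (exp (- s / 2) * (\<integral>\<omega>. W \<omega> \<partial>F))"
        unfolding prob_enlargement_integral[OF G Wc] by simp
      finally have lim: "(\<integral>\<omega>. iexp (U \<omega>) * complex_of_real (W \<omega>) \<partial>G) = complex_of_real (exp (- s / 2) * (\<integral>\<omega>. W \<omega> \<partial>F))" .
      have aY: "a \<bullet> (\<sigma> *\<^sub>R (\<chi> i. Y (t $ i) \<omega>)) = U \<omega>" for \<omega>
        by (simp add: U_def inner_vec_def mult_ac)
      have aX: "a \<bullet> (\<chi> i. power_variation X l n (t $ i) \<omega>) = (\<Sum>i\<in>UNIV. a $ i * power_variation X l n (t $ i) \<omega>)" for n \<omega>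
        by (simp add: inner_vec_def)
      show "(\<lambda>n. \<integral>\<omega>. iexp (a \<bullet> (\<chi> i. power_variation X l n (t $ i) \<omega>)) * complex_of_real (W \<omega>) \<partial>F)
          \<longlonglongrightarrow> (\<integral>\<omega>. iexp (a \<bullet> (\<sigma> *\<^sub>R (\<chi> i. Y (t $ i) \<omega>))) * complex_of_real (W \<omega>) \<partial>G)"
        unfolding aX aY lim s_def by (rule S.power_variation_mixing[OF F(2) finite_class.finite_UNIV t W])
    qed
  qed
  then show ?thesis using \<sigma> by blast
qed

end
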